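(* Let $K$ be a hermitian $2\times 2$-matrix and $Y$ be a linear subspace of $\mathbb C^2$, and let $A_{Y,K}$ be the operator on $H_Y$ associated with the form $a_K$ with form domain $V_Y$ (see context). Then the semigroup $(e^{-tA_{Y,K}})_{t\ge0}$ generated by $-A_{Y,K}$ on $H_Y$ leaves $V_Y$ invariant, and its restriction to $V_Y$ is a semigroup on $V_Y$ that is analytic of angle $\frac{\pi}{2}$ and immediately of trace class (i.e. the operators are of trace class for every $t>0$). Its generator is $-A_{Y,K}^{V_Y}$, where $A_{Y,K}^{V_Y}$ is the part of $A_{Y,K}$ in $V_Y$, which is explicitly given by $$D(A_{Y,K}^{V_Y})=\left\{u\in D(A_{Y,K})\cap H^2(0,1):\ K\Gamma_1u-\Gamma_2u\in Y^\perp,\ \Gamma_1(u'')\in Y\right\},\qquad A_{Y,K}^{V_Y}u=-u'' .$$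
   Context: All spaces are complex; inner products are linear in the first argument. $H^1(T):=\{u\in H^1(0,1):u(0)=u(1)\}$, $H^{-1}(T)$ is its dual, with $f\in L^2(0,1)$ identified with $\varphi\mapsto\int_0^1 f\varphi\,dx$. Put $\mu_0(\varphi):=\langle\varphi,1\rangle$ for $\varphi\in H^{-1}(T)$ and $\mu_1(f):=\int_0^1(1-x)f(x)\,dx$ for $f\in L^2(0,1)$; $$\Gamma_1 u:=\begin{pmatrix}\mu_0(u)\\ \mu_1(u)\end{pmatrix}\ (u\in L^2(0,1)),\qquad \Gamma_2u:=\begin{pmatrix}-\mu_0(u'')-u(1)\\ u(1)-u(0)\end{pmatrix}\ (u\in H^2(0,1)).$$ The operator $P:H^{-1}(T)\to L^2(0,1)$ (bounded) is defined by $\langle Pu,\varphi\rangle=\langle u,J\varphi\rangle$, $J\varphi(x):=\int_x^1\big(\varphi(y)-\int_0^1\varphi(z)dz\big)dy$. $H^{-1}(T)$ is equipped with the (equivalent) inner product $(f|g)_{H^{-1}(T)}:=(Pf|Pg)_{L^2}+\mu_0(f)\overline{\mu_0(g)}$. $H:=\{w\in H^{-1}(T):\mu_0(w)=0\}$ with the restricted inner product. For a subspace $Y$ of $\mathbb C^2$: $V_Y:=\{f\in L^2(0,1):\Gamma_1 f\in Y\}$ with the $L^2$ inner product; $H_Y:=H$ if $Y=\{0\}^2$ or $Y=\{0\}\times\mathbb C$, and $H_Y:=H^{-1}(T)$ otherwise ($V_Y$ is dense in $H_Y$). For a $2\times2$-matrix $K$, $a_K(f,g):=(f|g)_{L^2}+(K\Gamma_1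 f|\Gamma_1 g)_{\mathbb C^2}$, $f,g\in V_Y$. The associated operator is: $D(A_{Y,K}):=\{f\in V_Y:\exists g\in H_Y,\ a_K(f,h)=(g|h)_{H^{-1}(T)}\ \forall h\in V_Y\}$, $A_{Y,K}f:=g$. The part of $A_{Y,K}$ in $V_Y$ is its restriction to $\{u\in D(A_{Y,K}):A_{Y,K}u\in V_Y\}$. *)

theory Defs
  imports "HOL-Analysis.Analysis" "HOL-Library.Function_Algebras"
begin

section \<open>Operators and semigroups on complex inner product spaces\<close>

text \<open>
  An inner product space is given by a carrier \<open>X\<close>, a complex subspace of the space of all
  complex-valued functions on some type, and an inner product \<open>ip\<close> on \<open>X\<close>, linear in the first
  argument. Addition and subtraction are pointwise (\<open>HOL-Library.Function_Algebras\<close>).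
  Operators on \<open>X\<close> are total functions of which only the values on \<open>X\<close> matter; unbounded
  operators are identified with their graphs.
\<close>

definition cscale :: "complex \<Rightarrow> ('a \<Rightarrow> complex) \<Rightarrow> 'a \<Rightarrow> complex"  (infixr "*\<^sub>c" 75)
  where "c *\<^sub>c f = (\<lambda>x. c * f x)"

definition ip_norm :: "('v \<Rightarrow> 'v \<Rightarrow> complex) \<Rightarrow> 'v \<Rightarrow> real"
  where "ip_norm ip x = sqrt (Re (ip x x))"

definition bounded_op ::
  "('a \<Rightarrow> complex) set \<Rightarrow> (('a \<Rightarrow> complex) \<Rightarrow> ('a \<Rightarrow> complex) \<Rightarrow> complex)
    \<Rightarrow> (('a \<Rightarrow> complex) \<Rightarrow> ('a \<Rightarrow> complex)) \<Rightarrow> bool"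
  where "bounded_op X ip B \<longleftrightarrow>
    (\<forall>x\<in>X. B x \<in> X) \<and>
    (\<forall>x\<in>X. \<forall>y\<in>X. B (x + y) = B x + B y) \<and>
    (\<forall>c. \<forall>x\<in>X. B (c *\<^sub>c x) = c *\<^sub>c B x) \<and>
    (\<exists>C. \<forall>x\<in>X. ip_norm ip (B x) \<le> C * ip_norm ip x)"

definition C0_semigroup ::
  "('a \<Rightarrow> complex) set \<Rightarrow> (('a \<Rightarrow> complex) \<Rightarrow> ('a \<Rightarrow> complex) \<Rightarrow> complex)
    \<Rightarrow> (real \<Rightarrow> ('a \<Rightarrow> complex) \<Rightarrow> ('a \<Rightarrow> complex)) \<Rightarrow> bool"
  where "C0_semigroup X ip T \<longleftrightarrow>
    (\<forall>t\<ge>0. bounded_op X ip (T t)) \<and>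
    (\<forall>x\<in>X. T 0 x = x) \<and>
    (\<forall>s\<ge>0. \<forall>t\<ge>0. \<forall>x\<in>X. T (s + t) x = T s (T t x)) \<and>
    (\<forall>x\<in>X. ((\<lambda>t. ip_norm ip (T t x - x)) \<longlongrightarrow> 0) (at_right 0))"

definition generator ::
  "('a \<Rightarrow> complex) set \<Rightarrow> (('a \<Rightarrow> complex) \<Rightarrow> ('a \<Rightarrow> complex) \<Rightarrow> complex)
    \<Rightarrow> (real \<Rightarrow> ('a \<Rightarrow> complex) \<Rightarrow> ('a \<Rightarrow> complex)) \<Rightarrow> ('a \<Rightarrow> complex) rel"
  where "generator X ip T =
    {(x, y). x \<in> X \<and> y \<in> X \<and>
      ((\<lambda>t. ip_norm ip (complex_of_real (1 / t) *\<^sub>c (T t x - x) - y)) \<longlongrightarrow> 0) (at_right 0)}"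

definition neg_op :: "('a \<Rightarrow> complex) rel \<Rightarrow> ('a \<Rightarrow> complex) rel"
  where "neg_op A = {(x, - y) | x y. (x, y) \<in> A}"

definition part_op :: "'v rel \<Rightarrow> 'v set \<Rightarrow> 'v rel"
  where "part_op A V = {(x, y) \<in> A. x \<in> V \<and> y \<in> V}"

definition sector :: "real \<Rightarrow> complex set"
  where "sector \<theta> = {z. z \<noteq> 0 \<and> \<bar>Arg z\<bar> < \<theta>}"

text \<open>Complex differentiability at \<open>z\<close> with respect to the operator norm.\<close>

definition op_differentiable_at ::
  "('a \<Rightarrow> complex) set \<Rightarrow> (('a \<Rightarrow> complex) \<Rightarrow> ('a \<Rightarrow> complex) \<Rightarrow> complex)
    \<Rightarrow> (complex \<Rightarrow> ('a \<Rightarrow> complex) \<Rightarrow> ('a \<Rightarrow> complex)) \<Rightarrow> complex \<Rightarrow> bool"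
  where "op_differentiable_at X ip S z \<longleftrightarrow>
    (\<exists>D. bounded_op X ip D \<and>
      (\<forall>\<epsilon>>0. \<forall>\<^sub>F h in at 0. \<forall>x\<in>X.
        ip_norm ip ((1 / h) *\<^sub>c (S (z + h) x - S z x) - D x) \<le> \<epsilon> * ip_norm ip x))"

text \<open>
  Analytic semigroups of angle \<open>\<theta>\<close> in the sense of Engel and Nagel: \<open>T\<close> extends to a semigroup
  of bounded operators on the sector of half-angle \<open>\<theta>\<close> that is analytic there and strongly
  continuous at 0 in each smaller sector (for \<open>0 < \<theta> \<le> pi/2\<close> the sector is closed under addition).
\<close>

definition analytic_semigroup ::
  "('a \<Rightarrow> complex) set \<Rightarrow> (('a \<Rightarrow> complex) \<Rightarrow> ('a \<Rightarrow> complex) \<Rightarrow> complex)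
    \<Rightarrow> real \<Rightarrow> (real \<Rightarrow> ('a \<Rightarrow> complex) \<Rightarrow> ('a \<Rightarrow> complex)) \<Rightarrow> bool"
  where "analytic_semigroup X ip \<theta> T \<longleftrightarrow>
    C0_semigroup X ip T \<and>
    (\<exists>S. (\<forall>t\<ge>0. \<forall>x\<in>X. S (complex_of_real t) x = T t x) \<and>
      (\<forall>z \<in> sector \<theta>. bounded_op X ip (S z)) \<and>
      (\<forall>z \<in> sector \<theta>. \<forall>w \<in> sector \<theta>. \<forall>x\<in>X. S (z + w) x = S z (S w x)) \<and>
      (\<forall>z \<in> sector \<theta>. op_differentiable_at X ip S z) \<and>
      (\<forall>\<theta>'. 0 < \<theta>' \<and> \<theta>' < \<theta> \<longrightarrow>
        (\<forall>x\<in>X. ((\<lambda>z. ip_norm ip (S z x - x)) \<longlongrightarrow> 0) (at 0 within sector \<theta>'))))"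

definition orthonormal_basis ::
  "('a \<Rightarrow> complex) set \<Rightarrow> (('a \<Rightarrow> complex) \<Rightarrow> ('a \<Rightarrow> complex) \<Rightarrow> complex)
    \<Rightarrow> ('a \<Rightarrow> complex) set \<Rightarrow> bool"
  where "orthonormal_basis X ip E \<longleftrightarrow>
    E \<subseteq> X \<and>
    (\<forall>e\<in>E. \<forall>e'\<in>E. ip e e' = (if e = e' then 1 else 0)) \<and>
    (\<forall>x\<in>X. (\<forall>e\<in>E. ip x e = 0) \<longrightarrow> x = 0)"

text \<open>
  For Hilbert spaces \<open>X\<close>: \<open>is_abs_op X ip B R\<close> says that \<open>R = |B|\<close>, the positive square root of
  \<open>B\<^sup>* B\<close>. Since a positive \<open>R\<close> is self-adjoint, \<open>R R = B\<^sup>* B\<close> means \<open>(R x | R y) = (B x | B y)\<close>.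
\<close>

definition is_abs_op ::
  "('a \<Rightarrow> complex) set \<Rightarrow> (('a \<Rightarrow> complex) \<Rightarrow> ('a \<Rightarrow> complex) \<Rightarrow> complex)
    \<Rightarrow> (('a \<Rightarrow> complex) \<Rightarrow> ('a \<Rightarrow> complex)) \<Rightarrow> (('a \<Rightarrow> complex) \<Rightarrow> ('a \<Rightarrow> complex)) \<Rightarrow> bool"
  where "is_abs_op X ip B R \<longleftrightarrow>
    bounded_op X ip R \<and>
    (\<forall>x\<in>X. Im (ip (R x) x) = 0 \<and> Re (ip (R x) x) \<ge> 0) \<and>
    (\<forall>x\<in>X. \<forall>y\<in>X. ip (R x) (R y) = ip (B x) (B y))"

text \<open>Trace class: the trace of \<open>|B|\<close>, which does not depend on the orthonormal basis, is finite.\<close>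

definition trace_class ::
  "('a \<Rightarrow> complex) set \<Rightarrow> (('a \<Rightarrow> complex) \<Rightarrow> ('a \<Rightarrow> complex) \<Rightarrow> complex)
    \<Rightarrow> (('a \<Rightarrow> complex) \<Rightarrow> ('a \<Rightarrow> complex)) \<Rightarrow> bool"
  where "trace_class X ip B \<longleftrightarrow>
    bounded_op X ip B \<and>
    (\<exists>R E. is_abs_op X ip B R \<and> orthonormal_basis X ip E \<and>
      (\<lambda>e. Re (ip (R e) e)) summable_on E)"


section \<open>Function spaces on the unit interval\<close>

text \<open>
  Functions on \<open>(0,1)\<close> are total functions on the reals whose values outside the interval are
  irrelevant.
\<close>

abbreviation int01 :: "(real \<Rightarrow> complex) \<Rightarrow> complex"
  where "int01 f \<equiv> (LINT x|lebesgue_on {0<..<1}. f x)"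

definition L2 :: "(real \<Rightarrow> complex) set"
  where "L2 = {f \<in> borel_measurable (lebesgue_on {0<..<1}).
    integrable (lebesgue_on {0<..<1}) (\<lambda>x. (cmod (f x))\<^sup>2)}"

definition ip_L2 :: "(real \<Rightarrow> complex) \<Rightarrow> (real \<Rightarrow> complex) \<Rightarrow> complex"
  where "ip_L2 f g = int01 (\<lambda>x. f x * cnj (g x))"

text \<open>
  Weak derivatives on \<open>(0,1)\<close>. As usual in one dimension, the test functions are the continuously
  differentiable functions with compact support in the open interval (Brezis).
\<close>

definition test_function :: "(real \<Rightarrow> complex) \<Rightarrow> (real \<Rightarrow> complex) \<Rightarrow> bool"
  where "test_function \<phi> \<phi>' \<longleftrightarrow>
    (\<forall>x. (\<phi> has_vector_derivative \<phi>' x) (at x)) \<and> continuous_on UNIV \<phi>' \<and>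
    (\<exists>a>0. \<exists>b<1. \<forall>x. x \<notin> {a..b} \<longrightarrow> \<phi> x = 0)"

definition weak_deriv :: "(real \<Rightarrow> complex) \<Rightarrow> (real \<Rightarrow> complex) \<Rightarrow> bool"
  where "weak_deriv u v \<longleftrightarrow>
    (\<forall>\<phi> \<phi>'. test_function \<phi> \<phi>' \<longrightarrow> int01 (\<lambda>x. u x * \<phi>' x) = - int01 (\<lambda>x. v x * \<phi> x))"

text \<open>A representative of the weak derivative, which is unique up to null sets.\<close>

definition wderiv :: "(real \<Rightarrow> complex) \<Rightarrow> real \<Rightarrow> complex"
  where "wderiv u = (SOME v. v \<in> L2 \<and> weak_deriv u v)"

text \<open>
  An element of \<open>H\<^sup>1(0,1)\<close> is represented by its continuous representative on \<open>[0,1]\<close>, so that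
  \<open>u 0\<close> and \<open>u 1\<close> are its boundary values.
\<close>

definition H1 :: "(real \<Rightarrow> complex) set"
  where "H1 = {u. continuous_on {0..1} u \<and> (\<exists>v\<in>L2. weak_deriv u v)}"

definition H2 :: "(real \<Rightarrow> complex) set"
  where "H2 = {u \<in> H1. \<exists>v\<in>L2. weak_deriv (wderiv u) v}"

definition norm_H1 :: "(real \<Rightarrow> complex) \<Rightarrow> real"
  where "norm_H1 u = sqrt ((ip_norm ip_L2 u)\<^sup>2 + (ip_norm ip_L2 (wderiv u))\<^sup>2)"

definition H1T :: "(real \<Rightarrow> complex) set"
  where "H1T = {u \<in> H1. u 0 = u 1}"


section \<open>The space \<open>H\<^sup>-\<^sup>1(T)\<close>\<close>

type_synonym functional = "(real \<Rightarrow> complex) \<Rightarrow> complex"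

text \<open>
  The dual of \<open>H\<^sup>1(T)\<close>: bounded linear functionals, normalised to 0 outside \<open>H1T\<close>.
  Boundedness implies that the value at \<open>\<phi>\<close> depends on \<open>\<phi>\<close> on \<open>[0,1]\<close> only.
\<close>

definition Hm1 :: "functional set"
  where "Hm1 = {w.
    (\<forall>\<phi>. \<phi> \<notin> H1T \<longrightarrow> w \<phi> = 0) \<and>
    (\<forall>\<phi>\<in>H1T. \<forall>\<psi>\<in>H1T. w (\<phi> + \<psi>) = w \<phi> + w \<psi>) \<and>
    (\<forall>c. \<forall>\<phi>\<in>H1T. w (c *\<^sub>c \<phi>) = c * w \<phi>) \<and>
    (\<exists>C. \<forall>\<phi>\<in>H1T. cmod (w \<phi>) \<le> C * norm_H1 \<phi>)}"

text \<open>
  The identification of \<open>f \<in> L\<^sup>2(0,1)\<close> with a functional. Functions that agree almost everywhere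
  have the same image, so \<open>emb ` L2\<close> is the space \<open>L\<^sup>2(0,1)\<close> of equivalence classes; \<open>rep\<close> chooses
  a representative.
\<close>

definition emb :: "(real \<Rightarrow> complex) \<Rightarrow> functional"
  where "emb f = (\<lambda>\<phi>. if \<phi> \<in> H1T then int01 (\<lambda>x. f x * \<phi> x) else 0)"

definition rep :: "functional \<Rightarrow> real \<Rightarrow> complex"
  where "rep w = (SOME f. f \<in> L2 \<and> emb f = w)"

definition ip_emb_L2 :: "functional \<Rightarrow> functional \<Rightarrow> complex"
  where "ip_emb_L2 v w = ip_L2 (rep v) (rep w)"

definition J_op :: "(real \<Rightarrow> complex) \<Rightarrow> real \<Rightarrow> complex"
  where "J_op \<phi> = (\<lambda>x. LINT y|lebesgue_on {x<..<1}. \<phi> y - int01 \<phi>)"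

text \<open>A representative of \<open>P_op w \<in> L\<^sup>2(0,1)\<close>, determined by \<open>\<langle>P_op w, \<phi>\<rangle> = \<langle>w, J_op \<phi>\<rangle>\<close>.\<close>

definition P_op :: "functional \<Rightarrow> real \<Rightarrow> complex"
  where "P_op w = (SOME p. p \<in> L2 \<and> (\<forall>\<phi>\<in>L2. int01 (\<lambda>x. p x * \<phi> x) = w (J_op \<phi>)))"

definition mu0 :: "functional \<Rightarrow> complex"
  where "mu0 w = w (\<lambda>x. 1)"

definition mu1 :: "(real \<Rightarrow> complex) \<Rightarrow> complex"
  where "mu1 f = int01 (\<lambda>x. complex_of_real (1 - x) * f x)"

definition ip_Hm1 :: "functional \<Rightarrow> functional \<Rightarrow> complex"
  where "ip_Hm1 f g = ip_L2 (P_op f) (P_op g) + mu0 f * cnj (mu0 g)"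


section \<open>The form and its associated operator\<close>

definition ip_C2 :: "complex^2 \<Rightarrow> complex^2 \<Rightarrow> complex"
  where "ip_C2 x y = (\<Sum>i\<in>UNIV. x $ i * cnj (y $ i))"

definition orth_C2 :: "(complex^2) set \<Rightarrow> (complex^2) set"
  where "orth_C2 Y = {x. \<forall>y\<in>Y. ip_C2 x y = 0}"

definition hermitian :: "complex^2^2 \<Rightarrow> bool"
  where "hermitian K \<longleftrightarrow> (\<forall>i j. K $ i $ j = cnj (K $ j $ i))"

definition Gamma1 :: "(real \<Rightarrow> complex) \<Rightarrow> complex^2"
  where "Gamma1 f = vector [mu0 (emb f), mu1 f]"

definition Gamma2 :: "(real \<Rightarrow> complex) \<Rightarrow> complex^2"
  where "Gamma2 u = vector [- mu0 (emb (wderiv (wderiv u))) - u 1, u 1 - u 0]"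

text \<open>\<open>V_fun Y\<close> consists of the representatives of the elements of the form domain \<open>V_space Y\<close>.\<close>

definition V_fun :: "(complex^2) set \<Rightarrow> (real \<Rightarrow> complex) set"
  where "V_fun Y = {f \<in> L2. Gamma1 f \<in> Y}"

definition V_space :: "(complex^2) set \<Rightarrow> functional set"
  where "V_space Y = emb ` V_fun Y"

definition H_space :: "(complex^2) set \<Rightarrow> functional set"
  where "H_space Y = (if Y = {0} \<or> Y = {y. y $ 1 = 0} then {w \<in> Hm1. mu0 w = 0} else Hm1)"

definition a_form :: "complex^2^2 \<Rightarrow> (real \<Rightarrow> complex) \<Rightarrow> (real \<Rightarrow> complex) \<Rightarrow> complex"
  where "a_form K f g = ip_L2 f g + ip_C2 (K *v Gamma1 f) (Gamma1 g)"

definition A_op :: "(complex^2) set \<Rightarrow> complex^2^2 \<Rightarrow> functional rel"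
  where "A_op Y K = {(emb f, g) | f g. f \<in> V_fun Y \<and> g \<in> H_space Y \<and>
    (\<forall>h\<in>V_fun Y. a_form K f h = ip_Hm1 g (emb h))}"

end

theory Submission
  imports Defs
begin

text \<open>
  Adding a multiple \<open>\<omega>\<close> of the inner product of \<open>H\<^sup>-\<^sup>1(T)\<close> to the form \<open>a\<^sub>K\<close> gives an inner
  product \<open>q\<close> on \<open>V\<^sub>Y\<close> that is equivalent to the one of \<open>L\<^sup>2\<close>: the functional \<open>\<mu>\<^sub>0\<close> is bounded on
  \<open>H\<^sup>-\<^sup>1(T)\<close>, and \<open>\<mu>\<^sub>1\<close> is bounded there up to an arbitrarily small multiple of the \<open>L\<^sup>2\<close> norm.
  On \<open>L\<^sup>2\<close> the operator \<open>P\<close> maps into bounded functions, so by Bessel's inequality, applied pointwise,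
  the inner product of \<open>H\<^sup>-\<^sup>1(T)\<close> has finite trace with respect to \<open>q\<close>. Its spectral
  theorem yields a \<open>q\<close>-orthonormal basis of \<open>V\<^sub>Y\<close> that is orthogonal in \<open>H\<^sub>Y\<close> as well, with
  \<open>(e|e) = s\<^sub>e\<close> and \<open>\<Sum>s\<^sub>e < \<infinity>\<close>. It diagonalises \<open>A\<^sub>Y\<^sub>,\<^sub>K\<close> with eigenvalues \<open>1 / s\<^sub>e - \<omega>\<close>; hence the
  semigroup is the diagonal one on both spaces, and analyticity of angle \<open>pi / 2\<close> and the trace class
  property follow from \<open>exp (- t / s) = O(s)\<close>. Uniqueness of the semigroup with a given generator
  transfers this to every \<open>T\<close> in the statement.

  For the domain: a pair \<open>(r, z)\<close> annihilates \<open>{(h, \<Gamma>\<^sub>1 h) | h \<in> V\<^sub>Y}\<close> iff \<open>r = - (c\<^sub>1 + c\<^sub>2 (1 - x))\<close> with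
  \<open>z - c \<in> Y\<^sup>\<bottom>\<close>. For \<open>z = K \<Gamma>\<^sub>1 u - (\<mu>\<^sub>0 g, 0)\<close> and \<open>r\<close> the sum of \<open>u\<close> and the primitive of \<open>P g\<close>, this
  says that \<open>u\<close> is in \<open>H\<^sup>2\<close> with \<open>- u'' = g\<close>, and \<open>c\<close> is read off from the boundary values of \<open>u\<close>.
\<close>


section \<open>Inner products and orthonormal families\<close>

text \<open>The eigenbasis is orthonormal for \<open>q\<close>, whereas the assertions on V_Y refer
  to the inner product of L2, for which the semigroup need not be self-adjoint. Analyticity and
  generators depend on the norm only up to equivalence, but |B| changes with the inner product. The
  trace class property is therefore checked by a criterion that does not mention the eigenbasis: the
  sums of |B x|^2 and of |(B x | g x)| over finite orthonormal families of \<open>x\<close> and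
  \<open>g x\<close> stay bounded. |B| itself comes from the spectral theorem once more, applied to
  (B x | B y); that theorem rests on a bound for finite traces alone, which fits both uses and
  stands in for compactness. An arbitrary C0-semigroup with the given generator is compared with the
  diagonal one on eigenvectors. Only the behaviour at time 0 is known, and to propagate it local
  boundedness is required, hence the uniform boundedness principle. Elements w of H^-1(T) are
  handled through the pair (P w, mu0 w). On L2, P f is the primitive of f minus its mean, and the
  values of a primitive are inner products with step functions, hence bounded functionals to which
  Bessel's inequality applies at every single point.\<close>

lemma cscale_apply [simp]: "(c *\<^sub>c f) x = c * f x"
  by (simp add: cscale_def)

lemma cscale_simps [simp]:
  "1 *\<^sub>c f = f" "0 *\<^sub>c f = 0" "c *\<^sub>c (0 :: 'a \<Rightarrow> complex) = 0" "a *\<^sub>c b *\<^sub>c f = (a * b) *\<^sub>c f"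
  "(- 1) *\<^sub>c f = - f"
  by (simp_all add: fun_eq_iff)

lemma cscale_distribs:
  "c *\<^sub>c (f + g) = c *\<^sub>c f + c *\<^sub>c g" "c *\<^sub>c (f - g) = c *\<^sub>c f - c *\<^sub>c g"
  "(a + b) *\<^sub>c f = a *\<^sub>c f + b *\<^sub>c f" "(a - b) *\<^sub>c f = a *\<^sub>c f - b *\<^sub>c f"
  "c *\<^sub>c (- f) = - (c *\<^sub>c f)" "(- c) *\<^sub>c f = - (c *\<^sub>c f)"
  by (simp_all add: fun_eq_iff algebra_simps)

locale semi_ip =
  fixes X :: "('a \<Rightarrow> complex) set" and ip :: "('a \<Rightarrow> complex) \<Rightarrow> ('a \<Rightarrow> complex) \<Rightarrow> complex"
  assumes zero_mem [simp]: "0 \<in> X"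
    and add_mem [simp]: "x \<in> X \<Longrightarrow> y \<in> X \<Longrightarrow> x + y \<in> X"
    and scale_mem [simp]: "x \<in> X \<Longrightarrow> c *\<^sub>c x \<in> X"
    and add_left: "x \<in> X \<Longrightarrow> y \<in> X \<Longrightarrow> z \<in> X \<Longrightarrow> ip (x + y) z = ip x z + ip y z"
    and scale_left [simp]: "x \<in> X \<Longrightarrow> y \<in> X \<Longrightarrow> ip (c *\<^sub>c x) y = c * ip x y"
    and cnj_sym: "x \<in> X \<Longrightarrow> y \<in> X \<Longrightarrow> cnj (ip x y) = ip y x"
    and nonneg [simp]: "x \<in> X \<Longrightarrow> 0 \<le> Re (ip x x)"
begin

abbreviation nrm where "nrm \<equiv> ip_norm ip"

lemma minus_mem [simp]: "x \<in> X \<Longrightarrow> - x \<in> X"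
  using scale_mem[of x "-1"] by simp

lemma diff_mem [simp]: "x \<in> X \<Longrightarrow> y \<in> X \<Longrightarrow> x - y \<in> X"
  using add_mem[of x "- y"] by simp

lemma sum_mem: "(\<And>i. i \<in> F \<Longrightarrow> f i \<in> X) \<Longrightarrow> sum f F \<in> X"
  by (induction F rule: infinite_finite_induct) auto

lemma scale_right [simp]: "x \<in> X \<Longrightarrow> y \<in> X \<Longrightarrow> ip x (c *\<^sub>c y) = cnj c * ip x y"
  by (metis cnj_sym complex_cnj_mult scale_left scale_mem)

lemma add_right: "x \<in> X \<Longrightarrow> y \<in> X \<Longrightarrow> z \<in> X \<Longrightarrow> ip z (x + y) = ip z x + ip z y"
  by (metis cnj_sym complex_cnj_add add_left add_mem)

lemma minus_left [simp]: "x \<in> X \<Longrightarrow> y \<in> X \<Longrightarrow> ip (- x) y = - ip x y"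
  using scale_left[of x y "-1"] by simp

lemma minus_right [simp]: "x \<in> X \<Longrightarrow> y \<in> X \<Longrightarrow> ip x (- y) = - ip x y"
  using scale_right[of x y "-1"] by simp

lemma diff_left: "x \<in> X \<Longrightarrow> y \<in> X \<Longrightarrow> z \<in> X \<Longrightarrow> ip (x - y) z = ip x z - ip y z"
  using add_left[of x "- y" z] by simp

lemma diff_right: "x \<in> X \<Longrightarrow> y \<in> X \<Longrightarrow> z \<in> X \<Longrightarrow> ip z (x - y) = ip z x - ip z y"
  using add_right[of x "- y" z] by simp

lemma zero_left [simp]: "x \<in> X \<Longrightarrow> ip 0 x = 0"
  using scale_left[of 0 x 0] by simp

lemma zero_right [simp]: "x \<in> X \<Longrightarrow> ip x 0 = 0"
  using scale_right[of x 0 0] by simp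

lemma sum_left:
  "(\<And>i. i \<in> F \<Longrightarrow> f i \<in> X) \<Longrightarrow> y \<in> X \<Longrightarrow> ip (sum f F) y = (\<Sum>i\<in>F. ip (f i) y)"
  by (induction F rule: infinite_finite_induct) (auto simp: add_left sum_mem)

lemma Im_self [simp]: "x \<in> X \<Longrightarrow> Im (ip x x) = 0"
  using cnj_sym[of x x] by (metis Reals_cnj_iff complex_is_Real_iff)

lemma nrm_nonneg [simp]: "x \<in> X \<Longrightarrow> 0 \<le> nrm x"
  by (simp add: ip_norm_def)

lemma nrm_sq: "x \<in> X \<Longrightarrow> (nrm x)\<^sup>2 = Re (ip x x)"
  by (simp add: ip_norm_def)

lemma self_eq: "x \<in> X \<Longrightarrow> ip x x = complex_of_real ((nrm x)\<^sup>2)"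
  by (simp add: nrm_sq complex_eq_iff)

lemma nrm_0 [simp]: "nrm 0 = 0"
  by (simp add: ip_norm_def)

lemma nrm_scale [simp]: "x \<in> X \<Longrightarrow> nrm (c *\<^sub>c x) = cmod c * nrm x"
proof -
  assume x: "x \<in> X"
  have "ip (c *\<^sub>c x) (c *\<^sub>c x) = complex_of_real ((cmod c)\<^sup>2) * ip x x"
    using x by (simp del: of_real_power add: complex_norm_square mult_ac)
  then have "Re (ip (c *\<^sub>c x) (c *\<^sub>c x)) = (cmod c)\<^sup>2 * Re (ip x x)" by simp
  then show ?thesis by (simp add: ip_norm_def real_sqrt_mult)
qed

lemma nrm_minus [simp]: "x \<in> X \<Longrightarrow> nrm (- x) = nrm x"
  using nrm_scale[of x "-1"] by simp

lemma nrm_diff_commute: "x \<in> X \<Longrightarrow> y \<in> X \<Longrightarrow> nrm (x - y) = nrm (y - x)"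
  using nrm_minus[of "x - y"] by simp

lemma nrm_add_sq:
  "x \<in> X \<Longrightarrow> y \<in> X \<Longrightarrow> (nrm (x + y))\<^sup>2 = (nrm x)\<^sup>2 + 2 * Re (ip x y) + (nrm y)\<^sup>2"
proof -
  assume xy: "x \<in> X" "y \<in> X"
  have "Re (ip y x) = Re (ip x y)" using cnj_sym[of x y] xy by (metis complex_cnj(1) cnj.sel(1))
  then show ?thesis using xy by (simp add: nrm_sq add_left add_right)
qed

lemma nrm_diff_sq:
  "x \<in> X \<Longrightarrow> y \<in> X \<Longrightarrow> (nrm (x - y))\<^sup>2 = (nrm x)\<^sup>2 - 2 * Re (ip x y) + (nrm y)\<^sup>2"
  using nrm_add_sq[of x "- y"] by simp

text \<open>The squared norm of \<open>x - t a y\<close> with \<open>a = ip x y\<close> is a real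
  quadratic polynomial in \<open>t\<close>. Since \<open>ip\<close> is only semidefinite,
  \<open>nrm y = 0\<close> is a separate case: there the polynomial is affine in \<open>t\<close>,
  hence nonnegative only if \<open>a = 0\<close>. Otherwise it is evaluated at its minimum
  \<open>t = 1 / (nrm y)\<^sup>2\<close>.\<close>

lemma Cauchy_Schwarz: 
  assumes "x \<in> X" "y \<in> X" shows "cmod (ip x y) \<le> nrm x * nrm y"
proof -
  define a where "a = ip x y"
  have key: "0 \<le> (nrm x)\<^sup>2 - 2 * t * (cmod a)\<^sup>2 + t\<^sup>2 * (cmod a)\<^sup>2 * (nrm y)\<^sup>2" for t :: real
  proof -
    have "0 \<le> (nrm (x - (complex_of_real t * a) *\<^sub>c y))\<^sup>2" by simp
    also have "\<dots> = (nrm x)\<^sup>2 - 2 * t * (cmod a)\<^sup>2 + t\<^sup>2 * (cmod a)\<^sup>2 * (nrm y)\<^sup>2"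
      using assms unfolding nrm_diff_sq[OF assms(1) scale_mem[OF assms(2)]]
      by (simp add: a_def[symmetric] norm_mult power_mult_distrib)
        (simp add: cmod_power2[of a] algebra_simps flip: power2_eq_square)
    finally show ?thesis .
  qed
  have "cmod a ^ 2 \<le> (nrm x)\<^sup>2 * (nrm y)\<^sup>2"
  proof (cases "nrm y = 0")
    case True
    show ?thesis
    proof (rule ccontr)
      assume "\<not> ?thesis"
      then have pos: "0 < (cmod a)\<^sup>2" using True by simp
      have "0 \<le> (nrm x)\<^sup>2 - 2 * (((nrm x)\<^sup>2 + 1) / (cmod a)\<^sup>2) * (cmod a)\<^sup>2"
        using key[of "((nrm x)\<^sup>2 + 1) / (cmod a)\<^sup>2"] True by simp
      also have "\<dots> = - (nrm x)\<^sup>2 - 2" using pos by simp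
      finally show False by (smt (verit) zero_le_power2)
    qed
  next
    case False
    then have pos: "0 < (nrm y)\<^sup>2" by simp
    have "0 \<le> (nrm x)\<^sup>2 - 2 * (1 / (nrm y)\<^sup>2) * (cmod a)\<^sup>2 + (1 / (nrm y)\<^sup>2)\<^sup>2 * (cmod a)\<^sup>2 * (nrm y)\<^sup>2"
      by (rule key)
    also have "\<dots> = (nrm x)\<^sup>2 - (cmod a)\<^sup>2 / (nrm y)\<^sup>2"
      using pos by (simp add: power2_eq_square field_simps)
    finally show ?thesis using pos by (simp add: field_simps)
  qed
  then have "cmod a ^ 2 \<le> (nrm x * nrm y)\<^sup>2" by (simp add: power_mult_distrib)
  then show ?thesis using assms unfolding a_def by (meson nrm_nonneg mult_nonneg_nonneg power2_le_imp_le)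
qed

lemma nrm_triangle: "x \<in> X \<Longrightarrow> y \<in> X \<Longrightarrow> nrm (x + y) \<le> nrm x + nrm y"
proof -
  assume xy: "x \<in> X" "y \<in> X"
  have "Re (ip x y) \<le> nrm x * nrm y"
    using Cauchy_Schwarz[OF xy] complex_Re_le_cmod order_trans by blast
  then have "(nrm (x + y))\<^sup>2 \<le> (nrm x + nrm y)\<^sup>2"
    using xy by (simp add: nrm_add_sq power2_sum)
  then show ?thesis using xy by (meson nrm_nonneg add_nonneg_nonneg power2_le_imp_le)
qed

lemma nrm_triangle_diff: "x \<in> X \<Longrightarrow> y \<in> X \<Longrightarrow> nrm (x - y) \<le> nrm x + nrm y"
  using nrm_triangle[of x "- y"] by simp

lemma nrm_triangle3: "x \<in> X \<Longrightarrow> y \<in> X \<Longrightarrow> z \<in> X \<Longrightarrow> nrm (x - z) \<le> nrm (x - y) + nrm (y - z)"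
  using nrm_triangle[of "x - y" "y - z"] by simp

lemma nrm_triangle_rev: "x \<in> X \<Longrightarrow> y \<in> X \<Longrightarrow> \<bar>nrm x - nrm y\<bar> \<le> nrm (x - y)"
  using nrm_triangle[of "x - y" y] nrm_triangle[of "y - x" x] nrm_diff_commute[of x y] by simp

lemma nrm_sum_le:
  "(\<And>i. i \<in> F \<Longrightarrow> f i \<in> X) \<Longrightarrow> nrm (sum f F) \<le> (\<Sum>i\<in>F. nrm (f i))"
proof (induction F rule: infinite_finite_induct)
  case (insert i F)
  have "nrm (f i + sum f F) \<le> nrm (f i) + nrm (sum f F)"
    using insert.prems by (intro nrm_triangle sum_mem) auto
  moreover have "nrm (sum f F) \<le> (\<Sum>i\<in>F. nrm (f i))"
    using insert.prems by (intro insert.IH) auto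
  ultimately show ?case unfolding sum.insert[OF insert.hyps] by linarith
qed auto

lemma parallelogram:
  "x \<in> X \<Longrightarrow> y \<in> X \<Longrightarrow> (nrm (x - y))\<^sup>2 = 2 * (nrm x)\<^sup>2 + 2 * (nrm y)\<^sup>2 - (nrm (x + y))\<^sup>2"
  by (simp add: nrm_add_sq nrm_diff_sq)

lemma tendsto_ip_left:
  assumes "((\<lambda>n. nrm (\<sigma> n - x)) \<longlongrightarrow> 0) F" "\<And>n. \<sigma> n \<in> X" "x \<in> X" "y \<in> X"
  shows "((\<lambda>n. ip (\<sigma> n) y) \<longlongrightarrow> ip x y) F"
proof -
  have "((\<lambda>n. ip (\<sigma> n) y - ip x y) \<longlongrightarrow> 0) F"
  proof (rule Lim_null_comparison)
    show "\<forall>\<^sub>F n in F. cmod (ip (\<sigma> n) y - ip x y) \<le> nrm (\<sigma> n - x) * nrm y"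
      using assms Cauchy_Schwarz[of "\<sigma> _ - x" y] by (simp add: diff_left)
    show "((\<lambda>n. nrm (\<sigma> n - x) * nrm y) \<longlongrightarrow> 0) F"
      using tendsto_mult_right[OF assms(1), of "nrm y"] by simp
  qed
  then show ?thesis using Lim_null by blast
qed

lemma tendsto_nrm:
  assumes "((\<lambda>n. nrm (\<sigma> n - x)) \<longlongrightarrow> 0) F" "\<And>n. \<sigma> n \<in> X" "x \<in> X"
  shows "((\<lambda>n. nrm (\<sigma> n)) \<longlongrightarrow> nrm x) F"
proof -
  have "((\<lambda>n. nrm (\<sigma> n) - nrm x) \<longlongrightarrow> 0) F"
    by (rule Lim_null_comparison[OF _ assms(1)]) (use assms nrm_triangle_rev in simp)
  then show ?thesis using Lim_null by blast
qed

text \<open>Indexed families rather than sets: a set is the case of the identity, while the trace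
  class criterion needs a second orthonormal family over the same index set.\<close>

definition ons :: "'i set \<Rightarrow> ('i \<Rightarrow> 'a \<Rightarrow> complex) \<Rightarrow> bool" where
  "ons I e \<longleftrightarrow> e ` I \<subseteq> X \<and> (\<forall>i\<in>I. \<forall>j\<in>I. ip (e i) (e j) = (if i = j then 1 else 0))"

lemma ons_mem: "ons I e \<Longrightarrow> i \<in> I \<Longrightarrow> e i \<in> X"
  by (auto simp: ons_def)

lemma ons_subset: "ons I e \<Longrightarrow> J \<subseteq> I \<Longrightarrow> ons J e"
  unfolding ons_def by (meson image_mono order_trans subsetD)

lemma ons_nrm: "ons I e \<Longrightarrow> i \<in> I \<Longrightarrow> nrm (e i) = 1"
  by (auto simp: ons_def ip_norm_def)

definition lin :: "(('a \<Rightarrow> complex) \<Rightarrow> complex) \<Rightarrow> bool" where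
  "lin l \<longleftrightarrow> (\<forall>x\<in>X. \<forall>y\<in>X. l (x + y) = l x + l y) \<and> (\<forall>c. \<forall>x\<in>X. l (c *\<^sub>c x) = c * l x)"

lemma lin_ip: "y \<in> X \<Longrightarrow> lin (\<lambda>x. ip x y)"
  by (simp add: lin_def add_left)

lemma lin_zero: "lin l \<Longrightarrow> l 0 = 0"
  unfolding lin_def by (metis cscale_simps(2) mult_zero_left zero_mem)

lemma lin_sum: "lin l \<Longrightarrow> (\<And>i. i \<in> F \<Longrightarrow> f i \<in> X) \<Longrightarrow> l (sum f F) = (\<Sum>i\<in>F. l (f i))"
proof (induction F rule: infinite_finite_induct)
  case (insert i F)
  have "l (f i + sum f F) = l (f i) + l (sum f F)"
    using insert.prems sum_mem[of F f] by (simp add: lin_def)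
  moreover have "l (sum f F) = (\<Sum>i\<in>F. l (f i))"
    using insert.prems by (intro insert.IH) auto
  ultimately show ?case using insert.hyps by (metis sum.insert)
qed (auto simp: lin_zero)

definition lincomb :: "'i set \<Rightarrow> ('i \<Rightarrow> 'a \<Rightarrow> complex) \<Rightarrow> ('i \<Rightarrow> complex) \<Rightarrow> 'a \<Rightarrow> complex" where
  "lincomb F e c = (\<Sum>i\<in>F. c i *\<^sub>c e i)"

lemma lincomb_mem [simp]: "ons F e \<Longrightarrow> lincomb F e c \<in> X"
  unfolding lincomb_def by (intro sum_mem scale_mem) (auto simp: ons_mem)

lemma lincomb_ip:
  assumes "ons F e" "x \<in> X" shows "ip (lincomb F e c) x = (\<Sum>i\<in>F. c i * ip (e i) x)"
  unfolding lincomb_def using assms by (subst sum_left) (auto simp: ons_mem)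

lemma lincomb_coeff:
  assumes "ons I e" "F \<subseteq> I" "finite F" "i \<in> I"
  shows "ip (lincomb F e c) (e i) = (if i \<in> F then c i else 0)"
proof -
  have "ip (lincomb F e c) (e i) = (\<Sum>j\<in>F. c j * ip (e j) (e i))"
    using assms by (intro lincomb_ip) (auto simp: ons_mem intro: ons_subset)
  also have "\<dots> = (\<Sum>j\<in>F. if j = i then c j else 0)"
    using assms by (intro sum.cong) (auto simp: ons_def)
  finally show ?thesis using assms by simp
qed

lemma nrm_lincomb:
  assumes "ons F e" "finite F" shows "(nrm (lincomb F e c))\<^sup>2 = (\<Sum>i\<in>F. (cmod (c i))\<^sup>2)"
proof -
  have "ip (lincomb F e c) (lincomb F e c) = (\<Sum>i\<in>F. c i * ip (e i) (lincomb F e c))"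
    using assms by (simp add: lincomb_ip)
  also have "\<dots> = (\<Sum>i\<in>F. c i * cnj (c i))"
    using assms lincomb_coeff[OF assms(1) subset_refl assms(2)]
    by (intro sum.cong refl) (metis cnj_sym lincomb_mem ons_mem)
  finally show ?thesis using assms 
    by (simp add: nrm_sq complex_mult_cnj cmod_def)
qed

lemma lin_lincomb: "lin l \<Longrightarrow> ons F e \<Longrightarrow> l (lincomb F e c) = (\<Sum>i\<in>F. c i * l (e i))"
  unfolding lincomb_def by (subst lin_sum) (auto simp: lin_def ons_mem)

text \<open>At the combination \<open>v\<close> of the \<open>e i\<close> with coefficients
  \<open>cnj (l (e i))\<close> the functional takes the value \<open>S\<close>, the sum to be
  bounded, while \<open>nrm v\<close> is the square root of \<open>S\<close>; boundedness of
  \<open>l\<close> turns this into \<open>S \<le> C * sqrt S\<close>. This form serves functionals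
  that are not given as inner products, such as point evaluations.\<close>

lemma Bessel_functional:
  assumes l: "lin l" "\<And>x. x \<in> X \<Longrightarrow> cmod (l x) \<le> C * nrm x" and F: "ons F e" "finite F" and C: "0 \<le> C"
  shows "(\<Sum>i\<in>F. (cmod (l (e i)))\<^sup>2) \<le> C\<^sup>2"
proof -
  define S where "S = (\<Sum>i\<in>F. (cmod (l (e i)))\<^sup>2)"
  define v where "v = lincomb F e (\<lambda>i. cnj (l (e i)))"
  have v: "v \<in> X" and S0: "0 \<le> S" using F by (auto simp: v_def S_def intro: sum_nonneg)
  have "l v = complex_of_real S"
    unfolding v_def lin_lincomb[OF l(1) F(1)] S_def
    by (simp del: of_real_power add: complex_norm_square mult.commute)
  moreover have "(nrm v)\<^sup>2 = S" unfolding v_def nrm_lincomb[OF F] S_def by simp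
  ultimately have "S \<le> C * sqrt S" using l(2)[OF v] S0 v
    by (metis nrm_nonneg real_sqrt_unique norm_of_real abs_of_nonneg)
  then have "S * S \<le> C\<^sup>2 * S"
    using S0 mult_mono[of S "C * sqrt S" S "C * sqrt S"] C
    by (simp add: power2_eq_square mult_ac)
  then show ?thesis using S0 unfolding S_def[symmetric]
    by (cases "S = 0") auto
qed

lemma Bessel:
  assumes "ons F e" "finite F" "y \<in> X"
  shows "(\<Sum>i\<in>F. (cmod (ip (e i) y))\<^sup>2) \<le> (nrm y)\<^sup>2"
  by (rule Bessel_functional[OF lin_ip[OF assms(3)] _ assms(1,2)])
    (use assms Cauchy_Schwarz in \<open>auto simp: mult.commute\<close>)

lemma Bessel': 
  assumes "ons F e" "finite F" "y \<in> X"
  shows "(\<Sum>i\<in>F. (cmod (ip y (e i)))\<^sup>2) \<le> (nrm y)\<^sup>2"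
proof -
  have "cmod (ip y (e i)) = cmod (ip (e i) y)" if "i \<in> F" for i
    using cnj_sym[of y "e i"] assms that by (metis complex_mod_cnj ons_mem)
  then show ?thesis using Bessel[OF assms] by simp
qed

end

context semi_ip
begin

definition Cauchy_seq :: "(nat \<Rightarrow> 'a \<Rightarrow> complex) \<Rightarrow> bool" where
  "Cauchy_seq \<sigma> \<longleftrightarrow> (\<forall>\<epsilon>>0. \<exists>N. \<forall>m\<ge>N. \<forall>n\<ge>N. nrm (\<sigma> m - \<sigma> n) < \<epsilon>)"

lemma ons_insert:
  assumes E: "ons E (\<lambda>x. x)" and e: "e \<in> X" "nrm e = 1" and perp: "\<And>f. f \<in> E \<Longrightarrow> ip e f = 0"
  shows "ons (insert e E) (\<lambda>x. x)" "e \<notin> E"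
proof -
  have ee: "ip e e = 1" using e by (simp add: self_eq)
  show "e \<notin> E" using perp[of e] ee by auto
  have "ip f e = 0" if "f \<in> E" for f using cnj_sym[of e f] perp[OF that] e ons_mem[OF E that] by simp
  then show "ons (insert e E) (\<lambda>x. x)"
    using E e(1) ee perp \<open>e \<notin> E\<close> by (auto simp: ons_def)
qed

lemma Cauchy_seqI:
  assumes "\<And>m n. nrm (\<sigma> m - \<sigma> n) \<le> \<zeta> m + \<zeta> n" "\<zeta> \<longlonglongrightarrow> 0"
  shows "Cauchy_seq \<sigma>"
  unfolding Cauchy_seq_def
proof (intro allI impI)
  fix \<epsilon> :: real assume "0 < \<epsilon>"
  then have "\<forall>\<^sub>F n in sequentially. \<zeta> n < \<epsilon> / 2"
    using assms(2) by (intro order_tendstoD(2)[of \<zeta> 0]) auto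
  then obtain N where "\<And>n. n \<ge> N \<Longrightarrow> \<zeta> n < \<epsilon> / 2" unfolding eventually_sequentially by blast
  then have "nrm (\<sigma> m - \<sigma> n) < \<epsilon>" if "m \<ge> N" "n \<ge> N" for m n
    using assms(1)[of m n] that by (smt (verit) field_sum_of_halves)
  then show "\<exists>N. \<forall>m\<ge>N. \<forall>n\<ge>N. nrm (\<sigma> m - \<sigma> n) < \<epsilon>" by blast
qed

end

locale ip_space = semi_ip +
  assumes definite: "x \<in> X \<Longrightarrow> ip x x = 0 \<Longrightarrow> x = 0"
begin

lemma nrm_eq_0 [simp]: "x \<in> X \<Longrightarrow> nrm x = 0 \<longleftrightarrow> x = 0"
  using definite[of x] self_eq[of x] by auto

lemma nrm_pos: "x \<in> X \<Longrightarrow> x \<noteq> 0 \<Longrightarrow> 0 < nrm x"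
  using nrm_eq_0[of x] nrm_nonneg[of x] by linarith

lemma unit_vector:
  assumes "x \<in> X" "x \<noteq> 0"
  shows "nrm (complex_of_real (1 / nrm x) *\<^sub>c x) = 1"
  using nrm_pos[OF assms] assms(1) by (simp add: norm_divide del: nrm_eq_0)

end

text \<open>Definiteness is kept out of this locale: \<open>L2\<close> consists of functions, not of
  classes modulo null sets, and the Riesz theorem is applied to it as well.\<close>

locale complete_ip = semi_ip +
  assumes complete: "(\<And>n. \<sigma> n \<in> X) \<Longrightarrow> Cauchy_seq \<sigma> \<Longrightarrow> \<exists>x\<in>X. (\<lambda>n. nrm (\<sigma> n - x)) \<longlonglongrightarrow> 0"
begin

text \<open>The representing vector minimises \<open>\<parallel>x\<parallel>\<^sup>2 - 2 Re (l x)\<close>.\<close>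

theorem Riesz:
  assumes l: "lin l" and bd: "\<And>x. x \<in> X \<Longrightarrow> cmod (l x) \<le> C * nrm x"
  shows "\<exists>y\<in>X. \<forall>x\<in>X. l x = ip x y"
proof -
  define g where "g x = (nrm x)\<^sup>2 - 2 * Re (l x)" for x
  define m where "m = Inf (g ` X)"
  have ladd: "l (x + y) = l x + l y" and lscale: "l (c *\<^sub>c x) = c * l x" if "x \<in> X" "y \<in> X" for x y c
    using l that by (auto simp: lin_def)
  have low: "- C\<^sup>2 \<le> g x" if "x \<in> X" for x
  proof -
    have "Re (l x) \<le> C * nrm x" using bd[OF that] complex_Re_le_cmod[of "l x"] by linarith
    then show ?thesis unfolding g_def using zero_le_power2[of "nrm x - C"]
      by (simp add: power2_diff mult.commute)
  qed
  then have bdd: "bdd_below (g ` X)" by (intro bdd_belowI) auto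
  have m_le: "m \<le> g x" if "x \<in> X" for x
    unfolding m_def using bdd that by (intro cInf_lower) auto
  have "\<exists>x\<in>X. g x < m + 1 / Suc n" for n
  proof -
    have "Inf (g ` X) < m + 1 / Suc n" unfolding m_def by simp
    then show ?thesis using cInf_lessD[of "g ` X"] zero_mem by fastforce
  qed
  then obtain \<sigma> where \<sigma>: "\<And>n. \<sigma> n \<in> X" "\<And>n. g (\<sigma> n) < m + 1 / Suc n" by metis
  \<comment> \<open>The midpoint of \<open>x\<close> and \<open>y\<close> has value at least
    \<open>m\<close>; the parallelogram law turns this into a bound for the distance by the two
    excesses over \<open>m\<close>, which makes minimising sequences Cauchy.\<close>
  have key: "(nrm (x - y))\<^sup>2 \<le> 2 * (g x - m) + 2 * (g y - m)" if "x \<in> X" "y \<in> X" for x y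
  proof -
    have "m \<le> g ((1/2) *\<^sub>c (x + y))" using that by (intro m_le) simp
    also have "\<dots> = (nrm (x + y))\<^sup>2 / 4 - (Re (l x) + Re (l y))"
      using that by (simp add: g_def lscale[of "x + y" 0] ladd power_divide add_divide_distrib)
    finally show ?thesis unfolding parallelogram[OF that] g_def by simp
  qed
  have "Cauchy_seq \<sigma>"
  proof (rule Cauchy_seqI)
    fix i j
    have "nrm (\<sigma> i - \<sigma> j) \<le> sqrt (2 * (1 / Suc i) + 2 * (1 / Suc j))"
    proof (rule real_le_rsqrt)
      show "(nrm (\<sigma> i - \<sigma> j))\<^sup>2 \<le> 2 * (1 / Suc i) + 2 * (1 / Suc j)"
      proof -
        have "g (\<sigma> n) - m \<le> 1 / Suc n" for n
          using \<sigma>(2)[of n] by (metis add.commute diff_le_eq less_imp_le)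
        then have "2 * (g (\<sigma> i) - m) + 2 * (g (\<sigma> j) - m) \<le> 2 * (1 / Suc i) + 2 * (1 / Suc j)"
          by (intro add_mono mult_left_mono) auto
        then show ?thesis using key[OF \<sigma>(1) \<sigma>(1), of i j] by (rule order_trans[rotated])
      qed
    qed
    also have "\<dots> \<le> sqrt (2 * (1 / Suc i)) + sqrt (2 * (1 / Suc j))"
      by (rule sqrt_add_le_add_sqrt) auto
    finally show "nrm (\<sigma> i - \<sigma> j) \<le> sqrt (2 * (1 / Suc i)) + sqrt (2 * (1 / Suc j))" .
    have "(\<lambda>n. sqrt (2 * (1 / real (Suc n)))) \<longlonglongrightarrow> sqrt (2 * 0)"
      by (intro tendsto_intros lim_inverse_n'[THEN LIMSEQ_Suc])
    then show "(\<lambda>n. sqrt (2 * (1 / real (Suc n)))) \<longlonglongrightarrow> 0" by simp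
  qed
  then obtain y where y: "y \<in> X" and lim: "(\<lambda>n. nrm (\<sigma> n - y)) \<longlonglongrightarrow> 0"
    using complete[of \<sigma>] \<sigma>(1) by blast
  have "(\<lambda>n. l (\<sigma> n) - l y) \<longlonglongrightarrow> 0"
  proof (rule Lim_null_comparison)
    have "l (\<sigma> n) - l y = l (\<sigma> n - y)" for n
      using ladd[of "\<sigma> n - y" y] \<sigma>(1) y by simp
    then show "\<forall>\<^sub>F n in sequentially. cmod (l (\<sigma> n) - l y) \<le> C * nrm (\<sigma> n - y)"
      using bd \<sigma>(1) y by simp
    show "(\<lambda>n. C * nrm (\<sigma> n - y)) \<longlonglongrightarrow> 0" using tendsto_mult_left[OF lim, of C] by simp
  qed
  then have "(\<lambda>n. l (\<sigma> n)) \<longlonglongrightarrow> l y" using Lim_null by blast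
  then have "(\<lambda>n. g (\<sigma> n)) \<longlonglongrightarrow> g y"
    unfolding g_def by (intro tendsto_intros tendsto_nrm[OF lim \<sigma>(1) y])
  moreover have "(\<lambda>n. m + 1 / Suc n) \<longlonglongrightarrow> m + 0"
    by (intro tendsto_intros lim_inverse_n'[THEN LIMSEQ_Suc])
  ultimately have gy: "g y \<le> m"
    using LIMSEQ_le[of "\<lambda>n. g (\<sigma> n)" "g y" "\<lambda>n. m + 1 / Suc n" "m + 0"] \<sigma>(2) less_imp_le by auto
  have "l x = ip x y" if x: "x \<in> X" for x
  proof (rule ccontr)
    define d where "d = ip x y - l x"
    assume "l x \<noteq> ip x y"
    then have d: "0 < (cmod d)\<^sup>2" by (simp add: d_def)
    \<comment> \<open>Perturbing the minimiser by \<open>- t * cnj d\<close> times \<open>x\<close>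
      makes the first-order term \<open>- 2 * t * (cmod d)\<^sup>2\<close>.\<close>
    have var: "0 \<le> - 2 * t * (cmod d)\<^sup>2 + t\<^sup>2 * (cmod d)\<^sup>2 * (nrm x)\<^sup>2" for t :: real
    proof -
      define c where "c = - complex_of_real t * cnj d"
      have "g y \<le> g (y + c *\<^sub>c x)" using gy m_le[of "y + c *\<^sub>c x"] x y by simp
      also have "\<dots> = g y + (2 * Re (c * d) + (cmod c)\<^sup>2 * (nrm x)\<^sup>2)"
      proof -
        have "Re (ip y (c *\<^sub>c x)) = Re (c * ip x y)"
          using cnj_sym[OF y x] x y by (simp flip: cnj_sym[OF x y])
        then show ?thesis using x y
          by (simp add: g_def nrm_add_sq ladd lscale[of x 0] power_mult_distrib d_def algebra_simps)
      qed
      also have "c * d = - complex_of_real (t * (cmod d)\<^sup>2)"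
        by (simp del: of_real_power add: c_def complex_norm_square mult_ac)
      also have "(cmod c)\<^sup>2 = t\<^sup>2 * (cmod d)\<^sup>2"
        by (simp add: c_def norm_mult power_mult_distrib)
      finally show ?thesis by simp
    qed
    have "0 \<le> - 2 * t + t\<^sup>2 * (nrm x)\<^sup>2" for t
    proof -
      have "0 \<le> (cmod d)\<^sup>2 * (- 2 * t + t\<^sup>2 * (nrm x)\<^sup>2)"
        using var[of t] by (simp add: algebra_simps)
      then show ?thesis using d by (simp add: zero_le_mult_iff)
    qed
    \<comment> \<open>Any small positive \<open>t\<close> contradicts the inequality; the summand 1
      keeps the choice meaningful when \<open>nrm x = 0\<close>.\<close>
    then have "0 \<le> - 2 * (1 / (1 + (nrm x)\<^sup>2)) + (1 / (1 + (nrm x)\<^sup>2))\<^sup>2 * (nrm x)\<^sup>2" .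
    moreover have "(1 / (1 + (nrm x)\<^sup>2))\<^sup>2 * (nrm x)\<^sup>2 \<le> 1 / (1 + (nrm x)\<^sup>2)"
    proof -
      have p: "0 < 1 + (nrm x)\<^sup>2" by (smt (verit) zero_le_power2)
      have "(1 / (1 + (nrm x)\<^sup>2))\<^sup>2 * (nrm x)\<^sup>2 = (1 / (1 + (nrm x)\<^sup>2)) * ((nrm x)\<^sup>2 / (1 + (nrm x)\<^sup>2))"
        by (simp add: power2_eq_square)
      also have "\<dots> \<le> (1 / (1 + (nrm x)\<^sup>2)) * 1" using p by (intro mult_left_mono) auto
      finally show ?thesis by simp
    qed
    moreover have "0 < 1 / (1 + (nrm x)\<^sup>2)" by (smt (verit) zero_le_power2 divide_pos_pos)
    ultimately show False by linarith
  qed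
  then show ?thesis using y by blast
qed

end

locale hilbert = ip_space + complete_ip

section \<open>The spectral theorem for forms of finite trace\<close>

lemma finite_subsequence:
  fixes c :: "'i \<Rightarrow> nat \<Rightarrow> complex"
  assumes "finite F" "\<And>i n. i \<in> F \<Longrightarrow> cmod (c i n) \<le> B"
  shows "\<exists>r l. strict_mono r \<and> (\<forall>i\<in>F. (\<lambda>n. c i (r n)) \<longlonglongrightarrow> l i)"
  using assms
proof (induction F)
  case empty
  then show ?case by (auto intro: exI[of _ id] simp: strict_mono_id)
next
  case (insert i F)
  then obtain r l where r: "strict_mono (r :: nat \<Rightarrow> nat)" and l: "\<forall>j\<in>F. (\<lambda>n. c j (r n)) \<longlonglongrightarrow> l j"
    by (metis insert_iff)
  have "bounded (range (\<lambda>n. c i (r n)))"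
    unfolding bounded_iff using insert.prems by auto
  then obtain a s where s: "strict_mono (s :: nat \<Rightarrow> nat)" and a: "((\<lambda>n. c i (r n)) \<circ> s) \<longlonglongrightarrow> a"
    using bounded_imp_convergent_subsequence by metis
  have "(\<lambda>n. c j ((r \<circ> s) n)) \<longlonglongrightarrow> (l(i := a)) j" if "j \<in> insert i F" for j
    using that a LIMSEQ_subseq_LIMSEQ[OF _ s] l insert.hyps by (cases "j = i") (force simp: o_def)+
  then show ?case using strict_mono_o[OF r s] by blast
qed

text \<open>The form \<open>b\<close> is that of a positive operator with trace at most
  \<open>C\<close>; the bound on finite partial traces is all that is assumed, so neither the
  operator nor a basis has to be available beforehand.\<close>

locale trace_form = hilbert X ip + b: semi_ip X b
  for X :: "('a \<Rightarrow> complex) set" and ip b +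
  fixes C :: real
  assumes trace: "finite F \<Longrightarrow> ons F (\<lambda>x. x) \<Longrightarrow> (\<Sum>e\<in>F. Re (b e e)) \<le> C"
begin

text \<open>A single unit vector is an orthonormal family, so \<open>C\<close> bounds
  \<open>b\<close> on it.\<close>

lemma form_bound: assumes x: "x \<in> X" shows "b.nrm x \<le> sqrt C * nrm x"
proof (cases "x = 0")
  case False
  define e where "e = complex_of_real (1 / nrm x) *\<^sub>c x"
  have e: "e \<in> X" "nrm e = 1" using unit_vector[OF x False] x by (auto simp: e_def)
  then have "(\<Sum>e\<in>{e}. Re (b e e)) \<le> C" by (intro trace) (auto simp: ons_def self_eq)
  then have "(b.nrm e)\<^sup>2 \<le> C" using e by (simp add: b.nrm_sq)
  then have "b.nrm e \<le> sqrt C" by (rule real_le_rsqrt)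
  moreover have "b.nrm e = b.nrm x / nrm x"
    using x nrm_pos[OF x False] by (simp add: e_def norm_divide)
  ultimately show ?thesis using nrm_pos[OF x False] by (simp add: field_simps)
qed simp

lemma form_rep: assumes x: "x \<in> X" shows "\<exists>y\<in>X. \<forall>z\<in>X. b z x = ip z y"
proof (rule Riesz)
  show "lin (\<lambda>z. b z x)" using b.lin_ip[OF x] by (simp add: lin_def b.lin_def)
  fix z assume z: "z \<in> X"
  have "cmod (b z x) \<le> b.nrm z * b.nrm x" by (rule b.Cauchy_Schwarz[OF z x])
  also have "\<dots> \<le> (sqrt C * nrm z) * b.nrm x" using form_bound[OF z] x by (intro mult_right_mono) auto
  finally show "cmod (b z x) \<le> (sqrt C * b.nrm x) * nrm z" by (simp add: mult_ac)
qed

text \<open>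
  Let \<open>m\<close> be the supremum of \<open>b\<close> on the unit sphere of \<open>W\<close>. The trace bound provides finitely many
  orthonormal vectors in \<open>W\<close> such that \<open>b\<close> is at most \<open>m / 2\<close> on the unit vectors orthogonal to them, so
  the form \<open>m ip - b\<close> controls the norm there. Hence a maximising sequence whose coordinates with
  respect to these vectors converge is a Cauchy sequence.
\<close>

lemma eigenvector:
  assumes W: "W \<subseteq> X" "0 \<in> W" "\<And>x y. x \<in> W \<Longrightarrow> y \<in> W \<Longrightarrow> x + y \<in> W" "\<And>c x. x \<in> W \<Longrightarrow> c *\<^sub>c x \<in> W"
    and closed: "\<And>\<sigma> x. (\<And>n. \<sigma> n \<in> W) \<Longrightarrow> x \<in> X \<Longrightarrow> (\<lambda>n. nrm (\<sigma> n - x)) \<longlonglongrightarrow> 0 \<Longrightarrow> x \<in> W"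
    and inv: "\<And>x. x \<in> W \<Longrightarrow> \<exists>y\<in>W. \<forall>z\<in>X. b z x = ip z y"
    and w: "w \<in> W" "w \<noteq> 0"
  shows "\<exists>x\<in>W. \<exists>s\<ge>0. nrm x = 1 \<and> (\<forall>z\<in>X. b x z = complex_of_real s * ip x z)"
proof -
  have WX: "x \<in> W \<Longrightarrow> x \<in> X" for x using W by auto
  have W_minus: "x \<in> W \<Longrightarrow> y \<in> W \<Longrightarrow> x - y \<in> W" for x y
    using W(3)[of x "- 1 *\<^sub>c y"] W(4)[of y "-1"] by simp
  define U where "U = {x \<in> W. nrm x = 1}"
  define m where "m = Sup ((\<lambda>x. Re (b x x)) ` U)"
  have normalise: "complex_of_real (1 / nrm x) *\<^sub>c x \<in> U" if "x \<in> W" "x \<noteq> 0" for x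
    using that unit_vector[of x] W WX by (auto simp: U_def)
  have b_unit: "Re (b x x) \<le> C" if "x \<in> U" for x
    using trace[of "{x}"] that WX by (auto simp: U_def ons_def self_eq)
  have bdd: "bdd_above ((\<lambda>x. Re (b x x)) ` U)" using b_unit by (intro bdd_aboveI) auto
  have U_ne: "U \<noteq> {}" using normalise[OF w] by auto
  have m_ge: "Re (b x x) \<le> m" if "x \<in> U" for x
    unfolding m_def using bdd that by (intro cSup_upper) auto
  have m_W: "Re (b x x) \<le> m * (nrm x)\<^sup>2" if x: "x \<in> W" for x
  proof (cases "x = 0")
    case False
    have "Re (b x x) / (nrm x)\<^sup>2 \<le> m"
      using m_ge[OF normalise[OF x False]] x nrm_pos[OF WX[OF x] False] WX[OF x]
      by (simp add: power2_eq_square)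
    then show ?thesis using nrm_pos[OF WX[OF x] False] by (simp add: field_simps)
  qed (simp add: WX)
  have m0: "0 \<le> m"
    using U_ne m_ge b.nonneg WX unfolding U_def
    by (metis (mono_tags, lifting) all_not_in_conv mem_Collect_eq order_trans)
  show ?thesis
  proof (cases "m = 0")
    \<comment> \<open>If the supremum is 0, Cauchy-Schwarz for \<open>b\<close> shows that any unit
      vector of \<open>W\<close> is an eigenvector with eigenvalue 0.\<close>
    case True
    obtain x where x: "x \<in> U" using U_ne by auto
    then have "x \<in> W" "nrm x = 1" "x \<in> X" using WX by (auto simp: U_def)
    moreover have "b.nrm x = 0"
      using m_ge[OF x] True b.nonneg[OF \<open>x \<in> X\<close>] by (simp add: ip_norm_def)
    then have "b x z = 0" if "z \<in> X" for z
      using b.Cauchy_Schwarz[OF \<open>x \<in> X\<close> that] by simp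
    ultimately show ?thesis by (intro bexI[of _ x] exI[of _ 0]) auto
  next
    case False
    then have m: "0 < m" using m0 by simp
    define T where "T = (\<lambda>F. \<Sum>e\<in>F. Re (b e e)) ` {F. finite F \<and> F \<subseteq> W \<and> ons F (\<lambda>x. x)}"
    have T_bdd: "bdd_above T" using trace unfolding T_def by (intro bdd_aboveI) auto
    have "0 \<in> T" unfolding T_def by (rule image_eqI[of _ _ "{}"]) (auto simp: ons_def)
    moreover have "Sup T - m / 2 < Sup T" using m by simp
    \<comment> \<open>\<open>F\<close> comes within \<open>m / 2\<close> of the supremum of the
      traces in \<open>W\<close>. If \<open>b\<close> exceeded \<open>m / 2\<close> at a unit vector
      of \<open>W\<close> orthogonal to \<open>F\<close>, adding this vector to \<open>F\<close>
      would push the trace beyond the supremum.\<close>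
    ultimately obtain F where F: "finite F" "F \<subseteq> W" "ons F (\<lambda>x. x)"
      and FT: "Sup T - m / 2 < (\<Sum>e\<in>F. Re (b e e))"
      using less_cSupD[of T "Sup T - m / 2"] unfolding T_def by blast
    have tail: "Re (b z z) \<le> m / 2 * (nrm z)\<^sup>2" if z: "z \<in> W" "\<And>f. f \<in> F \<Longrightarrow> ip z f = 0" for z
    proof (cases "z = 0")
      case False
      define e where "e = complex_of_real (1 / nrm z) *\<^sub>c z"
      have e: "e \<in> W" "nrm e = 1" "e \<in> X" using normalise[OF z(1) False] WX by (auto simp: e_def U_def)
      have "ip e f = 0" if "f \<in> F" for f
        using z that F WX by (simp add: e_def subset_iff)
      note ins = ons_insert[OF F(3) e(3,2) this]
      have "e \<notin> F" using ins by blast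
      have "(\<Sum>e\<in>insert e F. Re (b e e)) \<le> Sup T"
        using F e ins by (intro cSup_upper[OF _ T_bdd]) (unfold T_def, rule imageI, auto)
      then have "Re (b e e) \<le> m / 2" using \<open>e \<notin> F\<close> F(1) FT by simp
      then have "Re (b z z) / (nrm z)\<^sup>2 \<le> m / 2"
        using WX[OF z(1)] nrm_pos[OF WX[OF z(1)] False] by (simp add: e_def power2_eq_square)
      then show ?thesis using nrm_pos[OF WX[OF z(1)] False] by (simp add: field_simps)
    qed (simp add: WX)
    \<comment> \<open>Positive semidefinite on \<open>W\<close> by the choice of \<open>m\<close>;
      its null vectors in \<open>W\<close> are the eigenvectors wanted.\<close>
    define Q where "Q x y = complex_of_real m * ip x y - b x y" for x y
    interpret Q: semi_ip W Q
    proof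
      show "0 \<le> Re (Q x x)" if "x \<in> W" for x
        using m_W[OF that] WX[OF that] by (simp add: Q_def nrm_sq)
      show "cnj (Q x y) = Q y x" if "x \<in> W" "y \<in> W" for x y
        using that WX by (simp add: Q_def cnj_sym b.cnj_sym)
    qed (use W WX in \<open>auto simp: Q_def add_left b.add_left algebra_simps\<close>)
    have Q_sq: "(Q.nrm x)\<^sup>2 = m * (nrm x)\<^sup>2 - Re (b x x)" if "x \<in> W" for x
      using that WX[OF that] by (simp add: Q.nrm_sq Q_def nrm_sq)
    have Q_le: "Q.nrm x \<le> sqrt m * nrm x" if "x \<in> W" for x
    proof -
      have "(Q.nrm x)\<^sup>2 \<le> (sqrt m * nrm x)\<^sup>2"
        using Q_sq[OF that] b.nonneg[OF WX[OF that]] m by (simp add: power_mult_distrib)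
      then show ?thesis by (rule power2_le_imp_le) (use m WX[OF that] in auto)
    qed
    have Q_ge: "nrm x \<le> sqrt (2 / m) * Q.nrm x" if "x \<in> W" "\<And>f. f \<in> F \<Longrightarrow> ip x f = 0" for x
    proof -
      have "m * (nrm x)\<^sup>2 \<le> 2 * (Q.nrm x)\<^sup>2" using Q_sq[OF that(1)] tail[OF that] by simp
      then have "(nrm x)\<^sup>2 \<le> (sqrt (2 / m) * Q.nrm x)\<^sup>2"
        using m by (simp add: power_mult_distrib field_simps)
      then show ?thesis by (rule power2_le_imp_le) (use m that in auto)
    qed
    have "\<exists>x\<in>U. m - 1 / Suc n < Re (b x x)" for n
      using less_cSupD[of "(\<lambda>x. Re (b x x)) ` U" "m - 1 / Suc n"] U_ne unfolding m_def[symmetric] by auto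
    then obtain \<sigma> where \<sigma>: "\<And>n. \<sigma> n \<in> U" "\<And>n. m - 1 / Suc n < Re (b (\<sigma> n) (\<sigma> n))" by metis
    have \<sigma>W: "\<sigma> n \<in> W" "nrm (\<sigma> n) = 1" "\<sigma> n \<in> X" for n using \<sigma>(1)[of n] WX by (auto simp: U_def)
    have "cmod (ip (\<sigma> n) f) \<le> 1" if "f \<in> F" for f n
      using Cauchy_Schwarz[of "\<sigma> n" f] \<sigma>W[of n] that F WX ons_nrm[OF F(3) that] by auto
    then obtain r l where r: "strict_mono (r :: nat \<Rightarrow> nat)"
      and l: "\<And>f. f \<in> F \<Longrightarrow> (\<lambda>n. ip (\<sigma> (r n)) f) \<longlonglongrightarrow> l f"
      using finite_subsequence[OF F(1), of "\<lambda>f n. ip (\<sigma> n) f" 1] by blast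
    define y where "y n = \<sigma> (r n)" for n
    have y: "y n \<in> W" "nrm (y n) = 1" "y n \<in> X" for n using \<sigma>W by (auto simp: y_def)
    define \<eta> where "\<eta> n = (\<Sum>f\<in>F. cmod (ip (y n) f - l f))" for n
    have \<eta>0: "\<eta> \<longlonglongrightarrow> 0"
    proof -
      have "\<eta> \<longlonglongrightarrow> (\<Sum>f\<in>F. cmod (l f - l f))"
        unfolding \<eta>_def y_def using l by (intro tendsto_sum tendsto_norm tendsto_diff tendsto_const) auto
      then show ?thesis by simp
    qed
    have Qy0: "(\<lambda>n. Q.nrm (y n)) \<longlonglongrightarrow> 0"
    proof (rule Lim_null_comparison)
      have "Q.nrm (y n) \<le> sqrt (1 / Suc n)" for n
      proof (rule real_le_rsqrt)
        have "n \<le> r n" using r by (rule seq_suble)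
        then have "1 / real (Suc (r n)) \<le> 1 / Suc n" by (simp add: frac_le)
        then show "(Q.nrm (y n))\<^sup>2 \<le> 1 / Suc n"
          using \<sigma>(2)[of "r n"] unfolding Q_sq[OF y(1)] y(2) by (simp add: y_def)
      qed
      then show "\<forall>\<^sub>F n in sequentially. norm (Q.nrm (y n)) \<le> sqrt (1 / Suc n)"
        using y by (auto intro!: always_eventually)
      have "(\<lambda>n. sqrt (1 / real (Suc n))) \<longlonglongrightarrow> sqrt 0"
        by (intro tendsto_intros lim_inverse_n'[THEN LIMSEQ_Suc])
      then show "(\<lambda>n. sqrt (1 / real (Suc n))) \<longlonglongrightarrow> 0" by simp
    qed
    define \<zeta> where "\<zeta> n = \<eta> n + sqrt (2 / m) * (Q.nrm (y n) + sqrt m * \<eta> n)" for n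
    have "Cauchy_seq y"
    proof (rule Cauchy_seqI)
      show "\<zeta> \<longlonglongrightarrow> 0" unfolding \<zeta>_def using \<eta>0 Qy0 by (auto intro!: tendsto_eq_intros)
      fix i j
      \<comment> \<open>\<open>v\<close> is the component of the difference in the span of
        \<open>F\<close>, small because the coordinates converge; the rest is orthogonal to
        \<open>F\<close>, where \<open>Q\<close> controls the norm.\<close>
      define v where "v = lincomb F (\<lambda>x. x) (\<lambda>f. ip (y i - y j) f)"
      have v: "v \<in> W" "v \<in> X"
      proof -
        have "sum g G \<in> W" if "\<And>f. f \<in> G \<Longrightarrow> g f \<in> W" for g and G :: "('a \<Rightarrow> complex) set"
          using that by (induction G rule: infinite_finite_induct) (auto simp: W)
        then show "v \<in> W" unfolding v_def lincomb_def using F W by (meson subsetD)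
        then show "v \<in> X" by (rule WX)
      qed
      have "(nrm v)\<^sup>2 = (\<Sum>f\<in>F. (cmod (ip (y i - y j) f))\<^sup>2)"
        unfolding v_def by (rule nrm_lincomb[OF F(3,1)])
      then have "nrm v = L2_set (\<lambda>f. cmod (ip (y i - y j) f)) F"
        using v by (simp add: L2_set_def real_sqrt_unique)
      also have "\<dots> \<le> (\<Sum>f\<in>F. cmod (ip (y i - y j) f))" by (rule L2_set_le_sum) auto
      also have "\<dots> \<le> (\<Sum>f\<in>F. cmod (ip (y i) f - l f) + cmod (ip (y j) f - l f))"
      proof (rule sum_mono)
        fix f assume "f \<in> F"
        then have "ip (y i - y j) f = (ip (y i) f - l f) - (ip (y j) f - l f)"
          using y F WX by (simp add: diff_left subset_iff)
        then show "cmod (ip (y i - y j) f) \<le> cmod (ip (y i) f - l f) + cmod (ip (y j) f - l f)"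
          by (metis norm_triangle_ineq4)
      qed
      also have "\<dots> = \<eta> i + \<eta> j" by (simp add: \<eta>_def sum.distrib)
      finally have v_le: "nrm v \<le> \<eta> i + \<eta> j" .
      define z where "z = (y i - y j) - v"
      have z: "z \<in> W" "z \<in> X" using y v W_minus WX by (auto simp: z_def)
      have "ip z f = 0" if "f \<in> F" for f
        using lincomb_coeff[OF F(3) subset_refl F(1) that] that y v F WX
        by (simp add: z_def v_def diff_left[of "y i - y j"] subset_iff)
      then have "nrm z \<le> sqrt (2 / m) * Q.nrm z" by (rule Q_ge[OF z(1)])
      also have "Q.nrm z \<le> (Q.nrm (y i) + Q.nrm (y j)) + sqrt m * (\<eta> i + \<eta> j)"
      proof -
        have "Q.nrm z \<le> Q.nrm (y i - y j) + Q.nrm v"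
          unfolding z_def using y v by (intro Q.nrm_triangle_diff) auto
        moreover have "Q.nrm (y i - y j) \<le> Q.nrm (y i) + Q.nrm (y j)"
          using y by (intro Q.nrm_triangle_diff) auto
        moreover have "Q.nrm v \<le> sqrt m * (\<eta> i + \<eta> j)"
          by (rule order_trans[OF Q_le[OF v(1)] mult_left_mono[OF v_le]]) (use m in simp)
        ultimately show ?thesis by linarith
      qed
      finally have "nrm z \<le> sqrt (2 / m) * ((Q.nrm (y i) + Q.nrm (y j)) + sqrt m * (\<eta> i + \<eta> j))"
        using m by simp
      moreover have "nrm (y i - y j) \<le> nrm z + nrm v"
        using nrm_triangle[OF z(2) v(2)] by (simp add: z_def)
      ultimately show "nrm (y i - y j) \<le> \<zeta> i + \<zeta> j"
        using v_le unfolding \<zeta>_def by (simp add: algebra_simps)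
    qed
    then obtain x where x: "x \<in> X" and lim: "(\<lambda>n. nrm (y n - x)) \<longlonglongrightarrow> 0"
      using complete[of y] y(3) by blast
    have xW: "x \<in> W" using closed[OF y(1) x lim] .
    have x1: "nrm x = 1"
      using LIMSEQ_unique[OF tendsto_nrm[OF lim y(3) x]] y(2) by simp
    have "Q.nrm x \<le> Q.nrm (y n) + sqrt m * nrm (y n - x)" for n
    proof -
      have "Q.nrm x \<le> Q.nrm (y n) + Q.nrm (y n - x)"
        using Q.nrm_triangle_diff[of "y n" "y n - x"] y xW W_minus by simp
      then show ?thesis using Q_le[OF W_minus[OF y(1) xW], of n] by linarith
    qed
    moreover have "(\<lambda>n. Q.nrm (y n) + sqrt m * nrm (y n - x)) \<longlonglongrightarrow> 0"
      using Qy0 lim by (auto intro!: tendsto_eq_intros)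
    ultimately have "Q.nrm x \<le> 0"
      using LIMSEQ_le_const[of "\<lambda>n. Q.nrm (y n) + sqrt m * nrm (y n - x)" 0 "Q.nrm x"] by blast
    then have Q0: "Q.nrm x = 0" using Q.nrm_nonneg[OF xW] by simp
    obtain u where u: "u \<in> W" "\<And>z. z \<in> X \<Longrightarrow> b z x = ip z u" using inv[OF xW] by blast
    define v where "v = complex_of_real m *\<^sub>c x - u"
    have v: "v \<in> W" "v \<in> X" using u xW W W_minus WX by (auto simp: v_def)
    \<comment> \<open>\<open>u\<close> is the value at \<open>x\<close> of the operator of
      \<open>b\<close>, so pairing \<open>v = m x - u\<close> with itself gives
      \<open>m * ip v x - b v x\<close>; and \<open>Q v x\<close> vanishes because \<open>x\<close>
      is a null vector of \<open>Q\<close>.\<close>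
    have "ip v v = Q v x"
      using u v x WX by (simp add: Q_def) (simp add: v_def diff_right)
    also have "\<dots> = 0" using Q.Cauchy_Schwarz[OF v(1) xW] Q0 by simp
    finally have "v = 0" using definite v by blast
    then have um: "u = complex_of_real m *\<^sub>c x" by (simp add: v_def)
    have "b x z = complex_of_real m * ip x z" if z: "z \<in> X" for z
    proof -
      have "b x z = cnj (b z x)" using z x by (simp add: b.cnj_sym)
      also have "\<dots> = complex_of_real m * cnj (ip z x)" using u(2)[OF z] um z x by simp
      finally show ?thesis using z x by (simp add: cnj_sym)
    qed
    then show ?thesis using xW x1 m by (intro bexI[of _ x] exI[of _ m]) auto
  qed
qed

text \<open>Zorn's lemma gives a maximal orthonormal set of eigenvectors. Its orthogonal complement
  is closed and invariant under the operator of \<open>b\<close>, so if it were nonzero,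
  \<open>eigenvector\<close> would supply a further member.\<close>

theorem spectral:
  "\<exists>E s. orthonormal_basis X ip E \<and> (\<forall>e\<in>E. 0 \<le> s e \<and> (\<forall>z\<in>X. b e z = complex_of_real (s e) * ip e z))"
proof -
  define eig where "eig e \<longleftrightarrow> (\<exists>s\<ge>0. \<forall>z\<in>X. b e z = complex_of_real s * ip e z)" for e
  define A where "A = {E. ons E (\<lambda>x. x) \<and> (\<forall>e\<in>E. eig e)}"
  have "\<exists>M\<in>A. \<forall>N\<in>A. M \<subseteq> N \<longrightarrow> N = M"
  proof (rule subset_Zorn')
    fix \<C> assume "subset.chain A \<C>"
    then have CA: "\<C> \<subseteq> A" and chain: "\<And>E F. E \<in> \<C> \<Longrightarrow> F \<in> \<C> \<Longrightarrow> E \<subseteq> F \<or> F \<subseteq> E"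
      by (auto simp: subset_chain_def)
    have "ip x y = (if x = y then 1 else 0)" if "x \<in> \<Union>\<C>" "y \<in> \<Union>\<C>" for x y
    proof -
      obtain E where "E \<in> \<C>" "x \<in> E" "y \<in> E" using \<open>x \<in> \<Union>\<C>\<close> \<open>y \<in> \<Union>\<C>\<close> chain by (meson UnionE subsetD)
      then show ?thesis using CA by (auto simp: A_def ons_def)
    qed
    moreover have "\<Union>\<C> \<subseteq> X" "\<forall>e\<in>\<Union>\<C>. eig e" using CA by (auto simp: A_def ons_def)
    ultimately show "\<Union>\<C> \<in> A" by (simp add: A_def ons_def)
  qed
  then obtain E where E: "E \<in> A" and max: "\<And>N. N \<in> A \<Longrightarrow> E \<subseteq> N \<Longrightarrow> N = E" by blast
  have EX: "e \<in> E \<Longrightarrow> e \<in> X" and eig: "e \<in> E \<Longrightarrow> eig e" for e using E by (auto simp: A_def ons_def)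
  have total: "x = 0" if x: "x \<in> X" "\<forall>e\<in>E. ip x e = 0" for x
  proof (rule ccontr)
    assume "x \<noteq> 0"
    define W where "W = {x \<in> X. \<forall>e\<in>E. ip x e = 0}"
    have "\<exists>x\<in>W. \<exists>s\<ge>0. nrm x = 1 \<and> (\<forall>z\<in>X. b x z = complex_of_real s * ip x z)"
    proof (rule eigenvector)
      fix \<sigma> x assume *: "\<And>n. \<sigma> n \<in> W" "x \<in> X" "(\<lambda>n. nrm (\<sigma> n - x)) \<longlonglongrightarrow> 0"
      have "ip x e = 0" if "e \<in> E" for e
      proof (rule LIMSEQ_unique)
        show "(\<lambda>n. ip (\<sigma> n) e) \<longlonglongrightarrow> ip x e"
          using * EX that by (intro tendsto_ip_left) (auto simp: W_def)
        show "(\<lambda>n. ip (\<sigma> n) e) \<longlonglongrightarrow> 0" using *(1) that by (simp add: W_def)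
      qed
      then show "x \<in> W" using * by (simp add: W_def)
    next
      fix x assume x: "x \<in> W"
      then obtain y where y: "y \<in> X" "\<And>z. z \<in> X \<Longrightarrow> b z x = ip z y"
        using form_rep[of x] by (auto simp: W_def)
      have "ip y e = 0" if e: "e \<in> E" for e
      proof -
        have "ip e x = 0" using x e cnj_sym[of x e] EX by (auto simp: W_def)
        moreover obtain s where "b e x = complex_of_real s * ip e x"
          using eig[OF e] x by (auto simp: eig_def W_def)
        ultimately have "ip e y = 0" using y(2)[OF EX[OF e]] by simp
        then show ?thesis using cnj_sym[of e y] EX[OF e] y by simp
      qed
      then show "\<exists>y\<in>W. \<forall>z\<in>X. b z x = ip z y" using y by (auto simp: W_def)
    qed (use x EX \<open>x \<noteq> 0\<close> in \<open>auto simp: W_def add_left\<close>)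
    then obtain e where e: "e \<in> W" "nrm e = 1" "eig e" by (auto simp: eig_def)
    have eX: "e \<in> X" and perp: "\<And>f. f \<in> E \<Longrightarrow> ip e f = 0" using e by (auto simp: W_def)
    have "ons (insert e E) (\<lambda>x. x)"
      using E eX e(2) perp unfolding A_def by (intro ons_insert) auto
    then have "insert e E \<in> A" using E e by (auto simp: A_def)
    then have "e \<in> E" using max by blast
    then show False using perp[of e] e(2) eX by (simp add: self_eq)
  qed
  have "orthonormal_basis X ip E"
    using E EX total by (auto simp: orthonormal_basis_def A_def ons_def)
  then show ?thesis using eig unfolding eig_def by metis
qed

end

section \<open>Expansion in an orthonormal basis\<close>

lemma square_summable_product:
  fixes a b :: "'i \<Rightarrow> complex"
  assumes "(\<lambda>i. (cmod (a i))\<^sup>2) summable_on I" "(\<lambda>i. (cmod (b i))\<^sup>2) summable_on I"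
  shows "(\<lambda>i. cmod (a i * b i)) summable_on I"
  using assms abs_summable_product[of a I b] by (simp add: norm_mult power2_eq_square)

lemma infsum_product_bound:
  fixes a b :: "'i \<Rightarrow> complex"
  assumes a: "\<And>F. finite F \<Longrightarrow> F \<subseteq> I \<Longrightarrow> (\<Sum>i\<in>F. (cmod (a i))\<^sup>2) \<le> A\<^sup>2"
    and b: "\<And>F. finite F \<Longrightarrow> F \<subseteq> I \<Longrightarrow> (\<Sum>i\<in>F. (cmod (b i))\<^sup>2) \<le> B\<^sup>2"
    and AB: "0 \<le> A" "0 \<le> B"
  shows "cmod (infsum (\<lambda>i. a i * b i) I) \<le> A * B"
proof -
  have s: "(\<lambda>i. cmod (a i * b i)) summable_on I"
    using a b by (intro square_summable_product nonneg_bdd_above_summable_on bdd_aboveI2) auto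
  have "cmod (infsum (\<lambda>i. a i * b i) I) \<le> infsum (\<lambda>i. cmod (a i * b i)) I"
    by (rule norm_infsum_bound[OF s])
  also have "\<dots> \<le> A * B"
  proof (rule infsum_le_finite_sums[OF s])
    fix F assume F: "finite F" "F \<subseteq> I"
    have "(\<Sum>i\<in>F. cmod (a i * b i)) = (\<Sum>i\<in>F. \<bar>cmod (a i)\<bar> * \<bar>cmod (b i)\<bar>)" by (simp add: norm_mult)
    also have "\<dots> \<le> L2_set (\<lambda>i. cmod (a i)) F * L2_set (\<lambda>i. cmod (b i)) F"
      by (rule L2_set_mult_ineq)
    also have "\<dots> \<le> A * B"
      using a[OF F] b[OF F] AB unfolding L2_set_def
      by (intro mult_mono real_le_lsqrt) (auto intro: sum_nonneg)
    finally show "(\<Sum>i\<in>F. cmod (a i * b i)) \<le> A * B" .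
  qed
  finally show ?thesis .
qed

locale onb = hilbert X ip
  for X :: "('a \<Rightarrow> complex) set" and ip +
  fixes I :: "'i set" and e :: "'i \<Rightarrow> 'a \<Rightarrow> complex"
  assumes ons: "ons I e"
    and total: "x \<in> X \<Longrightarrow> (\<And>i. i \<in> I \<Longrightarrow> ip x (e i) = 0) \<Longrightarrow> x = 0"
begin

lemma e_mem [simp]: "i \<in> I \<Longrightarrow> e i \<in> X"
  using ons by (rule ons_mem)

lemma coeff_eqI:
  assumes "x \<in> X" "y \<in> X" "\<And>i. i \<in> I \<Longrightarrow> ip x (e i) = ip y (e i)"
  shows "x = y"
  using total[of "x - y"] assms by (simp add: diff_left)

lemma coeff_Bessel:
  "x \<in> X \<Longrightarrow> finite F \<Longrightarrow> F \<subseteq> I \<Longrightarrow> (\<Sum>i\<in>F. (cmod (ip x (e i)))\<^sup>2) \<le> (nrm x)\<^sup>2"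
  using Bessel'[OF ons_subset[OF ons]] by blast

lemma coeff_summable: "x \<in> X \<Longrightarrow> (\<lambda>i. (cmod (ip x (e i)))\<^sup>2) summable_on I"
  using coeff_Bessel by (intro nonneg_bdd_above_summable_on bdd_aboveI2) auto

text \<open>The vector represents the functional that sends \<open>y\<close> to the sum of
  \<open>ip y (e i) * cnj (c i)\<close>, bounded by Cauchy-Schwarz for sums and Bessel; no partial
  sums have to be shown to converge. The representation also delivers the expansion of
  \<open>ip y x\<close>, from which \<open>Parseval\<close> follows.\<close>

lemma Riesz_Fischer:
  assumes c: "(\<lambda>i. (cmod (c i))\<^sup>2) summable_on I"
  shows "\<exists>x\<in>X. (\<forall>i\<in>I. ip x (e i) = c i) \<and> (\<forall>y\<in>X. ((\<lambda>i. ip y (e i) * cnj (c i)) has_sum ip y x) I)"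
proof -
  define l where "l y = infsum (\<lambda>i. ip y (e i) * cnj (c i)) I" for y
  have summ: "(\<lambda>i. ip y (e i) * cnj (c i)) summable_on I" if "y \<in> X" for y
    using square_summable_product[of "\<lambda>i. ip y (e i)" I "\<lambda>i. cnj (c i)"] coeff_summable[OF that] c
    by (simp add: abs_summable_summable)
  define S where "S = infsum (\<lambda>i. (cmod (c i))\<^sup>2) I"
  have S: "(\<Sum>i\<in>F. (cmod (cnj (c i)))\<^sup>2) \<le> (sqrt S)\<^sup>2" if "finite F" "F \<subseteq> I" for F
  proof -
    have "(\<Sum>i\<in>F. (cmod (c i))\<^sup>2) \<le> S"
      unfolding S_def using that by (intro finite_sum_le_infsum c) auto
    moreover have "0 \<le> S" unfolding S_def by (rule infsum_nonneg) auto
    ultimately show ?thesis by simp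
  qed
  have "\<exists>x\<in>X. \<forall>y\<in>X. l y = ip y x"
  proof (rule Riesz)
    show "lin l" unfolding lin_def
    proof (intro conjI ballI allI)
      fix y z assume "y \<in> X" "z \<in> X"
      then show "l (y + z) = l y + l z"
        unfolding l_def by (subst infsum_add[symmetric, OF summ summ])
          (auto intro!: infsum_cong simp: add_left algebra_simps)
    next
      fix a y assume "y \<in> X"
      then show "l (a *\<^sub>c y) = a * l y"
        unfolding l_def by (subst infsum_cmult_right'[symmetric]) (auto intro!: infsum_cong)
    qed
    show "cmod (l y) \<le> sqrt S * nrm y" if y: "y \<in> X" for y
    proof -
      have "0 \<le> S" unfolding S_def by (rule infsum_nonneg) auto
      then show ?thesis unfolding l_def
        using infsum_product_bound[of I "\<lambda>i. ip y (e i)" "nrm y" "\<lambda>i. cnj (c i)" "sqrt S"]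
          coeff_Bessel[OF y] S y by (simp add: mult.commute)
    qed
  qed
  then obtain x where x: "x \<in> X" "\<And>y. y \<in> X \<Longrightarrow> l y = ip y x" by auto
  have "ip x (e i) = c i" if i: "i \<in> I" for i
  proof -
    have "cnj (ip x (e i)) = ip (e i) x" using x i by (simp add: cnj_sym)
    also have "\<dots> = l (e i)" using x(2)[OF e_mem[OF i]] by simp
    also have "\<dots> = infsum (\<lambda>j. ip (e i) (e j) * cnj (c j)) {i}"
      unfolding l_def using ons i by (intro infsum_cong_neutral) (auto simp: ons_def)
    also have "\<dots> = cnj (c i)" using ons i by (simp add: ons_def)
    finally show ?thesis by simp
  qed
  moreover have "((\<lambda>i. ip y (e i) * cnj (c i)) has_sum ip y x) I" if "y \<in> X" for y
    using has_sum_infsum[OF summ[OF that]] x(2)[OF that] by (simp add: l_def)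
  ultimately show ?thesis using x by blast
qed

text \<open>The vector that \<open>Riesz_Fischer\<close> builds from the coefficients of
  \<open>y\<close> can only be \<open>y\<close>, by totality.\<close>

lemma Parseval:
  assumes "x \<in> X" "y \<in> X"
  shows "((\<lambda>i. ip x (e i) * cnj (ip y (e i))) has_sum ip x y) I"
proof -
  obtain z where z: "z \<in> X" "\<forall>i\<in>I. ip z (e i) = ip y (e i)"
    and *: "\<forall>x\<in>X. ((\<lambda>i. ip x (e i) * cnj (ip y (e i))) has_sum ip x z) I"
    using Riesz_Fischer[OF coeff_summable[OF assms(2)]] by blast
  then have "z = y" using assms by (intro coeff_eqI) auto
  then show ?thesis using * assms by simp
qed

lemma Parseval_nrm: "x \<in> X \<Longrightarrow> ((\<lambda>i. (cmod (ip x (e i)))\<^sup>2) has_sum (nrm x)\<^sup>2) I"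
  using has_sum_Re[OF Parseval[of x x]]
  by (simp add: nrm_sq complex_mult_cnj cmod_power2 flip: power2_eq_square)

lemma nrm_mono:
  assumes "x \<in> X" "y \<in> X" "0 \<le> B" "\<And>i. i \<in> I \<Longrightarrow> cmod (ip x (e i)) \<le> B * cmod (ip y (e i))"
  shows "nrm x \<le> B * nrm y"
proof -
  have "(nrm x)\<^sup>2 \<le> B\<^sup>2 * (nrm y)\<^sup>2"
  proof (rule has_sum_mono[OF Parseval_nrm[OF assms(1)] has_sum_cmult_right[OF Parseval_nrm[OF assms(2)]]])
    show "(cmod (ip x (e i)))\<^sup>2 \<le> B\<^sup>2 * (cmod (ip y (e i)))\<^sup>2" if "i \<in> I" for i
      using power_mono[OF assms(4)[OF that] norm_ge_zero, of 2] by (simp add: power_mult_distrib)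
  qed
  then have "(nrm x)\<^sup>2 \<le> (B * nrm y)\<^sup>2" by (simp add: power_mult_distrib)
  then show ?thesis by (rule power2_le_imp_le) (use assms in simp)
qed

lemma finite_approx:
  assumes x: "x \<in> X" and "0 < \<epsilon>"
  shows "\<exists>F. finite F \<and> F \<subseteq> I \<and> nrm (x - lincomb F e (\<lambda>i. ip x (e i))) < \<epsilon>"
proof -
  have "0 < (\<epsilon> / 2)\<^sup>2" using assms by simp
  then obtain F where F: "finite F" "F \<subseteq> I" "dist (\<Sum>i\<in>F. (cmod (ip x (e i)))\<^sup>2) ((nrm x)\<^sup>2) \<le> (\<epsilon> / 2)\<^sup>2"
    using has_sum_finite_approximation[OF Parseval_nrm[OF x], of "(\<epsilon> / 2)\<^sup>2"] by blast
  define v where "v = lincomb F e (\<lambda>i. ip x (e i))"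
  have onsF: "ons F e" using ons_subset[OF ons F(2)] .
  have v: "v \<in> X" using onsF by (simp add: v_def)
  have "ip v x = (\<Sum>i\<in>F. ip x (e i) * cnj (ip x (e i)))"
    unfolding v_def using onsF x F(2) by (subst lincomb_ip) (auto intro!: sum.cong simp: cnj_sym)
  then have "Re (ip v x) = (\<Sum>i\<in>F. (cmod (ip x (e i)))\<^sup>2)"
    by (simp add: complex_mult_cnj cmod_power2 flip: power2_eq_square)
  moreover have "Re (ip x v) = Re (ip v x)" using cnj_sym[OF x v] by (metis complex_cnj(1) cnj.sel(1))
  ultimately have "(nrm (x - v))\<^sup>2 = (nrm x)\<^sup>2 - (\<Sum>i\<in>F. (cmod (ip x (e i)))\<^sup>2)"
    using nrm_diff_sq[OF x v] nrm_lincomb[OF onsF F(1), of "\<lambda>i. ip x (e i)"] by (simp add: v_def)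
  also have "\<dots> \<le> (\<epsilon> / 2)\<^sup>2" using F(3) by (simp add: dist_real_def)
  finally have "nrm (x - v) \<le> \<epsilon> / 2" by (rule power2_le_imp_le) (use assms in simp)
  then show ?thesis using F \<open>0 < \<epsilon>\<close> unfolding v_def by (intro exI[of _ F]) auto
qed

text \<open>For bounded \<open>m\<close> the choice is possible, and it is unique by
  \<open>coeff_eqI\<close>; for other multipliers the value carries no information.\<close>

definition diag :: "('i \<Rightarrow> complex) \<Rightarrow> ('a \<Rightarrow> complex) \<Rightarrow> 'a \<Rightarrow> complex" where
  "diag m x = (SOME y. y \<in> X \<and> (\<forall>i\<in>I. ip y (e i) = m i * ip x (e i)))"

lemma diag:
  assumes m: "\<And>i. i \<in> I \<Longrightarrow> cmod (m i) \<le> B" and x: "x \<in> X"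
  shows "diag m x \<in> X" "i \<in> I \<Longrightarrow> ip (diag m x) (e i) = m i * ip x (e i)"
proof -
  have "(\<lambda>i. (cmod (m i * ip x (e i)))\<^sup>2) summable_on I"
  proof (rule summable_on_comparison_test)
    show "(\<lambda>i. B\<^sup>2 * (cmod (ip x (e i)))\<^sup>2) summable_on I"
      by (intro summable_on_cmult_right coeff_summable x)
    show "(cmod (m i * ip x (e i)))\<^sup>2 \<le> B\<^sup>2 * (cmod (ip x (e i)))\<^sup>2" if "i \<in> I" for i
      using power_mono[OF m[OF that] norm_ge_zero, of 2]
      by (simp add: norm_mult power_mult_distrib mult_right_mono)
  qed auto
  from Riesz_Fischer[OF this] have "\<exists>y. y \<in> X \<and> (\<forall>i\<in>I. ip y (e i) = m i * ip x (e i))" by auto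
  from someI_ex[OF this] show "diag m x \<in> X" "i \<in> I \<Longrightarrow> ip (diag m x) (e i) = m i * ip x (e i)"
    by (auto simp: diag_def)
qed

lemma diag_bounded_op:
  assumes m: "\<And>i. i \<in> I \<Longrightarrow> cmod (m i) \<le> B"
  shows "bounded_op X ip (diag m)"
  unfolding bounded_op_def
proof (intro conjI ballI allI exI)
  note d [simp] = diag[of m B, OF m]
  show "diag m x \<in> X" if "x \<in> X" for x using that by simp
  show "diag m (x + y) = diag m x + diag m y" if "x \<in> X" "y \<in> X" for x y
    using that by (intro coeff_eqI) (simp_all add: add_left algebra_simps)
  show "diag m (c *\<^sub>c x) = c *\<^sub>c diag m x" if "x \<in> X" for c x
    using that by (intro coeff_eqI) simp_all
  have "cmod (m i) \<le> \<bar>B\<bar>" if "i \<in> I" for i using m[OF that] by simp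
  then show "nrm (diag m x) \<le> \<bar>B\<bar> * nrm x" if "x \<in> X" for x
    using that by (intro nrm_mono) (simp_all add: norm_mult mult_right_mono)
qed

text \<open>Dominated convergence for multipliers: finitely many coordinates converge jointly, and
  what remains of \<open>x\<close> has small norm and is multiplied by at most
  \<open>2 * B\<close>.\<close>

lemma diag_tendsto:
  assumes B: "0 \<le> B" and ev: "\<forall>\<^sub>F p in F. \<forall>i\<in>I. cmod (m p i) \<le> B" and m0: "\<And>i. i \<in> I \<Longrightarrow> cmod (m0 i) \<le> B"
    and lim: "\<And>i. i \<in> I \<Longrightarrow> ((\<lambda>p. m p i) \<longlongrightarrow> m0 i) F" and x: "x \<in> X"
  shows "((\<lambda>p. nrm (diag (m p) x - diag m0 x)) \<longlongrightarrow> 0) F"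
proof (rule tendstoI)
  fix \<epsilon> :: real assume \<epsilon>: "0 < \<epsilon>"
  define \<delta> where "\<delta> = \<epsilon> / (4 * B + 4)"
  have \<delta>: "0 < \<delta>" "2 * B * \<delta> < \<epsilon> / 2" using \<epsilon> B by (auto simp: \<delta>_def field_simps)
  obtain K where K: "finite K" "K \<subseteq> I" "nrm (x - lincomb K e (\<lambda>i. ip x (e i))) < \<delta>"
    using finite_approx[OF x \<delta>(1)] by blast
  have onsK: "ons K e" using ons_subset[OF ons K(2)] .
  define S where "S p = (\<Sum>i\<in>K. cmod (m p i - m0 i) * cmod (ip x (e i)))" for p
  have "(S \<longlongrightarrow> (\<Sum>i\<in>K. cmod (m0 i - m0 i) * cmod (ip x (e i)))) F"
    unfolding S_def using K(2) by (intro tendsto_intros lim) auto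
  then have "\<forall>\<^sub>F p in F. S p < \<epsilon> / 2" using \<epsilon> by (intro order_tendstoD(2)[of S 0]) auto
  with ev show "\<forall>\<^sub>F p in F. dist (nrm (diag (m p) x - diag m0 x)) 0 < \<epsilon>"
  proof eventually_elim
    fix p assume mp: "\<forall>i\<in>I. cmod (m p i) \<le> B" and Sp: "S p < \<epsilon> / 2"
    have d [simp]: "diag (m p) x \<in> X" "\<And>i. i \<in> I \<Longrightarrow> ip (diag (m p) x) (e i) = m p i * ip x (e i)"
      using diag[of "m p" B x] mp x by auto
    have d0 [simp]: "diag m0 x \<in> X" "\<And>i. i \<in> I \<Longrightarrow> ip (diag m0 x) (e i) = m0 i * ip x (e i)"
      using diag[of m0 B x] m0 x by auto
    define u where "u = lincomb K e (\<lambda>i. (m p i - m0 i) * ip x (e i))"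
    define w where "w = x - lincomb K e (\<lambda>i. ip x (e i))"
    have u: "u \<in> X" and w: "w \<in> X" using onsK x by (auto simp: u_def w_def)
    have "nrm u \<le> (\<Sum>i\<in>K. nrm (((m p i - m0 i) * ip x (e i)) *\<^sub>c e i))"
      unfolding u_def lincomb_def using K(2) by (intro nrm_sum_le) auto
    also have "\<dots> = S p"
      unfolding S_def using K(2) ons_nrm[OF onsK] by (intro sum.cong refl) (auto simp: norm_mult)
    finally have "nrm u < \<epsilon> / 2" using Sp by simp
    moreover have "nrm (diag (m p) x - diag m0 x - u) \<le> 2 * B * nrm w"
    proof (rule nrm_mono)
      fix i assume i: "i \<in> I"
      have "ip (diag (m p) x - diag m0 x - u) (e i) = (m p i - m0 i) * ip w (e i)"
      proof -
        have "ip (diag (m p) x - diag m0 x - u) (e i) = (m p i - m0 i) * ip x (e i) - ip u (e i)"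
          using i x u by (simp add: diff_left left_diff_distrib)
        moreover have "ip w (e i) = ip x (e i) - ip (lincomb K e (\<lambda>i. ip x (e i))) (e i)"
          unfolding w_def using i x onsK by (simp add: diff_left)
        ultimately show ?thesis unfolding u_def lincomb_coeff[OF ons K(2,1) i] by simp
      qed
      moreover have "cmod (m p i - m0 i) \<le> 2 * B"
        using norm_triangle_ineq4[of "m p i" "m0 i"] bspec[OF mp i] m0[OF i] by linarith
      ultimately show "cmod (ip (diag (m p) x - diag m0 x - u) (e i)) \<le> 2 * B * cmod (ip w (e i))"
        by (simp add: norm_mult mult_right_mono)
    qed (use u w B in auto)
    moreover have "2 * B * nrm w \<le> 2 * B * \<delta>" using K(3) B by (intro mult_left_mono) (auto simp: w_def)
    moreover have "nrm (diag (m p) x - diag m0 x) \<le> nrm (diag (m p) x - diag m0 x - u) + nrm u"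
      using nrm_triangle[of "diag (m p) x - diag m0 x - u" u] u by simp
    ultimately show "dist (nrm (diag (m p) x - diag m0 x)) 0 < \<epsilon>" using \<delta>(2) by simp
  qed
qed

end

section \<open>The uniform boundedness principle\<close>

context hilbert
begin

text \<open>\<open>N\<close> is the operator norm of \<open>B\<close>. Any factor below 1 is
  available; \<open>uniform_boundedness\<close> needs one above 1/2, because the tail of its series
  costs half of \<open>N\<close>, and with 3/4 a quarter remains.\<close>

lemma almost_attained:
  assumes B: "bounded_op X ip B" and C: "0 \<le> C" and large: "\<not> (\<forall>x\<in>X. nrm (B x) \<le> C * nrm x)"
  shows "\<exists>N u. C \<le> N \<and> 0 < N \<and> u \<in> X \<and> nrm u = 1 \<and> 3 / 4 * N \<le> nrm (B u) \<and> (\<forall>x\<in>X. nrm (B x) \<le> N * nrm x)"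
proof -
  have BX [simp]: "x \<in> X \<Longrightarrow> B x \<in> X" and Bs: "x \<in> X \<Longrightarrow> B (c *\<^sub>c x) = c *\<^sub>c B x" for x c
    using B by (auto simp: bounded_op_def)
  obtain D where D: "\<And>x. x \<in> X \<Longrightarrow> nrm (B x) \<le> D * nrm x"
    using B unfolding bounded_op_def by blast
  define N where "N = Sup ((\<lambda>u. nrm (B u)) ` {u \<in> X. nrm u = 1})"
  have B0: "B 0 = 0" using Bs[of 0 0] by simp
  have scaled: "nrm (B (complex_of_real (1 / nrm x) *\<^sub>c x)) = nrm (B x) / nrm x" if "x \<in> X" "x \<noteq> 0" for x
    using that nrm_pos[OF that] by (simp add: Bs norm_divide)
  have bdd: "bdd_above ((\<lambda>u. nrm (B u)) ` {u \<in> X. nrm u = 1})"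
  proof (intro bdd_aboveI2)
    show "nrm (B u) \<le> D" if "u \<in> {u \<in> X. nrm u = 1}" for u using D[of u] that by simp
  qed
  have le: "nrm (B x) \<le> N * nrm x" if x: "x \<in> X" for x
  proof (cases "x = 0")
    case False
    have "nrm (B x) / nrm x \<le> N"
      unfolding N_def scaled[OF x False, symmetric]
      by (rule cSup_upper[OF _ bdd]) (use x False unit_vector[OF x] in auto)
    then show ?thesis using nrm_pos[OF x False] by (simp add: pos_divide_le_eq)
  qed (simp add: B0)
  obtain x where x: "x \<in> X" "C * nrm x < nrm (B x)" using large by force
  then have x0: "x \<noteq> 0" using B0 by auto
  have "C * nrm x < N * nrm x" using x le by fastforce
  then have CN: "C < N" using nrm_pos[OF x(1) x0] by simp
  have "3 / 4 * N < N" using CN C by simp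
  moreover have "complex_of_real (1 / nrm x) *\<^sub>c x \<in> {u \<in> X. nrm u = 1}"
    using unit_vector[OF x(1) x0] scale_mem[OF x(1)] by blast
  ultimately obtain u where "u \<in> X" "nrm u = 1" "3 / 4 * N < nrm (B u)"
    using less_cSupD[of "(\<lambda>u. nrm (B u)) ` {u \<in> X. nrm u = 1}" "3 / 4 * N"] unfolding N_def by blast
  then show ?thesis using le CN C by (intro exI[of _ N] exI[of _ u]) auto
qed

text \<open>
  Sokal's elementary proof: \<open>x (k + 1)\<close> is one of \<open>x k \<plusminus> 3\<^sup>-\<^sup>k u k\<close>, where \<open>u k\<close> almost attains an
  operator norm that is at least \<open>4\<^sup>k\<close>.
\<close>

theorem uniform_boundedness:
  assumes B: "\<And>n :: nat. bounded_op X ip (B n)" and pointwise: "\<And>x. x \<in> X \<Longrightarrow> \<exists>C. \<forall>n. nrm (B n x) \<le> C"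
  shows "\<exists>C. \<forall>n. \<forall>x\<in>X. nrm (B n x) \<le> C * nrm x"
proof (rule ccontr)
  assume "\<not> ?thesis"
  then have "\<exists>n N u. 4 ^ k \<le> N \<and> 0 < N \<and> u \<in> X \<and> nrm u = 1 \<and> 3 / 4 * N \<le> nrm (B n u) \<and> (\<forall>x\<in>X. nrm (B n x) \<le> N * nrm x)"
    for k
    using almost_attained[OF B, of "4 ^ k"] by (metis zero_le_numeral zero_le_power)
  then obtain n N u where N: "\<And>k. 4 ^ k \<le> N k" "\<And>k. 0 < N k" and u: "\<And>k. u k \<in> X" "\<And>k. nrm (u k) = 1"
    and at: "\<And>k. 3 / 4 * N k \<le> nrm (B (n k) (u k))" and bd: "\<And>k x. x \<in> X \<Longrightarrow> nrm (B (n k) x) \<le> N k * nrm x"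
    by metis
  have BX [simp]: "x \<in> X \<Longrightarrow> B k x \<in> X" and Ba: "x \<in> X \<Longrightarrow> y \<in> X \<Longrightarrow> B k (x + y) = B k x + B k y"
    and Bs: "x \<in> X \<Longrightarrow> B k (c *\<^sub>c x) = c *\<^sub>c B k x" for x y c k
    using B[of k] by (auto simp: bounded_op_def)
  have Bd: "B k (x - y) = B k x - B k y" if "x \<in> X" "y \<in> X" for x y k
    using Ba[of x "- 1 *\<^sub>c y" k] Bs[of y k "-1"] that by simp
  define v where "v k = complex_of_real ((1 / 3) ^ k) *\<^sub>c u k" for k
  define x where "x = rec_nat 0 (\<lambda>k x. if nrm (B (n k) (v k)) \<le> nrm (B (n k) (x + v k)) then x + v k else x - v k)"
  have x_Suc: "x (Suc k) = (if nrm (B (n k) (v k)) \<le> nrm (B (n k) (x k + v k)) then x k + v k else x k - v k)"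
    for k
    by (simp add: x_def)
  have v: "v k \<in> X" "nrm (v k) = (1 / 3) ^ k" for k
    using u by (auto simp: v_def norm_power norm_divide)
  have xX: "x k \<in> X" for k
  proof (induction k)
    case (Suc k)
    then show ?case using v by (simp add: x_Suc)
  next
    case 0
    have "x 0 = 0" unfolding x_def by (rule nat.rec)
    then show ?case by (metis zero_mem)
  qed
  \<comment> \<open>Twice \<open>v k\<close> is the difference of the candidates
    \<open>x k + v k\<close> and \<open>x k - v k\<close>, so at least one of their images is as
    large as that of \<open>v k\<close>, and the recursion selects it.\<close>
  have large: "nrm (B (n k) (v k)) \<le> nrm (B (n k) (x (Suc k)))" for k
  proof (rule ccontr)
    assume *: "\<not> ?thesis"
    have "2 *\<^sub>c v k = (x k + v k) - (x k - v k)" by (simp add: fun_eq_iff)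
    then have "B (n k) (2 *\<^sub>c v k) = B (n k) (x k + v k) - B (n k) (x k - v k)"
      using xX v by (simp only: Bd add_mem diff_mem)
    moreover have "nrm (B (n k) (2 *\<^sub>c v k)) = 2 * nrm (B (n k) (v k))"
      using v by (simp add: Bs)
    ultimately have "2 * nrm (B (n k) (v k)) \<le> nrm (B (n k) (x k + v k)) + nrm (B (n k) (x k - v k))"
      using nrm_triangle_diff[of "B (n k) (x k + v k)" "B (n k) (x k - v k)"] xX v
      by simp
    then show False using * by (auto simp: x_Suc split: if_splits)
  qed
  have step: "nrm (x (Suc k) - x k) \<le> (1 / 3) ^ k" for k
    using v[of k] xX[of k] by (simp add: x_Suc)
  have dist_le: "nrm (x (k + j) - x k) \<le> 3 / 2 * ((1 / 3) ^ k - (1 / 3) ^ (k + j))" for k j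
  proof (induction j)
    case (Suc j)
    have IH: "nrm (x (k + j) - x k) \<le> 3 / 2 * ((1 / 3) ^ k - (1 / 3) ^ (k + j))" by (rule Suc.IH)
    have "nrm (x (Suc (k + j)) - x k) \<le> nrm (x (Suc (k + j)) - x (k + j)) + nrm (x (k + j) - x k)"
      by (intro nrm_triangle3 xX)
    also have "\<dots> \<le> 3 / 2 * ((1 / 3) ^ k - (1 / 3) ^ Suc (k + j))"
      using IH step[of "k + j"] by simp
    finally show ?case by (simp only: add_Suc_right)
  next
    case 0
    have "x (k + 0) - x k = 0" by (simp add: fun_eq_iff)
    then show ?case using nrm_0
      by (metis add_0_right cancel_comm_monoid_add_class.diff_cancel mult_zero_right order_refl)
  qed
  have dist_le': "nrm (x j - x k) \<le> 3 / 2 * (1 / 3) ^ k" if "k \<le> j" for j k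
  proof -
    have "nrm (x (k + (j - k)) - x k) \<le> 3 / 2 * ((1 / 3) ^ k - (1 / 3) ^ (k + (j - k)))"
      by (rule dist_le)
    also have "\<dots> \<le> 3 / 2 * (1 / 3) ^ k" by (intro mult_left_mono) auto
    finally show ?thesis using that by simp
  qed
  have "Cauchy_seq x"
  proof (rule Cauchy_seqI)
    fix j k :: nat
    have nn: "0 \<le> 3 / 2 * (1 / 3 :: real) ^ j" "0 \<le> 3 / 2 * (1 / 3 :: real) ^ k" by auto
    show "nrm (x j - x k) \<le> 3 / 2 * (1 / 3) ^ j + 3 / 2 * (1 / 3) ^ k"
      using dist_le'[of j k] dist_le'[of k j] nrm_diff_commute[OF xX xX, of j k] nn
      by (cases "j \<le> k") linarith+
  next
    show "(\<lambda>k. 3 / 2 * (1 / 3 :: real) ^ k) \<longlonglongrightarrow> 0"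
      by (rule tendsto_mult_right_zero, rule LIMSEQ_realpow_zero) auto
  qed
  then obtain y where y: "y \<in> X" and lim: "(\<lambda>k. nrm (x k - y)) \<longlonglongrightarrow> 0"
    using complete[of x] xX by blast
  \<comment> \<open>The geometric series from \<open>k\<close> on. At \<open>Suc k\<close> the bound
    is half of \<open>(1 / 3) ^ k\<close>, the norm of \<open>v k\<close>.\<close>
  have close: "nrm (x k - y) \<le> 3 / 2 * (1 / 3) ^ k" for k
  proof (rule LIMSEQ_le_const)
    show "(\<lambda>j. 3 / 2 * (1 / 3) ^ k + nrm (x j - y)) \<longlonglongrightarrow> 3 / 2 * (1 / 3) ^ k"
      using tendsto_add[OF tendsto_const lim] by simp
    have "nrm (x k - y) \<le> 3 / 2 * (1 / 3) ^ k + nrm (x j - y)" if "k \<le> j" for j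
      using nrm_triangle3[OF xX[of k] xX[of j] y] dist_le'[OF that] nrm_diff_commute[OF xX xX, of j k]
      by simp
    then show "\<exists>N. \<forall>j\<ge>N. nrm (x k - y) \<le> 3 / 2 * (1 / 3) ^ k + nrm (x j - y)" by blast
  qed
  obtain C where C: "\<And>k. nrm (B k y) \<le> C" using pointwise[OF y] by blast
  have "(4 / 3) ^ k \<le> 4 * C" for k
  proof -
    have "3 / 4 * N k * (1 / 3) ^ k \<le> nrm (B (n k) (v k))"
    proof -
      have "nrm (B (n k) (v k)) = (1 / 3) ^ k * nrm (B (n k) (u k))"
        unfolding v_def using u by (simp add: Bs norm_power norm_divide)
      then show ?thesis using mult_right_mono[OF at[of k], of "(1 / 3) ^ k"] by (simp add: mult.commute)
    qed
    also have "\<dots> \<le> nrm (B (n k) (x (Suc k)))" by (rule large)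
    also have "\<dots> \<le> nrm (B (n k) (x (Suc k) - y)) + nrm (B (n k) y)"
      using nrm_triangle[of "B (n k) (x (Suc k) - y)" "B (n k) y"] xX y by (simp add: Bd)
    also have "\<dots> \<le> N k * (3 / 2 * (1 / 3) ^ Suc k) + C"
      using order_trans[OF bd[of "x (Suc k) - y" k] mult_left_mono[OF close[of "Suc k"], of "N k"]]
        N(2)[of k] C[of "n k"] xX y by (intro add_mono) auto
    finally have "N k * (1 / 3) ^ k \<le> 4 * C" by simp
    moreover have "(4 / 3 :: real) ^ k = 4 ^ k * (1 / 3) ^ k" by (simp flip: power_mult_distrib)
    moreover have "4 ^ k * (1 / 3) ^ k \<le> N k * (1 / 3) ^ k" by (intro mult_right_mono N) auto
    ultimately show ?thesis by linarith
  qed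
  moreover obtain k where "4 * C < (4 / 3) ^ k" using real_arch_pow[of "4 / 3" "4 * C"] by auto
  ultimately show False by (meson not_le)
qed

end

section \<open>Diagonal semigroups\<close>

lemma exp_slope_tendsto:
  "((\<lambda>t. (exp (- (t * a)) - 1) / t) \<longlongrightarrow> - a) (at_right (0::real))"
proof -
  have "((\<lambda>t. exp (- (t * a))) has_real_derivative - a) (at 0)"
    by (auto intro!: derivative_eq_intros)
  then have "((\<lambda>t. (exp (- (t * a)) - exp (- (0 * a))) / (t - 0)) \<longlongrightarrow> - a) (at 0)"
    by (simp add: has_field_derivative_iff)
  then have "((\<lambda>t. (exp (- (t * a)) - 1) / t) \<longlongrightarrow> - a) (at 0)" by simp
  then show ?thesis by (rule filterlim_mono[OF _ order_refl at_le]) auto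
qed

text \<open>The quotient is the multiplier that turns the value of the generator into the difference
  quotient of the semigroup. It is at most 1 for positive \<open>s\<close>; for negative
  \<open>s\<close> it is the lower bound \<open>- b\<close> of the spectrum that keeps it
  bounded.\<close>

lemma exp_slope_bound:
  fixes s b :: real
  assumes "s \<noteq> 0" "- b \<le> s" "0 \<le> b"
  shows "\<bar>(1 - exp (- s)) / s\<bar> \<le> exp b"
proof (cases "0 < s")
  case True
  have "1 - exp (- s) \<le> s" using exp_ge_add_one_self[of "- s"] by simp
  then have "\<bar>(1 - exp (- s)) / s\<bar> \<le> 1" using True by simp
  also have "\<dots> \<le> exp b" using assms by simp
  finally show ?thesis .
next
  case False
  define u where "u = - s"
  have u: "0 < u" "u \<le> b" using False assms by (auto simp: u_def)
  have "1 - u \<le> exp (- u)" using exp_ge_add_one_self[of "- u"] by simp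
  then have "(1 - u) * exp u \<le> exp (- u) * exp u" by (intro mult_right_mono) auto
  then have "exp u - 1 \<le> u * exp u" by (simp add: algebra_simps flip: exp_add)
  then have "(exp u - 1) / u \<le> exp u" using u by (simp add: field_simps)
  moreover have "(1 - exp (- s)) / s = (exp u - 1) / u" using u by (simp add: u_def field_simps)
  moreover have "0 \<le> (exp u - 1) / u" using u by simp
  moreover have "exp u \<le> exp b" using u by simp
  ultimately show ?thesis by linarith
qed

text \<open>Controls the second-order Taylor remainder of the multipliers of an analytic semigroup
  at \<open>z\<close> with \<open>a = Re z\<close>, independently of the eigenvalue
  \<open>x\<close>: the term \<open>a / 2 * \<bar>x\<bar>\<close> pays for increments of modulus up
  to \<open>a / 2\<close>, and for positive \<open>x\<close> half of the decay is left to beat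
  \<open>x\<^sup>2\<close>.\<close>

lemma exp_decay_bound:
  fixes a b x :: real
  assumes a: "0 < a" and x: "- b \<le> x" and b: "0 \<le> b"
  shows "x\<^sup>2 * exp (- a * x + a / 2 * \<bar>x\<bar>) \<le> 8 / a\<^sup>2 + b\<^sup>2 * exp (3 / 2 * a * b)"
proof (cases "0 \<le> x")
  case True
  define s where "s = a * x / 2"
  have s: "0 \<le> s" using True a by (simp add: s_def)
  have "s\<^sup>2 / 2 \<le> exp s" using exp_lower_Taylor_quadratic[OF s] s by simp
  then have "s\<^sup>2 * exp (- s) \<le> 2 * exp s * exp (- s)" by (intro mult_right_mono) auto
  moreover have "2 * exp s * exp (- s) = 2" by (simp add: exp_minus)
  ultimately have "s\<^sup>2 * exp (- s) \<le> 2" by linarith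
  then have "x\<^sup>2 * exp (- s) \<le> 8 / a\<^sup>2"
    using a by (simp add: s_def power2_eq_square field_simps)
  moreover have eq: "- a * x + a / 2 * \<bar>x\<bar> = - s" using True by (simp add: s_def)
  moreover have "0 \<le> b\<^sup>2 * exp (3 / 2 * a * b)" by simp
  ultimately show ?thesis unfolding eq by linarith
next
  case False
  have "x\<^sup>2 \<le> b\<^sup>2" using False x abs_le_square_iff[of x b] by simp
  moreover have "exp (- a * x + a / 2 * \<bar>x\<bar>) \<le> exp (3 / 2 * a * b)"
  proof -
    have "- a * x + a / 2 * \<bar>x\<bar> = 3 / 2 * a * (- x)" using False by simp
    also have "\<dots> \<le> 3 / 2 * a * b" using x a by (intro mult_left_mono) auto
    finally show ?thesis by simp
  qed
  ultimately have "x\<^sup>2 * exp (- a * x + a / 2 * \<bar>x\<bar>) \<le> b\<^sup>2 * exp (3 / 2 * a * b)"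
    by (intro mult_mono) auto
  moreover have "0 \<le> 8 / a\<^sup>2" by simp
  ultimately show ?thesis by linarith
qed

lemma Re_sector: "z \<in> sector (pi / 2) \<Longrightarrow> 0 < Re z"
  unfolding sector_def using Arg_Re_pos by auto

lemma sector_mono: "z \<in> sector a \<Longrightarrow> a \<le> b \<Longrightarrow> z \<in> sector b"
  by (auto simp: sector_def)

context semi_ip
begin

lemma C0_semigroupD:
  assumes "C0_semigroup X ip T"
  shows "0 \<le> t \<Longrightarrow> bounded_op X ip (T t)"
    and "x \<in> X \<Longrightarrow> T 0 x = x"
    and "0 \<le> s \<Longrightarrow> 0 \<le> t \<Longrightarrow> x \<in> X \<Longrightarrow> T (s + t) x = T s (T t x)"
    and "x \<in> X \<Longrightarrow> ((\<lambda>t. nrm (T t x - x)) \<longlongrightarrow> 0) (at_right 0)"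
  using assms by (auto simp: C0_semigroup_def)

lemma bounded_opD:
  assumes "bounded_op X ip B"
  shows "x \<in> X \<Longrightarrow> B x \<in> X" "x \<in> X \<Longrightarrow> y \<in> X \<Longrightarrow> B (x + y) = B x + B y"
    "x \<in> X \<Longrightarrow> B (c *\<^sub>c x) = c *\<^sub>c B x" "x \<in> X \<Longrightarrow> y \<in> X \<Longrightarrow> B (x - y) = B x - B y"
proof -
  show *: "x \<in> X \<Longrightarrow> B x \<in> X" "x \<in> X \<Longrightarrow> y \<in> X \<Longrightarrow> B (x + y) = B x + B y"
    "x \<in> X \<Longrightarrow> B (c *\<^sub>c x) = c *\<^sub>c B x" for x y c
    using assms by (auto simp: bounded_op_def)
  show "x \<in> X \<Longrightarrow> y \<in> X \<Longrightarrow> B (x - y) = B x - B y"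
    using *(2)[of x "- 1 *\<^sub>c y"] *(3)[of y "-1"] by simp
qed

lemma bounded_op_sum:
  assumes "bounded_op X ip B" "\<And>i. i \<in> F \<Longrightarrow> f i \<in> X"
  shows "B (sum f F) = (\<Sum>i\<in>F. B (f i))"
proof -
  have B0: "B 0 = 0" using bounded_opD(3)[OF assms(1) zero_mem, of 0] by simp
  show ?thesis using assms(2)
  proof (induction F rule: infinite_finite_induct)
    case (insert i F)
    have "B (f i + sum f F) = B (f i) + B (sum f F)"
      using insert.prems by (intro bounded_opD(2)[OF assms(1)] sum_mem) auto
    moreover have "B (sum f F) = (\<Sum>i\<in>F. B (f i))" using insert.prems by (intro insert.IH) auto
    ultimately show ?case using insert.hyps by (metis sum.insert)
  qed (metis sum.infinite B0, metis sum.empty B0)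
qed

end

section \<open>Local boundedness of strongly continuous semigroups\<close>

context hilbert
begin

text \<open>If the norms were unbounded near 0, they would be unbounded along a sequence of times
  tending to 0, although every orbit stays bounded along it by strong continuity, against
  \<open>uniform_boundedness\<close>. The semigroup law extends the bound from
  \<open>[0, \<delta>]\<close> to multiples of this interval.\<close>

lemma C0_semigroup_locally_bounded:
  assumes T: "C0_semigroup X ip T" and "0 \<le> r"
  shows "\<exists>M\<ge>1. \<forall>s\<in>{0..r}. \<forall>x\<in>X. nrm (T s x) \<le> M * nrm x"
proof -
  note TX = bounded_opD(1)[OF C0_semigroupD(1)[OF T]]
  have "\<exists>\<delta>>0. \<exists>M. \<forall>s\<in>{0..\<delta>}. \<forall>x\<in>X. nrm (T s x) \<le> M * nrm x"
  proof (rule ccontr)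
    assume neg: "\<not> ?thesis"
    have "\<exists>s\<in>{0..1 / Suc n}. \<not> (\<forall>x\<in>X. nrm (T s x) \<le> Suc n * nrm x)" for n
      using neg by (metis of_nat_0_less_iff zero_less_Suc zero_less_divide_1_iff)
    then obtain s where s: "\<And>n. s n \<in> {0..1 / Suc n}" "\<And>n. \<not> (\<forall>x\<in>X. nrm (T (s n) x) \<le> Suc n * nrm x)"
      by metis
    \<comment> \<open>At time 0 the semigroup is the identity, which obeys the bound
      \<open>Suc n\<close> because this is at least 1. So the witnesses are positive and approach 0
      from the right, as strong continuity requires.\<close>
    have pos: "0 < s n" for n
    proof (rule ccontr)
      assume "\<not> 0 < s n"
      then have "s n = 0" using s(1)[of n] by simp
      moreover have "nrm x \<le> Suc n * nrm x" if "x \<in> X" for x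
        using mult_right_mono[of 1 "real (Suc n)" "nrm x"] that by simp
      ultimately show False using s(2)[of n] C0_semigroupD(2)[OF T] by simp
    qed
    have "s \<longlonglongrightarrow> 0"
      by (rule tendsto_sandwich[OF _ _ tendsto_const lim_inverse_n'[THEN LIMSEQ_Suc]]) (use s(1) in auto)
    then have s0: "filterlim s (at_right 0) sequentially"
      using pos by (auto simp: filterlim_at intro!: always_eventually) (metis less_irrefl)
    have "\<exists>C. \<forall>n. \<forall>x\<in>X. nrm (T (s n) x) \<le> C * nrm x"
    proof (rule uniform_boundedness)
      show "bounded_op X ip (T (s n))" for n using C0_semigroupD(1)[OF T] pos[of n] by simp
      fix x assume x: "x \<in> X"
      have "((\<lambda>n. nrm (T (s n) x - x)) \<longlonglongrightarrow> 0)"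
        using filterlim_compose[OF C0_semigroupD(4)[OF T x] s0] .
      then have "Bseq (\<lambda>n. nrm (T (s n) x - x))" by (intro convergent_imp_Bseq convergentI)
      then obtain K where K: "\<And>n. nrm (T (s n) x - x) \<le> K" by (auto simp: Bseq_def abs_le_iff)
      have "nrm (T (s n) x) \<le> K + nrm x" for n
        using nrm_triangle[of "T (s n) x - x" x] K[of n] TX[of "s n" x] pos[of n] x by simp
      then show "\<exists>C. \<forall>n. nrm (T (s n) x) \<le> C" by blast
    qed
    then obtain C where C: "\<And>n x. x \<in> X \<Longrightarrow> nrm (T (s n) x) \<le> C * nrm x" by blast
    obtain n where n: "C < real n" using reals_Archimedean2 by blast
    have "nrm (T (s n) x) \<le> Suc n * nrm x" if x: "x \<in> X" for x
      using C[OF x, of n] mult_right_mono[of C "real (Suc n)" "nrm x"] n x by simp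
    then show False using s(2) by blast
  qed
  then obtain \<delta> M0 where \<delta>: "0 < \<delta>" and M0: "\<And>s x. s \<in> {0..\<delta>} \<Longrightarrow> x \<in> X \<Longrightarrow> nrm (T s x) \<le> M0 * nrm x"
    by blast
  define M where "M = max 1 M0"
  have M1: "1 \<le> M" by (simp add: M_def)
  have M: "nrm (T s x) \<le> M * nrm x" if "s \<in> {0..\<delta>}" "x \<in> X" for s x
    using M0[OF that] mult_right_mono[of M0 M "nrm x"] that by (simp add: M_def)
  have iter: "\<forall>s\<in>{0..real (Suc k) * \<delta>}. \<forall>x\<in>X. nrm (T s x) \<le> M ^ Suc k * nrm x" for k
  proof (induction k)
    case 0
    then show ?case using M by simp
  next
    case (Suc k)
    show ?case
    proof (intro ballI)
      fix s x assume s: "s \<in> {0..real (Suc (Suc k)) * \<delta>}" and x: "x \<in> X"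
      show "nrm (T s x) \<le> M ^ Suc (Suc k) * nrm x"
      proof (cases "s \<le> \<delta>")
        case True
        have "nrm (T s x) \<le> M * nrm x" using M True s x by simp
        also have "\<dots> \<le> M ^ Suc (Suc k) * nrm x"
          using M1 x self_le_power[of M "Suc (Suc k)"] by (intro mult_right_mono) auto
        finally show ?thesis .
      next
        case False
        then have s': "s - \<delta> \<in> {0..real (Suc k) * \<delta>}" using s by (simp add: algebra_simps)
        have "T s x = T \<delta> (T (s - \<delta>) x)"
          using C0_semigroupD(3)[OF T, of \<delta> "s - \<delta>" x] \<delta> s' x by simp
        then have "nrm (T s x) \<le> M * nrm (T (s - \<delta>) x)"
          using M[of \<delta> "T (s - \<delta>) x"] TX[of "s - \<delta>" x] \<delta> s' x by simp
        also have "\<dots> \<le> M * (M ^ Suc k * nrm x)"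
          using Suc.IH s' x M1 by (intro mult_left_mono) auto
        finally show ?thesis by (simp add: mult.assoc)
      qed
    qed
  qed
  obtain k where "r / \<delta> < real k" using reals_Archimedean2 by blast
  then have "r \<le> real (Suc k) * \<delta>" using \<delta> by (simp add: field_simps)
  then have "\<forall>s\<in>{0..r}. \<forall>x\<in>X. nrm (T s x) \<le> M ^ Suc k * nrm x" using iter[of k] by auto
  then show ?thesis using one_le_power[OF M1, of "Suc k"] by blast
qed

end

section \<open>The diagonal semigroup: generator, analyticity and uniqueness\<close>

locale diag_semigroup = onb X ip I e
  for X :: "('a \<Rightarrow> complex) set" and ip and I :: "'i set" and e +
  fixes lam :: "'i \<Rightarrow> real" and om :: real
  assumes om: "0 \<le> om" and lam: "i \<in> I \<Longrightarrow> - om \<le> lam i"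
begin

definition sg :: "complex \<Rightarrow> ('a \<Rightarrow> complex) \<Rightarrow> 'a \<Rightarrow> complex" where
  "sg z = diag (\<lambda>i. exp (- z * complex_of_real (lam i)))"

lemma exp_bound:
  assumes "i \<in> I" "0 \<le> Re z" shows "cmod (exp (- z * complex_of_real (lam i))) \<le> exp (om * Re z)"
proof -
  have "- (Re z * lam i) \<le> om * Re z"
    using mult_left_mono[OF lam[OF assms(1)] assms(2)] by (simp add: mult.commute)
  then show ?thesis by (simp add: norm_exp_eq_Re)
qed

lemma sg:
  assumes "0 \<le> Re z" "x \<in> X"
  shows "sg z x \<in> X" "i \<in> I \<Longrightarrow> ip (sg z x) (e i) = exp (- z * complex_of_real (lam i)) * ip x (e i)"
  using diag[of "\<lambda>i. exp (- z * complex_of_real (lam i))" "exp (om * Re z)" x] exp_bound assms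
  by (auto simp: sg_def)

lemma sg_bounded_op: "0 \<le> Re z \<Longrightarrow> bounded_op X ip (sg z)"
  unfolding sg_def using exp_bound by (intro diag_bounded_op)

lemma sg_add: "0 \<le> Re z \<Longrightarrow> 0 \<le> Re w \<Longrightarrow> x \<in> X \<Longrightarrow> sg (z + w) x = sg z (sg w x)"
proof (rule coeff_eqI)
  assume z: "0 \<le> Re z" and w: "0 \<le> Re w" and x: "x \<in> X"
  then have zw: "0 \<le> Re (z + w)" by simp
  show "sg (z + w) x \<in> X" "sg z (sg w x) \<in> X" using z w zw x by (simp_all only: sg)
  fix i assume "i \<in> I"
  moreover have "- (z + w) * complex_of_real (lam i) = - z * complex_of_real (lam i) + - w * complex_of_real (lam i)"
    by (simp add: algebra_simps)
  ultimately show "ip (sg (z + w) x) (e i) = ip (sg z (sg w x)) (e i)"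
    using z w zw x by (simp only: sg exp_add mult.assoc)
qed

lemma sg_0: "x \<in> X \<Longrightarrow> sg 0 x = x"
  by (intro coeff_eqI) (simp_all add: sg)

lemma diag_1: "x \<in> X \<Longrightarrow> diag (\<lambda>_. 1) x = x"
  by (intro coeff_eqI) (simp_all add: diag[of _ 1])

text \<open>The filter \<open>F\<close> is left open because the same limit is needed along the
  positive reals and within sectors. For modulus below 1 all multipliers are at most
  \<open>exp om\<close>.\<close>

lemma sg_tendsto:
  assumes "F \<le> at 0" "\<forall>\<^sub>F z in F. 0 \<le> Re z" "x \<in> X"
  shows "((\<lambda>z. nrm (sg z x - x)) \<longlongrightarrow> 0) F"
proof -
  have "((\<lambda>z. nrm (diag (\<lambda>i. exp (- z * complex_of_real (lam i))) x - diag (\<lambda>_. 1) x)) \<longlongrightarrow> 0) F"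
  proof (rule diag_tendsto)
    have "\<forall>\<^sub>F z in at 0. cmod z < 1"
      unfolding eventually_at by (rule exI[of _ 1]) auto
    then have "\<forall>\<^sub>F z in F. cmod z < 1" using assms(1) by (rule filter_leD[rotated])
    with assms(2) show "\<forall>\<^sub>F z in F. \<forall>i\<in>I. cmod (exp (- z * complex_of_real (lam i))) \<le> exp om"
    proof eventually_elim
      case (elim z)
      show ?case
      proof
        fix i assume "i \<in> I"
        then have "cmod (exp (- z * complex_of_real (lam i))) \<le> exp (om * Re z)" using elim
          by (intro exp_bound)
        also have "om * Re z \<le> om * 1"
          using elim om complex_Re_le_cmod[of z] by (intro mult_left_mono) auto
        then have "exp (om * Re z) \<le> exp om" by simp
        finally show "cmod (exp (- z * complex_of_real (lam i))) \<le> exp om" .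
      qed
    qed
    show "((\<lambda>z. exp (- z * complex_of_real (lam i))) \<longlongrightarrow> 1) F" for i
    proof (rule filterlim_mono[OF _ order_refl assms(1)])
      have "((\<lambda>z. exp (- z * complex_of_real (lam i))) \<longlongrightarrow> exp (- 0 * complex_of_real (lam i))) (at 0)"
        by (intro tendsto_intros)
      then show "((\<lambda>z. exp (- z * complex_of_real (lam i))) \<longlongrightarrow> 1) (at 0)" by simp
    qed
    show "cmod 1 \<le> exp om" using om by simp
  qed (use assms om in auto)
  then show ?thesis unfolding sg_def diag_1[OF assms(3)] .
qed

lemma of_real_at_right: "filtermap complex_of_real (at_right 0) \<le> at 0"
proof -
  have "filterlim complex_of_real (at 0) (at_right 0)"
    unfolding filterlim_at
    by (intro conjI tendsto_eq_intros) (auto simp: eventually_at_filter intro!: tendsto_eq_intros)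
  then show ?thesis by (simp add: filterlim_def)
qed

lemma sg_C0_semigroup: "C0_semigroup X ip (\<lambda>t. sg (complex_of_real t))"
  unfolding C0_semigroup_def
proof (intro conjI allI ballI impI)
  show "((\<lambda>t. nrm (sg (complex_of_real t) x - x)) \<longlongrightarrow> 0) (at_right 0)" if "x \<in> X" for x
  proof -
    have "((\<lambda>z. nrm (sg z x - x)) \<longlongrightarrow> 0) (filtermap complex_of_real (at_right 0))"
      using that of_real_at_right
      by (intro sg_tendsto) (auto simp: eventually_filtermap eventually_at_filter)
    then show ?thesis by (simp add: filterlim_filtermap)
  qed
qed (simp_all add: sg_bounded_op sg_0 sg_add)

lemma sg_slope_coeff:
  assumes t: "0 < t" and x: "x \<in> X" and i: "i \<in> I"
  shows "ip (complex_of_real (1 / t) *\<^sub>c (sg (complex_of_real t) x - x)) (e i)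
    = complex_of_real ((exp (- (t * lam i)) - 1) / t) * ip x (e i)"
proof -
  have "exp (- complex_of_real t * complex_of_real (lam i)) = complex_of_real (exp (- (t * lam i)))"
    by (simp flip: exp_of_real)
  then show ?thesis using t x i by (simp add: sg diff_left left_diff_distrib diff_divide_distrib)
qed

text \<open>Norm convergence of the difference quotient implies that of each coefficient.
  Conversely, the difference quotient at \<open>x\<close> is the multiplier \<open>m t\<close>
  applied to \<open>y\<close>, with \<open>m t\<close> bounded and tending to 1, so
  \<open>diag_tendsto\<close> gives norm convergence.\<close>

lemma sg_generator:
  "generator X ip (\<lambda>t. sg (complex_of_real t)) =
    {(x, y). x \<in> X \<and> y \<in> X \<and> (\<forall>i\<in>I. ip y (e i) = - complex_of_real (lam i) * ip x (e i))}"
proof (intro set_eqI iffI; clarify)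
  fix x y assume "(x, y) \<in> generator X ip (\<lambda>t. sg (complex_of_real t))"
  then have x: "x \<in> X" and y: "y \<in> X"
    and lim: "((\<lambda>t. nrm (complex_of_real (1 / t) *\<^sub>c (sg (complex_of_real t) x - x) - y)) \<longlongrightarrow> 0) (at_right 0)"
    by (auto simp: generator_def)
  have "ip y (e i) = - complex_of_real (lam i) * ip x (e i)" if i: "i \<in> I" for i
  proof (rule tendsto_unique[of "at_right 0"])
    define g where "g t = complex_of_real ((exp (- (t * lam i)) - 1) / t) * ip x (e i)" for t
    have "((\<lambda>t. g t - ip y (e i)) \<longlongrightarrow> 0) (at_right 0)"
    proof (rule Lim_null_comparison[OF _ lim])
      show "\<forall>\<^sub>F t in at_right 0. cmod (g t - ip y (e i))
        \<le> nrm (complex_of_real (1 / t) *\<^sub>c (sg (complex_of_real t) x - x) - y)"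
        using eventually_at_right_less[of 0]
      proof eventually_elim
        case (elim t)
        have m: "complex_of_real (1 / t) *\<^sub>c (sg (complex_of_real t) x - x) \<in> X"
          using elim x by (intro scale_mem diff_mem sg) auto
        have "g t - ip y (e i) = ip (complex_of_real (1 / t) *\<^sub>c (sg (complex_of_real t) x - x) - y) (e i)"
          unfolding diff_left[OF m y e_mem[OF i]] sg_slope_coeff[OF elim x i] g_def ..
        then show ?case
          using Cauchy_Schwarz[OF diff_mem[OF m y] e_mem[OF i]] ons_nrm[OF ons i] by simp
      qed
    qed
    then show "(g \<longlongrightarrow> ip y (e i)) (at_right 0)" using Lim_null by blast
    have "((\<lambda>t. complex_of_real ((exp (- (t * lam i)) - 1) / t)) \<longlongrightarrow> complex_of_real (- lam i)) (at_right 0)"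
      by (intro tendsto_of_real exp_slope_tendsto)
    from tendsto_mult_right[OF this, of "ip x (e i)"]
    show "(g \<longlongrightarrow> - complex_of_real (lam i) * ip x (e i)) (at_right 0)"
      unfolding g_def of_real_minus .
  qed simp
  then show "x \<in> X \<and> y \<in> X \<and> (\<forall>i\<in>I. ip y (e i) = - complex_of_real (lam i) * ip x (e i))"
    using x y by blast
next
  fix x y assume x: "x \<in> X" and y: "y \<in> X" and c: "\<forall>i\<in>I. ip y (e i) = - complex_of_real (lam i) * ip x (e i)"
  \<comment> \<open>For eigenvalue 0 both \<open>y\<close> and the difference quotient have
    coefficient 0, so any factor fits; the value 1 agrees with the limit.\<close>
  define m where "m t i = (if lam i = 0 then 1 else complex_of_real ((1 - exp (- (t * lam i))) / (t * lam i)))"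
    for t i
  have m_le: "cmod (m t i) \<le> exp om" if "i \<in> I" "0 < t" "t \<le> 1" for t i
  proof (cases "lam i = 0")
    case False
    have "- om \<le> t * - om" using om that mult_right_mono[of t 1 om] by simp
    also have "\<dots> \<le> t * lam i" using lam[OF that(1)] that by (intro mult_left_mono) auto
    finally have "\<bar>(1 - exp (- (t * lam i))) / (t * lam i)\<bar> \<le> exp om"
      using False that om by (intro exp_slope_bound) auto
    then show ?thesis using False unfolding m_def by (simp only: if_False norm_of_real)
  qed (use om in \<open>auto simp: m_def\<close>)
  have "((\<lambda>t. nrm (diag (m t) y - diag (\<lambda>_. 1) y)) \<longlongrightarrow> 0) (at_right 0)"
  proof (rule diag_tendsto)
    show "\<forall>\<^sub>F t in at_right 0. \<forall>i\<in>I. cmod (m t i) \<le> exp om"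
      unfolding eventually_at_right_field using m_le by (intro exI[of _ 1]) auto
    show "((\<lambda>t. m t i) \<longlongrightarrow> 1) (at_right 0)" for i
    proof (cases "lam i = 0")
      case False
      have "((\<lambda>t. complex_of_real ((exp (- (t * lam i)) - 1) / t / (- lam i))) \<longlongrightarrow> complex_of_real ((- lam i) / (- lam i))) (at_right 0)"
        using False by (intro tendsto_of_real tendsto_divide exp_slope_tendsto tendsto_const) auto
      moreover have "(\<lambda>t. complex_of_real ((exp (- (t * lam i)) - 1) / t / (- lam i))) = (\<lambda>t. m t i)"
        using False by (simp add: m_def fun_eq_iff minus_divide_left)
      ultimately show ?thesis using False by simp
    qed (simp add: m_def)
  qed (use om y in auto)
  moreover have "\<forall>\<^sub>F t in at_right 0. nrm (diag (m t) y - diag (\<lambda>_. 1) y)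
      = nrm (complex_of_real (1 / t) *\<^sub>c (sg (complex_of_real t) x - x) - y)"
    unfolding eventually_at_right_field
  proof (intro exI[of _ 1] conjI allI impI)
    fix t :: real assume "0 < t" "t < 1"
    then have t: "0 < t" "t \<le> 1" by auto
    have "diag (m t) y = complex_of_real (1 / t) *\<^sub>c (sg (complex_of_real t) x - x)"
    proof (rule coeff_eqI)
      show "diag (m t) y \<in> X" using diag[OF m_le[OF _ t]] y by auto
      show "complex_of_real (1 / t) *\<^sub>c (sg (complex_of_real t) x - x) \<in> X"
        using t x by (intro scale_mem diff_mem sg) auto
      fix i assume i: "i \<in> I"
      have "ip (diag (m t) y) (e i) = m t i * (- complex_of_real (lam i) * ip x (e i))"
        using diag(2)[OF m_le[OF _ t] y i] c i by auto
      also have "\<dots> = complex_of_real ((exp (- (t * lam i)) - 1) / t) * ip x (e i)"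
        using t by (simp add: m_def field_simps)
      finally show "ip (diag (m t) y) (e i) = ip (complex_of_real (1 / t) *\<^sub>c (sg (complex_of_real t) x - x)) (e i)"
        using sg_slope_coeff[OF t(1) x i] by simp
    qed
    then show "nrm (diag (m t) y - diag (\<lambda>_. 1) y) = nrm (complex_of_real (1 / t) *\<^sub>c (sg (complex_of_real t) x - x) - y)"
      by (simp only: diag_1[OF y])
  qed simp
  ultimately have "((\<lambda>t. nrm (complex_of_real (1 / t) *\<^sub>c (sg (complex_of_real t) x - x) - y)) \<longlongrightarrow> 0) (at_right 0)"
    by (rule Lim_transform_eventually)
  then show "(x, y) \<in> generator X ip (\<lambda>t. sg (complex_of_real t))"
    using x y by (simp add: generator_def)
qed

text \<open>The derivative is the multiplier \<open>d\<close>. Apart from the factor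
  \<open>exp (- z * lam i)\<close>, the error of the difference quotient is the Taylor remainder of
  \<open>exp w\<close> at \<open>w = - h * lam i\<close>, divided by \<open>h\<close>;
  \<open>exp_decay_bound\<close> controls it for all \<open>i\<close> at once, which gives an
  estimate in operator norm.\<close>

lemma sg_op_differentiable:
  assumes a: "0 < Re z"
  shows "op_differentiable_at X ip sg z"
proof -
  define a where "a = Re z"
  have a0: "0 < a" using assms by (simp add: a_def)
  define M where "M = 8 / a\<^sup>2 + om\<^sup>2 * exp (3 / 2 * a * om)"
  have M: "(lam i)\<^sup>2 * exp (- a * lam i + a / 2 * \<bar>lam i\<bar>) \<le> M" if "i \<in> I" for i
    unfolding M_def by (rule exp_decay_bound[OF a0 lam[OF that] om])
  have M0: "0 \<le> M" by (simp add: M_def)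
  define d where "d i = - complex_of_real (lam i) * exp (- z * complex_of_real (lam i))" for i
  have e_norm: "cmod (exp (- z * complex_of_real l)) = exp (- a * l)" for l
    by (simp add: norm_exp_eq_Re a_def)
  have d_le: "cmod (d i) \<le> exp (om * a) + M" if i: "i \<in> I" for i
  proof -
    have "\<bar>lam i\<bar> \<le> 1 + (lam i)\<^sup>2"
    proof -
      have "0 \<le> (\<bar>lam i\<bar> - 1)\<^sup>2" by simp
      then have "2 * \<bar>lam i\<bar> \<le> 1 + (lam i)\<^sup>2" by (simp add: power2_diff)
      then show ?thesis by simp
    qed
    then have "cmod (d i) \<le> (1 + (lam i)\<^sup>2) * exp (- a * lam i)"
      unfolding d_def norm_mult e_norm by (simp add: mult_right_mono)
    also have "\<dots> \<le> exp (om * a) + M"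
    proof -
      have "exp (- a * lam i) \<le> exp (om * a)"
        using exp_bound[OF i, of z] a0 by (simp only: e_norm a_def)
      moreover have "(lam i)\<^sup>2 * exp (- a * lam i) \<le> (lam i)\<^sup>2 * exp (- a * lam i + a / 2 * \<bar>lam i\<bar>)"
        using a0 by (intro mult_left_mono) auto
      ultimately show ?thesis using M[OF i] unfolding distrib_right mult_1 by linarith
    qed
    finally show ?thesis .
  qed
  have D: "bounded_op X ip (diag d)" by (rule diag_bounded_op[OF d_le])
  moreover have "\<forall>\<^sub>F h in at 0. \<forall>x\<in>X. nrm ((1 / h) *\<^sub>c (sg (z + h) x - sg z x) - diag d x) \<le> \<epsilon> * nrm x"
    if \<epsilon>: "0 < \<epsilon>" for \<epsilon>
  proof -
    define \<delta> where "\<delta> = min (a / 2) (\<epsilon> / (M + 1))"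
    have \<delta>: "0 < \<delta>" using a0 \<epsilon> M0 by (simp add: \<delta>_def)
    have "\<forall>x\<in>X. nrm ((1 / h) *\<^sub>c (sg (z + h) x - sg z x) - diag d x) \<le> \<epsilon> * nrm x"
      if h: "h \<noteq> 0" "cmod h < \<delta>" for h
    proof
      fix x assume x: "x \<in> X"
      have ha: "cmod h \<le> a / 2" using h by (simp add: \<delta>_def)
      have zh: "0 \<le> Re (z + h)" using abs_Re_le_cmod[of h] ha a0 by (simp add: a_def)
      have m: "sg (z + h) x \<in> X" "sg z x \<in> X" "diag d x \<in> X"
        using sg(1)[OF zh x] sg(1)[of z x] assms x bounded_opD(1)[OF D x] by auto
      show "nrm ((1 / h) *\<^sub>c (sg (z + h) x - sg z x) - diag d x) \<le> \<epsilon> * nrm x"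
      proof (rule nrm_mono)
        fix i assume i: "i \<in> I"
        define w where "w = - h * complex_of_real (lam i)"
        have "ip ((1 / h) *\<^sub>c (sg (z + h) x - sg z x) - diag d x) (e i)
          = ((exp (- (z + h) * complex_of_real (lam i)) - exp (- z * complex_of_real (lam i))) / h - d i) * ip x (e i)"
          using m x i zh assms diag(2)[OF d_le x i]
          by (simp add: diff_left sg diff_divide_distrib left_diff_distrib)
        also have "(exp (- (z + h) * complex_of_real (lam i)) - exp (- z * complex_of_real (lam i))) / h - d i
          = exp (- z * complex_of_real (lam i)) * (exp w - (1 + w)) / h"
        proof -
          have "- (z + h) * complex_of_real (lam i) = - z * complex_of_real (lam i) + w"
            by (simp add: w_def algebra_simps)
          then have "exp (- (z + h) * complex_of_real (lam i)) = exp (- z * complex_of_real (lam i)) * exp w"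
            by (simp only: exp_add)
          moreover have "d i = exp (- z * complex_of_real (lam i)) * w / h"
            using h by (simp add: d_def w_def)
          ultimately show ?thesis using h by (simp add: field_simps)
        qed
        finally have eq: "cmod (ip ((1 / h) *\<^sub>c (sg (z + h) x - sg z x) - diag d x) (e i))
          = exp (- a * lam i) * cmod (exp w - (1 + w)) / cmod h * cmod (ip x (e i))"
          by (simp only: norm_mult norm_divide e_norm)
        have w_le: "\<bar>Re w\<bar> \<le> a / 2 * \<bar>lam i\<bar>"
          using abs_Re_le_cmod[of w] mult_right_mono[OF ha, of "\<bar>lam i\<bar>"] by (simp add: w_def norm_mult)
        have "cmod (exp w - (1 + w)) \<le> exp \<bar>Re w\<bar> * (cmod w)\<^sup>2"
          using Taylor_exp[of w 1] by (simp add: power2_eq_square)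
        also have "\<dots> \<le> exp (a / 2 * \<bar>lam i\<bar>) * (cmod w)\<^sup>2"
          using w_le by (intro mult_right_mono) auto
        also have "\<dots> = exp (a / 2 * \<bar>lam i\<bar>) * ((cmod h)\<^sup>2 * (lam i)\<^sup>2)"
          by (simp add: w_def norm_mult power_mult_distrib)
        finally have "exp (- a * lam i) * cmod (exp w - (1 + w)) / cmod h
          \<le> exp (- a * lam i) * (exp (a / 2 * \<bar>lam i\<bar>) * ((cmod h)\<^sup>2 * (lam i)\<^sup>2)) / cmod h"
          by (intro divide_right_mono mult_left_mono) auto
        also have "\<dots> = cmod h * ((lam i)\<^sup>2 * exp (- a * lam i + a / 2 * \<bar>lam i\<bar>))"
          using h unfolding exp_add by (simp add: power2_eq_square)
        also have "\<dots> \<le> cmod h * M" using M[OF i] by (intro mult_left_mono) auto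
        also have "\<dots> \<le> \<epsilon>"
        proof -
          have "cmod h \<le> \<epsilon> / (M + 1)" using h by (simp add: \<delta>_def)
          then have "cmod h * (M + 1) \<le> \<epsilon>" using M0 by (simp add: field_simps)
          moreover have "cmod h * M \<le> cmod h * (M + 1)" by (intro mult_left_mono) auto
          ultimately show ?thesis by linarith
        qed
        finally show "cmod (ip ((1 / h) *\<^sub>c (sg (z + h) x - sg z x) - diag d x) (e i)) \<le> \<epsilon> * cmod (ip x (e i))"
          unfolding eq by (intro mult_right_mono) auto
      qed (use m x \<epsilon> in auto)
    qed
    then show ?thesis unfolding eventually_at using \<delta> by (intro exI[of _ \<delta>]) (auto simp: dist_norm)
  qed
  ultimately show ?thesis unfolding op_differentiable_at_def by blast
qed

lemma sg_analytic: "analytic_semigroup X ip (pi / 2) (\<lambda>t. sg (complex_of_real t))"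
  unfolding analytic_semigroup_def
proof (intro conjI exI[of _ sg] allI ballI impI)
  fix \<theta>' x assume \<theta>: "0 < \<theta>' \<and> \<theta>' < pi / 2" and x: "x \<in> X"
  show "((\<lambda>z. nrm (sg z x - x)) \<longlongrightarrow> 0) (at 0 within sector \<theta>')"
  proof (rule sg_tendsto[OF _ _ x])
    show "at 0 within sector \<theta>' \<le> at 0" by (simp add: at_le)
    show "\<forall>\<^sub>F z in at 0 within sector \<theta>'. 0 \<le> Re z"
      unfolding eventually_at_filter
      using \<theta> sector_mono[of _ \<theta>' "pi / 2"] Re_sector by (auto intro!: always_eventually less_imp_le)
  qed
qed (auto simp: sg_C0_semigroup sg_bounded_op sg_add sg_op_differentiable dest!: Re_sector)

lemma eigenvector_generator: "i \<in> I \<Longrightarrow> (e i, - complex_of_real (lam i) *\<^sub>c e i) \<in> generator X ip (\<lambda>t. sg (complex_of_real t))"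
  using ons by (auto simp: sg_generator ons_def)

text \<open>On an eigenvector, \<open>v s = exp (s * l) T s (e i) - e i\<close> has to vanish.
  Orbits are not differentiated away from 0: the identity
  \<open>v (s + r) = exp (s * l) T s (v r) + v s\<close> and local boundedness give
  \<open>nrm (v t) \<le> n * K * nrm (v (t / n))\<close>, and \<open>nrm (v h) / h\<close> tends to
  0 since \<open>e i\<close> lies in the domain of the generator. Bounded operators that agree on
  all eigenvectors agree everywhere by \<open>finite_approx\<close>.\<close>

theorem sg_unique:
  assumes T: "C0_semigroup X ip T" and gen: "generator X ip T = generator X ip (\<lambda>t. sg (complex_of_real t))"
    and t: "0 \<le> t" and x: "x \<in> X"
  shows "T t x = sg (complex_of_real t) x"
proof -
  note TX = bounded_opD(1)[OF C0_semigroupD(1)[OF T]]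
  have eig: "T t (e i) = complex_of_real (exp (- (t * lam i))) *\<^sub>c e i" if i: "i \<in> I" for i
  proof (cases "t = 0")
    case True
    then show ?thesis using C0_semigroupD(2)[OF T] i by simp
  next
    case False
    then have t0: "0 < t" using t by simp
    define l where "l = lam i"
    define v where "v s = complex_of_real (exp (s * l)) *\<^sub>c T s (e i) - e i" for s
    have vX: "v s \<in> X" if "0 \<le> s" for s using TX[OF that] i by (simp add: v_def)
    have v_add: "v (s + r) = complex_of_real (exp (s * l)) *\<^sub>c T s (v r) + v s" if "0 \<le> s" "0 \<le> r"
      for s r
      using C0_semigroupD(3)[OF T that e_mem[OF i]] TX[OF that(2)] that i
      by (simp add: v_def bounded_opD[OF C0_semigroupD(1)[OF T that(1)]] cscale_distribs distrib_right exp_add)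
    obtain M where M1: "1 \<le> M" and M: "\<And>s x. 0 \<le> s \<Longrightarrow> s \<le> t \<Longrightarrow> x \<in> X \<Longrightarrow> nrm (T s x) \<le> M * nrm x"
      using C0_semigroup_locally_bounded[OF T t] by (metis atLeastAtMost_iff)
    define K where "K = exp (t * \<bar>l\<bar>) * M"
    have K0: "0 \<le> K" using M1 by (simp add: K_def)
    have iter: "nrm (v (real k * h)) \<le> real k * (K * nrm (v h))" if h: "0 \<le> h" "real k * h \<le> t" for k h
      using h(2)
    proof (induction k)
      case 0
      have "v 0 = 0" using C0_semigroupD(2)[OF T] i by (simp add: v_def)
      then show ?case by (metis mult_zero_left nrm_0 of_nat_0 order_refl)
    next
      case (Suc k)
      define s where "s = real k * h"
      have s: "0 \<le> s" "s \<le> t" using h Suc.prems by (auto simp: s_def algebra_simps)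
      have IH: "nrm (v s) \<le> real k * (K * nrm (v h))" unfolding s_def
        by (rule Suc.IH) (use s in \<open>simp add: s_def\<close>)
      have "nrm (complex_of_real (exp (s * l)) *\<^sub>c T s (v h)) = exp (s * l) * nrm (T s (v h))"
        using TX[OF s(1) vX[OF h(1)]] by simp
      also have "\<dots> \<le> exp (t * \<bar>l\<bar>) * (M * nrm (v h))"
      proof (rule mult_mono)
        have "s * l \<le> s * \<bar>l\<bar>" using s by (intro mult_left_mono) auto
        also have "\<dots> \<le> t * \<bar>l\<bar>" using s by (intro mult_right_mono) auto
        finally have "s * l \<le> t * \<bar>l\<bar>" .
        then show "exp (s * l) \<le> exp (t * \<bar>l\<bar>)" by simp
      qed (use M[OF s vX[OF h(1)]] TX[OF s(1) vX[OF h(1)]] in auto)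
      finally have "nrm (complex_of_real (exp (s * l)) *\<^sub>c T s (v h)) \<le> K * nrm (v h)"
        by (simp add: K_def mult.assoc)
      moreover have "nrm (v (s + h)) \<le> nrm (complex_of_real (exp (s * l)) *\<^sub>c T s (v h)) + nrm (v s)"
        unfolding v_add[OF s(1) h(1)]
        by (rule nrm_triangle[OF scale_mem[OF TX[OF s(1) vX[OF h(1)]]] vX[OF s(1)]])
      ultimately have "nrm (v (s + h)) \<le> real (Suc k) * (K * nrm (v h))"
        using IH by (simp add: algebra_simps)
      moreover have "s + h = real (Suc k) * h" by (simp add: s_def algebra_simps)
      ultimately show ?case by (simp only:)
    qed
    have slope: "((\<lambda>h. nrm (v h) / h) \<longlongrightarrow> 0) (at_right 0)"
    proof (rule Lim_null_comparison)
      define w where "w h = complex_of_real (1 / h) *\<^sub>c (T h (e i) - e i) - (- complex_of_real l *\<^sub>c e i)"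
        for h
      have "(e i, - complex_of_real l *\<^sub>c e i) \<in> generator X ip T"
        using eigenvector_generator[OF i] gen by (simp add: l_def)
      then have w0: "((\<lambda>h. nrm (w h)) \<longlongrightarrow> 0) (at_right 0)" by (simp add: generator_def w_def)
      \<comment> \<open>\<open>v h / h\<close> is the scaled error \<open>w h\<close> of the
        generator limit plus a multiple of \<open>e i\<close> whose factor tends to 0, because the
        derivative \<open>l\<close> of \<open>exp (h * l)\<close> at 0 cancels against the
        eigenvalue.\<close>
      define g where "g h = exp (h * l) * nrm (w h) + \<bar>(exp (h * l) - 1) / h - l * exp (h * l)\<bar>" for h
      show "\<forall>\<^sub>F h in at_right 0. norm (nrm (v h) / h) \<le> g h"
        using eventually_at_right_less[of 0]
      proof eventually_elim
        case (elim h)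
        have wX: "w h \<in> X" using TX[of h] elim i by (simp add: w_def)
        have "complex_of_real (1 / h) *\<^sub>c v h = complex_of_real (exp (h * l)) *\<^sub>c w h
          + complex_of_real ((exp (h * l) - 1) / h - l * exp (h * l)) *\<^sub>c e i"
          using elim by (simp add: v_def w_def fun_eq_iff field_simps)
        then have "nrm (complex_of_real (1 / h) *\<^sub>c v h) \<le> nrm (complex_of_real (exp (h * l)) *\<^sub>c w h)
          + nrm (complex_of_real ((exp (h * l) - 1) / h - l * exp (h * l)) *\<^sub>c e i)"
          using wX i by (simp only:) (intro nrm_triangle scale_mem e_mem)
        moreover have "nrm (complex_of_real (1 / h) *\<^sub>c v h) = nrm (v h) / h"
          using vX[of h] elim by (simp add: norm_divide)
        moreover have "nrm (complex_of_real ((exp (h * l) - 1) / h - l * exp (h * l)) *\<^sub>c e i)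
          = \<bar>(exp (h * l) - 1) / h - l * exp (h * l)\<bar>"
          unfolding nrm_scale[OF e_mem[OF i]] ons_nrm[OF ons i] norm_of_real by simp
        moreover have "nrm (complex_of_real (exp (h * l)) *\<^sub>c w h) = exp (h * l) * nrm (w h)"
          using wX by simp
        ultimately show ?case using vX[of h] elim by (simp add: g_def)
      qed
      have "((\<lambda>h. (exp (h * l) - 1) / h) \<longlongrightarrow> l) (at_right 0)"
        using exp_slope_tendsto[of "- l"] by simp
      moreover have "((\<lambda>h. exp (h * l)) \<longlongrightarrow> exp (0 * l)) (at_right 0)" by (intro tendsto_intros)
      ultimately have "(g \<longlongrightarrow> exp (0 * l) * 0 + \<bar>l - l * exp (0 * l)\<bar>) (at_right 0)"
        unfolding g_def by (intro tendsto_intros w0)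
      then show "(g \<longlongrightarrow> 0) (at_right 0)" by simp
    qed
    have seq: "filterlim (\<lambda>n. t / real (Suc n)) (at_right 0) sequentially"
    proof -
      have "(\<lambda>n. t * (1 / real (Suc n))) \<longlonglongrightarrow> t * 0"
        by (intro tendsto_intros lim_inverse_n'[THEN LIMSEQ_Suc])
      then show ?thesis using t0 by (auto simp: filterlim_at)
    qed
    have "(\<lambda>n. t * K * (nrm (v (t / real (Suc n))) / (t / real (Suc n)))) \<longlonglongrightarrow> t * K * 0"
      by (intro tendsto_mult_left filterlim_compose[OF slope seq])
    moreover have "nrm (v t) \<le> t * K * (nrm (v (t / real (Suc n))) / (t / real (Suc n)))" for n
    proof -
      have "t * K * (V / (t / m)) = m * (K * V)" if "0 < m" for V m :: real
        using t0 that by (simp add: field_simps)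
      then have "t * K * (nrm (v (t / real (Suc n))) / (t / real (Suc n))) = real (Suc n) * (K * nrm (v (t / real (Suc n))))"
        by simp
      moreover have "real (Suc n) * (t / real (Suc n)) = t" by simp
      ultimately show ?thesis using iter[of "t / real (Suc n)" "Suc n"] t0
        by (simp only:) simp
    qed
    ultimately have "nrm (v t) \<le> 0"
      using LIMSEQ_le_const[of "\<lambda>n. t * K * (nrm (v (t / real (Suc n))) / (t / real (Suc n)))" 0 "nrm (v t)"]
      by auto
    then have "v t = 0" using vX[OF t] nrm_nonneg[OF vX[OF t]] by (metis antisym nrm_eq_0)
    then have "complex_of_real (exp (- (t * l))) *\<^sub>c (complex_of_real (exp (t * l)) *\<^sub>c T t (e i)) = complex_of_real (exp (- (t * l))) *\<^sub>c e i"
      by (simp add: v_def)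
    then show ?thesis by (simp add: l_def flip: of_real_mult exp_add)
  qed
  obtain C where C: "\<And>x. x \<in> X \<Longrightarrow> nrm (T t x) \<le> C * nrm x"
    using C0_semigroupD(1)[OF T t] unfolding bounded_op_def by blast
  have t': "0 \<le> Re (complex_of_real t)" using t by simp
  obtain D where D: "\<And>x. x \<in> X \<Longrightarrow> nrm (sg (complex_of_real t) x) \<le> D * nrm x"
    using sg_bounded_op[OF t'] unfolding bounded_op_def by blast
  define y where "y = T t x - sg (complex_of_real t) x"
  have y: "y \<in> X" unfolding y_def using TX[OF t x] sg(1)[OF t' x] by simp
  have "nrm y \<le> 0 + \<epsilon>" if \<epsilon>: "0 < \<epsilon>" for \<epsilon>
  proof -
    define \<delta> where "\<delta> = \<epsilon> / (\<bar>C\<bar> + \<bar>D\<bar> + 1)"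
    have \<delta>: "0 < \<delta>" "(\<bar>C\<bar> + \<bar>D\<bar>) * \<delta> \<le> \<epsilon>" using \<epsilon> by (auto simp: \<delta>_def field_simps)
    obtain F where F: "finite F" "F \<subseteq> I" "nrm (x - lincomb F e (\<lambda>i. ip x (e i))) < \<delta>"
      using finite_approx[OF x \<delta>(1)] by blast
    define u where "u = lincomb F e (\<lambda>i. ip x (e i))"
    have u: "u \<in> X" using ons_subset[OF ons F(2)] by (simp add: u_def)
    have eig_sg: "sg (complex_of_real t) (e i) = complex_of_real (exp (- (t * lam i))) *\<^sub>c e i"
      if "i \<in> I" for i
    proof (rule coeff_eqI)
      fix j assume "j \<in> I"
      then show "ip (sg (complex_of_real t) (e i)) (e j) = ip (complex_of_real (exp (- (t * lam i))) *\<^sub>c e i) (e j)"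
        using ons that sg(2)[OF t' e_mem[OF that]] by (auto simp: ons_def simp flip: exp_of_real)
    qed (use that sg(1)[OF t' e_mem[OF that]] in auto)
    have "T t u = sg (complex_of_real t) u"
      unfolding u_def lincomb_def using F(2)
      by (subst bounded_op_sum[OF C0_semigroupD(1)[OF T t]], force, subst bounded_op_sum[OF sg_bounded_op[OF t']], force)
        (auto intro!: sum.cong simp: bounded_opD(3)[OF C0_semigroupD(1)[OF T t]] bounded_opD(3)[OF sg_bounded_op[OF t']] eig eig_sg subset_iff)
    then have "y = T t (x - u) - sg (complex_of_real t) (x - u)"
      unfolding y_def bounded_opD(4)[OF C0_semigroupD(1)[OF T t] x u] bounded_opD(4)[OF sg_bounded_op[OF t'] x u]
      by simp
    then have "nrm y \<le> nrm (T t (x - u)) + nrm (sg (complex_of_real t) (x - u))"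
      using TX[OF t, of "x - u"] sg(1)[OF t', of "x - u"] x u
      by (simp only:) (intro nrm_triangle_diff, auto)
    also have "\<dots> \<le> (\<bar>C\<bar> + \<bar>D\<bar>) * nrm (x - u)"
    proof -
      have xu: "x - u \<in> X" using x u by simp
      have "nrm (T t (x - u)) \<le> \<bar>C\<bar> * nrm (x - u)"
        using C[OF xu] mult_right_mono[OF abs_ge_self nrm_nonneg[OF xu], of C] by linarith
      moreover have "nrm (sg (complex_of_real t) (x - u)) \<le> \<bar>D\<bar> * nrm (x - u)"
        using D[OF xu] mult_right_mono[OF abs_ge_self nrm_nonneg[OF xu], of D] by linarith
      ultimately show ?thesis by (simp add: distrib_right)
    qed
    also have "\<dots> \<le> (\<bar>C\<bar> + \<bar>D\<bar>) * \<delta>" using F(3) by (intro mult_left_mono) (auto simp: u_def)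
    finally show ?thesis using \<delta>(2) by simp
  qed
  then have "nrm y \<le> 0" by (rule field_le_epsilon)
  then have "y = 0" using y nrm_nonneg[OF y] by (metis antisym nrm_eq_0)
  then show ?thesis by (simp add: y_def)
qed

end

lemma has_sum_sum:
  fixes f :: "'n \<Rightarrow> 'i \<Rightarrow> real"
  assumes "\<And>n. n \<in> F \<Longrightarrow> (f n has_sum s n) I"
  shows "((\<lambda>i. \<Sum>n\<in>F. f n i) has_sum (\<Sum>n\<in>F. s n)) I"
  using assms by (induction F rule: infinite_finite_induct) (auto intro!: has_sum_add)

lemma sector_right_half_plane: "sector (pi / 2) = {z. 0 < Re z}"
  unfolding sector_def using Arg_Re_pos by fastforce

section \<open>Passage to an equivalent inner product\<close>

locale norm_equiv = N1: semi_ip X ip + N2: semi_ip X ip'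
  for X :: "('a \<Rightarrow> complex) set" and ip ip' +
  fixes c1 c2 :: real
  assumes le1: "x \<in> X \<Longrightarrow> ip_norm ip' x \<le> c1 * ip_norm ip x"
    and le2: "x \<in> X \<Longrightarrow> ip_norm ip x \<le> c2 * ip_norm ip' x"
    and c_pos: "0 < c1" "0 < c2"
begin

lemma sym: "norm_equiv X ip' ip c2 c1"
  using le1 le2 c_pos by unfold_locales auto

lemma tendsto_0:
  assumes "((\<lambda>p. ip_norm ip (\<sigma> p)) \<longlongrightarrow> 0) F" "\<forall>\<^sub>F p in F. \<sigma> p \<in> X"
  shows "((\<lambda>p. ip_norm ip' (\<sigma> p)) \<longlongrightarrow> 0) F"
proof (rule Lim_null_comparison)
  show "\<forall>\<^sub>F p in F. norm (ip_norm ip' (\<sigma> p)) \<le> c1 * ip_norm ip (\<sigma> p)"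
    using assms(2) by eventually_elim (simp add: le1)
  show "((\<lambda>p. c1 * ip_norm ip (\<sigma> p)) \<longlongrightarrow> 0) F"
    using tendsto_mult_left[OF assms(1), of c1] by simp
qed

lemma bounded_op:
  assumes B: "bounded_op X ip B" and eq: "\<And>x. x \<in> X \<Longrightarrow> B' x = B x"
  shows "bounded_op X ip' B'"
proof -
  note BX = N1.bounded_opD[OF B]
  obtain C where C: "\<And>x. x \<in> X \<Longrightarrow> ip_norm ip (B x) \<le> C * ip_norm ip x"
    using B unfolding bounded_op_def by blast
  have "ip_norm ip' (B x) \<le> (c1 * \<bar>C\<bar> * c2) * ip_norm ip' x" if x: "x \<in> X" for x
  proof -
    have "ip_norm ip' (B x) \<le> c1 * ip_norm ip (B x)" using le1[OF BX(1)[OF x]] .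
    also have "\<dots> \<le> c1 * (\<bar>C\<bar> * ip_norm ip x)"
      using C[OF x] mult_right_mono[OF abs_ge_self N1.nrm_nonneg[OF x], of C] c_pos
      by (intro mult_left_mono) auto
    also have "\<dots> \<le> c1 * (\<bar>C\<bar> * (c2 * ip_norm ip' x))"
      using le2[OF x] c_pos by (intro mult_left_mono) auto
    finally show ?thesis by (simp add: mult.assoc)
  qed
  moreover have "B' (x + y) = B' x + B' y" if "x \<in> X" "y \<in> X" for x y
    using that BX(2)[OF that] eq[OF N1.add_mem[OF that]] eq by metis
  moreover have "B' (c *\<^sub>c x) = c *\<^sub>c B' x" if "x \<in> X" for c x
    using that BX(3)[OF that] eq[OF N1.scale_mem[OF that]] eq by metis
  moreover have "B' x \<in> X" if "x \<in> X" for x using that BX(1) eq by metis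
  moreover have "\<exists>C. \<forall>x\<in>X. ip_norm ip' (B' x) \<le> C * ip_norm ip' x"
    using calculation(1) eq by (intro exI[of _ "c1 * \<bar>C\<bar> * c2"]) simp
  ultimately show ?thesis unfolding bounded_op_def by blast
qed

lemma C0_semigroup:
  assumes S: "C0_semigroup X ip S" and eq: "\<And>t x. 0 \<le> t \<Longrightarrow> x \<in> X \<Longrightarrow> T t x = S t x"
  shows "C0_semigroup X ip' T"
  unfolding C0_semigroup_def
proof (intro conjI allI ballI impI)
  note SX = N1.bounded_opD(1)[OF N1.C0_semigroupD(1)[OF S]]
  show "bounded_op X ip' (T t)" if "0 \<le> t" for t
    by (rule bounded_op[OF N1.C0_semigroupD(1)[OF S that] eq[OF that]])
  show "T 0 x = x" if "x \<in> X" for x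
    using eq[of 0 x] N1.C0_semigroupD(2)[OF S that] that by simp
  show "T (s + t) x = T s (T t x)" if "0 \<le> s" "0 \<le> t" "x \<in> X" for s t x
    using N1.C0_semigroupD(3)[OF S that] that eq[of "s + t" x] eq[of t x] eq[OF that(1) SX[OF that(2,3)]]
    by simp
  fix x assume x: "x \<in> X"
  have ev: "\<forall>\<^sub>F t in at_right 0. S t x - x \<in> X"
    using eventually_at_right_less[of 0] by eventually_elim (use SX x in auto)
  have "\<forall>\<^sub>F t in at_right 0. ip_norm ip' (S t x - x) = ip_norm ip' (T t x - x)"
    using eventually_at_right_less[of 0] by eventually_elim (use eq x in auto)
  then show "((\<lambda>t. ip_norm ip' (T t x - x)) \<longlongrightarrow> 0) (at_right 0)"
    by (rule Lim_transform_eventually[OF tendsto_0[OF N1.C0_semigroupD(4)[OF S x] ev]])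
qed

lemma generator_subset:
  assumes S: "C0_semigroup X ip S" and eq: "\<And>t x. 0 \<le> t \<Longrightarrow> x \<in> X \<Longrightarrow> T t x = S t x"
  shows "generator X ip S \<subseteq> generator X ip' T"
proof clarify
  fix x y assume "(x, y) \<in> generator X ip S"
  then have x: "x \<in> X" and y: "y \<in> X"
    and lim: "((\<lambda>t. ip_norm ip (complex_of_real (1 / t) *\<^sub>c (S t x - x) - y)) \<longlongrightarrow> 0) (at_right 0)"
    by (auto simp: generator_def)
  have ev: "\<forall>\<^sub>F t in at_right 0. complex_of_real (1 / t) *\<^sub>c (S t x - x) - y \<in> X"
    using eventually_at_right_less[of 0]
    by eventually_elim (use N1.bounded_opD(1)[OF N1.C0_semigroupD(1)[OF S]] x y in auto)
  have "\<forall>\<^sub>F t in at_right 0. ip_norm ip' (complex_of_real (1 / t) *\<^sub>c (S t x - x) - y)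
      = ip_norm ip' (complex_of_real (1 / t) *\<^sub>c (T t x - x) - y)"
    using eventually_at_right_less[of 0] by eventually_elim (use eq x in auto)
  then have "((\<lambda>t. ip_norm ip' (complex_of_real (1 / t) *\<^sub>c (T t x - x) - y)) \<longlongrightarrow> 0) (at_right 0)"
    by (rule Lim_transform_eventually[OF tendsto_0[OF lim ev]])
  then show "(x, y) \<in> generator X ip' T" using x y by (simp add: generator_def)
qed

lemma generator:
  assumes S: "C0_semigroup X ip S" and eq: "\<And>t x. 0 \<le> t \<Longrightarrow> x \<in> X \<Longrightarrow> T t x = S t x"
  shows "generator X ip' T = generator X ip S"
  using generator_subset[OF S eq] norm_equiv.generator_subset[OF sym C0_semigroup[OF S eq], of S] eq
  by auto

lemma analytic_semigroup:
  assumes S: "analytic_semigroup X ip (pi / 2) S" and eq: "\<And>t x. 0 \<le> t \<Longrightarrow> x \<in> X \<Longrightarrow> T t x = S t x"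
  shows "analytic_semigroup X ip' (pi / 2) T"
proof -
  obtain U where U: "\<forall>t\<ge>0. \<forall>x\<in>X. U (complex_of_real t) x = S t x"
    and bd: "\<forall>z \<in> sector (pi / 2). bounded_op X ip (U z)"
    and add: "\<forall>z \<in> sector (pi / 2). \<forall>w \<in> sector (pi / 2). \<forall>x\<in>X. U (z + w) x = U z (U w x)"
    and diff: "\<forall>z \<in> sector (pi / 2). op_differentiable_at X ip U z"
    and cont: "\<And>\<theta>' x. 0 < \<theta>' \<Longrightarrow> \<theta>' < pi / 2 \<Longrightarrow> x \<in> X \<Longrightarrow> ((\<lambda>z. ip_norm ip (U z x - x)) \<longlongrightarrow> 0) (at 0 within sector \<theta>')"
    using S unfolding analytic_semigroup_def by blast
  have C0: "C0_semigroup X ip S" using S by (simp add: analytic_semigroup_def)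
  note UX = N1.bounded_opD(1)[OF bspec[OF bd]]
  have diff': "op_differentiable_at X ip' U z" if z: "z \<in> sector (pi / 2)" for z
  proof -
    obtain D where D: "bounded_op X ip D"
      and lim: "\<And>\<epsilon>. 0 < \<epsilon> \<Longrightarrow> \<forall>\<^sub>F h in at 0. \<forall>x\<in>X. ip_norm ip ((1 / h) *\<^sub>c (U (z + h) x - U z x) - D x) \<le> \<epsilon> * ip_norm ip x"
      using diff z unfolding op_differentiable_at_def by blast
    have "((\<lambda>h. Re (z + h)) \<longlongrightarrow> Re (z + 0)) (at 0)" by (intro tendsto_intros)
    then have "\<forall>\<^sub>F h in at 0. 0 < Re (z + h)"
      using Re_sector[OF z] by (intro order_tendstoD(1)[of "\<lambda>h. Re (z + h)" "Re (z + 0)"]) auto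
    then have sec: "\<forall>\<^sub>F h in at 0. z + h \<in> sector (pi / 2)"
      by eventually_elim (simp only: sector_right_half_plane mem_Collect_eq)
    have "\<forall>\<^sub>F h in at 0. \<forall>x\<in>X. ip_norm ip' ((1 / h) *\<^sub>c (U (z + h) x - U z x) - D x) \<le> \<epsilon> * ip_norm ip' x"
      if "0 < \<epsilon>" for \<epsilon>
    proof -
      \<comment> \<open>The norm is changed twice, once for the error and once for \<open>x\<close>,
        at the cost of \<open>c1\<close> and \<open>c2\<close>.\<close>
      have "0 < \<epsilon> / (c1 * c2)" using that c_pos by simp
      from lim[OF this] sec show ?thesis
      proof eventually_elim
        case (elim h)
        show ?case
        proof
          fix x assume x: "x \<in> X"
          have "(1 / h) *\<^sub>c (U (z + h) x - U z x) - D x \<in> X"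
            using UX[OF elim(2) x] UX[OF z x] N1.bounded_opD(1)[OF D x] by simp
          then have "ip_norm ip' ((1 / h) *\<^sub>c (U (z + h) x - U z x) - D x) \<le> c1 * ip_norm ip ((1 / h) *\<^sub>c (U (z + h) x - U z x) - D x)"
            by (rule le1)
          also have "\<dots> \<le> c1 * (\<epsilon> / (c1 * c2) * (c2 * ip_norm ip' x))"
          proof (intro mult_left_mono)
            have "ip_norm ip ((1 / h) *\<^sub>c (U (z + h) x - U z x) - D x) \<le> \<epsilon> / (c1 * c2) * ip_norm ip x"
              using elim(1) x by blast
            also have "\<dots> \<le> \<epsilon> / (c1 * c2) * (c2 * ip_norm ip' x)"
              using le2[OF x] that c_pos by (intro mult_left_mono) auto
            finally show "ip_norm ip ((1 / h) *\<^sub>c (U (z + h) x - U z x) - D x) \<le> \<epsilon> / (c1 * c2) * (c2 * ip_norm ip' x)" .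
          qed (use c_pos in simp)
          also have "\<dots> = \<epsilon> * ip_norm ip' x" using c_pos by simp
          finally show "ip_norm ip' ((1 / h) *\<^sub>c (U (z + h) x - U z x) - D x) \<le> \<epsilon> * ip_norm ip' x" .
        qed
      qed
    qed
    then show ?thesis using bounded_op[OF D, of D] unfolding op_differentiable_at_def by blast
  qed
  show ?thesis
    unfolding analytic_semigroup_def
  proof (intro conjI exI[of _ U] allI ballI impI)
    show "C0_semigroup X ip' T" by (rule C0_semigroup[OF C0 eq])
    show "U (complex_of_real t) x = T t x" if "0 \<le> t" "x \<in> X" for t x using U eq that by simp
    show "bounded_op X ip' (U z)" if "z \<in> sector (pi / 2)" for z
      using bounded_op[OF bspec[OF bd that]] by blast
    show "U (z + w) x = U z (U w x)" if "z \<in> sector (pi / 2)" "w \<in> sector (pi / 2)" "x \<in> X" for z w x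
      using add that by blast
    show "op_differentiable_at X ip' U z" if "z \<in> sector (pi / 2)" for z by (rule diff'[OF that])
    fix \<theta>' x assume \<theta>: "0 < \<theta>' \<and> \<theta>' < pi / 2" and x: "x \<in> X"
    have "\<forall>\<^sub>F z in at 0 within sector \<theta>'. U z x - x \<in> X"
      unfolding eventually_at_filter
      using UX[OF sector_mono[of _ \<theta>' "pi / 2"] x] x \<theta> by (intro always_eventually) auto
    with cont[OF conjunct1[OF \<theta>] conjunct2[OF \<theta>] x]
    show "((\<lambda>z. ip_norm ip' (U z x - x)) \<longlongrightarrow> 0) (at 0 within sector \<theta>')" by (rule tendsto_0)
  qed
qed

end

section \<open>A criterion for the trace class\<close>

context hilbert
begin

text \<open>The Hilbert-Schmidt bound makes \<open>spectral\<close> applicable to the form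
  \<open>ip (B x) (B y)\<close>, and |B| is the multiplier \<open>sqrt (s e)\<close> in its
  eigenbasis. The second bound is then tested with the polar decomposition: the vectors
  \<open>g e\<close>, \<open>B e\<close> divided by \<open>sqrt (s e)\<close>, are again
  orthonormal, and \<open>ip (B e) (g e) = sqrt (s e)\<close>, so \<open>C'\<close> bounds the trace
  of |B|.\<close>

theorem trace_classI:
  assumes B: "bounded_op X ip B"
    and HS: "\<And>F. finite F \<Longrightarrow> ons F (\<lambda>x. x) \<Longrightarrow> (\<Sum>x\<in>F. (nrm (B x))\<^sup>2) \<le> C"
    and nuc: "\<And>F g. finite F \<Longrightarrow> ons F (\<lambda>x. x) \<Longrightarrow> ons F g \<Longrightarrow> (\<Sum>x\<in>F. cmod (ip (B x) (g x))) \<le> C'"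
  shows "trace_class X ip B"
proof -
  note BX = bounded_opD[OF B]
  interpret t: trace_form X ip "\<lambda>x y. ip (B x) (B y)" C
  proof
    show "(\<Sum>e\<in>F. Re (ip (B e) (B e))) \<le> C" if "finite F" "ons F (\<lambda>x. x)" for F
    proof -
      have "(\<Sum>e\<in>F. Re (ip (B e) (B e))) = (\<Sum>x\<in>F. (nrm (B x))\<^sup>2)"
        using that ons_mem[OF that(2)] BX(1) by (intro sum.cong refl) (simp add: nrm_sq)
      then show ?thesis using HS[OF that] by simp
    qed
  qed (auto simp: BX add_left cnj_sym)
  obtain E s where E: "orthonormal_basis X ip E"
    and s: "\<And>e. e \<in> E \<Longrightarrow> 0 \<le> s e" "\<And>e z. e \<in> E \<Longrightarrow> z \<in> X \<Longrightarrow> ip (B e) (B z) = complex_of_real (s e) * ip e z"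
    using t.spectral by blast
  interpret E: onb X ip E "\<lambda>x. x"
    using E by unfold_locales (auto simp: orthonormal_basis_def ons_def)
  define m where "m e = complex_of_real (sqrt (s e))" for e
  have s_eq: "(nrm (B e))\<^sup>2 = s e" if "e \<in> E" for e
    using s(2)[OF that E.e_mem[OF that]] ons_nrm[OF E.ons that] E.e_mem[OF that]
    by (simp add: nrm_sq BX self_eq[of e])
  have m_le: "cmod (m e) \<le> sqrt C" if "e \<in> E" for e
    using HS[of "{e}"] s_eq[OF that] s(1)[OF that] ons_subset[OF E.ons, of "{e}"] that
    by (simp add: m_def)
  define R where "R = E.diag m"
  have R: "bounded_op X ip R" unfolding R_def by (rule E.diag_bounded_op[OF m_le])
  note RX = bounded_opD(1)[OF R]
  have Re: "ip (R x) e = m e * ip x e" if "x \<in> X" "e \<in> E" for x e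
    unfolding R_def using E.diag(2)[of m "sqrt C" x e] m_le that by blast
  have pos: "Im (ip (R x) x) = 0 \<and> Re (ip (R x) x) \<ge> 0" if x: "x \<in> X" for x
  proof -
    have "ip (R x) e * cnj (ip x e) = complex_of_real (sqrt (s e) * (cmod (ip x e))\<^sup>2)" if "e \<in> E" for e
      unfolding Re[OF x that] by (simp del: of_real_power add: m_def complex_norm_square mult.assoc)
    then have "((\<lambda>e. complex_of_real (sqrt (s e) * (cmod (ip x e))\<^sup>2)) has_sum ip (R x) x) E"
      using E.Parseval[OF RX[OF x] x] by (subst has_sum_cong[symmetric]) auto
    from has_sum_Re[OF this] has_sum_Im[OF this]
    have re: "((\<lambda>e. sqrt (s e) * (cmod (ip x e))\<^sup>2) has_sum Re (ip (R x) x)) E"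
      and im: "((\<lambda>e. 0) has_sum Im (ip (R x) x)) E" by simp_all
    have "Im (ip (R x) x) = 0" by (rule has_sum_unique[OF im]) (rule has_sum_0, rule refl)
    then show ?thesis using s(1) by (intro conjI has_sum_nonneg[OF re]) auto
  qed
  have sq: "ip (R x) (R y) = ip (B x) (B y)" if x: "x \<in> X" and y: "y \<in> X" for x y
  proof -
    obtain z where z: "z \<in> X" "\<And>w. w \<in> X \<Longrightarrow> ip (B w) (B y) = ip w z" using t.form_rep[OF y] by blast
    have "ip (R x) e * cnj (ip (R y) e) = ip x e * cnj (ip z e)" if e: "e \<in> E" for e
    proof -
      have "cnj (ip z e) = ip e z" using z e by (simp add: cnj_sym)
      also have "\<dots> = complex_of_real (s e) * ip e y" using z(2)[of e] s(2)[OF e y] e by simp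
      also have "ip e y = cnj (ip y e)" using e y by (simp add: cnj_sym)
      finally show ?thesis unfolding Re[OF x e] Re[OF y e] using s(1)[OF e]
        by (simp add: m_def mult_ac flip: of_real_mult)
    qed
    then have "((\<lambda>e. ip (R x) e * cnj (ip (R y) e)) has_sum ip x z) E"
      using E.Parseval[OF x z(1)] by (subst has_sum_cong) auto
    then have "ip (R x) (R y) = ip x z" by (rule has_sum_unique[OF E.Parseval[OF RX[OF x] RX[OF y]]])
    then show ?thesis using z(2)[OF x] by simp
  qed
  have RE: "Re (ip (R e) e) = sqrt (s e)" if e: "e \<in> E" for e
    unfolding Re[OF E.e_mem[OF e] e] using E.ons e by (simp add: ons_def m_def)
  have "(\<lambda>e. Re (ip (R e) e)) summable_on E"
  proof (rule nonneg_bdd_above_summable_on)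
    show "0 \<le> Re (ip (R e) e)" if "e \<in> E" for e using RE[OF that] s(1)[OF that] by simp
    show "bdd_above (sum (\<lambda>e. Re (ip (R e) e)) ` {F. F \<subseteq> E \<and> finite F})"
    proof (rule bdd_aboveI2)
      fix F assume "F \<in> {F. F \<subseteq> E \<and> finite F}"
      then have F: "F \<subseteq> E" "finite F" by auto
      \<comment> \<open>If \<open>s e = 0\<close>, then \<open>B e = 0\<close> cannot be normalised,
        but such \<open>e\<close> contribute nothing to the trace.\<close>
      define G where "G = {e \<in> F. s e \<noteq> 0}"
      have G: "G \<subseteq> E" "finite G" "\<And>e. e \<in> G \<Longrightarrow> 0 < s e"
        using F s(1) by (auto simp: G_def less_le subset_iff)
      define g where "g e = complex_of_real (1 / sqrt (s e)) *\<^sub>c B e" for e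
      have BE: "B e \<in> X" if "e \<in> G" for e using G that BX(1) by auto
      have BB: "ip (B e) (B f) = (if e = f then complex_of_real (s e) else 0)" if "e \<in> G" "f \<in> G" for e f
      proof -
        have ef: "e \<in> E" "f \<in> E" using that G by auto
        then have "ip (B e) (B f) = complex_of_real (s e) * ip e f" by (intro s(2) E.e_mem)
        then show ?thesis using E.ons ef by (auto simp: ons_def)
      qed
      have "ons G g"
        unfolding ons_def g_def using BE BB less_imp_le[OF G(3)] less_imp_neq[OF G(3)]
        by (auto simp flip: of_real_mult)
      then have "(\<Sum>e\<in>G. cmod (ip (B e) (g e))) \<le> C'"
        using G ons_subset[OF E.ons] by (intro nuc) auto
      moreover have "cmod (ip (B e) (g e)) = sqrt (s e)" if "e \<in> G" for e
      proof -
        have "ip (B e) (g e) = complex_of_real (1 / sqrt (s e) * s e)"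
          unfolding g_def using BE[OF that] BB[OF that that] by simp
        also have "1 / sqrt (s e) * s e = sqrt (s e)" using G(3)[OF that] by (simp add: real_div_sqrt)
        finally show ?thesis using G(3)[OF that] by simp
      qed
      moreover have "(\<Sum>e\<in>F. Re (ip (R e) e)) = (\<Sum>e\<in>G. sqrt (s e))"
        using F RE by (intro sum.mono_neutral_cong_right) (auto simp: G_def)
      ultimately show "(\<Sum>e\<in>F. Re (ip (R e) e)) \<le> C'" by simp
    qed
  qed
  moreover have "is_abs_op X ip B R" unfolding is_abs_op_def using R pos sq by blast
  ultimately show ?thesis unfolding trace_class_def using B E by blast
qed

end

section \<open>The semigroup of a form whose two inner products have a common eigenbasis\<close>

text \<open>In the application \<open>XH\<close> and \<open>XV\<close> are H_Y and V_Y, and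
  \<open>q\<close> is the form shifted by \<open>om\<close> times \<open>ipH\<close>. Density of
  \<open>XV\<close> in \<open>XH\<close> is stated as triviality of the orthogonal complement, the
  shape in which it is both checked and used.\<close>

locale form_setting = H: hilbert XH ipH + V: hilbert XV ipV + q: semi_ip XV q
  for XH XV :: "('a \<Rightarrow> complex) set" and ipH ipV q +
  fixes om c1 c2 C :: real
  assumes subset: "XV \<subseteq> XH"
    and equiv: "norm_equiv XV ipV q c1 c2"
    and om: "0 \<le> om"
    and trace: "\<And>F. finite F \<Longrightarrow> q.ons F (\<lambda>x. x) \<Longrightarrow> (\<Sum>e\<in>F. Re (ipH e e)) \<le> C"
    and total: "\<And>x. x \<in> XH \<Longrightarrow> (\<And>v. v \<in> XV \<Longrightarrow> ipH x v = 0) \<Longrightarrow> x = 0"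
begin

interpretation VQ: norm_equiv XV ipV q c1 c2 by (rule equiv)
interpretation QV: norm_equiv XV q ipV c2 c1 by (rule VQ.sym)

definition A :: "('a \<Rightarrow> complex) rel" where
  "A = {(f, g). f \<in> XV \<and> g \<in> XH \<and> (\<forall>h\<in>XV. q f h - complex_of_real om * ipH f h = ipH g h)}"

lemma VH [simp]: "x \<in> XV \<Longrightarrow> x \<in> XH"
  using subset by blast

sublocale Q: hilbert XV q
proof
  show "x = 0" if "x \<in> XV" "q x x = 0" for x
  proof -
    have "q.nrm x = 0" using that by (simp add: ip_norm_def)
    then have "V.nrm x \<le> 0" using VQ.le2[OF that(1)] by simp
    then show ?thesis using V.nrm_nonneg[OF that(1)] that(1) V.nrm_eq_0 by (metis antisym)
  qed
  fix \<sigma> assume \<sigma>: "\<And>n. \<sigma> n \<in> XV" "q.Cauchy_seq \<sigma>"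
  have "V.Cauchy_seq \<sigma>"
    unfolding V.Cauchy_seq_def
  proof (intro allI impI)
    fix \<epsilon> :: real assume "0 < \<epsilon>"
    then obtain N where N: "\<forall>m\<ge>N. \<forall>n\<ge>N. q.nrm (\<sigma> m - \<sigma> n) < \<epsilon> / c2"
      using \<sigma>(2) VQ.c_pos unfolding q.Cauchy_seq_def by (metis divide_pos_pos)
    have "V.nrm (\<sigma> m - \<sigma> n) < \<epsilon>" if "m \<ge> N" "n \<ge> N" for m n
    proof -
      have "q.nrm (\<sigma> m - \<sigma> n) < \<epsilon> / c2" using N that by blast
      then have "c2 * q.nrm (\<sigma> m - \<sigma> n) < \<epsilon>" using VQ.c_pos
        by (simp add: pos_less_divide_eq mult.commute)
      then show ?thesis using VQ.le2[of "\<sigma> m - \<sigma> n"] \<sigma>(1) by (meson V.diff_mem le_less_trans)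
    qed
    then show "\<exists>N. \<forall>m\<ge>N. \<forall>n\<ge>N. V.nrm (\<sigma> m - \<sigma> n) < \<epsilon>" by blast
  qed
  then obtain x where x: "x \<in> XV" "(\<lambda>n. V.nrm (\<sigma> n - x)) \<longlonglongrightarrow> 0"
    using V.complete[of \<sigma>] \<sigma>(1) by blast
  have "(\<lambda>n. q.nrm (\<sigma> n - x)) \<longlonglongrightarrow> 0"
    by (rule VQ.tendsto_0[OF x(2)]) (use \<sigma>(1) x(1) in auto)
  then show "\<exists>x\<in>XV. (\<lambda>n. q.nrm (\<sigma> n - x)) \<longlonglongrightarrow> 0" using x(1) by blast
qed

sublocale QH: trace_form XV q ipH C
  by unfold_locales (use trace in \<open>auto simp: H.add_left H.cnj_sym\<close>)

text \<open>The vector \<open>z\<close> solves \<open>(A + om) z = g\<close>: this is the resolvent,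
  obtained from Riesz for \<open>q\<close> since \<open>ipH\<close> is bounded with respect to
  \<open>q\<close>.\<close>

lemma rep_H:
  assumes g: "g \<in> XH"
  shows "\<exists>z\<in>XV. \<forall>h\<in>XV. ipH h g = q h z \<and> ipH g h = q z h"
proof -
  have "\<exists>z\<in>XV. \<forall>h\<in>XV. ipH h g = q h z"
  proof (rule Q.Riesz)
    show "q.lin (\<lambda>h. ipH h g)" using g by (simp add: q.lin_def H.add_left)
    fix h assume h: "h \<in> XV"
    have "cmod (ipH h g) \<le> H.nrm h * H.nrm g" using h g by (intro H.Cauchy_Schwarz) auto
    also have "\<dots> \<le> (sqrt C * q.nrm h) * H.nrm g" using QH.form_bound[OF h] g
      by (intro mult_right_mono) auto
    finally show "cmod (ipH h g) \<le> (sqrt C * H.nrm g) * q.nrm h" by (simp add: mult_ac)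
  qed
  then obtain z where z: "z \<in> XV" "\<And>h. h \<in> XV \<Longrightarrow> ipH h g = q h z" by blast
  have "ipH g h = q z h" if "h \<in> XV" for h
    using arg_cong[OF z(2)[OF that], of cnj] that z(1) g by (simp add: H.cnj_sym q.cnj_sym)
  then show ?thesis using z by blast
qed

end

text \<open>The basis found by \<open>spectral\<close> becomes a parameter, so that the diagonal
  semigroups on both spaces can be set up as sublocales.\<close>

locale form_eigenbasis = form_setting +
  fixes E :: "('a \<Rightarrow> complex) set" and s :: "('a \<Rightarrow> complex) \<Rightarrow> real"
  assumes basis: "orthonormal_basis XV q E"
    and eigen: "\<And>e z. e \<in> E \<Longrightarrow> z \<in> XV \<Longrightarrow> ipH e z = complex_of_real (s e) * q e z"
begin

interpretation VQ: norm_equiv XV ipV q c1 c2 by (rule equiv)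
interpretation QV: norm_equiv XV q ipV c2 c1 by (rule VQ.sym)

sublocale EV: onb XV q E "\<lambda>x. x"
  using basis by unfold_locales (auto simp: orthonormal_basis_def q.ons_def)

lemma q_one: "i \<in> E \<Longrightarrow> q i i = 1"
  using EV.ons by (simp add: q.ons_def)

lemma s_pos: "i \<in> E \<Longrightarrow> 0 < s i"
proof -
  assume i: "i \<in> E"
  have "ipH i i = complex_of_real (s i)" using eigen[OF i EV.e_mem[OF i]] q_one[OF i] by simp
  moreover have "i \<noteq> 0" using q_one[OF i] by auto
  then have "ipH i i \<noteq> 0" using H.definite[of i] EV.e_mem[OF i] by auto
  ultimately show ?thesis using H.nonneg[of i] EV.e_mem[OF i] by (auto simp: less_le)
qed

lemma eigen': "w \<in> XV \<Longrightarrow> i \<in> E \<Longrightarrow> ipH w i = complex_of_real (s i) * q w i"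
  using arg_cong[OF eigen[of i w], of cnj] EV.e_mem[of i] by (simp add: H.cnj_sym q.cnj_sym)

lemma s_summable: "s summable_on E"
proof (rule nonneg_bdd_above_summable_on)
  show "0 \<le> s i" if "i \<in> E" for i using s_pos[OF that] by simp
  show "bdd_above (sum s ` {F. F \<subseteq> E \<and> finite F})"
  proof (rule bdd_aboveI2)
    fix F assume "F \<in> {F. F \<subseteq> E \<and> finite F}"
    then have F: "F \<subseteq> E" "finite F" by auto
    have "sum s F = (\<Sum>e\<in>F. Re (ipH e e))"
      using F eigen q_one EV.e_mem by (intro sum.cong refl) (auto simp: subset_iff)
    also have "\<dots> \<le> C" using F q.ons_subset[OF EV.ons] by (intro trace) auto
    finally show "sum s F \<le> C" .
  qed
qed

text \<open>At a basis vector \<open>i\<close> the form \<open>q\<close> is \<open>1 / s i\<close>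
  times \<open>ipH\<close>; removing the shift leaves the eigenvalue of \<open>A\<close>. As
  \<open>s i\<close> is positive, the spectrum is bounded below by \<open>- om\<close>.\<close>

definition lam :: "('a \<Rightarrow> complex) \<Rightarrow> real" where "lam i = 1 / s i - om"

text \<open>Since \<open>ipH i i = s i\<close>, this is the same basis normalised in
  \<open>XH\<close>.\<close>

definition eH :: "('a \<Rightarrow> complex) \<Rightarrow> 'a \<Rightarrow> complex" where
  "eH i = complex_of_real (1 / sqrt (s i)) *\<^sub>c i"

sublocale DV: diag_semigroup XV q E "\<lambda>x. x" lam om
  by unfold_locales (use om s_pos in \<open>auto simp: lam_def less_imp_le\<close>)

lemma eH_ip: "x \<in> XH \<Longrightarrow> i \<in> E \<Longrightarrow> ipH x (eH i) = complex_of_real (1 / sqrt (s i)) * ipH x i"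
  using EV.e_mem[of i] by (simp add: eH_def)

text \<open>Orthogonality is inherited from \<open>q\<close>. For totality, \<open>rep_H\<close>
  represents the functional of \<open>x\<close> on \<open>XV\<close> by some \<open>z\<close> whose
  \<open>q\<close>-coefficients all vanish; hence \<open>x\<close> is orthogonal to
  \<open>XV\<close>, which is dense.\<close>

sublocale EH: onb XH ipH E eH
proof
  show "H.ons E eH"
    unfolding H.ons_def
  proof (intro conjI ballI)
    show "eH ` E \<subseteq> XH" using EV.e_mem by (auto simp: eH_def)
    fix i j assume i: "i \<in> E" and j: "j \<in> E"
    have "ipH (eH i) (eH j) = complex_of_real (1 / sqrt (s i) * (1 / sqrt (s j)) * s i) * q i j"
      using eigen[OF i EV.e_mem[OF j]] EV.e_mem[OF i] EV.e_mem[OF j] by (simp add: eH_def)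
    then show "ipH (eH i) (eH j) = (if i = j then 1 else 0)"
      using s_pos[OF i] EV.ons i j by (auto simp: q.ons_def simp flip: of_real_mult)
  qed
  fix x assume x: "x \<in> XH" and 0: "\<And>i. i \<in> E \<Longrightarrow> ipH x (eH i) = 0"
  have x0: "ipH x i = 0" if "i \<in> E" for i
    using 0[OF that] s_pos[OF that] by (simp add: eH_ip[OF x that])
  obtain z where z: "z \<in> XV" "\<And>h. h \<in> XV \<Longrightarrow> ipH x h = q z h" using rep_H[OF x] by blast
  have "z = 0" using EV.total[OF z(1)] z(2)[OF EV.e_mem] x0 by simp
  then show "x = 0" using total[OF x] z(2) by simp
qed

sublocale DH: diag_semigroup XH ipH E eH lam om
  by unfold_locales (use DV.lam om in auto)

lemma H_coeff_iff:
  assumes "x \<in> XH" "y \<in> XH" "i \<in> E"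
  shows "ipH y (eH i) = c * ipH x (eH i) \<longleftrightarrow> ipH y i = c * ipH x i"
  using s_pos[OF assms(3)] by (simp add: eH_ip assms)

lemma generator_H: "generator XH ipH (\<lambda>t. DH.sg (complex_of_real t)) =
  {(x, y). x \<in> XH \<and> y \<in> XH \<and> (\<forall>i\<in>E. ipH y i = - complex_of_real (lam i) * ipH x i)}"
  unfolding DH.sg_generator using H_coeff_iff by blast

text \<open>A pair in the generator is known only through its coefficients in \<open>XH\<close>, so
  \<open>x\<close> has first to be recognised as an element of \<open>XV\<close>; afterwards the
  resolvents of \<open>x\<close> and \<open>- y\<close> reassemble the form equation.\<close>

lemma generator_A: "generator XH ipH (\<lambda>t. DH.sg (complex_of_real t)) = neg_op A"
proof (intro set_eqI iffI; clarify)
  fix x y assume "(x, y) \<in> neg_op A"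
  then obtain g where g: "y = - g" "x \<in> XV" "g \<in> XH"
    and A: "\<And>h. h \<in> XV \<Longrightarrow> q x h - complex_of_real om * ipH x h = ipH g h"
    by (auto simp: neg_op_def A_def)
  have "ipH y i = - complex_of_real (lam i) * ipH x i" if i: "i \<in> E" for i
  proof -
    have "q x i = ipH x i / complex_of_real (s i)" using eigen'[OF g(2) i] s_pos[OF i] by simp
    then have "ipH g i = complex_of_real (lam i) * ipH x i"
      using A[OF EV.e_mem[OF i]] by (simp add: lam_def algebra_simps)
    then show ?thesis using g EV.e_mem[OF i] by simp
  qed
  then show "(x, y) \<in> generator XH ipH (\<lambda>t. DH.sg (complex_of_real t))"
    using g by (auto simp: generator_H)
next
  fix x y assume "(x, y) \<in> generator XH ipH (\<lambda>t. DH.sg (complex_of_real t))"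
  then have x: "x \<in> XH" and y: "y \<in> XH" and yi: "\<And>i. i \<in> E \<Longrightarrow> ipH y i = - complex_of_real (lam i) * ipH x i"
    by (auto simp: generator_H)
  define c where "c i = ipH x i / complex_of_real (s i)" for i
  have "(\<lambda>i. (cmod (c i))\<^sup>2) summable_on E"
  proof (rule summable_on_comparison_test)
    define a where "a i = cmod (ipH x (eH i))" for i
    \<comment> \<open>\<open>b\<close> belongs to \<open>om x - y\<close>, which plays the role of
      \<open>(A + om) x\<close>: its coefficients are those of \<open>x\<close> divided by
      \<open>s i\<close>. The \<open>q\<close>-coefficient of \<open>x\<close> is in modulus the
      geometric mean of \<open>a i\<close> and \<open>b i\<close>, both of which are square
      summable.\<close>
    define b where "b i = cmod (ipH (complex_of_real om *\<^sub>c x - y) (eH i))" for i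
    show "(\<lambda>i. (a i)\<^sup>2 + (b i)\<^sup>2) summable_on E"
      unfolding a_def b_def using x y by (intro summable_on_add EH.coeff_summable) auto
    fix i assume i: "i \<in> E"
    have "b i = cmod (complex_of_real (1 / sqrt (s i)) * (complex_of_real om * ipH x i + complex_of_real (lam i) * ipH x i))"
      unfolding b_def using x y i yi[OF i] EV.e_mem[OF i] by (simp add: eH_ip H.diff_left)
    also have "complex_of_real om * ipH x i + complex_of_real (lam i) * ipH x i = ipH x i / complex_of_real (s i)"
      by (simp add: lam_def algebra_simps)
    finally have b: "b i = a i / s i"
      using s_pos[OF i] by (simp add: a_def eH_ip[OF x i] norm_mult norm_divide)
    have "(cmod (c i))\<^sup>2 = a i * b i"
    proof -
      have "cmod (ipH x i) = sqrt (s i) * a i"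
        using s_pos[OF i] by (simp add: a_def eH_ip[OF x i] norm_mult norm_divide)
      then have "(cmod (c i))\<^sup>2 = s i * (a i)\<^sup>2 / (s i)\<^sup>2"
        using s_pos[OF i] by (simp add: c_def norm_divide power_divide power_mult_distrib)
      then show ?thesis using s_pos[OF i] by (simp add: b power2_eq_square)
    qed
    also have "\<dots> \<le> (a i)\<^sup>2 + (b i)\<^sup>2"
    proof -
      have "0 \<le> a i * b i" by (simp add: a_def b_def)
      then show ?thesis using sum_squares_bound[of "a i" "b i"] by (simp add: mult.assoc)
    qed
    finally show "(cmod (c i))\<^sup>2 \<le> (a i)\<^sup>2 + (b i)\<^sup>2" .
  qed auto
  then obtain v where v: "v \<in> XV" "\<And>i. i \<in> E \<Longrightarrow> q v i = c i" using EV.Riesz_Fischer by blast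
  have "v = x"
  proof (rule EH.coeff_eqI)
    fix i assume i: "i \<in> E"
    then have "ipH v i = ipH x i" using eigen'[OF v(1) i] v(2)[OF i] s_pos[OF i] by (simp add: c_def)
    then show "ipH v (eH i) = ipH x (eH i)" using v(1) x i by (simp add: eH_ip)
  qed (use v x in auto)
  then have xV: "x \<in> XV" using v by simp
  obtain z where z: "z \<in> XV" "\<And>h. h \<in> XV \<Longrightarrow> ipH (- y) h = q z h" using rep_H[of "- y"] y by auto
  obtain z' where z': "z' \<in> XV" "\<And>h. h \<in> XV \<Longrightarrow> ipH x h = q z' h" using rep_H[OF x] by auto
  \<comment> \<open>This says that \<open>x\<close> is the resolvent at \<open>om x - y\<close>,
    with its two parts found separately.\<close>
  have xz: "x = complex_of_real om *\<^sub>c z' + z"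
  proof (rule EV.coeff_eqI)
    fix i assume i: "i \<in> E"
    have "q (complex_of_real om *\<^sub>c z' + z) i = complex_of_real om * ipH x i + complex_of_real (lam i) * ipH x i"
      using z z' i EV.e_mem[OF i] yi[OF i] y by (simp add: q.add_left flip: z(2) z'(2))
    also have "\<dots> = ipH x i / complex_of_real (s i)" by (simp add: lam_def algebra_simps)
    also have "\<dots> = q x i" using eigen'[OF xV i] s_pos[OF i] by simp
    finally show "q x i = q (complex_of_real om *\<^sub>c z' + z) i" by simp
  qed (use xV z z' in auto)
  have "q x h - complex_of_real om * ipH x h = ipH (- y) h" if h: "h \<in> XV" for h
  proof -
    have "q x h = q (complex_of_real om *\<^sub>c z' + z) h" using xz by simp
    also have "\<dots> = complex_of_real om * ipH x h + ipH (- y) h"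
      using z z' h by (simp only: q.add_left q.scale_mem q.scale_left)
    finally show ?thesis by simp
  qed
  then have "(x, - y) \<in> A" using xV y by (simp add: A_def)
  then have "(x, - (- y)) \<in> neg_op A" unfolding neg_op_def by blast
  then show "(x, y) \<in> neg_op A" by simp
qed

text \<open>Both semigroups multiply by the same exponentials, and for vectors of \<open>XV\<close>
  the two kinds of coefficients differ by a fixed factor depending on \<open>s i\<close>.\<close>

lemma sg_agree:
  assumes "0 \<le> Re z" "x \<in> XV" shows "DH.sg z x = DV.sg z x"
proof (rule EH.coeff_eqI)
  have w: "DV.sg z x \<in> XV" using DV.sg(1)[OF assms] .
  then show "DV.sg z x \<in> XH" by simp
  show "DH.sg z x \<in> XH" using DH.sg(1)[OF assms(1)] assms(2) by simp
  fix i assume i: "i \<in> E"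
  have "ipH (DH.sg z x) (eH i) = exp (- z * complex_of_real (lam i)) * ipH x (eH i)"
    using DH.sg(2)[OF assms(1) _ i] assms(2) by simp
  also have "\<dots> = ipH (DV.sg z x) (eH i)"
    using w assms i by (simp add: eH_ip eigen' DV.sg(2))
  finally show "ipH (DH.sg z x) (eH i) = ipH (DV.sg z x) (eH i)" .
qed

lemma generator_V: "generator XV q (\<lambda>t. DV.sg (complex_of_real t)) = neg_op (part_op A XV)"
proof -
  have "(x, y) \<in> neg_op (part_op A XV) \<longleftrightarrow> x \<in> XV \<and> y \<in> XV \<and> (x, y) \<in> neg_op A" for x y
  proof
    assume "(x, y) \<in> neg_op (part_op A XV)"
    then show "x \<in> XV \<and> y \<in> XV \<and> (x, y) \<in> neg_op A" by (auto simp: neg_op_def part_op_def)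
  next
    assume *: "x \<in> XV \<and> y \<in> XV \<and> (x, y) \<in> neg_op A"
    then obtain g where g: "(x, g) \<in> A" "y = - g" by (auto simp: neg_op_def)
    have "- y \<in> XV" using * by (intro q.minus_mem) auto
    then have "g \<in> XV" using g by simp
    then have "(x, g) \<in> part_op A XV" using g * by (auto simp: part_op_def)
    then show "(x, y) \<in> neg_op (part_op A XV)" using g(2) unfolding neg_op_def by blast
  qed
  moreover have "(ipH y i = - complex_of_real (lam i) * ipH x i) \<longleftrightarrow> (q y i = - complex_of_real (lam i) * q x i)"
    if "x \<in> XV" "y \<in> XV" "i \<in> E" for x y i
  proof -
    have "(ipH y i = - complex_of_real (lam i) * ipH x i)
      \<longleftrightarrow> complex_of_real (s i) * q y i = complex_of_real (s i) * (- complex_of_real (lam i) * q x i)"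
      unfolding eigen'[OF that(1,3)] eigen'[OF that(2,3)] by (simp only: mult.left_commute)
    then show ?thesis unfolding mult_cancel_left using s_pos[OF that(3)] by simp
  qed
  ultimately show ?thesis
    unfolding DV.sg_generator generator_A[symmetric] generator_H by (intro set_eqI) auto
qed

text \<open>From \<open>u \<le> exp u\<close> at \<open>u = t / s i\<close> one gets
  \<open>exp (- (t / s i)) \<le> s i / t\<close>; thus the finite trace of \<open>ipH\<close> makes
  the multipliers summable at every positive time.\<close>

lemma exp_summable:
  assumes t: "0 < t" shows "(\<lambda>i. exp (- (t * lam i))) summable_on E"
proof (rule summable_on_comparison_test)
  show "(\<lambda>i. exp (t * om) / t * s i) summable_on E" by (intro summable_on_cmult_right s_summable)
  fix i assume i: "i \<in> E"
  have p: "0 < t / s i" using t s_pos[OF i] by simp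
  have "t / s i \<le> 1 + t / s i" by simp
  also have "\<dots> \<le> exp (t / s i)" by (rule exp_ge_add_one_self)
  finally have "t / s i \<le> exp (t / s i)" .
  then have "exp (- (t / s i)) \<le> s i / t"
    using p t s_pos[OF i] by (simp add: exp_minus field_simps)
  then have "exp (t * om) * exp (- (t / s i)) \<le> exp (t * om) * (s i / t)" by (intro mult_left_mono) auto
  moreover have "exp (- (t * lam i)) = exp (t * om) * exp (- (t / s i))"
    by (simp add: lam_def algebra_simps flip: exp_add)
  ultimately show "exp (- (t * lam i)) \<le> exp (t * om) / t * s i" by simp
qed auto

text \<open>In the basis, \<open>ipV (T x) (g x)\<close> is the sum of
  \<open>m i * q x i * ipV i (g x)\<close>. For fixed \<open>i\<close> both factors obey Bessel over
  families orthonormal for \<open>ipV\<close>: \<open>q x i\<close> as a functional of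
  \<open>x\<close> bounded by \<open>c1\<close>, and \<open>ipV i (g x)\<close> because the norm of
  \<open>i\<close> is at most \<open>c2\<close>. Cauchy-Schwarz over the family and the summability
  of \<open>m\<close> give the bound.\<close>

lemma sg_trace_class:
  assumes t: "0 < t" and T: "bounded_op XV ipV T" and eq: "\<And>x. x \<in> XV \<Longrightarrow> T x = DV.sg (complex_of_real t) x"
  shows "trace_class XV ipV T"
proof (rule V.trace_classI[OF T])
  have t': "0 \<le> Re (complex_of_real t)" using t by simp
  define m where "m i = exp (- (t * lam i))" for i
  have m: "exp (- complex_of_real t * complex_of_real (lam i)) = complex_of_real (m i)" for i
    by (simp add: m_def flip: exp_of_real)
  \<comment> \<open>The Hilbert-Schmidt bound needs summable squares; they are the multipliers at
    time \<open>2 * t\<close>.\<close>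
  have m2: "(m i)\<^sup>2 = exp (- (2 * t * lam i))" for i
    by (simp add: m_def power2_eq_square flip: exp_add)
  have coeffs: "q (T x) i = complex_of_real (m i) * q x i" if "x \<in> XV" "i \<in> E" for x i
    using DV.sg(2)[OF t' that] eq[OF that(1)] by (simp only: m)
  have TX: "x \<in> XV \<Longrightarrow> T x \<in> XV" for x using V.bounded_opD(1)[OF T] .
  have i_nrm: "V.nrm i \<le> c2" "V.nrm i \<ge> 0" if "i \<in> E" for i
    using QV.le1[OF EV.e_mem[OF that]] q.ons_nrm[OF EV.ons that] EV.e_mem[OF that] by auto
  have Bq: "(\<Sum>x\<in>F. (cmod (q x i))\<^sup>2) \<le> c1\<^sup>2" if F: "finite F" "V.ons F (\<lambda>x. x)" and i: "i \<in> E" for F i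
  proof (rule V.Bessel_functional[OF _ _ F(2,1)])
    show "V.lin (\<lambda>x. q x i)" using q.lin_ip[OF EV.e_mem[OF i]] by (simp add: V.lin_def q.lin_def)
    show "cmod (q x i) \<le> c1 * V.nrm x" if "x \<in> XV" for x
      using q.Cauchy_Schwarz[OF that EV.e_mem[OF i]] q.ons_nrm[OF EV.ons i] VQ.le1[OF that] by simp
  qed (use VQ.c_pos in simp)
  show "(\<Sum>x\<in>F. (V.nrm (T x))\<^sup>2) \<le> c2\<^sup>2 * (c1\<^sup>2 * infsum (\<lambda>i. (m i)\<^sup>2) E)"
    if F: "finite F" "V.ons F (\<lambda>x. x)" for F
  proof -
    have FX: "x \<in> F \<Longrightarrow> x \<in> XV" for x using V.ons_mem[OF F(2)] .
    have "(\<Sum>x\<in>F. (V.nrm (T x))\<^sup>2) \<le> (\<Sum>x\<in>F. c2\<^sup>2 * (q.nrm (T x))\<^sup>2)"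
    proof (rule sum_mono)
      fix x assume "x \<in> F"
      then have "T x \<in> XV" using FX TX by blast
      then show "(V.nrm (T x))\<^sup>2 \<le> c2\<^sup>2 * (q.nrm (T x))\<^sup>2"
        using power_mono[OF QV.le1 V.nrm_nonneg, of "T x" 2] by (simp add: power_mult_distrib)
    qed
    also have "\<dots> = c2\<^sup>2 * (\<Sum>x\<in>F. (q.nrm (T x))\<^sup>2)" by (simp add: sum_distrib_left)
    also have "(\<Sum>x\<in>F. (q.nrm (T x))\<^sup>2) \<le> c1\<^sup>2 * infsum (\<lambda>i. (m i)\<^sup>2) E"
    proof (rule has_sum_mono)
      show "((\<lambda>i. \<Sum>x\<in>F. (cmod (q (T x) i))\<^sup>2) has_sum (\<Sum>x\<in>F. (q.nrm (T x))\<^sup>2)) E"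
        using FX TX by (intro has_sum_sum EV.Parseval_nrm) auto
      show "((\<lambda>i. c1\<^sup>2 * (m i)\<^sup>2) has_sum c1\<^sup>2 * infsum (\<lambda>i. (m i)\<^sup>2) E) E"
        using exp_summable[of "2 * t"] t by (intro has_sum_cmult_right has_sum_infsum) (simp add: m2)
      fix i assume i: "i \<in> E"
      have "(\<Sum>x\<in>F. (cmod (q (T x) i))\<^sup>2) = (m i)\<^sup>2 * (\<Sum>x\<in>F. (cmod (q x i))\<^sup>2)"
        unfolding sum_distrib_left using coeffs FX i
        by (intro sum.cong refl) (simp add: norm_mult power_mult_distrib)
      also have "\<dots> \<le> (m i)\<^sup>2 * c1\<^sup>2" using Bq[OF F i] by (intro mult_left_mono) auto
      finally show "(\<Sum>x\<in>F. (cmod (q (T x) i))\<^sup>2) \<le> c1\<^sup>2 * (m i)\<^sup>2" by (simp add: mult.commute)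
    qed
    finally show ?thesis by (simp add: mult_left_mono)
  qed
  show "(\<Sum>x\<in>F. cmod (ipV (T x) (g x))) \<le> infsum (\<lambda>i. m i * (c1 * c2)) E"
    if F: "finite F" "V.ons F (\<lambda>x. x)" and g: "V.ons F g" for F g
  proof -
    have FX: "x \<in> F \<Longrightarrow> x \<in> XV" and gX: "x \<in> F \<Longrightarrow> g x \<in> XV" for x
      using V.ons_mem[OF F(2)] V.ons_mem[OF g] by auto
    define h where "h x i = m i * (cmod (q x i) * cmod (ipV i (g x)))" for x i
    have hs: "((\<lambda>i. complex_of_real (m i) * q x i * ipV i (g x)) has_sum ipV (T x) (g x)) E"
      if x: "x \<in> F" for x
    proof -
      \<comment> \<open>The functional is given by \<open>ipV\<close>; Riesz for \<open>q\<close>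
        rewrites it so that Parseval in the \<open>q\<close>-basis applies.\<close>
      have "\<exists>z\<in>XV. \<forall>w\<in>XV. ipV w (g x) = q w z"
      proof (rule Q.Riesz)
        show "q.lin (\<lambda>w. ipV w (g x))" using V.lin_ip[OF gX[OF x]] by (simp add: V.lin_def q.lin_def)
        fix w assume w: "w \<in> XV"
        have "cmod (ipV w (g x)) \<le> V.nrm w * V.nrm (g x)" by (rule V.Cauchy_Schwarz[OF w gX[OF x]])
        then show "cmod (ipV w (g x)) \<le> c2 * q.nrm w" using QV.le1[OF w] V.ons_nrm[OF g x] by simp
      qed
      then obtain z where z: "z \<in> XV" "\<And>w. w \<in> XV \<Longrightarrow> ipV w (g x) = q w z" by blast
      have "((\<lambda>i. q (T x) i * cnj (q z i)) has_sum q (T x) z) E"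
        by (rule EV.Parseval[OF TX[OF FX[OF x]] z(1)])
      moreover have "q (T x) i * cnj (q z i) = complex_of_real (m i) * q x i * ipV i (g x)"
        if i: "i \<in> E" for i
        using coeffs[OF FX[OF x] i] z(2)[OF EV.e_mem[OF i]] q.cnj_sym[OF z(1) EV.e_mem[OF i]] by simp
      ultimately have "((\<lambda>i. complex_of_real (m i) * q x i * ipV i (g x)) has_sum q (T x) z) E"
        by (subst has_sum_cong[symmetric]) auto
      then show ?thesis using z(2)[OF TX[OF FX[OF x]]] by simp
    qed
    have m_nn: "0 \<le> m i" for i by (simp add: m_def)
    have h_norm: "cmod (complex_of_real (m i) * q x i * ipV i (g x)) = h x i" for x i
      using m_nn[of i] by (simp add: h_def norm_mult)
    have m_sum: "(\<lambda>i. m i * (c1 * c2)) summable_on E"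
      unfolding m_def by (intro summable_on_cmult_left exp_summable t)
    have h_le: "(\<Sum>x\<in>F. h x i) \<le> m i * (c1 * c2)" if i: "i \<in> E" for i
    proof -
      have "(\<Sum>x\<in>F. cmod (q x i) * cmod (ipV i (g x))) = (\<Sum>x\<in>F. \<bar>cmod (q x i)\<bar> * \<bar>cmod (ipV i (g x))\<bar>)"
        by simp
      also have "\<dots> \<le> L2_set (\<lambda>x. cmod (q x i)) F * L2_set (\<lambda>x. cmod (ipV i (g x))) F"
        by (rule L2_set_mult_ineq)
      also have "\<dots> \<le> c1 * c2"
      proof (rule mult_mono)
        show "L2_set (\<lambda>x. cmod (q x i)) F \<le> c1"
          unfolding L2_set_def using Bq[OF F i] VQ.c_pos by (intro real_le_lsqrt) auto
        have "(\<Sum>x\<in>F. (cmod (ipV i (g x)))\<^sup>2) \<le> (V.nrm i)\<^sup>2"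
          using V.Bessel'[OF g F(1) EV.e_mem[OF i]] .
        also have "\<dots> \<le> c2\<^sup>2" using i_nrm[OF i] by (intro power_mono)
        finally show "L2_set (\<lambda>x. cmod (ipV i (g x))) F \<le> c2"
          unfolding L2_set_def using VQ.c_pos by (intro real_le_lsqrt) auto
      qed (use VQ.c_pos in \<open>auto simp: L2_set_nonneg\<close>)
      finally show ?thesis unfolding h_def sum_distrib_left[symmetric] using m_nn
        by (intro mult_left_mono)
    qed
    have h_nn: "0 \<le> h x i" for x i using m_nn[of i] by (simp add: h_def)
    have h_sum: "h x summable_on E" if x: "x \<in> F" for x
    proof (rule summable_on_comparison_test[OF m_sum])
      show "h x i \<le> m i * (c1 * c2)" if "i \<in> E" for i
        using member_le_sum[OF x, of "\<lambda>x. h x i"] h_nn F(1) h_le[OF that] by (meson order_trans)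
    qed (use h_nn in auto)
    have "(\<Sum>x\<in>F. cmod (ipV (T x) (g x))) \<le> (\<Sum>x\<in>F. infsum (h x) E)"
    proof (rule sum_mono)
      fix x assume x: "x \<in> F"
      have "cmod (infsum (\<lambda>i. complex_of_real (m i) * q x i * ipV i (g x)) E)
        \<le> infsum (\<lambda>i. cmod (complex_of_real (m i) * q x i * ipV i (g x))) E"
        using h_sum[OF x] by (intro norm_infsum_bound) (simp add: h_norm)
      then show "cmod (ipV (T x) (g x)) \<le> infsum (h x) E"
        by (simp only: h_norm infsumI[OF hs[OF x]])
    qed
    also have "\<dots> \<le> infsum (\<lambda>i. m i * (c1 * c2)) E"
      by (rule has_sum_mono[OF has_sum_sum[OF has_sum_infsum[OF h_sum]] has_sum_infsum[OF m_sum] h_le])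
    finally show ?thesis .
  qed
qed

end

context form_setting
begin

text \<open>The diagonal semigroup on \<open>XH\<close> settles existence. Any other semigroup with
  this generator equals it by \<open>sg_unique\<close>, and on \<open>XV\<close> it equals the
  diagonal semigroup there; the claims are then moved from \<open>q\<close> to
  \<open>ipV\<close>.\<close>

theorem main:
  shows "\<exists>T. C0_semigroup XH ipH T \<and> generator XH ipH T = neg_op A"
    and "C0_semigroup XH ipH T \<Longrightarrow> generator XH ipH T = neg_op A \<Longrightarrow>
      (\<forall>t\<ge>0. \<forall>u\<in>XV. T t u \<in> XV) \<and> analytic_semigroup XV ipV (pi / 2) T \<and>
      (\<forall>t>0. trace_class XV ipV (T t)) \<and> generator XV ipV T = neg_op (part_op A XV)"
proof -
  obtain E s where "orthonormal_basis XV q E"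
    "\<And>e z. e \<in> E \<Longrightarrow> z \<in> XV \<Longrightarrow> ipH e z = complex_of_real (s e) * q e z"
    using QH.spectral by blast
  then interpret eb: form_eigenbasis XH XV ipH ipV q om c1 c2 C E s
    by unfold_locales
  show "\<exists>T. C0_semigroup XH ipH T \<and> generator XH ipH T = neg_op A"
    using eb.DH.sg_C0_semigroup eb.generator_A by blast
  assume T: "C0_semigroup XH ipH T" and gen: "generator XH ipH T = neg_op A"
  have eq: "T t x = eb.DV.sg (complex_of_real t) x" if "0 \<le> t" "x \<in> XV" for t x
    using eb.DH.sg_unique[OF T gen[folded eb.generator_A] that(1) VH[OF that(2)]]
      eb.sg_agree[of "complex_of_real t" x] that by simp
  interpret QV: norm_equiv XV q ipV c2 c1 by (rule norm_equiv.sym[OF equiv])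
  have an: "analytic_semigroup XV ipV (pi / 2) T"
    by (rule QV.analytic_semigroup[OF eb.DV.sg_analytic eq])
  then have C0: "C0_semigroup XV ipV T" by (simp add: analytic_semigroup_def)
  have "T t u \<in> XV" if "0 \<le> t" "u \<in> XV" for t u
    using V.bounded_opD(1)[OF V.C0_semigroupD(1)[OF C0 that(1)] that(2)] .
  moreover have "trace_class XV ipV (T t)" if "0 < t" for t
    using that V.C0_semigroupD(1)[OF C0] eq by (intro eb.sg_trace_class[OF that]) auto
  moreover have "generator XV ipV T = neg_op (part_op A XV)"
    by (rule trans[OF QV.generator[OF eb.DV.sg_C0_semigroup eq] eb.generator_V])
  ultimately show "(\<forall>t\<ge>0. \<forall>u\<in>XV. T t u \<in> XV) \<and> analytic_semigroup XV ipV (pi / 2) T \<and>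
      (\<forall>t>0. trace_class XV ipV (T t)) \<and> generator XV ipV T = neg_op (part_op A XV)"
    using an by blast
qed

end

section \<open>\<open>L\<^sup>2\<close> and weak derivatives on the unit interval\<close>

abbreviation unit_measure :: "real measure" ("\<mu>01") where
  "unit_measure \<equiv> lebesgue_on {0<..<1::real}"

interpretation unit_measure: finite_measure \<mu>01
  by (rule finite_measure_lebesgue_on) simp

lemma emeasure_unit_measure: "emeasure \<mu>01 {0<..<1} = 1" "measure \<mu>01 {0<..<1} = 1"
proof -
  show "emeasure \<mu>01 {0<..<1} = 1"
    by (subst emeasure_restrict_space) auto
  then show "measure \<mu>01 {0<..<1} = 1" by (simp add: measure_def)
qed

lemma AE_unit_measure: "(AE x in \<mu>01. P x) \<longleftrightarrow> (AE x in lebesgue. x \<in> {0<..<1} \<longrightarrow> P x)"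
  by (rule AE_restrict_space_iff) auto

lemma AE_unit_interval: "AE x in \<mu>01. x \<in> {0<..<1}"
  by (simp add: AE_unit_measure)

lemma borel_measurable_unit_measure:
  "f \<in> borel_measurable borel \<Longrightarrow> f \<in> borel_measurable \<mu>01"
  by (intro measurable_restrict_space1 measurable_completion) (simp add: measurable_def)

lemma L2_measurable [measurable_dest]: "f \<in> L2 \<Longrightarrow> f \<in> borel_measurable \<mu>01"
  by (simp add: L2_def)

lemma L2_mult_integrable:
  assumes "f \<in> L2" "g \<in> L2" shows "integrable \<mu>01 (\<lambda>x. f x * g x)"
proof (rule Bochner_Integration.integrable_bound)
  show "integrable \<mu>01 (\<lambda>x. (cmod (f x))\<^sup>2 + (cmod (g x))\<^sup>2)"
    using assms by (auto simp: L2_def)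
  show "(\<lambda>x. f x * g x) \<in> borel_measurable \<mu>01" using assms by measurable
  show "AE x in \<mu>01. norm (f x * g x) \<le> norm ((cmod (f x))\<^sup>2 + (cmod (g x))\<^sup>2)"
  proof (rule AE_I2)
    fix x
    have "0 \<le> cmod (f x) * cmod (g x)" by simp
    then have "cmod (f x) * cmod (g x) \<le> (cmod (f x))\<^sup>2 + (cmod (g x))\<^sup>2"
      using sum_squares_bound[of "cmod (f x)" "cmod (g x)"] by linarith
    then show "norm (f x * g x) \<le> norm ((cmod (f x))\<^sup>2 + (cmod (g x))\<^sup>2)" by (simp add: norm_mult)
  qed
qed

lemma L2_bounded:
  assumes "f \<in> borel_measurable \<mu>01" "\<And>x. x \<in> {0<..<1} \<Longrightarrow> cmod (f x) \<le> B"
  shows "f \<in> L2"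
  unfolding L2_def
proof (intro CollectI conjI assms(1))
  have "(cmod (f x))\<^sup>2 \<le> B\<^sup>2" if "x \<in> {0<..<1}" for x
    using assms(2)[OF that] by (intro power_mono) auto
  then show "integrable \<mu>01 (\<lambda>x. (cmod (f x))\<^sup>2)"
    using assms(1)
    by (intro unit_measure.integrable_const_bound[of _ "B\<^sup>2"]) (auto intro!: AE_I2 simp: space_restrict_space)
qed

lemma L2_continuous:
  assumes "continuous_on {0..1} f" shows "f \<in> L2"
proof (rule L2_bounded)
  show "f \<in> borel_measurable \<mu>01"
    by (rule continuous_imp_measurable_on_sets_lebesgue)
      (use assms in \<open>auto intro: continuous_on_subset\<close>)
  have "bounded (f ` {0..1})" using assms by (intro compact_imp_bounded compact_continuous_image) auto
  then have "\<exists>B. \<forall>x\<in>{0..1}. cmod (f x) \<le> B" unfolding bounded_iff by blast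
  then show "x \<in> {0<..<1} \<Longrightarrow> cmod (f x) \<le> (SOME B. \<forall>x\<in>{0..1}. cmod (f x) \<le> B)" for x
    by (rule someI2_ex) auto
qed

lemma L2_const [simp]: "(\<lambda>x. c) \<in> L2"
  by (rule L2_continuous) auto

lemma measurable_cnj [measurable (raw)]: "f \<in> borel_measurable M \<Longrightarrow> (\<lambda>x. cnj (f x)) \<in> borel_measurable M"
  by (rule borel_measurable_continuous_on[of cnj]) (auto intro: continuous_intros)

lemma L2_cnj: "f \<in> L2 \<Longrightarrow> (\<lambda>x. cnj (f x)) \<in> L2"
  by (auto simp: L2_def intro: measurable_cnj)

lemma L2_integrable: "f \<in> L2 \<Longrightarrow> integrable \<mu>01 f"
  using L2_mult_integrable[of f "\<lambda>x. 1"] by simp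

lemma L2_mult_bounded:
  assumes f: "f \<in> L2" and g: "g \<in> borel_measurable \<mu>01" "\<And>x. x \<in> {0<..<1} \<Longrightarrow> cmod (g x) \<le> B"
  shows "(\<lambda>x. f x * g x) \<in> L2"
  unfolding L2_def
proof (intro CollectI conjI)
  show m: "(\<lambda>x. f x * g x) \<in> borel_measurable \<mu>01" using f g by measurable
  show "integrable \<mu>01 (\<lambda>x. (cmod (f x * g x))\<^sup>2)"
  proof (rule Bochner_Integration.integrable_bound)
    show "integrable \<mu>01 (\<lambda>x. B\<^sup>2 * (cmod (f x))\<^sup>2)" using f by (auto simp: L2_def)
    have "(cmod (f x * g x))\<^sup>2 \<le> B\<^sup>2 * (cmod (f x))\<^sup>2" if "x \<in> {0<..<1}" for x
      using mult_right_mono[OF power_mono[OF g(2)[OF that] norm_ge_zero, of 2], of "(cmod (f x))\<^sup>2"]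
      by (simp add: norm_mult power_mult_distrib mult.commute)
    then show "AE x in \<mu>01. norm ((cmod (f x * g x))\<^sup>2) \<le> norm (B\<^sup>2 * (cmod (f x))\<^sup>2)"
      by (intro AE_I2) (simp add: space_restrict_space)
  qed (use m in measurable)
qed

interpretation L2: semi_ip L2 ip_L2
proof
  show "0 \<in> L2" using L2_const[of 0] by (simp add: zero_fun_def)
  show "f + g \<in> L2" if "f \<in> L2" "g \<in> L2" for f g
    unfolding L2_def
  proof (intro CollectI conjI)
    show m: "f + g \<in> borel_measurable \<mu>01" unfolding plus_fun_def using that by measurable
    show "integrable \<mu>01 (\<lambda>x. (cmod ((f + g) x))\<^sup>2)"
    proof (rule Bochner_Integration.integrable_bound)
      show "integrable \<mu>01 (\<lambda>x. 2 * (cmod (f x))\<^sup>2 + 2 * (cmod (g x))\<^sup>2)"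
        using that by (auto simp: L2_def)
      show "AE x in \<mu>01. norm ((cmod ((f + g) x))\<^sup>2) \<le> norm (2 * (cmod (f x))\<^sup>2 + 2 * (cmod (g x))\<^sup>2)"
      proof (rule AE_I2)
        fix x
        have "(cmod (f x + g x))\<^sup>2 \<le> (cmod (f x) + cmod (g x))\<^sup>2"
          by (intro power_mono norm_triangle_ineq) auto
        also have "\<dots> \<le> 2 * (cmod (f x))\<^sup>2 + 2 * (cmod (g x))\<^sup>2"
          using sum_squares_bound[of "cmod (f x)" "cmod (g x)"] by (simp add: power2_sum)
        finally show "norm ((cmod ((f + g) x))\<^sup>2) \<le> norm (2 * (cmod (f x))\<^sup>2 + 2 * (cmod (g x))\<^sup>2)"
          by simp
      qed
    qed (use m in measurable)
  qed
  show "c *\<^sub>c f \<in> L2" if "f \<in> L2" for c f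
    using L2_mult_bounded[OF that, of "\<lambda>x. c" "cmod c"] by (simp add: cscale_def mult.commute)
  show "ip_L2 (f + g) h = ip_L2 f h + ip_L2 g h" if "f \<in> L2" "g \<in> L2" "h \<in> L2" for f g h
    unfolding ip_L2_def
    using L2_mult_integrable[OF that(1) L2_cnj[OF that(3)]] L2_mult_integrable[OF that(2) L2_cnj[OF that(3)]]
    by (simp add: distrib_right)
  show "ip_L2 (c *\<^sub>c f) g = c * ip_L2 f g" for c f g by (simp add: ip_L2_def mult.assoc)
  show "cnj (ip_L2 f g) = ip_L2 g f" for f g
    unfolding ip_L2_def 
    by (subst Bochner_Integration.integral_cnj[symmetric]) (simp add: mult.commute)
  show "0 \<le> Re (ip_L2 f f)" if "f \<in> L2" for f
  proof -
    have "ip_L2 f f = int01 (\<lambda>x. complex_of_real ((cmod (f x))\<^sup>2))"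
      unfolding ip_L2_def by (simp only: complex_norm_square)
    then show ?thesis by (simp only: integral_complex_of_real Re_complex_of_real) simp
  qed
qed

abbreviation nrm2 :: "(real \<Rightarrow> complex) \<Rightarrow> real" where "nrm2 \<equiv> ip_norm ip_L2"

lemma ip_L2_self: "ip_L2 f f = complex_of_real (LINT x|\<mu>01. (cmod (f x))\<^sup>2)"
  unfolding ip_L2_def by (simp only: complex_norm_square[symmetric] integral_complex_of_real)

lemma nrm2_sq: "f \<in> L2 \<Longrightarrow> (nrm2 f)\<^sup>2 = (LINT x|\<mu>01. (cmod (f x))\<^sup>2)"
  by (simp add: L2.nrm_sq ip_L2_self)

lemma nrm2_eq_0: "f \<in> L2 \<Longrightarrow> nrm2 f = 0 \<longleftrightarrow> (AE x in \<mu>01. f x = 0)"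
proof -
  assume f: "f \<in> L2"
  have "nrm2 f = 0 \<longleftrightarrow> (LINT x|\<mu>01. (cmod (f x))\<^sup>2) = 0" using nrm2_sq[OF f] by auto
  also have "\<dots> \<longleftrightarrow> (AE x in \<mu>01. (cmod (f x))\<^sup>2 = 0)"
    using f by (intro integral_nonneg_eq_0_iff_AE) (auto simp: L2_def)
  finally show ?thesis by simp
qed

lemma nrm2_bounded:
  assumes "f \<in> borel_measurable \<mu>01" "\<And>x. x \<in> {0<..<1} \<Longrightarrow> cmod (f x) \<le> B" "0 \<le> B"
  shows "nrm2 f \<le> B"
proof -
  have f: "f \<in> L2" using L2_bounded[OF assms(1,2)] .
  have "(LINT x|\<mu>01. (cmod (f x))\<^sup>2) \<le> (LINT x|\<mu>01. B\<^sup>2)"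
    using f assms(2) by (intro integral_mono) (auto simp: L2_def space_restrict_space intro!: power_mono)
  also have "\<dots> = B\<^sup>2" by (simp add: space_restrict_space emeasure_unit_measure)
  finally have "(nrm2 f)\<^sup>2 \<le> B\<^sup>2" using nrm2_sq[OF f] by simp
  then show ?thesis using assms(3) by (rule power2_le_imp_le)
qed

lemma ip_L2_cong_AE:
  assumes "AE x in \<mu>01. f x = f' x" "AE x in \<mu>01. g x = g' x" "f \<in> L2" "f' \<in> L2" "g \<in> L2" "g' \<in> L2"
  shows "ip_L2 f g = ip_L2 f' g'"
proof -
  note [measurable] = L2_measurable[OF assms(3)] L2_measurable[OF assms(4)] L2_measurable[OF assms(5)] L2_measurable[OF assms(6)]
  have "AE x in \<mu>01. f x * cnj (g x) = f' x * cnj (g' x)" using assms(1,2) by eventually_elim simp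
  then show ?thesis unfolding ip_L2_def by (intro integral_cong_AE) measurable
qed

text \<open>Cauchy in L2 implies Cauchy in L1, as the interval has measure 1; hence a subsequence
  converges almost everywhere. Fatou's lemma with one index fixed shows that its limit is also the
  limit in L2.\<close>

theorem L2_complete:
  assumes \<sigma>: "\<And>n. \<sigma> n \<in> L2" and Cauchy: "L2.Cauchy_seq \<sigma>"
  shows "\<exists>f\<in>L2. (\<lambda>n. nrm2 (\<sigma> n - f)) \<longlonglongrightarrow> 0"
proof -
  have L1: "(LINT x|\<mu>01. cmod (f x)) \<le> nrm2 f" if f: "f \<in> L2" for f
  proof -
    define g where "g x = complex_of_real (cmod (f x))" for x
    have "g \<in> borel_measurable \<mu>01" unfolding g_def using L2_measurable[OF f] by measurable
    then have g: "g \<in> L2" using f by (auto simp: L2_def g_def)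
    have "(nrm2 g)\<^sup>2 = (nrm2 f)\<^sup>2" by (simp add: nrm2_sq f g) (simp add: g_def)
    then have "nrm2 g = nrm2 f" using f g by simp
    moreover have "ip_L2 g (\<lambda>x. 1) = complex_of_real (LINT x|\<mu>01. cmod (f x))"
      by (simp add: ip_L2_def g_def)
    moreover have "nrm2 (\<lambda>x. 1) \<le> 1" by (rule nrm2_bounded) auto
    moreover have "0 \<le> nrm2 f" using f by simp
    ultimately show ?thesis
      using L2.Cauchy_Schwarz[OF g L2_const[of 1]] mult_left_mono[of "nrm2 (\<lambda>x. 1)" 1 "nrm2 f"] by simp
  qed
  have "\<exists>N. \<forall>i\<ge>N. \<forall>j\<ge>N. (LINT x|\<mu>01. norm (\<sigma> i x - \<sigma> j x)) < e" if e: "0 < e" for e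
  proof -
    obtain N where N: "\<forall>m\<ge>N. \<forall>n\<ge>N. nrm2 (\<sigma> m - \<sigma> n) < e"
      using Cauchy e unfolding L2.Cauchy_seq_def by blast
    have "(LINT x|\<mu>01. norm (\<sigma> i x - \<sigma> j x)) < e" if "i \<ge> N" "j \<ge> N" for i j
      using L1[OF L2.diff_mem[OF \<sigma> \<sigma>, of i j]] N that by (simp add: le_less_trans)
    then show ?thesis by blast
  qed
  then obtain r where r: "strict_mono r" and AE: "AE x in \<mu>01. Cauchy (\<lambda>i. \<sigma> (r i) x)"
    using cauchy_L1_AE_cauchy_subseq[of \<mu>01 \<sigma>] L2_integrable[OF \<sigma>] by blast
  have AE_conv: "AE x in \<mu>01. convergent (\<lambda>i. \<sigma> (r i) x)"
    using AE by eventually_elim (rule Cauchy_convergent)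
  \<comment> \<open>Where the subsequence diverges the value is arbitrary; this concerns a null set
    only.\<close>
  define f where "f x = lim (\<lambda>i. \<sigma> (r i) x)" for x
  have [measurable]: "\<sigma> n \<in> borel_measurable \<mu>01" for n using L2_measurable[OF \<sigma>] .
  have f_meas [measurable]: "f \<in> borel_measurable \<mu>01" unfolding f_def by measurable
  have AE_lim: "AE x in \<mu>01. (\<lambda>i. \<sigma> (r i) x) \<longlonglongrightarrow> f x"
    using AE_conv by eventually_elim (simp add: f_def convergent_LIMSEQ_iff)
  have close: "\<exists>N. \<forall>n\<ge>N. (\<integral>\<^sup>+x. ennreal ((cmod (\<sigma> n x - f x))\<^sup>2) \<partial>\<mu>01) \<le> ennreal (\<epsilon>\<^sup>2)"
    if \<epsilon>: "0 < \<epsilon>" for \<epsilon>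
  proof -
    obtain N where N: "\<forall>m\<ge>N. \<forall>n\<ge>N. nrm2 (\<sigma> m - \<sigma> n) < \<epsilon>"
      using Cauchy \<epsilon> unfolding L2.Cauchy_seq_def by blast
    have "(\<integral>\<^sup>+x. ennreal ((cmod (\<sigma> n x - f x))\<^sup>2) \<partial>\<mu>01) \<le> ennreal (\<epsilon>\<^sup>2)" if n: "n \<ge> N" for n
    proof -
      have "(\<integral>\<^sup>+x. ennreal ((cmod (\<sigma> n x - f x))\<^sup>2) \<partial>\<mu>01)
        = (\<integral>\<^sup>+x. liminf (\<lambda>i. ennreal ((cmod (\<sigma> n x - \<sigma> (r i) x))\<^sup>2)) \<partial>\<mu>01)"
      proof (rule nn_integral_cong_AE)
        show "AE x in \<mu>01. ennreal ((cmod (\<sigma> n x - f x))\<^sup>2) = liminf (\<lambda>i. ennreal ((cmod (\<sigma> n x - \<sigma> (r i) x))\<^sup>2))"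
          using AE_lim
        proof eventually_elim
          case (elim x)
          have "(\<lambda>i. ennreal ((cmod (\<sigma> n x - \<sigma> (r i) x))\<^sup>2)) \<longlonglongrightarrow> ennreal ((cmod (\<sigma> n x - f x))\<^sup>2)"
            by (intro tendsto_ennrealI tendsto_intros elim)
          then show ?case using lim_imp_Liminf[OF sequentially_bot] by fastforce
        qed
      qed
      also have "\<dots> \<le> liminf (\<lambda>i. \<integral>\<^sup>+x. ennreal ((cmod (\<sigma> n x - \<sigma> (r i) x))\<^sup>2) \<partial>\<mu>01)"
        by (rule nn_integral_liminf) measurable
      also have "\<dots> \<le> liminf (\<lambda>i. ennreal (\<epsilon>\<^sup>2))"
      proof (rule Liminf_mono)
        show "\<forall>\<^sub>F i in sequentially. (\<integral>\<^sup>+x. ennreal ((cmod (\<sigma> n x - \<sigma> (r i) x))\<^sup>2) \<partial>\<mu>01) \<le> ennreal (\<epsilon>\<^sup>2)"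
          unfolding eventually_sequentially
        proof (intro exI[of _ N] allI impI)
          fix i assume "i \<ge> N"
          then have "r i \<ge> N" using seq_suble[OF r, of i] by simp
          have d: "\<sigma> n - \<sigma> (r i) \<in> L2" using \<sigma> by simp
          have "(\<integral>\<^sup>+x. ennreal ((cmod (\<sigma> n x - \<sigma> (r i) x))\<^sup>2) \<partial>\<mu>01) = ennreal ((nrm2 (\<sigma> n - \<sigma> (r i)))\<^sup>2)"
            unfolding nrm2_sq[OF d] using d by (subst nn_integral_eq_integral) (auto simp: L2_def)
          also have "\<dots> \<le> ennreal (\<epsilon>\<^sup>2)"
            using N n \<open>r i \<ge> N\<close> d by (intro ennreal_leI power_mono) (auto intro: less_imp_le)
          finally show "(\<integral>\<^sup>+x. ennreal ((cmod (\<sigma> n x - \<sigma> (r i) x))\<^sup>2) \<partial>\<mu>01) \<le> ennreal (\<epsilon>\<^sup>2)" .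
        qed
      qed
      also have "\<dots> = ennreal (\<epsilon>\<^sup>2)" by (simp add: Liminf_const)
      finally show ?thesis .
    qed
    then show ?thesis by blast
  qed
  have diff_L2: "\<sigma> n - f \<in> L2" if "(\<integral>\<^sup>+x. ennreal ((cmod (\<sigma> n x - f x))\<^sup>2) \<partial>\<mu>01) \<le> ennreal (\<epsilon>\<^sup>2)" for n \<epsilon>
  proof -
    have "integrable \<mu>01 (\<lambda>x. (cmod (\<sigma> n x - f x))\<^sup>2)"
      using that le_less_trans[OF that ennreal_less_top] by (intro integrableI_nonneg) auto
    then show ?thesis by (simp add: L2_def fun_diff_def)
  qed
  obtain N where "(\<integral>\<^sup>+x. ennreal ((cmod (\<sigma> N x - f x))\<^sup>2) \<partial>\<mu>01) \<le> ennreal (1\<^sup>2)" using close[of 1]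
    by auto
  then have "\<sigma> N - (\<sigma> N - f) \<in> L2" using \<sigma> by (intro L2.diff_mem diff_L2)
  then have f: "f \<in> L2" by simp
  have "(\<lambda>n. nrm2 (\<sigma> n - f)) \<longlonglongrightarrow> 0"
  proof (rule LIMSEQ_I)
    fix \<epsilon> :: real assume \<epsilon>: "0 < \<epsilon>"
    obtain N where N: "\<forall>n\<ge>N. (\<integral>\<^sup>+x. ennreal ((cmod (\<sigma> n x - f x))\<^sup>2) \<partial>\<mu>01) \<le> ennreal ((\<epsilon> / 2)\<^sup>2)"
      using close[of "\<epsilon> / 2"] \<epsilon> by auto
    have "norm (nrm2 (\<sigma> n - f) - 0) < \<epsilon>" if "n \<ge> N" for n
    proof -
      have d: "\<sigma> n - f \<in> L2" using \<sigma> f by simp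
      have "ennreal ((nrm2 (\<sigma> n - f))\<^sup>2) = (\<integral>\<^sup>+x. ennreal ((cmod (\<sigma> n x - f x))\<^sup>2) \<partial>\<mu>01)"
        unfolding nrm2_sq[OF d] using d by (subst nn_integral_eq_integral) (auto simp: L2_def)
      then have "(nrm2 (\<sigma> n - f))\<^sup>2 \<le> (\<epsilon> / 2)\<^sup>2" using N that
        by (metis ennreal_le_iff zero_le_power2)
      then have "nrm2 (\<sigma> n - f) \<le> \<epsilon> / 2" by (rule power2_le_imp_le) (use \<epsilon> in simp)
      then show ?thesis using \<epsilon> d by simp
    qed
    then show "\<exists>N. \<forall>n\<ge>N. norm (nrm2 (\<sigma> n - f) - 0) < \<epsilon>" by blast
  qed
  then show ?thesis using f by blast
qed

section \<open>Primitives of square integrable functions\<close>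

definition step :: "real \<Rightarrow> real \<Rightarrow> complex" where
  "step x = (\<lambda>y. if y < x then 1 else 0)"

text \<open>As integrals against step functions the values of a primitive are L2 inner products
  (\<open>prim_ip\<close>), so linearity and estimates come from the inner product. Beyond the unit
  interval the function continues as a constant.\<close>

definition prim :: "(real \<Rightarrow> complex) \<Rightarrow> real \<Rightarrow> complex" where
  "prim f x = int01 (\<lambda>y. f y * step x y)"

lemma step_measurable [measurable]: "step x \<in> borel_measurable \<mu>01"
proof -
  have "(\<lambda>y. if y < x then 1 else 0 :: complex) \<in> borel_measurable (borel :: real measure)" by measurable
  then show ?thesis unfolding step_def by (rule borel_measurable_unit_measure)
qed

lemma step_L2 [simp]: "step x \<in> L2"
  by (rule L2_bounded[OF step_measurable, of _ 1]) (simp add: step_def)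

lemma prim_ip: "prim f x = ip_L2 f (step x)"
  unfolding prim_def ip_L2_def by (intro Bochner_Integration.integral_cong refl) (simp add: step_def)

lemma int01_ip: "int01 f = ip_L2 f (\<lambda>x. 1)"
  by (simp add: ip_L2_def)

lemma prim_add: "f \<in> L2 \<Longrightarrow> g \<in> L2 \<Longrightarrow> prim (f + g) x = prim f x + prim g x"
  by (simp add: prim_ip L2.add_left)

lemma prim_diff: "f \<in> L2 \<Longrightarrow> g \<in> L2 \<Longrightarrow> prim (f - g) x = prim f x - prim g x"
  by (simp add: prim_ip L2.diff_left)

lemma prim_scale: "f \<in> L2 \<Longrightarrow> prim (c *\<^sub>c f) x = c * prim f x"
  by (simp add: prim_ip)

lemma prim_le_0: "x \<le> 0 \<Longrightarrow> prim f x = 0"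
  unfolding prim_def
  by (subst Bochner_Integration.integral_cong[of \<mu>01 \<mu>01 _ "\<lambda>_. 0"]) (auto simp: step_def space_restrict_space)

lemma prim_0 [simp]: "prim f 0 = 0"
  by (rule prim_le_0) simp

lemma prim_ge_1: "1 \<le> x \<Longrightarrow> prim f x = int01 f"
  unfolding prim_def
  by (intro Bochner_Integration.integral_cong refl) (auto simp: step_def space_restrict_space)

lemma prim_1 [simp]: "prim f 1 = int01 f"
  by (rule prim_ge_1) simp

lemma prim_cong_AE:
  assumes "AE x in \<mu>01. f x = g x" "f \<in> L2" "g \<in> L2" shows "prim f x = prim g x"
  unfolding prim_ip using assms by (intro ip_L2_cong_AE) auto

lemma nrm2_step_diff:
  assumes "0 \<le> x" "x \<le> y" "y \<le> 1"
  shows "nrm2 (step y - step x) = sqrt (y - x)"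
proof -
  have d: "step y - step x \<in> L2" by simp
  have "(LINT z|\<mu>01. (cmod ((step y - step x) z))\<^sup>2) = (LINT z|\<mu>01. indicator {x..<y} z)"
    using assms by (intro Bochner_Integration.integral_cong refl) (auto simp: step_def indicator_def)
  also have "\<dots> = measure \<mu>01 ({x..<y} \<inter> {0<..<1})"
    by (simp add: space_restrict_space)
  also have "\<dots> = measure lebesgue ({x..<y} \<inter> {0<..<1})"
    by (intro measure_restrict_space) auto
  also have "\<dots> = measure lebesgue {x..<y}"
  proof (rule measure_eq_AE)
    have "AE z in lebesgue. z \<noteq> 0" by (rule AE_completion) (rule AE_lborel_singleton)
    then show "AE z in lebesgue. z \<in> {x..<y} \<inter> {0<..<1} \<longleftrightarrow> z \<in> {x..<y}"
      by eventually_elim (use assms in auto)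
  qed auto
  also have "\<dots> = y - x" using assms by simp
  finally have "(nrm2 (step y - step x))\<^sup>2 = y - x" using nrm2_sq[OF d] by simp
  then show ?thesis using d by (simp add: real_sqrt_unique)
qed

text \<open>Cauchy-Schwarz with \<open>step y - step x\<close>, whose L2 norm is the square root of
  the length.\<close>

lemma prim_holder:
  assumes "f \<in> L2" "x \<in> {0..1}" "y \<in> {0..1}"
  shows "cmod (prim f y - prim f x) \<le> nrm2 f * sqrt \<bar>y - x\<bar>"
proof -
  have *: "cmod (prim f y - prim f x) \<le> nrm2 f * sqrt \<bar>y - x\<bar>" if "x \<in> {0..1}" "y \<in> {0..1}" "x \<le> y"
    for x y
    using L2.Cauchy_Schwarz[OF assms(1), of "step y - step x"] nrm2_step_diff[of x y] that assms(1)
    by (simp add: prim_ip L2.diff_right)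
  show ?thesis
  proof (cases "x \<le> y")
    case False
    then have "cmod (prim f x - prim f y) \<le> nrm2 f * sqrt \<bar>x - y\<bar>" using *[of y x] assms by simp
    then show ?thesis by (simp add: norm_minus_commute abs_minus_commute)
  qed (use *[of x y] assms in simp)
qed

lemma prim_bound: "f \<in> L2 \<Longrightarrow> x \<in> {0..1} \<Longrightarrow> cmod (prim f x) \<le> nrm2 f"
proof -
  assume f: "f \<in> L2" and x: "x \<in> {0..1}"
  have "cmod (prim f x) \<le> nrm2 f * sqrt x" using prim_holder[OF f, of 0 x] x by simp
  also have "\<dots> \<le> nrm2 f * 1" using f x by (intro mult_left_mono) auto
  finally show ?thesis by simp
qed

lemma prim_continuous: assumes f: "f \<in> L2" shows "continuous_on {0..1} (prim f)"
  unfolding continuous_on_def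
proof
  fix x :: real assume x: "x \<in> {0..1}"
  have "((\<lambda>y. prim f y - prim f x) \<longlongrightarrow> 0) (at x within {0..1})"
  proof (rule Lim_null_comparison)
    show "\<forall>\<^sub>F y in at x within {0..1}. norm (prim f y - prim f x) \<le> nrm2 f * sqrt \<bar>y - x\<bar>"
      unfolding eventually_at_filter using prim_holder[OF f x] by (auto intro: always_eventually)
    have "((\<lambda>y. nrm2 f * sqrt \<bar>y - x\<bar>) \<longlongrightarrow> nrm2 f * sqrt \<bar>x - x\<bar>) (at x within {0..1})"
      by (intro tendsto_intros)
    then show "((\<lambda>y. nrm2 f * sqrt \<bar>y - x\<bar>) \<longlongrightarrow> 0) (at x within {0..1})" by simp
  qed
  then show "(prim f \<longlongrightarrow> prim f x) (at x within {0..1})" using Lim_null by blast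
qed

lemma prim_L2 [simp]: "f \<in> L2 \<Longrightarrow> prim f \<in> L2"
  by (rule L2_continuous[OF prim_continuous])

lemma AE_neq: "AE x in \<mu>01. x \<noteq> p"
proof -
  have "AE z in lebesgue. z \<noteq> p" by (rule AE_completion) (rule AE_lborel_singleton)
  then show ?thesis unfolding AE_unit_measure by eventually_elim simp
qed

lemma int01_tail:
  assumes f: "f \<in> L2" shows "int01 (\<lambda>x. f x * step x y) = int01 f - prim f y"
proof -
  have "int01 (\<lambda>x. f x * step x y) = int01 (\<lambda>x. f x - f x * step y x)"
  proof (rule integral_cong_AE)
    note [measurable] = L2_measurable[OF f]
    have "(\<lambda>x. if y < x then 1 else 0 :: complex) \<in> borel_measurable (borel :: real measure)"
      by measurable
    then have [measurable]: "(\<lambda>x. step x y) \<in> borel_measurable \<mu>01"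
      unfolding step_def by (rule borel_measurable_unit_measure)
    show "(\<lambda>x. f x * step x y) \<in> borel_measurable \<mu>01" by measurable
    show "(\<lambda>x. f x - f x * step y x) \<in> borel_measurable \<mu>01" by measurable
    show "AE x in \<mu>01. f x * step x y = f x - f x * step y x"
      using AE_neq[of y] by eventually_elim (auto simp: step_def)
  qed
  also have "\<dots> = int01 f - prim f y"
    unfolding prim_def using f
    by (intro Bochner_Integration.integral_diff L2_integrable L2_mult_integrable step_L2)
  finally show ?thesis .
qed

text \<open>Integration by parts with the boundary term included: both sides are the integral of
  \<open>f x * g y\<close> over the triangle \<open>y < x\<close>.\<close>

lemma Fubini_prim:
  assumes f: "f \<in> L2" and g: "g \<in> L2"
  shows "int01 (\<lambda>x. f x * prim g x) = int01 (\<lambda>y. g y * (int01 f - prim f y))"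
proof -
  interpret P: pair_sigma_finite \<mu>01 \<mu>01 by unfold_locales
  note [measurable] = L2_measurable[OF f] L2_measurable[OF g]
  define h where "h x y = f x * (g y * step x y)" for x y
  have step2: "(\<lambda>p. step (fst p) (snd p)) \<in> borel_measurable (\<mu>01 \<Otimes>\<^sub>M \<mu>01)"
  proof -
    have id: "(\<lambda>x. x) \<in> measurable \<mu>01 (borel :: real measure)"
      by (rule borel_measurable_unit_measure) simp
    have "snd \<in> borel_measurable (\<mu>01 \<Otimes>\<^sub>M \<mu>01)" by (rule measurable_compose[OF measurable_snd id])
    moreover have "fst \<in> borel_measurable (\<mu>01 \<Otimes>\<^sub>M \<mu>01)"
      by (rule measurable_compose[OF measurable_fst id])
    ultimately have "{p \<in> space (\<mu>01 \<Otimes>\<^sub>M \<mu>01). snd p < fst p} \<in> sets (\<mu>01 \<Otimes>\<^sub>M \<mu>01)"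
      by (rule borel_measurable_less)
    then show ?thesis
      unfolding step_def by (intro measurable_If measurable_const) simp_all
  qed
  have h: "integrable (\<mu>01 \<Otimes>\<^sub>M \<mu>01) (case_prod h)"
  proof (rule P.Fubini_integrable)
    show m: "case_prod h \<in> borel_measurable (\<mu>01 \<Otimes>\<^sub>M \<mu>01)"
      unfolding h_def case_prod_beta using step2 by measurable
    have gi: "integrable \<mu>01 (\<lambda>y. cmod (g y * step x y))" for x
      by (intro integrable_norm L2_mult_integrable g step_L2)
    have n: "(LINT y|\<mu>01. norm (case_prod h (x, y))) = cmod (f x) * (LINT y|\<mu>01. cmod (g y * step x y))"
      for x
      by (simp add: h_def norm_mult)
    show "integrable \<mu>01 (\<lambda>x. LINT y|\<mu>01. norm (case_prod h (x, y)))"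
    proof (rule Bochner_Integration.integrable_bound)
      show "integrable \<mu>01 (\<lambda>x. cmod (f x) * (LINT y|\<mu>01. cmod (g y)))"
        by (intro integrable_mult_left integrable_norm L2_integrable f)
      show "(\<lambda>x. LINT y|\<mu>01. norm (case_prod h (x, y))) \<in> borel_measurable \<mu>01"
        using m by measurable
      have "(LINT y|\<mu>01. cmod (g y * step x y)) \<le> (LINT y|\<mu>01. cmod (g y))" for x
        by (intro integral_mono gi integrable_norm L2_integrable g) (auto simp: step_def)
      then show "AE x in \<mu>01. norm (LINT y|\<mu>01. norm (case_prod h (x, y))) \<le> norm (cmod (f x) * (LINT y|\<mu>01. cmod (g y)))"
        unfolding n by (intro AE_I2) (simp add: abs_mult mult_left_mono)
    qed
    show "AE x in \<mu>01. integrable \<mu>01 (\<lambda>y. case_prod h (x, y))"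
      unfolding h_def by (intro AE_I2) (simp add: L2_mult_integrable g)
  qed
  have "int01 (\<lambda>x. f x * prim g x) = int01 (\<lambda>x. int01 (\<lambda>y. h x y))"
    by (simp add: h_def prim_def)
  also have "\<dots> = int01 (\<lambda>y. int01 (\<lambda>x. h x y))"
    using P.Fubini_integral[OF h] by simp
  also have "\<dots> = int01 (\<lambda>y. g y * (int01 f - prim f y))"
  proof (rule Bochner_Integration.integral_cong[OF refl])
    fix y
    have "int01 (\<lambda>x. h x y) = g y * int01 (\<lambda>x. f x * step x y)"
      by (simp add: h_def mult.left_commute[of _ "g y"])
    then show "int01 (\<lambda>x. h x y) = g y * (int01 f - prim f y)" unfolding int01_tail[OF f] .
  qed
  finally show ?thesis .
qed

text \<open>The sets over which the integral vanishes form a Dynkin system.\<close>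

lemma prim_eq_0_imp_AE:
  assumes g: "g \<in> L2" and 0: "\<And>x. x \<in> {0..1} \<Longrightarrow> prim g x = 0"
  shows "AE x in \<mu>01. g x = 0"
proof (rule unit_measure.density_zero[OF L2_integrable[OF g]])
  note gi = L2_integrable[OF g]
  have prim0: "prim g x = 0" for x
    using 0[of x] prim_le_0[of x g] prim_ge_1[of x g] 0[of 1] by (cases "x \<le> 0"; cases "1 \<le> x") auto
  have meas: "{0<..<1} \<inter> A \<in> sets \<mu>01" if "A \<in> sets borel" for A
    using that by (auto simp: sets_restrict_space)
  have borel0: "set_lebesgue_integral \<mu>01 ({0<..<1} \<inter> A) g = 0"
    if "A \<in> sets (borel :: real measure)" for A
  proof -
    have mem: "A \<in> sigma_sets UNIV (range lessThan)"
      using that unfolding borel_Iio by (simp add: sets_measure_of)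
    have "Int_stable (range lessThan :: real set set)"
      unfolding Int_stable_def
    proof clarify
      fix a b :: real
      show "{..<a} \<inter> {..<b} \<in> range lessThan" by (rule range_eqI[of _ _ "min a b"]) auto
    qed
    moreover have "range lessThan \<subseteq> Pow (UNIV :: real set)" by simp
    ultimately show ?thesis using mem
    proof (rule sigma_sets_induct_disjoint)
      fix A :: "real set" assume "A \<in> range lessThan"
      then obtain x where A: "A = {..<x}" by auto
      have "set_lebesgue_integral \<mu>01 ({0<..<1} \<inter> A) g = prim g x"
        unfolding set_lebesgue_integral_def prim_def A
        by (intro Bochner_Integration.integral_cong refl) (auto simp: step_def indicator_def space_restrict_space)
      then show "set_lebesgue_integral \<mu>01 ({0<..<1} \<inter> A) g = 0" using prim0 by simp
    next
      fix A :: "real set" assume A': "A \<in> sigma_sets UNIV (range lessThan)"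
        and IH: "set_lebesgue_integral \<mu>01 ({0<..<1} \<inter> A) g = 0"
      then have A: "A \<in> sets borel" unfolding borel_Iio by (simp add: sets_measure_of)
      have "set_lebesgue_integral \<mu>01 ({0<..<1} \<inter> (UNIV - A)) g = (LINT x|\<mu>01. g x - indicator ({0<..<1} \<inter> A) x *\<^sub>R g x)"
        unfolding set_lebesgue_integral_def
        by (intro Bochner_Integration.integral_cong refl) (auto simp: indicator_def space_restrict_space)
      also have "\<dots> = int01 g - set_lebesgue_integral \<mu>01 ({0<..<1} \<inter> A) g"
        unfolding set_lebesgue_integral_def
        by (intro Bochner_Integration.integral_diff gi integrable_mult_indicator meas A)
      also have "int01 g = 0" using prim0[of 1] by simp
      finally show "set_lebesgue_integral \<mu>01 ({0<..<1} \<inter> (UNIV - A)) g = 0" using IH by simp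
    next
      fix A :: "nat \<Rightarrow> real set" assume disj: "disjoint_family A" and rng: "range A \<subseteq> sigma_sets UNIV (range lessThan)"
        and IH: "\<And>i. set_lebesgue_integral \<mu>01 ({0<..<1} \<inter> A i) g = 0"
      have A: "A i \<in> sets borel" for i using rng unfolding borel_Iio by (auto simp: sets_measure_of)
      have "set_lebesgue_integral \<mu>01 (\<Union>i. {0<..<1} \<inter> A i) g = (\<Sum>i. set_lebesgue_integral \<mu>01 ({0<..<1} \<inter> A i) g)"
      proof (rule lebesgue_integral_countable_add)
        show "{0<..<1} \<inter> A i \<in> sets \<mu>01" for i by (rule meas[OF A])
        show "({0<..<1} \<inter> A i) \<inter> ({0<..<1} \<inter> A j) = {}" if "i \<noteq> j" for i j
          using disj that by (auto simp: disjoint_family_on_def)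
        show "set_integrable \<mu>01 (\<Union>i. {0<..<1} \<inter> A i) g"
          unfolding set_integrable_def
        proof (rule integrable_mult_indicator[OF _ gi])
          show "(\<Union>i. {0<..<1} \<inter> A i) \<in> sets \<mu>01"
            by (rule sets.countable_UN) (use meas[OF A] in blast)
        qed
      qed
      also have "\<dots> = 0" unfolding IH by simp
      also have "(\<Union>i. {0<..<1} \<inter> A i) = {0<..<1} \<inter> (\<Union>i. A i)" by blast
      finally show "set_lebesgue_integral \<mu>01 ({0<..<1} \<inter> (\<Union>i. A i)) g = 0" .
    qed (simp add: set_lebesgue_integral_def)
  qed
  fix A assume A: "A \<in> sets \<mu>01"
  then have AL: "A \<in> sets lebesgue" "A \<subseteq> {0<..<1}" by (auto simp: sets_restrict_space)
  \<comment> \<open>The measurable sets here are Lebesgue sets; up to a null set they are Borel, so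
    the Borel case suffices.\<close>
  obtain C T where C: "fsigma C" "T \<in> null_sets lebesgue" "C \<union> T = A"
    using lebesgue_set_almost_fsigma[OF AL(1)] by metis
  have Cb: "C \<in> sets borel" using C(1) by (auto elim!: fsigma.cases intro: borel_closed)
  have "AE x in lebesgue. x \<notin> T" using C(2) by (rule AE_not_in)
  then have AE: "AE x in \<mu>01. x \<notin> T" unfolding AE_unit_measure by eventually_elim simp
  have "set_lebesgue_integral \<mu>01 A g = set_lebesgue_integral \<mu>01 ({0<..<1} \<inter> C) g"
    unfolding set_lebesgue_integral_def
  proof (rule integral_cong_AE)
    show "(\<lambda>x. indicat_real A x *\<^sub>R g x) \<in> borel_measurable \<mu>01"
      using A L2_measurable[OF g] by measurable
    show "(\<lambda>x. indicat_real ({0<..<1} \<inter> C) x *\<^sub>R g x) \<in> borel_measurable \<mu>01"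
      using meas[OF Cb] L2_measurable[OF g] by measurable
    show "AE x in \<mu>01. indicat_real A x *\<^sub>R g x = indicat_real ({0<..<1} \<inter> C) x *\<^sub>R g x"
      using AE AE_unit_interval by eventually_elim (use C(3) in \<open>auto simp: indicator_def\<close>)
  qed
  then show "set_lebesgue_integral \<mu>01 A g = 0" using borel0[OF Cb] by simp
qed

lemma FTC_prim:
  assumes f: "\<And>x. x \<in> {0..1} \<Longrightarrow> (f has_vector_derivative f' x) (at x within {0..1})"
    and f': "continuous_on {0..1} f'" and x: "x \<in> {0..1}"
  shows "prim f' x = f x - f 0"
proof -
  have "(f' has_integral (f x - f 0)) {0..x}"
    using x
    by (intro fundamental_theorem_of_calculus) (auto intro: has_vector_derivative_within_subset[OF f])
  then have "((\<lambda>y. if y \<in> {0..x} then f' y else 0) has_integral (f x - f 0)) {0..1}"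
    using x by (subst has_integral_restrict) auto
  then have "((\<lambda>y. f' y * step x y) has_integral (f x - f 0)) {0..1}"
    by (rule has_integral_spike_finite[of "{x}", rotated 2]) (auto simp: step_def)
  then have "((\<lambda>y. f' y * step x y) has_integral (f x - f 0)) {0<..<1}"
    by (simp add: has_integral_Icc_iff_Ioo)
  moreover have "prim f' x = integral {0<..<1} (\<lambda>y. f' y * step x y)"
    unfolding prim_def
    by (intro lebesgue_integral_eq_integral L2_mult_integrable L2_continuous[OF f'] step_L2) auto
  ultimately show ?thesis by (simp add: integral_unique)
qed

section \<open>Weak derivatives and primitives\<close>

lemma test_functionD:
  assumes "test_function \<phi> \<phi>'"
  shows "continuous_on {0..1} \<phi>" "continuous_on {0..1} \<phi>'" "\<phi> 0 = 0" "\<phi> 1 = 0"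
    and "x \<in> {0..1} \<Longrightarrow> prim \<phi>' x = \<phi> x"
proof -
  have d: "(\<phi> has_vector_derivative \<phi>' x) (at x)" for x using assms by (simp add: test_function_def)
  have "continuous (at x) \<phi>" for x using d by (rule has_vector_derivative_continuous)
  then show "continuous_on {0..1} \<phi>" by (simp add: continuous_at_imp_continuous_on)
  show c: "continuous_on {0..1} \<phi>'" using assms unfolding test_function_def
    by (meson continuous_on_subset subset_UNIV)
  show 0: "\<phi> 0 = 0" "\<phi> 1 = 0" using assms by (auto simp: test_function_def)
  show "x \<in> {0..1} \<Longrightarrow> prim \<phi>' x = \<phi> x"
    using FTC_prim[OF has_vector_derivative_at_within[OF d] c, of x] 0 by simp
qed

lemma weak_deriv_prim:
  assumes v: "v \<in> L2" and u: "\<And>x. x \<in> {0<..<1} \<Longrightarrow> u x = c + prim v x"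
  shows "weak_deriv u v"
  unfolding weak_deriv_def
proof (intro allI impI)
  fix \<phi> \<phi>' assume t: "test_function \<phi> \<phi>'"
  note T = test_functionD[OF t]
  have p: "\<phi>' \<in> L2" using T(2) by (rule L2_continuous)
  have i0: "int01 \<phi>' = 0" using T(5)[of 1] T(4) by simp
  have "int01 (\<lambda>x. u x * \<phi>' x) = int01 (\<lambda>x. c * \<phi>' x + \<phi>' x * prim v x)"
    using u
    by (intro Bochner_Integration.integral_cong refl) (auto simp: space_restrict_space algebra_simps)
  also have "\<dots> = int01 (\<lambda>x. c * \<phi>' x) + int01 (\<lambda>x. \<phi>' x * prim v x)"
    using p v
    by (intro Bochner_Integration.integral_add integrable_mult_right L2_integrable L2_mult_integrable prim_L2)
  also have "\<dots> = int01 (\<lambda>y. v y * (int01 \<phi>' - prim \<phi>' y))"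
    unfolding Fubini_prim[OF p v] using i0 by simp
  also have "\<dots> = int01 (\<lambda>y. - (v y * \<phi> y))"
    using T(5) i0 by (intro Bochner_Integration.integral_cong refl) (auto simp: space_restrict_space)
  finally show "int01 (\<lambda>x. u x * \<phi>' x) = - int01 (\<lambda>x. v x * \<phi> x)" by simp
qed

text \<open>A continuous approximation of the indicator of the interval from \<open>p\<close> to
  \<open>q\<close>, with support in \<open>{p..q}\<close>. Test functions need only a continuous
  derivative, so trapezoids corrected to mean zero can serve directly as derivatives of test
  functions.\<close>

definition trapezoid :: "nat \<Rightarrow> real \<Rightarrow> real \<Rightarrow> real \<Rightarrow> complex" where
  "trapezoid n p q x = complex_of_real (min 1 (max 0 (real n * min (x - p) (q - x))))"

lemma trapezoid_continuous: "continuous_on A (trapezoid n p q)"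
  unfolding trapezoid_def by (intro continuous_intros)

lemma trapezoid_support: "x \<notin> {p..q} \<Longrightarrow> trapezoid n p q x = 0"
proof -
  assume "x \<notin> {p..q}"
  then have "real n * min (x - p) (q - x) \<le> 0" by (intro mult_nonneg_nonpos) auto
  then show ?thesis by (simp add: trapezoid_def)
qed

lemma trapezoid_L2 [simp]: "trapezoid n p q \<in> L2"
  by (rule L2_continuous[OF trapezoid_continuous])

lemma trapezoid_norm: "cmod (trapezoid n p q x) \<le> 1"
  unfolding trapezoid_def norm_of_real by simp

text \<open>The point \<open>p\<close> is excepted because every trapezoid vanishes there, while
  \<open>step q p - step p p = 1\<close>.\<close>

lemma trapezoid_tendsto:
  assumes "x \<noteq> p" "p < q" shows "(\<lambda>n. trapezoid n p q x) \<longlonglongrightarrow> step q x - step p x"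
proof (cases "p < x \<and> x < q")
  case True
  define d where "d = min (x - p) (q - x)"
  have d: "0 < d" using True by (simp add: d_def)
  obtain N where N: "1 / d < real N" using reals_Archimedean2 by blast
  have "trapezoid n p q x = 1" if "n \<ge> N" for n
  proof -
    have "1 / d \<le> real n" using N that by linarith
    then have "1 \<le> real n * d" using d by (simp add: field_simps)
    then show ?thesis by (simp add: trapezoid_def d_def)
  qed
  then have "\<forall>\<^sub>F n in sequentially. trapezoid n p q x = 1" unfolding eventually_sequentially by blast
  moreover have "step q x - step p x = 1" using True by (simp add: step_def)
  ultimately show ?thesis by (simp add: tendsto_eventually)
next
  case False
  then have "trapezoid n p q x = 0" for n
  proof (cases "x = q")
    case True
    then show ?thesis using assms by (simp add: trapezoid_def)
  qed (use assms in \<open>auto intro!: trapezoid_support\<close>)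
  moreover have "step q x - step p x = 0" using False assms by (auto simp: step_def)
  ultimately show ?thesis by simp
qed

lemma int_trapezoid_tendsto:
  assumes w: "w \<in> L2" and pq: "p < q"
  shows "(\<lambda>n. int01 (\<lambda>x. w x * trapezoid n p q x)) \<longlonglongrightarrow> prim w q - prim w p"
proof -
  have "(\<lambda>n. int01 (\<lambda>x. w x * trapezoid n p q x)) \<longlonglongrightarrow> int01 (\<lambda>x. w x * (step q x - step p x))"
  proof (rule integral_dominated_convergence)
    note [measurable] = L2_measurable[OF w] L2_measurable[OF trapezoid_L2]
    show "(\<lambda>x. w x * (step q x - step p x)) \<in> borel_measurable \<mu>01" by measurable
    show "(\<lambda>x. w x * trapezoid n p q x) \<in> borel_measurable \<mu>01" for n by measurable
    show "integrable \<mu>01 (\<lambda>x. cmod (w x))" by (intro integrable_norm L2_integrable w)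
    show "AE x in \<mu>01. (\<lambda>n. w x * trapezoid n p q x) \<longlonglongrightarrow> w x * (step q x - step p x)"
      using AE_neq[of p] by eventually_elim (intro tendsto_mult_left trapezoid_tendsto pq)
    show "AE x in \<mu>01. norm (w x * trapezoid n p q x) \<le> cmod (w x)" for n
      using trapezoid_norm by (intro AE_I2) (simp add: norm_mult mult_left_le)
  qed
  also have "int01 (\<lambda>x. w x * (step q x - step p x)) = prim w q - prim w p"
    unfolding prim_def right_diff_distrib
    by (intro Bochner_Integration.integral_diff L2_mult_integrable w step_L2)
  finally show ?thesis .
qed

text \<open>The antiderivative from 0 vanishes to the left of the support, and to the right of it
  because the total integral is 0; outside the unit interval it is set to 0.\<close>

lemma antiderivative_test_function:
  fixes \<psi> :: "real \<Rightarrow> complex"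
  assumes cont: "continuous_on UNIV \<psi>" and supp: "\<And>x. x \<notin> {a..b} \<Longrightarrow> \<psi> x = 0" and ab: "0 < a" "b < 1"
    and int: "int01 \<psi> = 0"
  shows "\<exists>\<phi>. test_function \<phi> \<psi>"
proof -
  have c01: "continuous_on {0..1} \<psi>" using cont by (rule continuous_on_subset) simp
  define \<Phi> where "\<Phi> x = integral {0..x} \<psi>" for x
  have \<Phi>': "(\<Phi> has_vector_derivative \<psi> x) (at x within {0..1})" if "x \<in> {0..1}" for x
    unfolding \<Phi>_def using c01 that by (rule integral_has_vector_derivative)
  have \<Phi>_prim: "\<Phi> x = prim \<psi> x" if "x \<in> {0..1}" for x
    using FTC_prim[OF \<Phi>' c01 that] by (simp add: \<Phi>_def)
  define \<phi> where "\<phi> x = (if x \<in> {0..1} then \<Phi> x else 0)" for x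
  have zero_left: "\<phi> x = 0" if "x < a" for x
  proof (cases "x \<in> {0..1}")
    case True
    have "integral {0..x} \<psi> = integral {0..x} (\<lambda>_. 0)" using supp that by (intro integral_cong) auto
    then show ?thesis using True by (simp add: \<phi>_def \<Phi>_def)
  qed (auto simp: \<phi>_def)
  have zero_right: "\<phi> x = 0" if "b < x" for x
  proof (cases "x \<in> {0..1}")
    case True
    have "prim \<psi> x = int01 \<psi>"
      unfolding prim_def using supp that
      by (intro Bochner_Integration.integral_cong refl) (auto simp: step_def)
    then show ?thesis using True \<Phi>_prim[OF True] int by (simp add: \<phi>_def)
  qed (auto simp: \<phi>_def)
  have "(\<phi> has_vector_derivative \<psi> x) (at x)" for x
  proof (cases "x \<in> {0<..<1}")
    case True
    have d: "(\<Phi> has_vector_derivative \<psi> x) (at x within {0<..<1})"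
      using True by (intro has_vector_derivative_within_subset[OF \<Phi>']) auto
    have "(\<phi> has_vector_derivative \<psi> x) (at x within {0<..<1})"
      by (rule has_vector_derivative_transform[OF True _ d]) (simp add: \<phi>_def)
    then show ?thesis unfolding at_within_open[OF True open_greaterThanLessThan] .
  next
    case False
    define S where "S = (if x < a then {..<a} else {b<..})"
    have S: "open S" "x \<in> S" using False ab by (auto simp: S_def)
    have z: "\<phi> y = 0" if "y \<in> S" for y using that zero_left zero_right
      by (auto simp: S_def split: if_splits)
    have "(\<phi> has_vector_derivative 0) (at x within S)"
      by (rule has_vector_derivative_transform[OF S(2) _ has_vector_derivative_const[of 0]]) (rule z)
    moreover have "\<psi> x = 0" using supp[of x] False ab by auto
    ultimately show ?thesis unfolding at_within_open[OF S(2,1)] by simp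
  qed
  then have "test_function \<phi> \<psi>"
    unfolding test_function_def using cont ab zero_left zero_right
    by (intro conjI allI exI[of _ a] exI[of _ b]) auto
  then show ?thesis by blast
qed

text \<open>\<open>w = u - prim v\<close> annihilates all derivatives of test functions, in
  particular every trapezoid from which the right multiple of a fixed one, \<open>\<eta>\<close>,
  has been subtracted. So \<open>w\<close> minus a suitable constant annihilates all trapezoids;
  hence its primitive is constant, and the function vanishes almost everywhere.\<close>

theorem du_Bois_Reymond:
  assumes u: "u \<in> L2" and v: "v \<in> L2" and weak: "weak_deriv u v"
  shows "\<exists>c. AE x in \<mu>01. u x = c + prim v x"
proof -
  define w where "w = u - prim v"
  have w: "w \<in> L2" using u v by (simp add: w_def)
  have w0: "int01 (\<lambda>x. w x * \<phi>' x) = 0" if t: "test_function \<phi> \<phi>'" for \<phi> \<phi>'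
  proof -
    have p: "\<phi>' \<in> L2" using test_functionD(2)[OF t] by (rule L2_continuous)
    have "int01 (\<lambda>x. w x * \<phi>' x) = int01 (\<lambda>x. u x * \<phi>' x) - int01 (\<lambda>x. prim v x * \<phi>' x)"
      unfolding w_def minus_apply left_diff_distrib
      by (intro Bochner_Integration.integral_diff L2_mult_integrable u p prim_L2 v)
    also have "\<dots> = 0"
      using weak weak_deriv_prim[OF v, of "prim v" 0] t unfolding weak_deriv_def by simp
    finally show ?thesis .
  qed
  \<comment> \<open>Only some \<open>\<eta>\<close> with nonzero integral is wanted: the integrals
    tend to the length 1/2 of the interval, so a large \<open>n\<close> will do.\<close>
  have "(\<lambda>n. int01 (\<lambda>x. 1 * trapezoid n (1/4) (3/4) x)) \<longlonglongrightarrow> prim (\<lambda>x. 1) (3/4) - prim (\<lambda>x. 1) (1/4)"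
    by (rule int_trapezoid_tendsto) auto
  moreover have "prim (\<lambda>x. 1) (3/4) - prim (\<lambda>x. 1) (1/4) = 1 / 2"
  proof -
    have "(complex_of_real has_vector_derivative 1) (at x within {0..1})" for x
      by (auto intro!: derivative_eq_intros)
    then show ?thesis using FTC_prim[of complex_of_real "\<lambda>x. 1"] by simp
  qed
  ultimately have "\<forall>\<^sub>F n in sequentially. int01 (\<lambda>x. 1 * trapezoid n (1/4) (3/4) x) \<noteq> 0"
    by (intro tendsto_imp_eventually_ne) auto
  then obtain n where n: "int01 (trapezoid n (1/4) (3/4)) \<noteq> 0"
    by (auto simp: eventually_sequentially)
  define \<eta> where "\<eta> = trapezoid n (1/4) (3/4)"
  define \<kappa> where "\<kappa> = int01 \<eta>"
  have \<kappa>: "\<kappa> \<noteq> 0" using n by (simp add: \<kappa>_def \<eta>_def)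
  have \<eta>: "\<eta> \<in> L2" by (simp add: \<eta>_def)
  define c where "c = int01 (\<lambda>x. w x * \<eta> x) / \<kappa>"
  define g where "g = w - (\<lambda>x. c)"
  have g: "g \<in> L2" using w by (simp add: g_def)
  have trap0: "int01 (\<lambda>x. g x * trapezoid m p q x) = 0" if pq: "0 < p" "p < q" "q < 1" for m p q
  proof -
    define \<tau> where "\<tau> = trapezoid m p q"
    have \<tau>: "\<tau> \<in> L2" by (simp add: \<tau>_def)
    \<comment> \<open>The multiple of \<open>\<eta>\<close> that makes the mean of
      \<open>\<psi>\<close> zero.\<close>
    define k where "k = int01 \<tau> / \<kappa>"
    define \<psi> where "\<psi> = (\<lambda>x. \<tau> x - k * \<eta> x)"
    have "\<exists>\<phi>. test_function \<phi> \<psi>"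
    proof (rule antiderivative_test_function)
      show "continuous_on UNIV \<psi>"
        unfolding \<psi>_def \<tau>_def \<eta>_def by (intro continuous_intros trapezoid_continuous)
      show "\<psi> x = 0" if "x \<notin> {min p (1/4)..max q (3/4)}" for x
      proof -
        have "x \<notin> {p..q}" "x \<notin> {1/4..3/4}" using that by auto
        from this[THEN trapezoid_support] show ?thesis unfolding \<psi>_def \<tau>_def \<eta>_def by simp
      qed
      have "int01 \<psi> = int01 \<tau> - k * int01 \<eta>"
        unfolding \<psi>_def using \<tau> \<eta>
        by (subst Bochner_Integration.integral_diff) (auto intro: L2_integrable)
      then show "int01 \<psi> = 0" using \<kappa> by (simp add: k_def \<kappa>_def)
    qed (use pq in auto)
    then have "int01 (\<lambda>x. w x * \<psi> x) = 0" using w0 by blast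
    moreover have "int01 (\<lambda>x. w x * \<psi> x) = int01 (\<lambda>x. w x * \<tau> x) - k * int01 (\<lambda>x. w x * \<eta> x)"
    proof -
      have "int01 (\<lambda>x. w x * \<psi> x) = int01 (\<lambda>x. w x * \<tau> x - k * (w x * \<eta> x))"
        by (simp add: \<psi>_def algebra_simps)
      also have "\<dots> = int01 (\<lambda>x. w x * \<tau> x) - int01 (\<lambda>x. k * (w x * \<eta> x))"
        by (intro Bochner_Integration.integral_diff integrable_mult_right L2_mult_integrable w \<tau> \<eta>)
      finally show ?thesis by simp
    qed
    moreover have "int01 (\<lambda>x. g x * \<tau> x) = int01 (\<lambda>x. w x * \<tau> x) - c * int01 \<tau>"
    proof -
      have "int01 (\<lambda>x. g x * \<tau> x) = int01 (\<lambda>x. w x * \<tau> x - c * \<tau> x)"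
        by (simp add: g_def algebra_simps)
      also have "\<dots> = int01 (\<lambda>x. w x * \<tau> x) - int01 (\<lambda>x. c * \<tau> x)"
        by (intro Bochner_Integration.integral_diff integrable_mult_right L2_mult_integrable L2_integrable w \<tau>)
      finally show ?thesis by simp
    qed
    ultimately show ?thesis by (simp add: c_def k_def \<tau>_def)
  qed
  have eq: "prim g q = prim g p" if "0 < p" "p < q" "q < 1" for p q
  proof -
    have "(\<lambda>n :: nat. 0) \<longlonglongrightarrow> prim g q - prim g p"
      using int_trapezoid_tendsto[OF g that(2)] unfolding trap0[OF that] .
    from LIMSEQ_unique[OF this tendsto_const] show ?thesis by simp
  qed
  have const: "prim g x = prim g (1/2)" if "x \<in> {0<..<1}" for x
  proof (cases x "1/2 :: real" rule: linorder_cases)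
    case less
    then show ?thesis using that eq[of x "1/2"] by simp
  next
    case greater
    then show ?thesis using that eq[of "1/2" x] by simp
  qed (simp only:)
  have half: "prim g x = prim g (1/2)" if "x \<in> {0..1}" for x
  proof (rule continuous_constant_on_closure[OF _ const])
    show "continuous_on (closure {0<..<1}) (prim g)" using prim_continuous[OF g] by simp
    show "x \<in> closure {0<..<1}" using that by simp
  qed
  have "prim g x = 0" if "x \<in> {0..1}" for x using half[OF that] half[of 0] by simp
  then have "AE x in \<mu>01. g x = 0" by (rule prim_eq_0_imp_AE[OF g])
  then have "AE x in \<mu>01. u x = c + prim v x"
    by eventually_elim (simp add: g_def w_def algebra_simps)
  then show ?thesis by blast
qed

lemma continuous_AE_eq:
  fixes f g :: "real \<Rightarrow> complex"
  assumes f: "continuous_on {0..1} f" and g: "continuous_on {0..1} g" and AE: "AE x in \<mu>01. f x = g x"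
    and x: "x \<in> {0..1}"
  shows "f x = g x"
proof -
  define h where "h x = f x - g x" for x
  have h: "continuous_on {0..1} h" unfolding h_def by (intro continuous_intros f g)
  define U where "U = {x \<in> {0<..<1}. h x \<noteq> 0}"
  have "U = {0<..<1} \<inter> h -` (- {0})" by (auto simp: U_def)
  moreover have "open ({0<..<1} \<inter> h -` (- {0}))"
    using h by (intro continuous_open_preimage) (auto intro: continuous_on_subset)
  ultimately have "open U" by simp
  moreover have "negligible U"
  proof -
    have "AE x in lebesgue. x \<notin> U"
      using AE unfolding AE_unit_measure by eventually_elim (auto simp: U_def h_def)
    then have "U \<in> null_sets lebesgue"
      using AE_iff_null_sets[of U lebesgue] \<open>open U\<close> by (simp add: lebesgue_openin)
    then show ?thesis by (simp add: negligible_iff_null_sets)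
  qed
  ultimately have "U = {}" using open_not_negligible by blast
  then have "h y = 0" if "y \<in> {0<..<1}" for y using that by (auto simp: U_def)
  then have "h x = 0"
    using continuous_constant_on_closure[of "{0<..<1}" h 0 x] h x by simp
  then show ?thesis by (simp add: h_def)
qed

lemma weak_deriv_unique:
  assumes u: "u \<in> L2" "v \<in> L2" "v' \<in> L2" and w: "weak_deriv u v" "weak_deriv u v'"
  shows "AE x in \<mu>01. v x = v' x"
proof -
  obtain c c' where "AE x in \<mu>01. u x = c + prim v x" "AE x in \<mu>01. u x = c' + prim v' x"
    using du_Bois_Reymond[OF u(1,2) w(1)] du_Bois_Reymond[OF u(1,3) w(2)] by blast
  then have AE: "AE x in \<mu>01. c + prim v x = c' + prim v' x" by eventually_elim simp
  have eq: "c + prim v x = c' + prim v' x" if "x \<in> {0..1}" for x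
    using AE that u by (intro continuous_AE_eq) (auto intro!: continuous_intros prim_continuous)
  then have "c = c'" using eq[of 0] by simp
  then have "prim (v - v') x = 0" if "x \<in> {0..1}" for x using eq[OF that] u by (simp add: prim_diff)
  then have "AE x in \<mu>01. (v - v') x = 0" using u by (intro prim_eq_0_imp_AE[of "v - v'"] L2.diff_mem)
  then show ?thesis by eventually_elim simp
qed

lemma weak_deriv_cong:
  assumes "AE x in \<mu>01. u x = u' x" "u \<in> L2" "u' \<in> L2" "weak_deriv u v" shows "weak_deriv u' v"
  unfolding weak_deriv_def
proof (intro allI impI)
  fix \<phi> \<phi>' assume t: "test_function \<phi> \<phi>'"
  have "\<phi>' \<in> L2" using test_functionD(2)[OF t] by (rule L2_continuous)
  note [measurable] = L2_measurable[OF this] L2_measurable[OF assms(2)] L2_measurable[OF assms(3)]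
  have "int01 (\<lambda>x. u' x * \<phi>' x) = int01 (\<lambda>x. u x * \<phi>' x)"
  proof (rule integral_cong_AE)
    show "AE x in \<mu>01. u' x * \<phi>' x = u x * \<phi>' x" using assms(1) by eventually_elim simp
  qed measurable
  then show "int01 (\<lambda>x. u' x * \<phi>' x) = - int01 (\<lambda>x. v x * \<phi> x)"
    using assms(4) t by (simp add: weak_deriv_def)
qed

section \<open>Sobolev functions as primitives\<close>

lemma wderiv:
  assumes "v \<in> L2" "weak_deriv u v"
  shows "wderiv u \<in> L2" "weak_deriv u (wderiv u)" "u \<in> L2 \<Longrightarrow> AE x in \<mu>01. wderiv u x = v x"
proof -
  have "\<exists>v. v \<in> L2 \<and> weak_deriv u v" using assms by blast
  from someI_ex[OF this] show *: "wderiv u \<in> L2" "weak_deriv u (wderiv u)" by (auto simp: wderiv_def)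
  show "u \<in> L2 \<Longrightarrow> AE x in \<mu>01. wderiv u x = v x" using weak_deriv_unique * assms by blast
qed

lemma H1_L2: "u \<in> H1 \<Longrightarrow> u \<in> L2"
  by (auto simp: H1_def intro: L2_continuous)

lemma H1_wderiv:
  assumes "u \<in> H1"
  shows "wderiv u \<in> L2" "x \<in> {0..1} \<Longrightarrow> u x = u 0 + prim (wderiv u) x"
proof -
  obtain v where "v \<in> L2" "weak_deriv u v" using assms by (auto simp: H1_def)
  note w = wderiv[OF this]
  show "wderiv u \<in> L2" by (rule w)
  obtain c where AE: "AE x in \<mu>01. u x = c + prim (wderiv u) x"
    using du_Bois_Reymond[OF H1_L2[OF assms] w(1,2)] by blast
  have eq: "u x = c + prim (wderiv u) x" if "x \<in> {0..1}" for x
    using AE that assms w(1)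
    by (intro continuous_AE_eq) (auto simp: H1_def intro!: continuous_intros prim_continuous)
  then have "u 0 = c" using eq[of 0] by simp
  then show "x \<in> {0..1} \<Longrightarrow> u x = u 0 + prim (wderiv u) x" using eq by simp
qed

lemma H1I:
  assumes v: "v \<in> L2" and u: "\<And>x. x \<in> {0..1} \<Longrightarrow> u x = c + prim v x"
  shows "u \<in> H1" "AE x in \<mu>01. wderiv u x = v x"
proof -
  have "continuous_on {0..1} (\<lambda>x. c + prim v x)" by (intro continuous_intros prim_continuous v)
  then have cont: "continuous_on {0..1} u" by (rule continuous_on_eq) (simp add: u)
  have w: "weak_deriv u v" using u by (intro weak_deriv_prim[OF v]) auto
  show "u \<in> H1" using cont v w by (auto simp: H1_def)
  show "AE x in \<mu>01. wderiv u x = v x" by (rule wderiv(3)[OF v w L2_continuous[OF cont]])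
qed

lemma H2_wderiv:
  assumes "u \<in> H2"
  shows "u \<in> H1" "wderiv (wderiv u) \<in> L2" "\<exists>c. AE x in \<mu>01. wderiv u x = c + prim (wderiv (wderiv u)) x"
proof -
  obtain v where v: "u \<in> H1" "v \<in> L2" "weak_deriv (wderiv u) v" using assms by (auto simp: H2_def)
  note w = wderiv[OF v(2,3)]
  show "u \<in> H1" "wderiv (wderiv u) \<in> L2" using v w by auto
  show "\<exists>c. AE x in \<mu>01. wderiv u x = c + prim (wderiv (wderiv u)) x"
    by (rule du_Bois_Reymond[OF H1_wderiv(1)[OF v(1)] w(1,2)])
qed

text \<open>The first derivative is identified almost everywhere only, so the second one is carried
  over by \<open>weak_deriv_cong\<close>.\<close>

lemma H2I:
  assumes v: "v \<in> L2" and u: "\<And>x. x \<in> {0..1} \<Longrightarrow> u x = a + prim (\<lambda>y. c + prim v y) x"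
  shows "u \<in> H2" "AE x in \<mu>01. wderiv (wderiv u) x = v x"
proof -
  define p where "p = (\<lambda>y. c + prim v y)"
  have p: "p \<in> L2" unfolding p_def by (intro L2_continuous continuous_intros prim_continuous v)
  have H1: "u \<in> H1" and AE: "AE x in \<mu>01. wderiv u x = p x"
    using H1I[OF p, of u a] u by (auto simp: p_def)
  have "weak_deriv p v" by (rule weak_deriv_prim[OF v, of _ c]) (simp add: p_def)
  then have w: "weak_deriv (wderiv u) v"
    using AE H1_wderiv(1)[OF H1] p
    by (intro weak_deriv_cong[of p "wderiv u"]) (auto elim: eventually_mono)
  show "u \<in> H2" using H1 v w by (auto simp: H2_def)
  show "AE x in \<mu>01. wderiv (wderiv u) x = v x" by (rule wderiv(3)[OF v w H1_wderiv(1)[OF H1]])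
qed

section \<open>The dual of \<open>H\<^sup>1(T)\<close>\<close>

interpretation L2: complete_ip L2 ip_L2
  by unfold_locales (rule L2_complete)

lemma H1T_repr:
  assumes "\<phi> \<in> H1T"
  shows "\<phi> \<in> H1" "\<phi> \<in> L2" "wderiv \<phi> \<in> L2" "\<phi> 1 = \<phi> 0" "int01 (wderiv \<phi>) = 0"
    and "x \<in> {0..1} \<Longrightarrow> \<phi> x = \<phi> 1 + prim (wderiv \<phi>) x"
proof -
  show H: "\<phi> \<in> H1" and e: "\<phi> 1 = \<phi> 0" using assms by (auto simp: H1T_def)
  then show "\<phi> \<in> L2" "wderiv \<phi> \<in> L2" using H1_L2 H1_wderiv(1) by blast+
  show r: "x \<in> {0..1} \<Longrightarrow> \<phi> x = \<phi> 1 + prim (wderiv \<phi>) x" for x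
    unfolding e by (rule H1_wderiv(2)[OF H])
  show "int01 (wderiv \<phi>) = 0" using r[of 1] by simp
qed

lemma H1T_I:
  assumes v: "v \<in> L2" "int01 v = 0" and u: "\<And>x. x \<in> {0..1} \<Longrightarrow> u x = c + prim v x"
  shows "u \<in> H1T" "AE x in \<mu>01. wderiv u x = v x"
  using H1I[OF v(1) u] u[of 0] u[of 1] v(2) by (auto simp: H1T_def)

text \<open>\<open>wderiv\<close> chooses representatives and is therefore additive only almost
  everywhere; membership and derivative are both read off from the primitive.\<close>

lemma H1T_add:
  assumes "\<phi> \<in> H1T" "\<psi> \<in> H1T"
  shows "\<phi> + \<psi> \<in> H1T" "AE x in \<mu>01. wderiv (\<phi> + \<psi>) x = (wderiv \<phi> + wderiv \<psi>) x"
proof -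
  note p = H1T_repr[OF assms(1)] and q = H1T_repr[OF assms(2)]
  have i: "int01 (wderiv \<phi> + wderiv \<psi>) = 0"
    using L2.add_left[OF p(3) q(3) L2_const[of 1]] p(5) q(5) by (simp only: int01_ip) simp
  have "(\<phi> + \<psi>) x = (\<phi> 1 + \<psi> 1) + prim (wderiv \<phi> + wderiv \<psi>) x" if "x \<in> {0..1}" for x
    using p(6)[OF that] q(6)[OF that] by (simp add: prim_add[OF p(3) q(3)])
  from H1T_I[of "wderiv \<phi> + wderiv \<psi>" "\<phi> + \<psi>", OF L2.add_mem[OF p(3) q(3)] i this]
  show "\<phi> + \<psi> \<in> H1T" "AE x in \<mu>01. wderiv (\<phi> + \<psi>) x = (wderiv \<phi> + wderiv \<psi>) x" by blast+
qed

lemma H1T_scale: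
  assumes "\<phi> \<in> H1T"
  shows "c *\<^sub>c \<phi> \<in> H1T" "AE x in \<mu>01. wderiv (c *\<^sub>c \<phi>) x = (c *\<^sub>c wderiv \<phi>) x"
proof -
  note p = H1T_repr[OF assms(1)]
  have i: "int01 (c *\<^sub>c wderiv \<phi>) = 0"
    using L2.scale_left[OF p(3) L2_const[of 1], of c] p(5) by (simp only: int01_ip) simp
  have "(c *\<^sub>c \<phi>) x = c * \<phi> 1 + prim (c *\<^sub>c wderiv \<phi>) x" if "x \<in> {0..1}" for x
    using p(6)[OF that] by (simp add: prim_scale[OF p(3)] algebra_simps)
  from H1T_I[of "c *\<^sub>c wderiv \<phi>" "c *\<^sub>c \<phi>", OF L2.scale_mem[OF p(3)] i this]
  show "c *\<^sub>c \<phi> \<in> H1T" "AE x in \<mu>01. wderiv (c *\<^sub>c \<phi>) x = (c *\<^sub>c wderiv \<phi>) x" by blast+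
qed

lemma H1T_const: "(\<lambda>x. 1) \<in> H1T"
  by (rule H1T_I[of 0 _ 1]) (auto simp: prim_def)

lemma nrm2_cong_AE:
  assumes "AE x in \<mu>01. f x = g x" "f \<in> L2" "g \<in> L2" shows "nrm2 f = nrm2 g"
  unfolding ip_norm_def using ip_L2_cong_AE[OF assms(1,1,2,3,2,3)] by simp

lemma norm_H1_ge: "nrm2 \<phi> \<le> norm_H1 \<phi>" "nrm2 (wderiv \<phi>) \<le> norm_H1 \<phi>"
  unfolding norm_H1_def by simp_all

lemma norm_H1_le: "0 \<le> nrm2 \<phi> \<Longrightarrow> 0 \<le> nrm2 (wderiv \<phi>) \<Longrightarrow> norm_H1 \<phi> \<le> nrm2 \<phi> + nrm2 (wderiv \<phi>)"
  unfolding norm_H1_def by (rule sqrt_sum_squares_le_sum)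

lemma Hm1D:
  assumes "w \<in> Hm1"
  shows "\<phi> \<notin> H1T \<Longrightarrow> w \<phi> = 0" "\<phi> \<in> H1T \<Longrightarrow> \<psi> \<in> H1T \<Longrightarrow> w (\<phi> + \<psi>) = w \<phi> + w \<psi>"
    "\<phi> \<in> H1T \<Longrightarrow> w (c *\<^sub>c \<phi>) = c * w \<phi>" "\<exists>C\<ge>0. \<forall>\<phi>\<in>H1T. cmod (w \<phi>) \<le> C * norm_H1 \<phi>"
proof -
  show "\<phi> \<notin> H1T \<Longrightarrow> w \<phi> = 0" "\<phi> \<in> H1T \<Longrightarrow> \<psi> \<in> H1T \<Longrightarrow> w (\<phi> + \<psi>) = w \<phi> + w \<psi>"
    "\<phi> \<in> H1T \<Longrightarrow> w (c *\<^sub>c \<phi>) = c * w \<phi>" using assms by (auto simp: Hm1_def)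
  obtain C where C: "\<forall>\<phi>\<in>H1T. cmod (w \<phi>) \<le> C * norm_H1 \<phi>" using assms by (auto simp: Hm1_def)
  have "cmod (w \<phi>) \<le> \<bar>C\<bar> * norm_H1 \<phi>" if "\<phi> \<in> H1T" for \<phi>
  proof -
    have "0 \<le> norm_H1 \<phi>" by (simp add: norm_H1_def)
    then have "C * norm_H1 \<phi> \<le> \<bar>C\<bar> * norm_H1 \<phi>" by (intro mult_right_mono) auto
    then show ?thesis using C that by force
  qed
  then show "\<exists>C\<ge>0. \<forall>\<phi>\<in>H1T. cmod (w \<phi>) \<le> C * norm_H1 \<phi>" by (intro exI[of _ "\<bar>C\<bar>"]) auto
qed

text \<open>The difference has norm 0 in H1, and \<open>w\<close> is bounded. This is needed
  wherever functions agree on \<open>[0,1]\<close> without being equal as total functions, such as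
  \<open>J_op\<close> of a sum and the sum of the values of \<open>J_op\<close>.\<close>

lemma Hm1_cong:
  assumes w: "w \<in> Hm1" and p: "\<phi> \<in> H1T" "\<psi> \<in> H1T" and eq: "\<And>x. x \<in> {0..1} \<Longrightarrow> \<phi> x = \<psi> x"
  shows "w \<phi> = w \<psi>"
proof -
  define d where "d = \<phi> + (- 1) *\<^sub>c \<psi>"
  have d: "d \<in> H1T" unfolding d_def using p by (intro H1T_add H1T_scale)
  have "d x = 0 + prim 0 x" if "x \<in> {0..1}" for x using eq[OF that] by (simp add: d_def prim_def)
  from H1I(2)[OF L2.zero_mem this] have "AE x in \<mu>01. wderiv d x = 0 x" by simp
  from nrm2_cong_AE[OF this H1T_repr(3)[OF d] L2.zero_mem] have "nrm2 (wderiv d) = 0" by simp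
  moreover have "AE x in \<mu>01. d x = 0"
    using AE_unit_interval by eventually_elim (use eq in \<open>simp add: d_def\<close>)
  then have "nrm2 d = 0" using nrm2_eq_0[OF H1T_repr(2)[OF d]] by simp
  ultimately have "norm_H1 d = 0" by (simp add: norm_H1_def)
  then have "w d = 0" using Hm1D(4)[OF w] d by force
  then show ?thesis unfolding d_def
    using Hm1D(2)[OF w p(1) H1T_scale(1)[OF p(2)], of "-1"] Hm1D(3)[OF w p(2), of "-1"]
    by simp
qed

section \<open>The operators J and P, and the coordinates of a functional\<close>

definition mean_free :: "(real \<Rightarrow> complex) \<Rightarrow> real \<Rightarrow> complex" where
  "mean_free \<phi> = \<phi> - (\<lambda>x. int01 \<phi>)"

lemma int01_const: "int01 (\<lambda>x. c) = c"
  by (simp add: emeasure_unit_measure space_restrict_space)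

lemma cmod_int01_le: "f \<in> L2 \<Longrightarrow> cmod (int01 f) \<le> nrm2 f"
  using prim_bound[of f 1] by simp

lemma mean_free:
  assumes "\<phi> \<in> L2"
  shows "mean_free \<phi> \<in> L2" "int01 (mean_free \<phi>) = 0" "nrm2 (mean_free \<phi>) \<le> 2 * nrm2 \<phi>"
proof -
  show "mean_free \<phi> \<in> L2" unfolding mean_free_def by (intro L2.diff_mem assms L2_const)
  have "int01 (mean_free \<phi>) = int01 \<phi> - int01 (\<lambda>x. int01 \<phi>)"
    unfolding mean_free_def int01_ip using assms by (intro L2.diff_left) auto
  then show "int01 (mean_free \<phi>) = 0" by (simp only: int01_const) simp
  have "nrm2 (mean_free \<phi>) \<le> nrm2 \<phi> + nrm2 (\<lambda>x. int01 \<phi>)"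
    unfolding mean_free_def by (intro L2.nrm_triangle_diff assms L2_const)
  moreover have "nrm2 (\<lambda>x. int01 \<phi>) \<le> nrm2 \<phi>"
    using cmod_int01_le[OF assms] assms by (intro nrm2_bounded) auto
  ultimately show "nrm2 (mean_free \<phi>) \<le> 2 * nrm2 \<phi>" by simp
qed

text \<open>For a function with mean zero the integral from \<open>x\<close> to 1 is minus the
  integral from 0 to \<open>x\<close>. In this form \<open>J_op \<phi>\<close> is accessible to
  \<open>H1T_I\<close>.\<close>

lemma J_op_eq:
  assumes \<phi>: "\<phi> \<in> L2" and x: "x \<in> {0..1}"
  shows "J_op \<phi> x = - prim (mean_free \<phi>) x"
proof -
  have "J_op \<phi> x = (LINT y|lebesgue. indicator {x<..<1} y *\<^sub>R mean_free \<phi> y)"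
    unfolding J_op_def by (subst integral_restrict_space) (auto simp: mean_free_def)
  also have "\<dots> = (LINT y|lebesgue. indicator {0<..<1} y *\<^sub>R (mean_free \<phi> y * step y x))"
    using x by (intro Bochner_Integration.integral_cong refl) (auto simp: indicator_def step_def)
  also have "\<dots> = int01 (\<lambda>y. mean_free \<phi> y * step y x)"
    by (subst integral_restrict_space) auto
  also have "\<dots> = - prim (mean_free \<phi>) x"
    unfolding int01_tail[OF mean_free(1)[OF \<phi>]] mean_free(2)[OF \<phi>] by simp
  finally show ?thesis .
qed

lemma J_op_H1T:
  assumes \<phi>: "\<phi> \<in> L2"
  shows "J_op \<phi> \<in> H1T" "norm_H1 (J_op \<phi>) \<le> 4 * nrm2 \<phi>"
proof -
  define v where "v = (- 1) *\<^sub>c mean_free \<phi>"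
  have v: "v \<in> L2" unfolding v_def by (intro L2.scale_mem mean_free \<phi>)
  have v0: "int01 v = 0" unfolding v_def using mean_free[OF \<phi>] by simp
  have eq: "J_op \<phi> x = 0 + prim v x" if "x \<in> {0..1}" for x
    unfolding v_def prim_scale[OF mean_free(1)[OF \<phi>]] J_op_eq[OF \<phi> that] by simp
  note J = H1T_I[OF v v0 eq]
  show H: "J_op \<phi> \<in> H1T" by (rule J(1))
  have nv: "nrm2 v = nrm2 (mean_free \<phi>)" unfolding v_def using mean_free(1)[OF \<phi>]
    by (simp only: L2.nrm_scale) simp
  have "nrm2 (wderiv (J_op \<phi>)) = nrm2 v" by (rule nrm2_cong_AE[OF J(2) H1T_repr(3)[OF H] v])
  moreover have "nrm2 (J_op \<phi>) \<le> nrm2 v"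
    using eq prim_bound[OF v] L2_measurable[OF H1T_repr(2)[OF H]] v by (intro nrm2_bounded) auto
  ultimately show "norm_H1 (J_op \<phi>) \<le> 4 * nrm2 \<phi>"
    using norm_H1_le[OF L2.nrm_nonneg[OF H1T_repr(2)[OF H]] L2.nrm_nonneg[OF H1T_repr(3)[OF H]]] mean_free(3)[OF \<phi>] nv
    by simp
qed

lemma mean_free_add:
  assumes "\<phi> \<in> L2" "\<psi> \<in> L2" shows "mean_free (\<phi> + \<psi>) = mean_free \<phi> + mean_free \<psi>"
proof -
  have "int01 (\<phi> + \<psi>) = int01 \<phi> + int01 \<psi>" unfolding int01_ip using assms by (intro L2.add_left) auto
  then show ?thesis by (simp add: mean_free_def fun_eq_iff)
qed

lemma mean_free_scale:
  assumes "\<phi> \<in> L2" shows "mean_free (c *\<^sub>c \<phi>) = c *\<^sub>c mean_free \<phi>"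
proof -
  have "int01 (c *\<^sub>c \<phi>) = c * int01 \<phi>" unfolding int01_ip using assms by (intro L2.scale_left) auto
  then show ?thesis by (simp add: mean_free_def fun_eq_iff algebra_simps)
qed

text \<open>Riesz represents by the sesquilinear \<open>ip_L2\<close>, whereas P is defined by a
  bilinear pairing; the witness is therefore the conjugate of the Riesz vector.\<close>

lemma P_op_exists:
  assumes w: "w \<in> Hm1"
  shows "\<exists>p. p \<in> L2 \<and> (\<forall>\<phi>\<in>L2. int01 (\<lambda>x. p x * \<phi> x) = w (J_op \<phi>))"
proof -
  obtain C where C: "0 \<le> C" "\<forall>\<phi>\<in>H1T. cmod (w \<phi>) \<le> C * norm_H1 \<phi>" using Hm1D(4)[OF w] by blast
  have "\<exists>y\<in>L2. \<forall>\<phi>\<in>L2. w (J_op \<phi>) = ip_L2 \<phi> y"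
  proof (rule L2.Riesz)
    show "L2.lin (\<lambda>\<phi>. w (J_op \<phi>))"
      unfolding L2.lin_def
    proof (intro conjI ballI allI)
      fix \<phi> \<psi> assume p: "\<phi> \<in> L2" "\<psi> \<in> L2"
      have "w (J_op (\<phi> + \<psi>)) = w (J_op \<phi> + J_op \<psi>)"
      proof (rule Hm1_cong[OF w J_op_H1T(1)[OF L2.add_mem[OF p]] H1T_add(1)[OF J_op_H1T(1)[OF p(1)] J_op_H1T(1)[OF p(2)]]])
        fix x :: real assume "x \<in> {0..1}"
        then show "J_op (\<phi> + \<psi>) x = (J_op \<phi> + J_op \<psi>) x"
          using p by (simp add: J_op_eq mean_free_add prim_add mean_free)
      qed
      then show "w (J_op (\<phi> + \<psi>)) = w (J_op \<phi>) + w (J_op \<psi>)"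
        using Hm1D(2)[OF w J_op_H1T(1)[OF p(1)] J_op_H1T(1)[OF p(2)]] by simp
    next
      fix c \<phi> assume p: "\<phi> \<in> L2"
      have "w (J_op (c *\<^sub>c \<phi>)) = w (c *\<^sub>c J_op \<phi>)"
      proof (rule Hm1_cong[OF w J_op_H1T(1)[OF L2.scale_mem[OF p]] H1T_scale(1)[OF J_op_H1T(1)[OF p]]])
        fix x :: real assume "x \<in> {0..1}"
        then show "J_op (c *\<^sub>c \<phi>) x = (c *\<^sub>c J_op \<phi>) x"
          using p by (simp add: J_op_eq mean_free_scale prim_scale mean_free)
      qed
      then show "w (J_op (c *\<^sub>c \<phi>)) = c * w (J_op \<phi>)"
        using Hm1D(3)[OF w J_op_H1T(1)[OF p]] by simp
    qed
    show "cmod (w (J_op \<phi>)) \<le> (C * 4) * nrm2 \<phi>" if p: "\<phi> \<in> L2" for \<phi>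
      using order_trans[OF bspec[OF C(2) J_op_H1T(1)[OF p]] mult_left_mono[OF J_op_H1T(2)[OF p] C(1)]]
      by (simp only: mult.assoc)
  qed
  then obtain y where "y \<in> L2" "\<forall>\<phi>\<in>L2. w (J_op \<phi>) = ip_L2 \<phi> y" by blast
  then show ?thesis by (intro exI[of _ "\<lambda>x. cnj (y x)"]) (auto simp: L2_cnj ip_L2_def mult.commute)
qed

lemma P_op:
  assumes "w \<in> Hm1"
  shows "P_op w \<in> L2" "\<phi> \<in> L2 \<Longrightarrow> int01 (\<lambda>x. P_op w x * \<phi> x) = w (J_op \<phi>)"
  using someI_ex[OF P_op_exists[OF assms]] by (auto simp: P_op_def)

lemma P_op_eqI:
  assumes w: "w \<in> Hm1" and p: "p \<in> L2" "\<And>\<phi>. \<phi> \<in> L2 \<Longrightarrow> int01 (\<lambda>x. p x * \<phi> x) = w (J_op \<phi>)"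
  shows "AE x in \<mu>01. P_op w x = p x"
proof -
  define d where "d = P_op w - p"
  have d: "d \<in> L2" unfolding d_def by (intro L2.diff_mem P_op w p)
  have "ip_L2 d d = ip_L2 (P_op w) d - ip_L2 p d"
    unfolding d_def by (intro L2.diff_left L2.diff_mem P_op w p)
  also have "\<dots> = 0"
    unfolding ip_L2_def using P_op(2)[OF w L2_cnj[OF d]] p(2)[OF L2_cnj[OF d]] by simp
  finally have "nrm2 d = 0" by (simp add: ip_norm_def)
  then have "AE x in \<mu>01. d x = 0" using nrm2_eq_0[OF d] by simp
  then show ?thesis by eventually_elim (simp add: d_def)
qed

text \<open>\<open>J_op\<close> annihilates constants, so the pairing of \<open>P_op w\<close> with
  1 is 0.\<close>

lemma P_op_mean:
  assumes w: "w \<in> Hm1" shows "int01 (P_op w) = 0"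
proof -
  have z: "(\<lambda>x. 0) \<in> H1T" using H1T_scale(1)[OF H1T_const, of 0] by (simp add: cscale_def)
  have m0: "mean_free (\<lambda>x. 1) = 0"
    by (simp add: mean_free_def fun_eq_iff emeasure_unit_measure space_restrict_space)
  have "w (J_op (\<lambda>x. 1)) = w (\<lambda>x. 0)"
  proof (rule Hm1_cong[OF w J_op_H1T(1)[OF L2_const] z])
    fix x :: real assume "x \<in> {0..1}"
    then show "J_op (\<lambda>x. 1) x = 0" using J_op_eq[OF L2_const[of 1], of x] m0 by (simp add: prim_def)
  qed
  also have "\<dots> = 0" using Hm1D(3)[OF w H1T_const, of 0] by (simp add: cscale_def)
  finally show ?thesis using P_op(2)[OF w L2_const[of 1]] by simp
qed

text \<open>On \<open>[0,1]\<close> the function \<open>\<phi>\<close> is the constant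
  \<open>\<phi> 1\<close> plus \<open>J_op\<close> applied to minus its derivative. Hence
  \<open>mu0 w\<close> and \<open>P_op w\<close> determine \<open>w\<close>, which makes the inner
  product definite.\<close>

lemma Hm1_repr:
  assumes w: "w \<in> Hm1" and \<phi>: "\<phi> \<in> H1T"
  shows "w \<phi> = \<phi> 1 * mu0 w - int01 (\<lambda>x. P_op w x * wderiv \<phi> x)"
proof -
  note p = H1T_repr[OF \<phi>]
  define v where "v = (- 1) *\<^sub>c wderiv \<phi>"
  have v: "v \<in> L2" unfolding v_def by (intro L2.scale_mem p)
  have "int01 v = 0" using p(5) by (simp add: v_def)
  then have mf: "mean_free v = v" by (simp add: mean_free_def fun_eq_iff)
  have "w \<phi> = w (\<phi> 1 *\<^sub>c (\<lambda>x. 1) + J_op v)"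
  proof (rule Hm1_cong[OF w \<phi> H1T_add(1)[OF H1T_scale(1)[OF H1T_const] J_op_H1T(1)[OF v]]])
    fix x :: real assume x: "x \<in> {0..1}"
    have "J_op v x = prim (wderiv \<phi>) x"
      unfolding J_op_eq[OF v x] mf unfolding v_def prim_scale[OF p(3)] by simp
    then show "\<phi> x = (\<phi> 1 *\<^sub>c (\<lambda>x. 1) + J_op v) x" using p(6)[OF x] by simp
  qed
  also have "\<dots> = \<phi> 1 * mu0 w + w (J_op v)"
    unfolding Hm1D(2)[OF w H1T_scale(1)[OF H1T_const] J_op_H1T(1)[OF v]] Hm1D(3)[OF w H1T_const] mu0_def ..
  also have "w (J_op v) = - int01 (\<lambda>x. P_op w x * wderiv \<phi> x)"
    unfolding P_op(2)[OF w v, symmetric] by (simp add: v_def)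
  finally show ?thesis by simp
qed

text \<open>Recovers a functional from its coordinates \<open>P_op w\<close> and
  \<open>mu0 w\<close>, see \<open>Hm1_repr\<close>; it realises every pair whose first component
  has mean zero, the condition found in \<open>P_op_mean\<close>.\<close>

definition Hm1_of :: "(real \<Rightarrow> complex) \<Rightarrow> complex \<Rightarrow> functional" where
  "Hm1_of p c = (\<lambda>\<phi>. if \<phi> \<in> H1T then \<phi> 1 * c - int01 (\<lambda>x. p x * wderiv \<phi> x) else 0)"

lemma int01_cong_AE:
  assumes "AE x in \<mu>01. f x = g x" "f \<in> L2" "g \<in> L2" "h \<in> L2"
  shows "int01 (\<lambda>x. h x * f x) = int01 (\<lambda>x. h x * g x)"
proof -
  note [measurable] = L2_measurable[OF assms(2)] L2_measurable[OF assms(3)] L2_measurable[OF assms(4)]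
  show ?thesis
  proof (rule integral_cong_AE)
    show "AE x in \<mu>01. h x * f x = h x * g x" using assms(1) by eventually_elim simp
  qed measurable
qed

text \<open>The mean of \<open>\<phi>\<close> differs from \<open>\<phi> 1\<close> by the mean of a
  primitive of its derivative.\<close>

lemma H1T_trace_bound:
  assumes \<phi>: "\<phi> \<in> H1T" shows "cmod (\<phi> 1) \<le> 2 * norm_H1 \<phi>"
proof -
  note p = H1T_repr[OF \<phi>]
  have pd: "prim (wderiv \<phi>) \<in> L2" using p(3) by simp
  have "int01 \<phi> = int01 (\<lambda>x. \<phi> 1 + prim (wderiv \<phi>) x)"
  proof (rule Bochner_Integration.integral_cong[OF refl])
    show "\<phi> x = \<phi> 1 + prim (wderiv \<phi>) x" if "x \<in> space \<mu>01" for x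
      by (rule p(6)) (use that in \<open>simp add: space_restrict_space\<close>)
  qed
  also have "\<dots> = int01 (\<lambda>x. \<phi> 1) + int01 (prim (wderiv \<phi>))"
    by (intro Bochner_Integration.integral_add L2_integrable L2_const pd)
  finally have "\<phi> 1 = int01 \<phi> - int01 (prim (wderiv \<phi>))" by (simp only: int01_const) simp
  then have "cmod (\<phi> 1) \<le> cmod (int01 \<phi>) + cmod (int01 (prim (wderiv \<phi>)))"
    by (metis norm_triangle_ineq4)
  also have "\<dots> \<le> nrm2 \<phi> + nrm2 (prim (wderiv \<phi>))"
    by (intro add_mono cmod_int01_le p pd)
  also have "nrm2 (prim (wderiv \<phi>)) \<le> nrm2 (wderiv \<phi>)"
    using prim_bound[OF p(3)] L2_measurable[OF pd] p(3) by (intro nrm2_bounded) auto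
  finally show ?thesis using norm_H1_ge[of \<phi>] by simp
qed

lemma int01_Cauchy_Schwarz:
  assumes "f \<in> L2" "g \<in> L2" shows "cmod (int01 (\<lambda>x. f x * g x)) \<le> nrm2 f * nrm2 g"
proof -
  define h where "h = (\<lambda>x. cnj (g x))"
  have h: "h \<in> L2" unfolding h_def by (rule L2_cnj[OF assms(2)])
  have "(nrm2 h)\<^sup>2 = (nrm2 g)\<^sup>2" unfolding nrm2_sq[OF h] nrm2_sq[OF assms(2)] by (simp add: h_def)
  then have "nrm2 h = nrm2 g" using h assms by simp
  then show ?thesis using L2.Cauchy_Schwarz[OF assms(1) h] by (simp add: ip_L2_def h_def)
qed

lemma Hm1_of_mem:
  assumes p: "p \<in> L2" shows "Hm1_of p c \<in> Hm1"
  unfolding Hm1_def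
proof (intro CollectI conjI allI ballI impI)
  fix \<phi> \<psi> assume a: "\<phi> \<in> H1T" "\<psi> \<in> H1T"
  note f = H1T_repr[OF a(1)] and g = H1T_repr[OF a(2)] and fg = H1T_add[OF a]
  have "int01 (\<lambda>x. p x * wderiv (\<phi> + \<psi>) x) = int01 (\<lambda>x. p x * (wderiv \<phi> + wderiv \<psi>) x)"
    by (rule int01_cong_AE[OF fg(2) H1T_repr(3)[OF fg(1)] L2.add_mem[OF f(3) g(3)] p])
  also have "\<dots> = int01 (\<lambda>x. p x * wderiv \<phi> x) + int01 (\<lambda>x. p x * wderiv \<psi> x)"
    unfolding plus_fun_apply distrib_left
    by (intro Bochner_Integration.integral_add L2_mult_integrable p f g)
  finally show "Hm1_of p c (\<phi> + \<psi>) = Hm1_of p c \<phi> + Hm1_of p c \<psi>"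
    using a fg(1) by (simp add: Hm1_of_def algebra_simps)
next
  fix k \<phi> assume a: "\<phi> \<in> H1T"
  note f = H1T_repr[OF a] and s = H1T_scale[OF a, of k]
  have "int01 (\<lambda>x. p x * wderiv (k *\<^sub>c \<phi>) x) = int01 (\<lambda>x. p x * (k *\<^sub>c wderiv \<phi>) x)"
    by (rule int01_cong_AE[OF s(2) H1T_repr(3)[OF s(1)] L2.scale_mem[OF f(3)] p])
  also have "\<dots> = k * int01 (\<lambda>x. p x * wderiv \<phi> x)" by (simp add: mult.left_commute[of _ k])
  finally show "Hm1_of p c (k *\<^sub>c \<phi>) = k * Hm1_of p c \<phi>"
    using a s(1) by (simp add: Hm1_of_def algebra_simps)
next
  have "cmod (Hm1_of p c \<phi>) \<le> (2 * cmod c + nrm2 p) * norm_H1 \<phi>" if a: "\<phi> \<in> H1T" for \<phi>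
  proof -
    have "cmod (Hm1_of p c \<phi>) \<le> cmod (\<phi> 1 * c) + cmod (int01 (\<lambda>x. p x * wderiv \<phi> x))"
      using a by (simp add: Hm1_of_def norm_triangle_ineq4)
    also have "cmod (\<phi> 1 * c) \<le> 2 * norm_H1 \<phi> * cmod c"
      unfolding norm_mult using H1T_trace_bound[OF a] by (intro mult_right_mono) auto
    also have "cmod (int01 (\<lambda>x. p x * wderiv \<phi> x)) \<le> nrm2 p * norm_H1 \<phi>"
      using int01_Cauchy_Schwarz[OF p H1T_repr(3)[OF a]] mult_left_mono[OF norm_H1_ge(2)[of \<phi>] L2.nrm_nonneg[OF p]]
      by linarith
    finally show ?thesis by (simp add: algebra_simps)
  qed
  then show "\<exists>C. \<forall>\<phi>\<in>H1T. cmod (Hm1_of p c \<phi>) \<le> C * norm_H1 \<phi>" by blast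
qed (simp add: Hm1_of_def)

lemma mu0_Hm1_of:
  assumes p: "p \<in> L2" shows "mu0 (Hm1_of p c) = c"
proof -
  have "(1 :: complex) = 1 + prim 0 x" for x by (simp add: prim_def)
  then have "AE x in \<mu>01. wderiv (\<lambda>x. 1) x = 0 x" by (rule H1I(2)[OF L2.zero_mem])
  from int01_cong_AE[OF this H1T_repr(3)[OF H1T_const] L2.zero_mem p]
  show ?thesis using H1T_const by (simp add: mu0_def Hm1_of_def)
qed

lemma P_op_Hm1_of:
  assumes p: "p \<in> L2" "int01 p = 0" shows "AE x in \<mu>01. P_op (Hm1_of p c) x = p x"
proof (rule P_op_eqI[OF Hm1_of_mem[OF p(1)] p(1)])
  fix \<phi> assume \<phi>: "\<phi> \<in> L2"
  define v where "v = (- 1) *\<^sub>c mean_free \<phi>"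
  have v: "v \<in> L2" unfolding v_def by (intro L2.scale_mem mean_free \<phi>)
  have v0: "int01 v = 0" unfolding v_def using mean_free[OF \<phi>] by simp
  have eq: "J_op \<phi> x = 0 + prim v x" if "x \<in> {0..1}" for x
    unfolding v_def prim_scale[OF mean_free(1)[OF \<phi>]] J_op_eq[OF \<phi> that] by simp
  note J = H1T_I[OF v v0 eq]
  have "J_op \<phi> 1 = 0" using eq[of 1] v0 by simp
  then have "Hm1_of p c (J_op \<phi>) = - int01 (\<lambda>x. p x * v x)"
    using J(1) int01_cong_AE[OF J(2) H1T_repr(3)[OF J(1)] v p(1)] by (simp add: Hm1_of_def)
  also have "\<dots> = int01 (\<lambda>x. p x * \<phi> x - int01 \<phi> * p x)"
    by (subst Bochner_Integration.integral_minus[symmetric]) (simp add: v_def mean_free_def algebra_simps)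
  also have "\<dots> = int01 (\<lambda>x. p x * \<phi> x) - int01 (\<lambda>x. int01 \<phi> * p x)"
    by (intro Bochner_Integration.integral_diff L2_mult_integrable integrable_mult_right L2_integrable p \<phi>)
  finally show "int01 (\<lambda>x. p x * \<phi> x) = Hm1_of p c (J_op \<phi>)" using p(2) by simp
qed

section \<open>The Hilbert space of functionals\<close>

lemma Hm1_subspace:
  shows "0 \<in> Hm1" "v \<in> Hm1 \<Longrightarrow> w \<in> Hm1 \<Longrightarrow> v + w \<in> Hm1" "w \<in> Hm1 \<Longrightarrow> c *\<^sub>c w \<in> Hm1"
proof -
  show "0 \<in> Hm1" unfolding Hm1_def by (auto intro: exI[of _ 0])
  show "v + w \<in> Hm1" if v: "v \<in> Hm1" and w: "w \<in> Hm1"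
  proof -
    obtain C D where C: "\<forall>\<phi>\<in>H1T. cmod (v \<phi>) \<le> C * norm_H1 \<phi>" and D: "\<forall>\<phi>\<in>H1T. cmod (w \<phi>) \<le> D * norm_H1 \<phi>"
      using Hm1D(4)[OF v] Hm1D(4)[OF w] by blast
    have "cmod ((v + w) \<phi>) \<le> (C + D) * norm_H1 \<phi>" if "\<phi> \<in> H1T" for \<phi>
      using norm_triangle_ineq[of "v \<phi>" "w \<phi>"] bspec[OF C that] bspec[OF D that]
      by (simp add: distrib_right)
    then have "\<exists>C. \<forall>\<phi>\<in>H1T. cmod ((v + w) \<phi>) \<le> C * norm_H1 \<phi>" by blast
    then show ?thesis unfolding Hm1_def
      using Hm1D[OF v] Hm1D[OF w] by (simp add: algebra_simps)
  qed
  show "c *\<^sub>c w \<in> Hm1" if w: "w \<in> Hm1"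
  proof -
    obtain D where D: "\<forall>\<phi>\<in>H1T. cmod (w \<phi>) \<le> D * norm_H1 \<phi>" using Hm1D(4)[OF w] by blast
    have "cmod ((c *\<^sub>c w) \<phi>) \<le> (cmod c * D) * norm_H1 \<phi>" if "\<phi> \<in> H1T" for \<phi>
      using mult_left_mono[OF bspec[OF D that], of "cmod c"] by (simp add: norm_mult mult.assoc)
    then have "\<exists>C. \<forall>\<phi>\<in>H1T. cmod ((c *\<^sub>c w) \<phi>) \<le> C * norm_H1 \<phi>" by blast
    then show ?thesis unfolding Hm1_def
      using Hm1D[OF w] by (simp add: algebra_simps)
  qed
qed

lemma P_op_add:
  assumes "v \<in> Hm1" "w \<in> Hm1" shows "AE x in \<mu>01. P_op (v + w) x = (P_op v + P_op w) x"
proof (rule P_op_eqI[OF Hm1_subspace(2)[OF assms] L2.add_mem[OF P_op(1)[OF assms(1)] P_op(1)[OF assms(2)]]])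
  fix \<phi> assume "\<phi> \<in> L2"
  then have "int01 (\<lambda>x. (P_op v + P_op w) x * \<phi> x) = int01 (\<lambda>x. P_op v x * \<phi> x) + int01 (\<lambda>x. P_op w x * \<phi> x)"
    unfolding plus_fun_apply distrib_right
    by (intro Bochner_Integration.integral_add L2_mult_integrable P_op assms)
  then show "int01 (\<lambda>x. (P_op v + P_op w) x * \<phi> x) = (v + w) (J_op \<phi>)"
    using P_op(2)[OF assms(1) \<open>\<phi> \<in> L2\<close>] P_op(2)[OF assms(2) \<open>\<phi> \<in> L2\<close>] by simp
qed

lemma P_op_scale:
  assumes "w \<in> Hm1" shows "AE x in \<mu>01. P_op (c *\<^sub>c w) x = (c *\<^sub>c P_op w) x"
proof (rule P_op_eqI[OF Hm1_subspace(3)[OF assms] L2.scale_mem[OF P_op(1)[OF assms]]])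
  fix \<phi> assume "\<phi> \<in> L2"
  then show "int01 (\<lambda>x. (c *\<^sub>c P_op w) x * \<phi> x) = (c *\<^sub>c w) (J_op \<phi>)"
    using P_op(2)[OF assms] by (simp add: mult.assoc)
qed

lemma Hm1_ip_space: "ip_space Hm1 ip_Hm1"
proof
  show "ip_Hm1 (u + v) w = ip_Hm1 u w + ip_Hm1 v w" if "u \<in> Hm1" "v \<in> Hm1" "w \<in> Hm1" for u v w
  proof -
    have "ip_L2 (P_op (u + v)) (P_op w) = ip_L2 (P_op u + P_op v) (P_op w)"
      using that by (intro ip_L2_cong_AE P_op_add AE_I2 refl P_op L2.add_mem Hm1_subspace)
    then show ?thesis using that by (simp add: ip_Hm1_def L2.add_left P_op mu0_def algebra_simps)
  qed
  show "ip_Hm1 (c *\<^sub>c u) w = c * ip_Hm1 u w" if "u \<in> Hm1" "w \<in> Hm1" for c u w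
  proof -
    have "ip_L2 (P_op (c *\<^sub>c u)) (P_op w) = ip_L2 (c *\<^sub>c P_op u) (P_op w)"
      using that by (intro ip_L2_cong_AE P_op_scale AE_I2 refl P_op L2.scale_mem Hm1_subspace)
    then show ?thesis using that by (simp add: ip_Hm1_def P_op mu0_def algebra_simps)
  qed
  show "cnj (ip_Hm1 u w) = ip_Hm1 w u" if "u \<in> Hm1" "w \<in> Hm1" for u w
    using that by (simp add: ip_Hm1_def L2.cnj_sym P_op mult.commute)
  show "0 \<le> Re (ip_Hm1 u u)" if "u \<in> Hm1" for u
    using that by (simp add: ip_Hm1_def P_op complex_mult_cnj)
  show "u = 0" if u: "u \<in> Hm1" and 0: "ip_Hm1 u u = 0" for u
  proof -
    have "Re (ip_L2 (P_op u) (P_op u)) + (cmod (mu0 u))\<^sup>2 = 0"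
      using arg_cong[OF 0, of Re] by (simp add: ip_Hm1_def complex_mult_cnj cmod_power2)
    moreover have "0 \<le> Re (ip_L2 (P_op u) (P_op u))" by (intro L2.nonneg P_op u)
    moreover have "0 \<le> (cmod (mu0 u))\<^sup>2" by simp
    ultimately have "Re (ip_L2 (P_op u) (P_op u)) = 0" and m: "(cmod (mu0 u))\<^sup>2 = 0" by linarith+
    then have "nrm2 (P_op u) = 0" by (simp add: ip_norm_def)
    then have AE: "AE x in \<mu>01. P_op u x = 0 x" using nrm2_eq_0[OF P_op(1)[OF u]] by simp
    show "u = 0"
    proof
      fix \<phi>
      show "u \<phi> = 0 \<phi>"
      proof (cases "\<phi> \<in> H1T")
        case True
        have "int01 (\<lambda>x. wderiv \<phi> x * P_op u x) = int01 (\<lambda>x. wderiv \<phi> x * 0 x)"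
          by (rule int01_cong_AE[OF AE P_op(1)[OF u] L2.zero_mem H1T_repr(3)[OF True]])
        then show ?thesis using Hm1_repr[OF u True] m by (simp add: mult.commute)
      qed (simp add: Hm1D(1)[OF u])
    qed
  qed
qed (use Hm1_subspace in auto)

interpretation Hm1: ip_space Hm1 ip_Hm1
  by (rule Hm1_ip_space)

lemma nrm_Hm1_sq: "w \<in> Hm1 \<Longrightarrow> (Hm1.nrm w)\<^sup>2 = (nrm2 (P_op w))\<^sup>2 + (cmod (mu0 w))\<^sup>2"
  by (simp add: Hm1.nrm_sq L2.nrm_sq P_op) (simp add: ip_Hm1_def complex_mult_cnj cmod_power2)

lemma nrm_Hm1_ge:
  assumes "w \<in> Hm1" shows "nrm2 (P_op w) \<le> Hm1.nrm w" "cmod (mu0 w) \<le> Hm1.nrm w"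
proof -
  have "(nrm2 (P_op w))\<^sup>2 \<le> (Hm1.nrm w)\<^sup>2" "(cmod (mu0 w))\<^sup>2 \<le> (Hm1.nrm w)\<^sup>2"
    unfolding nrm_Hm1_sq[OF assms] by simp_all
  then show "nrm2 (P_op w) \<le> Hm1.nrm w" "cmod (mu0 w) \<le> Hm1.nrm w"
    using Hm1.nrm_nonneg[OF assms] by (auto intro: power2_le_imp_le)
qed

lemma P_op_diff_nrm:
  assumes v: "v \<in> Hm1" and w: "w \<in> Hm1" shows "nrm2 (P_op v - P_op w) = nrm2 (P_op (v - w))"
proof -
  have "AE x in \<mu>01. P_op (v + (- 1) *\<^sub>c w) x = (P_op v + P_op ((- 1) *\<^sub>c w)) x"
    by (rule P_op_add[OF v Hm1_subspace(3)[OF w]])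
  with P_op_scale[OF w, of "-1"] have "AE x in \<mu>01. P_op (v - w) x = (P_op v - P_op w) x"
    by eventually_elim simp
  then show ?thesis
    by (intro nrm2_cong_AE[of "P_op (v - w)" "P_op v - P_op w", symmetric] P_op L2.diff_mem Hm1.diff_mem v w)
qed

text \<open>Both coordinates converge, and \<open>Hm1_of\<close> turns their limits into a
  functional, since mean zero survives the limit in L2. Convergence of \<open>mu0\<close> is
  recorded because \<open>H_space\<close> may impose \<open>mu0 w = 0\<close>.\<close>

lemma Hm1_complete:
  assumes \<sigma>: "\<And>n. \<sigma> n \<in> Hm1" and Cauchy: "Hm1.Cauchy_seq \<sigma>"
  shows "\<exists>w\<in>Hm1. (\<lambda>n. Hm1.nrm (\<sigma> n - w)) \<longlonglongrightarrow> 0 \<and> (\<lambda>n. mu0 (\<sigma> n)) \<longlonglongrightarrow> mu0 w"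
proof -
  have "L2.Cauchy_seq (\<lambda>n. P_op (\<sigma> n))"
    unfolding L2.Cauchy_seq_def
  proof (intro allI impI)
    fix \<epsilon> :: real assume "0 < \<epsilon>"
    then obtain N where "\<forall>m\<ge>N. \<forall>n\<ge>N. Hm1.nrm (\<sigma> m - \<sigma> n) < \<epsilon>" using Cauchy
      unfolding Hm1.Cauchy_seq_def by blast
    moreover have "nrm2 (P_op (\<sigma> m) - P_op (\<sigma> n)) \<le> Hm1.nrm (\<sigma> m - \<sigma> n)" for m n
      unfolding P_op_diff_nrm[OF \<sigma> \<sigma>] by (intro nrm_Hm1_ge Hm1.diff_mem \<sigma>)
    ultimately show "\<exists>N. \<forall>m\<ge>N. \<forall>n\<ge>N. nrm2 (P_op (\<sigma> m) - P_op (\<sigma> n)) < \<epsilon>" by (meson le_less_trans)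
  qed
  then obtain p where p: "p \<in> L2" and lim: "(\<lambda>n. nrm2 (P_op (\<sigma> n) - p)) \<longlonglongrightarrow> 0"
    using L2_complete[of "\<lambda>n. P_op (\<sigma> n)"] P_op(1)[OF \<sigma>] by blast
  have "Cauchy (\<lambda>n. mu0 (\<sigma> n))"
  proof (rule metric_CauchyI)
    fix \<epsilon> :: real assume "0 < \<epsilon>"
    then obtain N where "\<forall>m\<ge>N. \<forall>n\<ge>N. Hm1.nrm (\<sigma> m - \<sigma> n) < \<epsilon>" using Cauchy
      unfolding Hm1.Cauchy_seq_def by blast
    moreover have "dist (mu0 (\<sigma> m)) (mu0 (\<sigma> n)) \<le> Hm1.nrm (\<sigma> m - \<sigma> n)" for m n
      using nrm_Hm1_ge(2)[OF Hm1.diff_mem[OF \<sigma> \<sigma>], of m n] by (simp add: dist_norm mu0_def)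
    ultimately show "\<exists>N. \<forall>m\<ge>N. \<forall>n\<ge>N. dist (mu0 (\<sigma> m)) (mu0 (\<sigma> n)) < \<epsilon>" by (meson le_less_trans)
  qed
  then obtain c where c: "(\<lambda>n. mu0 (\<sigma> n)) \<longlonglongrightarrow> c" using Cauchy_convergent convergentD by blast
  have "(\<lambda>n. ip_L2 (P_op (\<sigma> n)) (\<lambda>x. 1)) \<longlonglongrightarrow> ip_L2 p (\<lambda>x. 1)"
    by (rule L2.tendsto_ip_left[OF lim P_op(1)[OF \<sigma>] p L2_const])
  then have p0: "int01 p = 0"
    using P_op_mean[OF \<sigma>] LIMSEQ_unique[OF _ tendsto_const[of 0]] by (simp add: int01_ip)
  define w where "w = Hm1_of p c"
  have w: "w \<in> Hm1" unfolding w_def by (rule Hm1_of_mem[OF p])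
  have mw: "mu0 w = c" unfolding w_def by (rule mu0_Hm1_of[OF p])
  have AE: "AE x in \<mu>01. P_op w x = p x" unfolding w_def by (rule P_op_Hm1_of[OF p p0])
  have "(\<lambda>n. sqrt ((nrm2 (P_op (\<sigma> n) - p))\<^sup>2 + (cmod (mu0 (\<sigma> n) - c))\<^sup>2)) \<longlonglongrightarrow> sqrt (0\<^sup>2 + (cmod (c - c))\<^sup>2)"
    by (intro tendsto_intros lim c)
  then have lim': "(\<lambda>n. sqrt ((nrm2 (P_op (\<sigma> n) - p))\<^sup>2 + (cmod (mu0 (\<sigma> n) - c))\<^sup>2)) \<longlonglongrightarrow> 0" by simp
  have "Hm1.nrm (\<sigma> n - w) = sqrt ((nrm2 (P_op (\<sigma> n) - p))\<^sup>2 + (cmod (mu0 (\<sigma> n) - c))\<^sup>2)" for n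
  proof -
    have "AE x in \<mu>01. (P_op (\<sigma> n) - P_op w) x = (P_op (\<sigma> n) - p) x" using AE by eventually_elim simp
    then have "nrm2 (P_op (\<sigma> n) - P_op w) = nrm2 (P_op (\<sigma> n) - p)"
      by (intro nrm2_cong_AE L2.diff_mem P_op \<sigma> w p)
    moreover have "mu0 (\<sigma> n - w) = mu0 (\<sigma> n) - c" using mw by (simp add: mu0_def)
    ultimately have "(Hm1.nrm (\<sigma> n - w))\<^sup>2 = (nrm2 (P_op (\<sigma> n) - p))\<^sup>2 + (cmod (mu0 (\<sigma> n) - c))\<^sup>2"
      using nrm_Hm1_sq[OF Hm1.diff_mem[OF \<sigma> w]] P_op_diff_nrm[OF \<sigma> w] by simp
    then show ?thesis using Hm1.nrm_nonneg[OF Hm1.diff_mem[OF \<sigma> w]] by (simp add: real_sqrt_unique)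
  qed
  then have "(\<lambda>n. Hm1.nrm (\<sigma> n - w)) \<longlonglongrightarrow> 0" using lim' by (simp only:)
  then show ?thesis using w c mw by blast
qed

section \<open>The embedding of L2\<close>

lemma emb_Hm1:
  assumes f: "f \<in> L2" shows "emb f \<in> Hm1"
  unfolding Hm1_def
proof (intro CollectI conjI allI ballI impI)
  fix \<phi> \<psi> assume a: "\<phi> \<in> H1T" "\<psi> \<in> H1T"
  have "int01 (\<lambda>x. f x * (\<phi> + \<psi>) x) = int01 (\<lambda>x. f x * \<phi> x) + int01 (\<lambda>x. f x * \<psi> x)"
    unfolding plus_fun_apply distrib_left
    by (intro Bochner_Integration.integral_add L2_mult_integrable f H1T_repr a)
  then show "emb f (\<phi> + \<psi>) = emb f \<phi> + emb f \<psi>" using a H1T_add(1)[OF a] by (simp add: emb_def)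
next
  fix c \<phi> assume a: "\<phi> \<in> H1T"
  then show "emb f (c *\<^sub>c \<phi>) = c * emb f \<phi>" using H1T_scale(1)[OF a]
    by (simp add: emb_def mult.left_commute[of _ c])
next
  have "cmod (emb f \<phi>) \<le> nrm2 f * norm_H1 \<phi>" if a: "\<phi> \<in> H1T" for \<phi>
    using int01_Cauchy_Schwarz[OF f H1T_repr(2)[OF a]] mult_left_mono[OF norm_H1_ge(1)[of \<phi>] L2.nrm_nonneg[OF f]] a
    by (simp add: emb_def)
  then show "\<exists>C. \<forall>\<phi>\<in>H1T. cmod (emb f \<phi>) \<le> C * norm_H1 \<phi>" by blast
qed (simp add: emb_def)

lemma mu0_emb: "mu0 (emb f) = int01 f"
  using H1T_const by (simp add: mu0_def emb_def)

lemma ramp_L2 [simp]: "(\<lambda>x. complex_of_real (1 - x)) \<in> L2"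
  by (intro L2_continuous continuous_intros)

lemma mu1_ip: "mu1 f = ip_L2 f (\<lambda>x. complex_of_real (1 - x))"
  by (simp add: mu1_def ip_L2_def mult.commute)

lemma prim_const:
  assumes "x \<in> {0..1}" shows "prim (\<lambda>y. c) x = c * complex_of_real x"
proof -
  have "((\<lambda>x. c * complex_of_real x) has_vector_derivative c) (at x within {0..1})" for x
    by (auto intro!: derivative_eq_intros)
  from FTC_prim[OF this _ assms] show ?thesis by simp
qed

lemma int01_prim: assumes f: "f \<in> L2" shows "int01 (prim f) = mu1 f"
proof -
  have "int01 (prim f) = int01 (\<lambda>x. 1 * prim f x)" by simp
  also have "\<dots> = int01 (\<lambda>y. f y * (int01 (\<lambda>x. 1) - prim (\<lambda>x. 1) y))" by (rule Fubini_prim[OF L2_const f])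
  also have "\<dots> = mu1 f"
    unfolding mu1_def int01_const
    by (intro Bochner_Integration.integral_cong refl) (simp add: space_restrict_space prim_const mult.commute)
  finally show ?thesis .
qed

text \<open>P on L2 in closed form: the primitive minus its mean (\<open>int01_prim\<close>). Unlike
  the chosen representative \<open>P_op (emb f)\<close> it has meaningful values at every point, on
  which the pointwise use of Bessel's inequality relies.\<close>

definition P_fun :: "(real \<Rightarrow> complex) \<Rightarrow> real \<Rightarrow> complex" where
  "P_fun f x = prim f x - mu1 f"

lemma P_fun_L2: "f \<in> L2 \<Longrightarrow> P_fun f \<in> L2"
  unfolding P_fun_def by (rule L2_continuous) (intro continuous_intros prim_continuous)

lemma P_op_emb:
  assumes f: "f \<in> L2" shows "AE x in \<mu>01. P_op (emb f) x = P_fun f x"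
proof (rule P_op_eqI[OF emb_Hm1[OF f] P_fun_L2[OF f]])
  fix \<phi> assume \<phi>: "\<phi> \<in> L2"
  note m = mean_free[OF \<phi>]
  have pf: "prim f \<in> L2" using f by simp
  have "emb f (J_op \<phi>) = int01 (\<lambda>x. - (f x * prim (mean_free \<phi>) x))"
    using J_op_H1T(1)[OF \<phi>] J_op_eq[OF \<phi>] unfolding emb_def
    by (simp del: Bochner_Integration.integral_minus) (intro Bochner_Integration.integral_cong refl, simp add: space_restrict_space)
  also have "\<dots> = - int01 (\<lambda>y. mean_free \<phi> y * (int01 f - prim f y))"
    unfolding Bochner_Integration.integral_minus Fubini_prim[OF f m(1)] ..
  also have "int01 (\<lambda>y. mean_free \<phi> y * (int01 f - prim f y)) = int01 (\<lambda>y. int01 f * mean_free \<phi> y) - int01 (\<lambda>y. mean_free \<phi> y * prim f y)"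
    unfolding right_diff_distrib mult.commute[of _ "int01 f"]
    by (intro Bochner_Integration.integral_diff integrable_mult_right L2_integrable L2_mult_integrable m pf)
  also have "int01 (\<lambda>y. int01 f * mean_free \<phi> y) = 0" using m(2) by simp
  also have "int01 (\<lambda>y. mean_free \<phi> y * prim f y) = int01 (\<lambda>y. \<phi> y * prim f y) - int01 (\<lambda>y. int01 \<phi> * prim f y)"
    unfolding mean_free_def minus_apply left_diff_distrib
    by (intro Bochner_Integration.integral_diff integrable_mult_right L2_integrable L2_mult_integrable \<phi> pf)
  also have "int01 (\<lambda>y. int01 \<phi> * prim f y) = int01 (\<lambda>y. mu1 f * \<phi> y)"
    using int01_prim[OF f] by simp
  also have "- (0 - (int01 (\<lambda>y. \<phi> y * prim f y) - int01 (\<lambda>y. mu1 f * \<phi> y))) = int01 (\<lambda>y. \<phi> y * prim f y) - int01 (\<lambda>y. mu1 f * \<phi> y)"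
    by simp
  also have "\<dots> = int01 (\<lambda>y. \<phi> y * prim f y - mu1 f * \<phi> y)"
    by (intro Bochner_Integration.integral_diff[symmetric] integrable_mult_right L2_integrable L2_mult_integrable \<phi> pf)
  also have "\<dots> = int01 (\<lambda>x. P_fun f x * \<phi> x)" by (simp add: P_fun_def algebra_simps)
  finally show "int01 (\<lambda>x. P_fun f x * \<phi> x) = emb f (J_op \<phi>)" by simp
qed

text \<open>Equal embeddings have equal \<open>P_fun\<close>, first almost everywhere and then on
  \<open>[0,1]\<close> by continuity; the value at 0 gives equal \<open>mu1\<close>, hence equal
  primitives.\<close>

lemma emb_eq_iff:
  assumes f: "f \<in> L2" and g: "g \<in> L2"
  shows "emb f = emb g \<longleftrightarrow> (AE x in \<mu>01. f x = g x)"
proof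
  assume eq: "emb f = emb g"
  have AE: "AE x in \<mu>01. P_fun f x = P_fun g x"
    using P_op_emb[OF f] P_op_emb[OF g] unfolding eq by eventually_elim simp
  have P: "P_fun f x = P_fun g x" if "x \<in> {0..1}" for x
  proof (rule continuous_AE_eq[OF _ _ AE that])
    show "continuous_on {0..1} (P_fun f)" unfolding P_fun_def
      by (intro continuous_intros prim_continuous f)
    show "continuous_on {0..1} (P_fun g)" unfolding P_fun_def
      by (intro continuous_intros prim_continuous g)
  qed
  have "mu1 f = mu1 g" using P[of 0] by (simp add: P_fun_def)
  then have "prim (f - g) x = 0" if "x \<in> {0..1}" for x
    using P[OF that] by (simp add: prim_diff[OF f g] P_fun_def)
  then have "AE x in \<mu>01. (f - g) x = 0" by (intro prim_eq_0_imp_AE[of "f - g"] L2.diff_mem f g)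
  then show "AE x in \<mu>01. f x = g x" by eventually_elim simp
next
  assume AE: "AE x in \<mu>01. f x = g x"
  show "emb f = emb g"
  proof
    fix \<phi> show "emb f \<phi> = emb g \<phi>"
      using int01_cong_AE[OF AE f g H1T_repr(2)] by (simp add: emb_def mult.commute)
  qed
qed

lemma rep_emb:
  assumes f: "f \<in> L2"
  shows "rep (emb f) \<in> L2" "emb (rep (emb f)) = emb f" "AE x in \<mu>01. rep (emb f) x = f x"
proof -
  have "\<exists>g. g \<in> L2 \<and> emb g = emb f" using f by blast
  from someI_ex[OF this] show "rep (emb f) \<in> L2" "emb (rep (emb f)) = emb f" by (auto simp: rep_def)
  then show "AE x in \<mu>01. rep (emb f) x = f x" using emb_eq_iff f by blast
qed

lemma emb_add: "f \<in> L2 \<Longrightarrow> g \<in> L2 \<Longrightarrow> emb (f + g) = emb f + emb g"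
proof
  fix \<phi> assume f: "f \<in> L2" and g: "g \<in> L2"
  show "emb (f + g) \<phi> = (emb f + emb g) \<phi>"
  proof (cases "\<phi> \<in> H1T")
    case True
    have "int01 (\<lambda>x. (f + g) x * \<phi> x) = int01 (\<lambda>x. f x * \<phi> x) + int01 (\<lambda>x. g x * \<phi> x)"
      unfolding plus_fun_apply distrib_right
      by (intro Bochner_Integration.integral_add L2_mult_integrable f g H1T_repr True)
    then show ?thesis using True by (simp add: emb_def)
  qed (simp add: emb_def)
qed

lemma emb_scale: "emb (c *\<^sub>c f) = c *\<^sub>c emb f"
  by (simp add: emb_def fun_eq_iff mult.assoc)

lemma ip_emb_L2_emb: "f \<in> L2 \<Longrightarrow> g \<in> L2 \<Longrightarrow> ip_emb_L2 (emb f) (emb g) = ip_L2 f g"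
  unfolding ip_emb_L2_def by (intro ip_L2_cong_AE rep_emb)

text \<open>Integration by parts moves P away from \<open>h\<close>, so that \<open>h\<close> enters
  only through itself and its mean. The boundary term and the constant \<open>mu1 h\<close> in
  \<open>P_fun h\<close> both disappear because \<open>P_op w\<close> has mean zero.\<close>

lemma ip_Hm1_emb:
  assumes w: "w \<in> Hm1" and h: "h \<in> L2"
  shows "ip_Hm1 w (emb h) = ip_L2 (- prim (P_op w)) h + mu0 w * cnj (mu0 (emb h))"
proof -
  define p where "p = P_op w"
  have p: "p \<in> L2" and p0: "int01 p = 0" using P_op(1)[OF w] P_op_mean[OF w] by (auto simp: p_def)
  have hc: "(\<lambda>x. cnj (h x)) \<in> L2" by (rule L2_cnj[OF h])
  have cnj_prim: "cnj (prim h x) = prim (\<lambda>x. cnj (h x)) x" for x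
  proof -
    have "cnj (step x y) = step x y" for y by (simp add: step_def)
    then show ?thesis unfolding prim_def by (subst Bochner_Integration.integral_cnj[symmetric]) simp
  qed
  have "ip_L2 p (P_op (emb h)) = ip_L2 p (P_fun h)"
    by (intro ip_L2_cong_AE AE_I2 refl P_op_emb P_op P_fun_L2 emb_Hm1 h p)
  also have "\<dots> = int01 (\<lambda>x. p x * prim (\<lambda>x. cnj (h x)) x - cnj (mu1 h) * p x)"
    unfolding ip_L2_def by (simp add: P_fun_def cnj_prim algebra_simps)
  also have "\<dots> = int01 (\<lambda>x. p x * prim (\<lambda>x. cnj (h x)) x) - int01 (\<lambda>x. cnj (mu1 h) * p x)"
    by (intro Bochner_Integration.integral_diff integrable_mult_right L2_integrable L2_mult_integrable p prim_L2 hc)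
  also have "\<dots> = int01 (\<lambda>y. cnj (h y) * (int01 p - prim p y))"
    unfolding Fubini_prim[OF p hc] using p0 by simp
  also have "\<dots> = ip_L2 (- prim p) h" using p0 by (simp add: ip_L2_def mult.commute)
  finally show ?thesis by (simp add: ip_Hm1_def p_def)
qed

section \<open>The form on \<open>V_space Y\<close>\<close>

lemma ip_C2_eq: "ip_C2 x y = x $ 1 * cnj (y $ 1) + x $ 2 * cnj (y $ 2)"
  by (simp add: ip_C2_def sum_2)

lemma Gamma1_nth [simp]: "Gamma1 f $ 1 = int01 f" "Gamma1 f $ 2 = mu1 f"
  by (simp_all add: Gamma1_def mu0_emb)

lemma vec2_eqI: "x $ 1 = y $ 1 \<Longrightarrow> x $ 2 = y $ 2 \<Longrightarrow> x = (y :: complex^2)"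
  by (simp add: vec_eq_iff forall_2)

lemma Gamma1_add:
  assumes "f \<in> L2" "g \<in> L2" shows "Gamma1 (f + g) = Gamma1 f + Gamma1 g"
proof (rule vec2_eqI)
  show "Gamma1 (f + g) $ 1 = (Gamma1 f + Gamma1 g) $ 1"
    unfolding vector_add_component Gamma1_nth int01_ip by (rule L2.add_left[OF assms L2_const])
  show "Gamma1 (f + g) $ 2 = (Gamma1 f + Gamma1 g) $ 2"
    unfolding vector_add_component Gamma1_nth mu1_ip by (rule L2.add_left[OF assms ramp_L2])
qed

lemma Gamma1_scale:
  assumes "f \<in> L2" shows "Gamma1 (c *\<^sub>c f) = c *s Gamma1 f"
proof (rule vec2_eqI)
  show "Gamma1 (c *\<^sub>c f) $ 1 = (c *s Gamma1 f) $ 1"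
    unfolding vector_smult_component Gamma1_nth int01_ip by (rule L2.scale_left[OF assms L2_const])
  show "Gamma1 (c *\<^sub>c f) $ 2 = (c *s Gamma1 f) $ 2"
    unfolding vector_smult_component Gamma1_nth mu1_ip by (rule L2.scale_left[OF assms ramp_L2])
qed

lemma Gamma1_cong_AE:
  assumes "AE x in \<mu>01. f x = g x" "f \<in> L2" "g \<in> L2" shows "Gamma1 f = Gamma1 g"
proof (rule vec2_eqI)
  show "Gamma1 f $ 1 = Gamma1 g $ 1"
    unfolding Gamma1_nth int01_ip by (intro ip_L2_cong_AE assms L2_const AE_I2 refl)
  show "Gamma1 f $ 2 = Gamma1 g $ 2"
    unfolding Gamma1_nth mu1_ip by (intro ip_L2_cong_AE assms ramp_L2 AE_I2 refl)
qed

text \<open>The value at \<open>c\<close> of the adjoint of \<open>Gamma1\<close> (see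
  \<open>ip_affine_fun\<close>): in L2 the functionals \<open>mu0\<close> and \<open>mu1\<close> are
  represented by 1 and \<open>1 - x\<close>.\<close>

definition affine_fun :: "complex^2 \<Rightarrow> real \<Rightarrow> complex" where
  "affine_fun c = (c $ 1) *\<^sub>c (\<lambda>x. 1) + (c $ 2) *\<^sub>c (\<lambda>x. complex_of_real (1 - x))"

lemma affine_fun_apply: "affine_fun c x = c $ 1 + c $ 2 * complex_of_real (1 - x)"
  by (simp add: affine_fun_def)

lemma affine_fun_L2 [simp]: "affine_fun c \<in> L2"
  unfolding affine_fun_def by (intro L2.add_mem L2.scale_mem L2_const ramp_L2)

lemma ip_affine_fun:
  assumes h: "h \<in> L2" shows "ip_L2 (affine_fun c) h = ip_C2 c (Gamma1 h)"
proof -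
  have "ip_L2 (affine_fun c) h = c $ 1 * ip_L2 (\<lambda>x. 1) h + c $ 2 * ip_L2 (\<lambda>x. complex_of_real (1 - x)) h"
    unfolding affine_fun_def using h
    by (simp only: L2.add_left L2.scale_left L2.scale_mem L2_const ramp_L2)
  also have "ip_L2 (\<lambda>x. 1) h = cnj (int01 h)" using L2.cnj_sym[OF h L2_const[of 1]]
    by (simp only: int01_ip)
  also have "ip_L2 (\<lambda>x. complex_of_real (1 - x)) h = cnj (mu1 h)" using L2.cnj_sym[OF h ramp_L2]
    by (simp only: mu1_ip)
  finally show ?thesis by (simp add: ip_C2_eq)
qed

lemma int01_FTC:
  assumes "\<And>x. (f has_vector_derivative f' x) (at x)" "continuous_on {0..1} f'"
  shows "int01 f' = f 1 - f 0"
  using FTC_prim[OF has_vector_derivative_at_within[OF assms(1)] assms(2), of 1] by simp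

lemma int01_ramp: "int01 (\<lambda>x. complex_of_real (1 - x)) = 1 / 2"
proof -
  have "((\<lambda>x. complex_of_real (x - x\<^sup>2 / 2)) has_vector_derivative complex_of_real (1 - x)) (at x)" for x
    by (intro has_vector_derivative_of_real) (auto intro!: derivative_eq_intros simp: has_real_derivative_iff_has_vector_derivative[symmetric])
  from int01_FTC[OF this] show ?thesis by (simp add: continuous_intros)
qed

lemma mu1_ramp: "mu1 (\<lambda>x. complex_of_real (1 - x)) = 1 / 3"
proof -
  have "((\<lambda>x. complex_of_real (- ((1 - x) ^ 3) / 3)) has_vector_derivative complex_of_real ((1 - x)\<^sup>2)) (at x)"
    for x
    by (intro has_vector_derivative_of_real)
      (auto intro!: derivative_eq_intros simp: has_real_derivative_iff_has_vector_derivative[symmetric] power2_eq_square)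
  from int01_FTC[OF this] have "int01 (\<lambda>x. complex_of_real ((1 - x)\<^sup>2)) = 1 / 3"
    by (simp add: continuous_intros)
  then show ?thesis by (simp add: mu1_def power2_eq_square)
qed

lemma Gamma1_affine_fun:
  "Gamma1 (affine_fun c) = vector [c $ 1 + c $ 2 / 2, c $ 1 / 2 + c $ 2 / 3]"
proof (rule vec2_eqI)
  have "int01 (affine_fun c) = c $ 1 * int01 (\<lambda>x. 1) + c $ 2 * int01 (\<lambda>x. complex_of_real (1 - x))"
    unfolding int01_ip affine_fun_def
    by (simp only: L2.add_left L2.scale_left L2.scale_mem L2_const ramp_L2)
  then show "Gamma1 (affine_fun c) $ 1 = (vector [c $ 1 + c $ 2 / 2, c $ 1 / 2 + c $ 2 / 3] :: complex^2) $ 1"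
    by (simp only: Gamma1_nth int01_const int01_ramp) simp
  have m: "mu1 (\<lambda>x. 1) = 1 / 2" using int01_ramp by (simp add: mu1_def)
  have "mu1 (affine_fun c) = c $ 1 * mu1 (\<lambda>x. 1) + c $ 2 * mu1 (\<lambda>x. complex_of_real (1 - x))"
    unfolding mu1_ip affine_fun_def
    by (simp only: L2.add_left L2.scale_left L2.scale_mem L2_const ramp_L2)
  then show "Gamma1 (affine_fun c) $ 2 = (vector [c $ 1 + c $ 2 / 2, c $ 1 / 2 + c $ 2 / 3] :: complex^2) $ 2"
    by (simp only: Gamma1_nth m mu1_ramp) simp
qed

lemma Gamma1_surj: "\<exists>c. Gamma1 (affine_fun c) = y"
proof -
  \<comment> \<open>The Gram matrix of 1 and \<open>1 - x\<close> has rows (1, 1/2) and (1/2, 1/3);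
    its inverse has rows (4, -6) and (-6, 12).\<close>
  have "Gamma1 (affine_fun (vector [4 * y $ 1 - 6 * y $ 2, 12 * y $ 2 - 6 * y $ 1])) = y"
    unfolding Gamma1_affine_fun by (rule vec2_eqI) (simp_all add: field_simps)
  then show ?thesis by blast
qed

text \<open>A suitable affine function added to \<open>r\<close> makes \<open>Gamma1\<close> vanish;
  the result lies in \<open>V_fun Y\<close>, and testing with it shows that it is null. What is left
  of the condition is tested with affine functions, whose \<open>Gamma1\<close> reaches every
  element of \<open>Y\<close>.\<close>

lemma functional_eq_0_iff:
  assumes Y: "vec.subspace Y" and r: "r \<in> L2"
  shows "(\<forall>h\<in>V_fun Y. ip_L2 r h + ip_C2 z (Gamma1 h) = 0) \<longleftrightarrow>
    (\<exists>c. (AE x in \<mu>01. r x = - affine_fun c x) \<and> z - c \<in> orth_C2 Y)"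
proof
  assume 0: "\<forall>h\<in>V_fun Y. ip_L2 r h + ip_C2 z (Gamma1 h) = 0"
  obtain c where c: "Gamma1 (affine_fun c) = - Gamma1 r" using Gamma1_surj by blast
  define r' where "r' = r + affine_fun c"
  have r': "r' \<in> L2" unfolding r'_def by (intro L2.add_mem r affine_fun_L2)
  have G0: "Gamma1 r' = 0" unfolding r'_def Gamma1_add[OF r affine_fun_L2] c by simp
  have "0 \<in> Y" using Y by (rule vec.subspace_0)
  then have "r' \<in> V_fun Y" using r' G0 by (simp add: V_fun_def)
  then have "ip_L2 r r' = 0" using 0 G0 by (fastforce simp: ip_C2_eq)
  moreover have "ip_L2 r' r' = ip_L2 r r' + ip_L2 (affine_fun c) r'"
    using L2.add_left[OF r affine_fun_L2[of c] r'] by (simp only: r'_def)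
  ultimately have "ip_L2 r' r' = 0" unfolding ip_affine_fun[OF r'] G0 by (simp add: ip_C2_eq)
  then have "nrm2 r' = 0" by (simp add: ip_norm_def)
  then have "AE x in \<mu>01. r' x = 0" using nrm2_eq_0[OF r'] by simp
  then have AE: "AE x in \<mu>01. r x = - affine_fun c x"
    by eventually_elim (simp add: r'_def add_eq_0_iff2)
  have "z - c \<in> orth_C2 Y"
    unfolding orth_C2_def
  proof (intro CollectI ballI)
    fix y assume y: "y \<in> Y"
    obtain d where d: "Gamma1 (affine_fun d) = y" using Gamma1_surj by blast
    have "ip_L2 r (affine_fun d) = ip_L2 (- affine_fun c) (affine_fun d)"
      by (rule ip_L2_cong_AE) (use AE r in \<open>auto intro: L2.minus_mem\<close>)
    also have "\<dots> = - ip_C2 c y" using ip_affine_fun[of "affine_fun d" c] d by simp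
    finally have "- ip_C2 c y + ip_C2 z y = 0"
      using 0 d y by (force simp: V_fun_def)
    then show "ip_C2 (z - c) y = 0" by (simp add: ip_C2_eq algebra_simps)
  qed
  then show "\<exists>c. (AE x in \<mu>01. r x = - affine_fun c x) \<and> z - c \<in> orth_C2 Y" using AE by blast
next
  assume "\<exists>c. (AE x in \<mu>01. r x = - affine_fun c x) \<and> z - c \<in> orth_C2 Y"
  then obtain c where AE: "AE x in \<mu>01. r x = - affine_fun c x" and orth: "z - c \<in> orth_C2 Y" by blast
  show "\<forall>h\<in>V_fun Y. ip_L2 r h + ip_C2 z (Gamma1 h) = 0"
  proof
    fix h assume "h \<in> V_fun Y"
    then have h: "h \<in> L2" "Gamma1 h \<in> Y" by (auto simp: V_fun_def)
    have "ip_L2 r h = ip_L2 (- affine_fun c) h"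
      by (rule ip_L2_cong_AE) (use AE r h in \<open>auto intro: L2.minus_mem\<close>)
    also have "\<dots> = - ip_C2 c (Gamma1 h)" using ip_affine_fun[OF h(1), of c] h by simp
    finally have "ip_L2 r h = - ip_C2 c (Gamma1 h)" .
    moreover have "ip_C2 (z - c) u = ip_C2 z u - ip_C2 c u" for u by (simp add: ip_C2_eq algebra_simps)
    ultimately have "ip_L2 r h + ip_C2 z (Gamma1 h) = ip_C2 (z - c) (Gamma1 h)" by (simp only:) simp
    then show "ip_L2 r h + ip_C2 z (Gamma1 h) = 0" using orth h(2) by (simp add: orth_C2_def)
  qed
qed

text \<open>By \<open>ip_Hm1_emb\<close> the form equation says that a functional of
  \<open>h\<close> and \<open>Gamma1 h\<close> vanishes. It serves the description of the domain
  and, with \<open>f = 0\<close> and \<open>K = 0\<close>, the density of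
  \<open>V_space Y\<close>.\<close>

lemma form_eq_iff:
  assumes Y: "vec.subspace Y" and f: "f \<in> L2" and g: "g \<in> Hm1"
  shows "(\<forall>h\<in>V_fun Y. a_form K f h = ip_Hm1 g (emb h)) \<longleftrightarrow>
    (\<exists>c. (AE x in \<mu>01. f x + prim (P_op g) x = - affine_fun c x) \<and>
      K *v Gamma1 f - vector [mu0 g, 0] - c \<in> orth_C2 Y)"
proof -
  have p: "prim (P_op g) \<in> L2" by (intro prim_L2 P_op g)
  have "a_form K f h = ip_Hm1 g (emb h) \<longleftrightarrow>
      ip_L2 (f + prim (P_op g)) h + ip_C2 (K *v Gamma1 f - vector [mu0 g, 0]) (Gamma1 h) = 0"
    if h: "h \<in> V_fun Y" for h
  proof -
    have h': "h \<in> L2" using h by (simp add: V_fun_def)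
    have "ip_Hm1 g (emb h) = - ip_L2 (prim (P_op g)) h + mu0 g * cnj (int01 h)"
      unfolding ip_Hm1_emb[OF g h'] L2.minus_left[OF p h'] mu0_emb ..
    moreover have "ip_L2 (f + prim (P_op g)) h = ip_L2 f h + ip_L2 (prim (P_op g)) h"
      by (rule L2.add_left[OF f p h'])
    moreover have "ip_C2 (K *v Gamma1 f - vector [mu0 g, 0]) (Gamma1 h)
        = ip_C2 (K *v Gamma1 f) (Gamma1 h) - mu0 g * cnj (int01 h)"
      by (simp add: ip_C2_eq algebra_simps)
    ultimately show ?thesis unfolding a_form_def
      by (simp only:) (auto simp: algebra_simps eq_neg_iff_add_eq_0 add_eq_0_iff)
  qed
  then have "(\<forall>h\<in>V_fun Y. a_form K f h = ip_Hm1 g (emb h)) \<longleftrightarrow>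
      (\<forall>h\<in>V_fun Y. ip_L2 (f + prim (P_op g)) h + ip_C2 (K *v Gamma1 f - vector [mu0 g, 0]) (Gamma1 h) = 0)"
    by (intro ball_cong refl)
  then show ?thesis unfolding functional_eq_0_iff[OF Y L2.add_mem[OF f p]] by simp
qed

section \<open>The Hilbert spaces \<open>V_space Y\<close> and \<open>H_space Y\<close>\<close>

lemma V_fun_subspace:
  assumes Y: "vec.subspace Y"
  shows "0 \<in> V_fun Y" "f \<in> V_fun Y \<Longrightarrow> g \<in> V_fun Y \<Longrightarrow> f + g \<in> V_fun Y" "f \<in> V_fun Y \<Longrightarrow> c *\<^sub>c f \<in> V_fun Y"
proof -
  have "Gamma1 0 = 0" using Gamma1_scale[OF L2.zero_mem, of 0] by simp
  then show "0 \<in> V_fun Y" using vec.subspace_0[OF Y] L2.zero_mem by (simp only: V_fun_def mem_Collect_eq)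
  show "f \<in> V_fun Y \<Longrightarrow> g \<in> V_fun Y \<Longrightarrow> f + g \<in> V_fun Y"
    unfolding V_fun_def using L2.add_mem Gamma1_add vec.subspace_add[OF Y] by simp
  show "f \<in> V_fun Y \<Longrightarrow> c *\<^sub>c f \<in> V_fun Y"
    unfolding V_fun_def using L2.scale_mem Gamma1_scale vec.subspace_scale[OF Y] by simp
qed

lemma V_spaceE:
  assumes "v \<in> V_space Y"
  obtains f where "f \<in> V_fun Y" "f \<in> L2" "v = emb f"
  using assms by (auto simp: V_space_def V_fun_def)

lemma V_space_rep:
  assumes "v \<in> V_space Y"
  shows "rep v \<in> V_fun Y" "rep v \<in> L2" "emb (rep v) = v"
proof -
  obtain f where f: "f \<in> V_fun Y" "f \<in> L2" "v = emb f" using assms by (rule V_spaceE)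
  note r = rep_emb[OF f(2), folded f(3)]
  show "rep v \<in> L2" "emb (rep v) = v" using r f by auto
  then show "rep v \<in> V_fun Y" using Gamma1_cong_AE[OF r(3) r(1) f(2)] f(1) by (simp add: V_fun_def)
qed

lemma nrm_emb: "f \<in> L2 \<Longrightarrow> ip_norm ip_emb_L2 (emb f) = nrm2 f"
  by (simp add: ip_norm_def ip_emb_L2_emb)

lemma emb_diff: "f \<in> L2 \<Longrightarrow> g \<in> L2 \<Longrightarrow> emb f - emb g = emb (f - g)"
  using emb_add[of f "(- 1) *\<^sub>c g"] L2.scale_mem[of g "-1"] emb_scale[of "-1" g] by simp

lemma emb_0: "emb 0 = 0"
  using emb_scale[of 0 0] by simp

lemma closed_complex_subspace:
  assumes "vec.subspace (Y :: (complex^2) set)" shows "closed Y"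
proof (rule closed_subspace)
  show "subspace Y"
    unfolding subspace_def
  proof (intro conjI ballI allI)
    show "c *\<^sub>R x \<in> Y" if "x \<in> Y" for c x
    proof -
      have "c *\<^sub>R x = complex_of_real c *s x"
        unfolding vec_eq_iff vector_scaleR_component vector_smult_component
        by (simp add: scaleR_conv_of_real)
      then show ?thesis using vec.subspace_scale[OF assms that] by simp
    qed
  qed (use vec.subspace_0[OF assms] vec.subspace_add[OF assms] in auto)
qed

text \<open>Completeness is that of L2, transported along \<open>rep\<close>: \<open>Gamma1\<close>
  is continuous for the L2 norm and \<open>Y\<close> is closed, so limits stay in
  \<open>V_fun Y\<close>.\<close>

lemma V_space_hilbert:
  assumes Y: "vec.subspace Y" shows "hilbert (V_space Y) ip_emb_L2"
proof -
  interpret V: ip_space "V_space Y" ip_emb_L2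
  proof
    show "0 \<in> V_space Y" using V_fun_subspace(1)[OF Y] unfolding V_space_def by (metis emb_0 image_eqI)
    fix x y z c
    assume "x \<in> V_space Y"
    then obtain f where f: "f \<in> V_fun Y" "f \<in> L2" "x = emb f" by (rule V_spaceE)
    show "c *\<^sub>c x \<in> V_space Y"
      using V_fun_subspace(3)[OF Y f(1), of c] f(3) unfolding V_space_def by (metis emb_scale image_eqI)
    show "0 \<le> Re (ip_emb_L2 x x)" using f by (simp add: ip_emb_L2_emb)
    show "x = 0" if "ip_emb_L2 x x = 0"
    proof -
      have "nrm2 f = 0" using that f by (simp add: ip_emb_L2_emb ip_norm_def)
      then have "AE x in \<mu>01. f x = 0 x" using nrm2_eq_0[OF f(2)] by simp
      then have "emb f = emb 0" using emb_eq_iff[OF f(2) L2.zero_mem] by blast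
      then show ?thesis using f(3) emb_0 by metis
    qed
    assume "y \<in> V_space Y"
    then obtain g where g: "g \<in> V_fun Y" "g \<in> L2" "y = emb g" by (rule V_spaceE)
    show "x + y \<in> V_space Y"
      using V_fun_subspace(2)[OF Y f(1) g(1)] emb_add[OF f(2) g(2)] f(3) g(3) unfolding V_space_def
      by (metis image_eqI)
    show "ip_emb_L2 (c *\<^sub>c x) y = c * ip_emb_L2 x y"
      unfolding f(3) g(3) emb_scale[symmetric] using f(2) g(2)
      by (simp only: ip_emb_L2_emb L2.scale_mem L2.scale_left)
    show "cnj (ip_emb_L2 x y) = ip_emb_L2 y x"
      unfolding f(3) g(3) using f(2) g(2) by (simp only: ip_emb_L2_emb L2.cnj_sym)
    assume "z \<in> V_space Y"
    then obtain h where h: "h \<in> V_fun Y" "h \<in> L2" "z = emb h" by (rule V_spaceE)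
    show "ip_emb_L2 (x + y) z = ip_emb_L2 x z + ip_emb_L2 y z"
      unfolding f(3) g(3) h(3) emb_add[OF f(2) g(2), symmetric] using f(2) g(2) h(2)
      by (simp only: ip_emb_L2_emb L2.add_mem L2.add_left)
  qed
  show ?thesis
  proof
    fix \<sigma> assume \<sigma>: "\<And>n. \<sigma> n \<in> V_space Y" and C: "V.Cauchy_seq \<sigma>"
    define f where "f n = rep (\<sigma> n)" for n
    have f: "f n \<in> V_fun Y" "f n \<in> L2" "\<sigma> n = emb (f n)" for n using V_space_rep[OF \<sigma>]
      by (auto simp: f_def)
    have "nrm2 (f m - f n) = V.nrm (\<sigma> m - \<sigma> n)" for m n
      unfolding f(3) emb_diff[OF f(2) f(2)] by (rule nrm_emb[OF L2.diff_mem[OF f(2) f(2)], symmetric])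
    then have "L2.Cauchy_seq f" using C unfolding L2.Cauchy_seq_def V.Cauchy_seq_def by simp
    then obtain g where g: "g \<in> L2" and lim: "(\<lambda>n. nrm2 (f n - g)) \<longlonglongrightarrow> 0" using L2_complete[of f] f(2)
      by blast
    have "(\<lambda>n. Gamma1 (f n)) \<longlonglongrightarrow> Gamma1 g"
    proof (rule vec_tendstoI)
      fix i :: 2
      have "(\<lambda>n. Gamma1 (f n) $ 1) \<longlonglongrightarrow> Gamma1 g $ 1"
        unfolding Gamma1_nth int01_ip by (rule L2.tendsto_ip_left[OF lim f(2) g L2_const])
      moreover have "(\<lambda>n. Gamma1 (f n) $ 2) \<longlonglongrightarrow> Gamma1 g $ 2"
        unfolding Gamma1_nth mu1_ip by (rule L2.tendsto_ip_left[OF lim f(2) g ramp_L2])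
      ultimately show "(\<lambda>n. Gamma1 (f n) $ i) \<longlonglongrightarrow> Gamma1 g $ i" using exhaust_2[of i] by metis
    qed
    then have "Gamma1 g \<in> Y"
      using closed_sequentially[OF closed_complex_subspace[OF Y], of "\<lambda>n. Gamma1 (f n)"] f(1)
      by (simp add: V_fun_def)
    then have "emb g \<in> V_space Y" using g by (auto simp: V_space_def V_fun_def)
    moreover have "(\<lambda>n. V.nrm (\<sigma> n - emb g)) \<longlonglongrightarrow> 0"
      using lim unfolding f(3) emb_diff[OF f(2) g] nrm_emb[OF L2.diff_mem[OF f(2) g]] .
    ultimately show "\<exists>x\<in>V_space Y. (\<lambda>n. V.nrm (\<sigma> n - x)) \<longlonglongrightarrow> 0" by blast
  qed
qed

lemma H_space_hilbert: "hilbert (H_space Y) ip_Hm1"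
proof -
  define b where "b \<longleftrightarrow> Y = {0} \<or> Y = {y. y $ 1 = 0}"
  have H: "H_space Y = {w \<in> Hm1. b \<longrightarrow> mu0 w = 0}" by (auto simp: H_space_def b_def)
  show ?thesis unfolding H
  proof
    fix \<sigma> assume \<sigma>: "\<And>n. \<sigma> n \<in> {w \<in> Hm1. b \<longrightarrow> mu0 w = 0}" and C: "Hm1.Cauchy_seq \<sigma>"
    have mem: "\<sigma> n \<in> Hm1" and m0: "b \<Longrightarrow> mu0 (\<sigma> n) = 0" for n using \<sigma>[of n] by auto
    obtain w where w: "w \<in> Hm1" "(\<lambda>n. Hm1.nrm (\<sigma> n - w)) \<longlonglongrightarrow> 0" "(\<lambda>n. mu0 (\<sigma> n)) \<longlonglongrightarrow> mu0 w"
      using Hm1_complete[OF mem C] by blast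
    have "mu0 w = 0" if b using w(3) unfolding m0[OF that] by (rule LIMSEQ_unique) (rule tendsto_const)
    then show "\<exists>x\<in>{w \<in> Hm1. b \<longrightarrow> mu0 w = 0}. (\<lambda>n. Hm1.nrm (\<sigma> n - x)) \<longlonglongrightarrow> 0" using w by blast
  qed (auto simp: mu0_def Hm1.add_left Hm1.cnj_sym intro: Hm1.definite)
qed

lemma mem_Hm1: "w \<in> H_space Y \<Longrightarrow> w \<in> Hm1"
  by (auto simp: H_space_def split: if_splits)

lemma V_space_subset_H_space: "V_space Y \<subseteq> H_space Y"
proof
  fix v assume "v \<in> V_space Y"
  then obtain f where f: "f \<in> V_fun Y" "f \<in> L2" "v = emb f" by (rule V_spaceE)
  have "mu0 v = 0" if "Y = {0} \<or> Y = {y. y $ 1 = 0}"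
  proof -
    have "Gamma1 f $ 1 = 0" using f(1) that by (auto simp: V_fun_def simp del: Gamma1_nth)
    then show ?thesis using f(3) by (simp add: mu0_emb)
  qed
  then show "v \<in> H_space Y" using emb_Hm1[OF f(2)] f(3) by (simp add: H_space_def)
qed

text \<open>By \<open>form_eq_iff\<close> the primitive of \<open>P_op w\<close> is affine; as it
  vanishes at both ends, it is 0, and so is \<open>P_op w\<close> almost everywhere. Then
  \<open>(mu0 w, 0)\<close> is orthogonal to \<open>Y\<close>, which forces \<open>mu0 w = 0\<close>
  unless all elements of \<open>Y\<close> have first component 0; these are exactly the two cases in
  which \<open>H_space\<close> prescribes it.\<close>

lemma H_space_total:
  assumes Y: "vec.subspace Y" and w: "w \<in> H_space Y" and perp: "\<And>v. v \<in> V_space Y \<Longrightarrow> ip_Hm1 w v = 0"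
  shows "w = 0"
proof -
  have wH: "w \<in> Hm1" using w by (rule mem_Hm1)
  define p where "p = P_op w"
  have p: "p \<in> L2" and p0: "int01 p = 0" unfolding p_def using P_op(1)[OF wH] P_op_mean[OF wH] by auto
  have pp: "prim p \<in> L2" using p by simp
  have "\<forall>h\<in>V_fun Y. a_form 0 0 h = ip_Hm1 w (emb h)"
    using perp by (auto simp: a_form_def V_space_def V_fun_def ip_C2_eq)
  then obtain c where AE: "AE x in \<mu>01. 0 x + prim p x = - affine_fun c x"
    and orth: "0 *v Gamma1 0 - vector [mu0 w, 0] - c \<in> orth_C2 Y"
    unfolding form_eq_iff[OF Y L2.zero_mem wH] p_def by blast
  have eq: "prim p x = - affine_fun c x" if "x \<in> {0..1}" for x
  proof (rule continuous_AE_eq[OF prim_continuous[OF p] _ _ that])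
    show "continuous_on {0..1} (\<lambda>x. - affine_fun c x)" unfolding affine_fun_apply
      by (intro continuous_intros)
    show "AE x in \<mu>01. prim p x = - affine_fun c x" using AE by simp
  qed
  have "c $ 1 = 0" using eq[of 1] p0 by (simp add: affine_fun_apply)
  moreover have "c $ 1 + c $ 2 = 0" using eq[of 0] by (simp add: affine_fun_apply add_eq_0_iff)
  ultimately have c: "c $ 1 = 0" "c $ 2 = 0" by simp_all
  then have "prim p x = 0" if "x \<in> {0..1}" for x using eq[OF that] by (simp add: affine_fun_apply)
  then have "AE x in \<mu>01. p x = 0" by (rule prim_eq_0_imp_AE[OF p])
  then have n0: "nrm2 (P_op w) = 0" using nrm2_eq_0[OF p] by (simp add: p_def)
  have "mu0 w = 0"
  proof (cases "Y = {0} \<or> Y = {y. y $ 1 = 0}")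
    case True
    then show ?thesis using w by (auto simp: H_space_def split: if_splits)
  next
    case False
    \<comment> \<open>A subspace of the line \<open>{y. y $ 1 = 0}\<close> is trivial or the whole
      line, so outside the two exceptional cases \<open>Y\<close> is not contained in it.\<close>
    have "\<exists>y\<in>Y. y $ 1 \<noteq> 0"
    proof (rule ccontr)
      assume "\<not> ?thesis"
      then have sub: "Y \<subseteq> {y. y $ 1 = 0}" by auto
      obtain y where y: "y \<in> Y" "y \<noteq> 0" using False vec.subspace_0[OF Y] by blast
      then have y1: "y $ 1 = 0" and y2: "y $ 2 \<noteq> 0" using sub vec2_eqI[of y 0] by auto
      have "x \<in> Y" if "x $ 1 = 0" for x
      proof -
        have "x = (x $ 2 / y $ 2) *s y" using that y1 y2 by (intro vec2_eqI) simp_all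
        then show ?thesis using vec.subspace_scale[OF Y y(1)] by metis
      qed
      then show False using sub False by blast
    qed
    then obtain y where "y \<in> Y" "y $ 1 \<noteq> 0" by blast
    then show ?thesis using orth c by (auto simp: orth_C2_def ip_C2_eq)
  qed
  then have "(Hm1.nrm w)\<^sup>2 = 0" unfolding nrm_Hm1_sq[OF wH] using n0 by simp
  then show ?thesis using Hm1.nrm_eq_0[OF wH] by simp
qed

section \<open>Bounds for the shifted form\<close>

lemma P_fun_bound: "f \<in> L2 \<Longrightarrow> x \<in> {0..1} \<Longrightarrow> cmod (P_fun f x) \<le> 2 * nrm2 f"
proof -
  assume f: "f \<in> L2" and x: "x \<in> {0..1}"
  have "mu1 f = int01 (prim f)" using int01_prim[OF f] by simp
  also have "cmod \<dots> \<le> nrm2 (prim f)" using f by (intro cmod_int01_le) simp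
  also have "\<dots> \<le> nrm2 f"
    using prim_bound[OF f] L2_measurable[OF prim_L2[OF f]] f by (intro nrm2_bounded) auto
  finally have "cmod (mu1 f) \<le> nrm2 f" .
  then show ?thesis using prim_bound[OF f x] norm_triangle_ineq4[of "prim f x" "mu1 f"]
    by (simp add: P_fun_def)
qed

lemma mu1_bound: "f \<in> L2 \<Longrightarrow> cmod (mu1 f) \<le> nrm2 f"
proof -
  assume f: "f \<in> L2"
  have "nrm2 (\<lambda>x. complex_of_real (1 - x)) \<le> 1"
  proof (rule nrm2_bounded[OF L2_measurable[OF ramp_L2]])
    show "cmod (complex_of_real (1 - x)) \<le> 1" if "x \<in> {0<..<1}" for x
      unfolding norm_of_real using that by simp
  qed simp
  then show ?thesis
    using L2.Cauchy_Schwarz[OF f ramp_L2] mult_left_mono[OF _ L2.nrm_nonneg[OF f]] unfolding mu1_ip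
    by (metis mult.right_neutral order_trans)
qed

lemma nrm_Hm1_emb_sq:
  assumes f: "f \<in> L2"
  shows "(Hm1.nrm (emb f))\<^sup>2 = (nrm2 (P_fun f))\<^sup>2 + (cmod (int01 f))\<^sup>2"
  unfolding nrm_Hm1_sq[OF emb_Hm1[OF f]] mu0_emb
  using nrm2_cong_AE[OF P_op_emb[OF f] P_op(1)[OF emb_Hm1[OF f]] P_fun_L2[OF f]] by simp

text \<open>
  Since \<open>prim f\<close> vanishes at 0 and is Hoelder continuous, averaging \<open>mu1 f = prim f x - P_fun f x\<close>
  over \<open>0 < x < \<delta>\<close> shows that \<open>mu1\<close> is a small perturbation relative to the norm of \<open>L\<^sup>2\<close>.
\<close>

lemma mu1_interpolation:
  assumes f: "f \<in> L2" and \<delta>: "0 < \<delta>" "\<delta> \<le> 1"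
  shows "(cmod (mu1 f))\<^sup>2 \<le> 2 * \<delta> * (nrm2 f)\<^sup>2 + 2 / \<delta> * (nrm2 (P_fun f))\<^sup>2"
proof -
  define N where "N = nrm2 f"
  define P where "P = nrm2 (P_fun f)"
  have N: "0 \<le> N" and P: "0 \<le> P" using f P_fun_L2[OF f] by (auto simp: N_def P_def)
  have pf: "prim f \<in> L2" using f by simp
  have step_int: "int01 (\<lambda>x. step \<delta> x) = complex_of_real \<delta>"
    using prim_const[of \<delta> 1] \<delta> by (simp add: prim_def)
  have step_nrm: "nrm2 (step \<delta>) = sqrt \<delta>"
  proof -
    have "AE x in \<mu>01. step \<delta> x = (step \<delta> - step 0) x"
      using AE_unit_interval by eventually_elim (simp add: step_def)
    then have "nrm2 (step \<delta>) = nrm2 (step \<delta> - step 0)" by (intro nrm2_cong_AE step_L2 L2.diff_mem)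
    then show ?thesis using nrm2_step_diff[of 0 \<delta>] \<delta> by simp
  qed
  \<comment> \<open>\<open>\<delta> * mu1 f\<close> is the integral of
    \<open>prim f - P_fun f\<close> up to \<open>\<delta>\<close>; the first part is at most
    \<open>N * sqrt \<delta> * \<delta>\<close> by the Hoelder bound, the second at most
    \<open>P * sqrt \<delta>\<close>.\<close>
  have "int01 (\<lambda>x. prim f x * step \<delta> x) - int01 (\<lambda>x. P_fun f x * step \<delta> x) = int01 (\<lambda>x. prim f x * step \<delta> x - P_fun f x * step \<delta> x)"
    by (intro Bochner_Integration.integral_diff[symmetric] L2_mult_integrable pf P_fun_L2 f step_L2)
  also have "\<dots> = int01 (\<lambda>x. mu1 f * step \<delta> x)" by (simp add: P_fun_def algebra_simps)
  also have "\<dots> = mu1 f * complex_of_real \<delta>" using step_int by simp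
  finally have "cmod (mu1 f * complex_of_real \<delta>) \<le> cmod (int01 (\<lambda>x. prim f x * step \<delta> x)) + cmod (int01 (\<lambda>x. P_fun f x * step \<delta> x))"
    by (metis norm_triangle_ineq4)
  also have "cmod (int01 (\<lambda>x. P_fun f x * step \<delta> x)) \<le> P * sqrt \<delta>"
    using int01_Cauchy_Schwarz[OF P_fun_L2[OF f] step_L2[of \<delta>]] step_nrm by (simp add: P_def)
  also have "cmod (int01 (\<lambda>x. prim f x * step \<delta> x)) \<le> (LINT x|\<mu>01. cmod (prim f x * step \<delta> x))"
    by (rule integral_norm_bound)
  also have "\<dots> \<le> (LINT x|\<mu>01. N * sqrt \<delta> * Re (step \<delta> x))"
  proof (rule integral_mono)
    show "integrable \<mu>01 (\<lambda>x. cmod (prim f x * step \<delta> x))"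
      by (intro integrable_norm L2_mult_integrable pf step_L2)
    show "integrable \<mu>01 (\<lambda>x. N * sqrt \<delta> * Re (step \<delta> x))"
      by (intro integrable_mult_right integrable_Re L2_integrable step_L2)
    fix x assume "x \<in> space \<mu>01"
    then have x: "0 < x" "x < 1" by (auto simp: space_restrict_space)
    have "cmod (prim f x) \<le> N * sqrt x" using prim_holder[OF f, of 0 x] x by (simp add: N_def)
    moreover have "N * sqrt x \<le> N * sqrt \<delta>" if "x < \<delta>" using that N by (intro mult_left_mono) auto
    ultimately show "cmod (prim f x * step \<delta> x) \<le> N * sqrt \<delta> * Re (step \<delta> x)" by (auto simp: step_def)
  qed
  also have "\<dots> = N * sqrt \<delta> * Re (int01 (step \<delta>))"
    by (simp add: integral_Re[OF L2_integrable[OF step_L2]])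
  also have "Re (int01 (step \<delta>)) = \<delta>" using step_int by simp
  finally have "cmod (mu1 f) * \<delta> \<le> N * sqrt \<delta> * \<delta> + P * sqrt \<delta>" using \<delta> by (simp add: norm_mult)
  moreover have "P * sqrt \<delta> = P / sqrt \<delta> * \<delta>" using \<delta> by (simp add: field_simps)
  ultimately have "cmod (mu1 f) * \<delta> \<le> (N * sqrt \<delta> + P / sqrt \<delta>) * \<delta>" by (simp add: distrib_right)
  then have "cmod (mu1 f) \<le> N * sqrt \<delta> + P / sqrt \<delta>" using \<delta> by simp
  then have "(cmod (mu1 f))\<^sup>2 \<le> (N * sqrt \<delta> + P / sqrt \<delta>)\<^sup>2" by (intro power_mono) auto
  also have "\<dots> \<le> 2 * (N * sqrt \<delta>)\<^sup>2 + 2 * (P / sqrt \<delta>)\<^sup>2"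
    using sum_squares_bound[of "N * sqrt \<delta>" "P / sqrt \<delta>"] by (simp only: power2_sum)
  also have "\<dots> = 2 * \<delta> * N\<^sup>2 + 2 / \<delta> * P\<^sup>2" using \<delta> by (simp add: power_mult_distrib power_divide)
  finally show ?thesis by (simp only: N_def P_def)
qed

definition mat_bound :: "complex^2^2 \<Rightarrow> real" where
  "mat_bound K = cmod (K $ 1 $ 1) + cmod (K $ 1 $ 2) + cmod (K $ 2 $ 1) + cmod (K $ 2 $ 2)"

lemma mat_bound:
  "cmod (ip_C2 (K *v x) x) \<le> mat_bound K * ((cmod (x $ 1))\<^sup>2 + (cmod (x $ 2))\<^sup>2)"
proof -
  define n where "n = (cmod (x $ 1))\<^sup>2 + (cmod (x $ 2))\<^sup>2"
  have t: "cmod (k * x $ j * cnj (x $ i)) \<le> cmod k * n" for k and i j :: 2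
  proof -
    have "cmod (x $ 1) * cmod (x $ 2) \<le> n"
    proof -
      have "0 \<le> cmod (x $ 1) * cmod (x $ 2)" by simp
      then show ?thesis using sum_squares_bound[of "cmod (x $ 1)" "cmod (x $ 2)"] unfolding n_def
        by linarith
    qed
    then have "cmod (x $ j) * cmod (x $ i) \<le> n"
      using exhaust_2[of i] exhaust_2[of j] by (auto simp: n_def mult.commute power2_eq_square)
    then show ?thesis using mult_left_mono[of "cmod (x $ j) * cmod (x $ i)" n "cmod k"]
      by (simp add: norm_mult mult.assoc)
  qed
  have "ip_C2 (K *v x) x = K $ 1 $ 1 * x $ 1 * cnj (x $ 1) + K $ 1 $ 2 * x $ 2 * cnj (x $ 1)
    + (K $ 2 $ 1 * x $ 1 * cnj (x $ 2) + K $ 2 $ 2 * x $ 2 * cnj (x $ 2))"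
    by (simp add: ip_C2_eq matrix_vector_mult_def sum_2 algebra_simps)
  also have "cmod \<dots> \<le> cmod (K $ 1 $ 1) * n + cmod (K $ 1 $ 2) * n + (cmod (K $ 2 $ 1) * n + cmod (K $ 2 $ 2) * n)"
    by (intro norm_triangle_mono t)
  finally show ?thesis by (simp add: mat_bound_def n_def algebra_simps)
qed

text \<open>With \<open>k = mat_bound K\<close> and \<open>\<delta> = 1 / (4 * k + 4)\<close>,
  \<open>mu1_interpolation\<close> bounds \<open>k\<close> times the square of \<open>mu1\<close> by
  half of the squared L2 norm plus \<open>2 * k * (4 * k + 4)\<close> times the squared norm of
  \<open>P_fun f\<close>; the summand \<open>k\<close> absorbs the contribution of
  \<open>mu0\<close>.\<close>

definition shift :: "complex^2^2 \<Rightarrow> real" where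
  "shift K = mat_bound K + 2 * mat_bound K * (4 * mat_bound K + 4)"

text \<open>The form is given on functions while \<open>V_space Y\<close> consists of functionals,
  hence \<open>rep\<close>; by \<open>a_form_rep\<close> the choice of representatives does not
  matter.\<close>

definition q_form :: "complex^2^2 \<Rightarrow> functional \<Rightarrow> functional \<Rightarrow> complex" where
  "q_form K v w = a_form K (rep v) (rep w) + complex_of_real (shift K) * ip_Hm1 v w"

lemma mat_bound_nonneg: "0 \<le> mat_bound K"
  by (simp add: mat_bound_def)

lemma shift_nonneg: "0 \<le> shift K"
  using mat_bound_nonneg[of K] by (simp add: shift_def)

lemma a_form_cong_AE:
  assumes "AE x in \<mu>01. f x = f' x" "AE x in \<mu>01. g x = g' x" "f \<in> L2" "f' \<in> L2" "g \<in> L2" "g' \<in> L2"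
  shows "a_form K f g = a_form K f' g'"
  unfolding a_form_def using ip_L2_cong_AE[OF assms] Gamma1_cong_AE assms by simp

lemma a_form_rep: "f \<in> L2 \<Longrightarrow> g \<in> L2 \<Longrightarrow> a_form K (rep (emb f)) (rep (emb g)) = a_form K f g"
  by (intro a_form_cong_AE rep_emb)

text \<open>Below, the shift absorbs the matrix term up to half of the squared L2 norm. Above, the
  squares of \<open>mu0\<close> and \<open>mu1\<close> are each at most the squared L2 norm and that
  of \<open>P_fun f\<close> is at most four times it, whence the factors 2 and 5.\<close>

lemma Re_q_form:
  assumes f: "f \<in> L2"
  shows "(nrm2 f)\<^sup>2 / 2 \<le> Re (q_form K (emb f) (emb f))"
    and "Re (q_form K (emb f) (emb f)) \<le> (1 + 2 * mat_bound K + 5 * shift K) * (nrm2 f)\<^sup>2"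
proof -
  define k where "k = mat_bound K"
  have k: "0 \<le> k" by (simp add: k_def mat_bound_nonneg)
  define N m0 m1 P where "N = (nrm2 f)\<^sup>2" and "m0 = (cmod (int01 f))\<^sup>2" and "m1 = (cmod (mu1 f))\<^sup>2" and "P = (nrm2 (P_fun f))\<^sup>2"
  define R where "R = Re (ip_C2 (K *v Gamma1 f) (Gamma1 f))"
  have nn: "0 \<le> N" "0 \<le> m0" "0 \<le> P" by (auto simp: N_def m0_def P_def)
  have eq: "Re (q_form K (emb f) (emb f)) = N + R + shift K * (P + m0)"
    using L2.nrm_sq[OF f] Hm1.nrm_sq[OF emb_Hm1[OF f]] nrm_Hm1_emb_sq[OF f]
    unfolding q_form_def a_form_rep[OF f f] R_def N_def P_def m0_def by (simp add: a_form_def)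
  have R: "\<bar>R\<bar> \<le> k * (m0 + m1)"
    using mat_bound[of K "Gamma1 f"] abs_Re_le_cmod[of "ip_C2 (K *v Gamma1 f) (Gamma1 f)"]
    by (simp add: R_def k_def m0_def m1_def)
  define \<delta> where "\<delta> = 1 / (4 * k + 4)"
  have \<delta>: "0 < \<delta>" "\<delta> \<le> 1" using k by (auto simp: \<delta>_def)
  have "m1 \<le> 2 * \<delta> * N + 2 / \<delta> * P" using mu1_interpolation[OF f \<delta>] by (simp only: m1_def N_def P_def)
  then have "k * m1 \<le> k * (2 * \<delta> * N + 2 / \<delta> * P)" using k by (rule mult_left_mono)
  also have "\<dots> = (2 * k * \<delta>) * N + 2 * k * (4 * k + 4) * P" by (simp add: \<delta>_def algebra_simps)
  also have "(2 * k * \<delta>) * N \<le> 1 / 2 * N" using k nn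
    by (intro mult_right_mono) (auto simp: \<delta>_def field_simps)
  finally have km1: "k * m1 \<le> N / 2 + 2 * k * (4 * k + 4) * P" by simp
  have "shift K * (P + m0) = k * P + k * m0 + 2 * k * (4 * k + 4) * P + 2 * k * (4 * k + 4) * m0"
    by (simp add: shift_def k_def algebra_simps)
  moreover have "0 \<le> k * P" "0 \<le> 2 * k * (4 * k + 4) * m0" using k nn by simp_all
  moreover have "k * (m0 + m1) = k * m0 + k * m1" by (simp add: distrib_left)
  ultimately show "(nrm2 f)\<^sup>2 / 2 \<le> Re (q_form K (emb f) (emb f))"
    unfolding eq using R km1 by (fold N_def) linarith
  have "m0 \<le> N" unfolding m0_def N_def using cmod_int01_le[OF f] by (intro power_mono) auto
  moreover have "m1 \<le> N" unfolding m1_def N_def using mu1_bound[OF f] by (intro power_mono) auto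
  moreover have "P \<le> 4 * N"
  proof -
    have "nrm2 (P_fun f) \<le> 2 * nrm2 f"
      using P_fun_bound[OF f] L2_measurable[OF P_fun_L2[OF f]] f by (intro nrm2_bounded) auto
    then have "(nrm2 (P_fun f))\<^sup>2 \<le> (2 * nrm2 f)\<^sup>2" using P_fun_L2[OF f] by (intro power_mono) auto
    then show ?thesis by (simp add: P_def N_def power_mult_distrib)
  qed
  ultimately have "k * (m0 + m1) \<le> k * (2 * N)" "shift K * (P + m0) \<le> shift K * (5 * N)"
    using k shift_nonneg[of K] by (auto intro!: mult_left_mono)
  then show "Re (q_form K (emb f) (emb f)) \<le> (1 + 2 * mat_bound K + 5 * shift K) * (nrm2 f)\<^sup>2"
    unfolding eq using R by (fold N_def k_def) (simp add: algebra_simps)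
qed

lemma q_form_semi_ip:
  assumes Y: "vec.subspace Y" and K: "hermitian K"
  shows "semi_ip (V_space Y) (q_form K)"
proof -
  interpret V: hilbert "V_space Y" ip_emb_L2 by (rule V_space_hilbert[OF Y])
  have Kij: "cnj (K $ i $ j) = K $ j $ i" for i j using K unfolding hermitian_def by metis
  show ?thesis
  proof
    fix x y z c
    assume "x \<in> V_space Y"
    then obtain f where f: "f \<in> V_fun Y" "f \<in> L2" "x = emb f" by (rule V_spaceE)
    show "0 \<le> Re (q_form K x x)"
      using order_trans[OF _ Re_q_form(1)[OF f(2), of K]] f(3) by simp
    assume "y \<in> V_space Y"
    then obtain g where g: "g \<in> V_fun Y" "g \<in> L2" "y = emb g" by (rule V_spaceE)
    note H = emb_Hm1[OF f(2)] emb_Hm1[OF g(2)]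
    have "ip_C2 (K *v Gamma1 (c *\<^sub>c f)) u = c * ip_C2 (K *v Gamma1 f) u" for u
      unfolding Gamma1_scale[OF f(2)] by (simp add: ip_C2_eq matrix_vector_mult_def sum_2 algebra_simps)
    then have "a_form K (c *\<^sub>c f) g = c * a_form K f g"
      using f(2) g(2) by (simp add: a_form_def distrib_left)
    moreover have "a_form K (rep (emb (c *\<^sub>c f))) (rep (emb g)) = a_form K (c *\<^sub>c f) g"
      using f(2) g(2) by (intro a_form_rep L2.scale_mem)
    ultimately show "q_form K (c *\<^sub>c x) y = c * q_form K x y"
      using Hm1.scale_left[OF H, of c] f(2) g(2)
      by (simp only: q_form_def f(3) g(3) emb_scale[symmetric] a_form_rep) (simp add: emb_scale distrib_left)
    have "cnj (ip_C2 (K *v Gamma1 f) (Gamma1 g)) = ip_C2 (K *v Gamma1 g) (Gamma1 f)"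
      by (simp add: ip_C2_eq matrix_vector_mult_def sum_2 Kij algebra_simps)
    then have "cnj (a_form K f g) = a_form K g f" using f(2) g(2) by (simp add: a_form_def L2.cnj_sym)
    then show "cnj (q_form K x y) = q_form K y x"
      using f(2) g(2) by (simp add: q_form_def f(3) g(3) a_form_rep Hm1.cnj_sym emb_Hm1)
    assume "z \<in> V_space Y"
    then obtain h where h: "h \<in> V_fun Y" "h \<in> L2" "z = emb h" by (rule V_spaceE)
    have "ip_C2 (K *v Gamma1 (f + g)) u = ip_C2 (K *v Gamma1 f) u + ip_C2 (K *v Gamma1 g) u" for u
      unfolding Gamma1_add[OF f(2) g(2)]
      by (simp add: ip_C2_eq matrix_vector_mult_def sum_2 algebra_simps)
    then have "a_form K (f + g) h = a_form K f h + a_form K g h"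
      using L2.add_left[OF f(2) g(2) h(2)] by (simp add: a_form_def)
    moreover have "a_form K (rep (emb (f + g))) (rep (emb h)) = a_form K (f + g) h"
      using f(2) g(2) h(2) by (intro a_form_rep L2.add_mem)
    ultimately show "q_form K (x + y) z = q_form K x z + q_form K y z"
      using Hm1.add_left[OF H emb_Hm1[OF h(2)]] f(2) g(2) h(2)
      by (simp only: q_form_def f(3) g(3) h(3) emb_add[OF f(2) g(2), symmetric] a_form_rep)
        (simp add: emb_add distrib_left)
  qed (auto intro: V.add_mem V.scale_mem)
qed

lemma P_fun_cong_AE:
  assumes "AE x in \<mu>01. f x = g x" "f \<in> L2" "g \<in> L2" shows "P_fun f = P_fun g"
  using prim_cong_AE[OF assms] Gamma1_cong_AE[OF assms] unfolding P_fun_def by (metis Gamma1_nth(2))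

text \<open>The constant 2 is the square root of the 2 in \<open>Re_q_form(1)\<close>, rounded up.
  Hence \<open>P_fun (rep v) x\<close> is at each \<open>x\<close> a functional of \<open>v\<close>
  bounded by 4, and \<open>mu0\<close> is one bounded by 2; integrating Bessel's inequality over
  \<open>x\<close> gives the trace bound 16 + 4 = 20.\<close>

theorem form_setting_concrete:
  assumes Y: "vec.subspace Y" and K: "hermitian K"
  shows "form_setting (H_space Y) (V_space Y) ip_Hm1 ip_emb_L2 (q_form K) (shift K)
    (1 + 2 * mat_bound K + 5 * shift K) 2 20"
proof -
  interpret H: hilbert "H_space Y" ip_Hm1 by (rule H_space_hilbert)
  interpret V: hilbert "V_space Y" ip_emb_L2 by (rule V_space_hilbert[OF Y])
  interpret q: semi_ip "V_space Y" "q_form K" by (rule q_form_semi_ip[OF Y K])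
  define c1 where "c1 = 1 + 2 * mat_bound K + 5 * shift K"
  have c1: "1 \<le> c1" using mat_bound_nonneg[of K] shift_nonneg[of K] by (simp add: c1_def)
  have low: "V.nrm v \<le> 2 * q.nrm v" if v: "v \<in> V_space Y" for v
  proof -
    obtain f where f: "f \<in> V_fun Y" "f \<in> L2" "v = emb f" using v by (rule V_spaceE)
    have "(nrm2 f)\<^sup>2 \<le> 2 * (q.nrm v)\<^sup>2" using Re_q_form(1)[OF f(2), of K] q.nrm_sq[OF v] f(3) by simp
    also have "\<dots> \<le> (2 * q.nrm v)\<^sup>2" by (simp add: power_mult_distrib)
    finally have "nrm2 f \<le> 2 * q.nrm v" by (rule power2_le_imp_le) (use q.nrm_nonneg[OF v] in simp)
    then show ?thesis using nrm_emb[OF f(2)] f(3) by simp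
  qed
  have equiv: "norm_equiv (V_space Y) ip_emb_L2 (q_form K) c1 2"
  proof
    fix v assume v: "v \<in> V_space Y"
    obtain f where f: "f \<in> V_fun Y" "f \<in> L2" "v = emb f" using v by (rule V_spaceE)
    have "(q.nrm v)\<^sup>2 \<le> c1 * (nrm2 f)\<^sup>2" using Re_q_form(2)[OF f(2), of K] q.nrm_sq[OF v] f(3)
      by (simp add: c1_def)
    \<comment> \<open>\<open>c1\<close> is at least 1, so it may be used in place of its square
      root.\<close>
    also have "\<dots> \<le> c1\<^sup>2 * (nrm2 f)\<^sup>2" using c1 by (intro mult_right_mono) (auto simp: power2_eq_square)
    also have "\<dots> = (c1 * V.nrm v)\<^sup>2" using nrm_emb[OF f(2)] f(3) by (simp add: power_mult_distrib)
    finally show "q.nrm v \<le> c1 * V.nrm v" by (rule power2_le_imp_le) (use c1 v in simp)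
  qed (use c1 low in auto)
  have rep_add: "AE x in \<mu>01. rep (v + w) x = (rep v + rep w) x" if "v \<in> V_space Y" "w \<in> V_space Y"
    for v w
    using rep_emb(3)[OF L2.add_mem[OF V_space_rep(2)[OF that(1)] V_space_rep(2)[OF that(2)]]]
    unfolding emb_add[OF V_space_rep(2)[OF that(1)] V_space_rep(2)[OF that(2)]] V_space_rep(3)[OF that(1)] V_space_rep(3)[OF that(2)] .
  have rep_scale: "AE x in \<mu>01. rep (c *\<^sub>c v) x = (c *\<^sub>c rep v) x" if "v \<in> V_space Y" for c v
    using rep_emb(3)[OF L2.scale_mem[OF V_space_rep(2)[OF that], of c]]
    unfolding emb_scale V_space_rep(3)[OF that] .
  have nrm_rep: "nrm2 (rep v) \<le> 2 * q.nrm v" if "v \<in> V_space Y" for v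
    using low[OF that] nrm_emb[OF V_space_rep(2)[OF that]] V_space_rep(3)[OF that] by simp
  have lin_P: "q.lin (\<lambda>v. P_fun (rep v) x)" for x
    unfolding q.lin_def
  proof (intro conjI ballI allI)
    fix v w assume vw: "v \<in> V_space Y" "w \<in> V_space Y"
    note L = V_space_rep(2)[OF vw(1)] V_space_rep(2)[OF vw(2)]
    have "P_fun (rep (v + w)) = P_fun (rep v + rep w)"
      by (rule P_fun_cong_AE[OF rep_add[OF vw] V_space_rep(2)[OF q.add_mem[OF vw]] L2.add_mem[OF L]])
    moreover have "mu1 (rep v + rep w) = mu1 (rep v) + mu1 (rep w)" unfolding mu1_ip
      by (rule L2.add_left[OF L ramp_L2])
    ultimately show "P_fun (rep (v + w)) x = P_fun (rep v) x + P_fun (rep w) x"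
      using prim_add[OF L, of x] by (simp add: P_fun_def)
  next
    fix c v assume v: "v \<in> V_space Y"
    note L = V_space_rep(2)[OF v]
    have "P_fun (rep (c *\<^sub>c v)) = P_fun (c *\<^sub>c rep v)"
      by (rule P_fun_cong_AE[OF rep_scale[OF v] V_space_rep(2)[OF q.scale_mem[OF v]] L2.scale_mem[OF L]])
    moreover have "mu1 (c *\<^sub>c rep v) = c * mu1 (rep v)" unfolding mu1_ip
      by (rule L2.scale_left[OF L ramp_L2])
    ultimately show "P_fun (rep (c *\<^sub>c v)) x = c * P_fun (rep v) x"
      using prim_scale[OF L, of c x] by (simp add: P_fun_def algebra_simps)
  qed
  have trace: "(\<Sum>e\<in>F. Re (ip_Hm1 e e)) \<le> 20" if F: "finite F" "q.ons F (\<lambda>x. x)" for F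
  proof -
    have FV: "e \<in> F \<Longrightarrow> e \<in> V_space Y" for e using q.ons_mem[OF F(2)] .
    have L: "e \<in> F \<Longrightarrow> P_fun (rep e) \<in> L2" for e by (intro P_fun_L2 V_space_rep(2)[OF FV])
    have "(\<Sum>e\<in>F. (cmod (P_fun (rep e) x))\<^sup>2) \<le> 4\<^sup>2" if x: "x \<in> {0..1}" for x
    proof (rule q.Bessel_functional[OF lin_P _ F(2,1)])
      fix v assume v: "v \<in> V_space Y"
      show "cmod (P_fun (rep v) x) \<le> 4 * q.nrm v"
        using P_fun_bound[OF V_space_rep(2)[OF v] x] nrm_rep[OF v] by simp
    qed simp
    then have "(LINT x|\<mu>01. (\<Sum>e\<in>F. (cmod (P_fun (rep e) x))\<^sup>2)) \<le> (LINT x|\<mu>01. 4\<^sup>2)"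
      using L
      by (intro integral_mono Bochner_Integration.integrable_sum) (auto simp: L2_def space_restrict_space)
    also have "\<dots> = 16" by (simp add: space_restrict_space emeasure_unit_measure)
    also have "(LINT x|\<mu>01. (\<Sum>e\<in>F. (cmod (P_fun (rep e) x))\<^sup>2)) = (\<Sum>e\<in>F. (nrm2 (P_fun (rep e)))\<^sup>2)"
      using L by (subst Bochner_Integration.integral_sum) (auto simp: nrm2_sq L2_def)
    finally have P: "(\<Sum>e\<in>F. (nrm2 (P_fun (rep e)))\<^sup>2) \<le> 16" .
    have M: "(\<Sum>e\<in>F. (cmod (mu0 e))\<^sup>2) \<le> 2\<^sup>2"
    proof (rule q.Bessel_functional[OF _ _ F(2,1)])
      show "q.lin mu0" by (simp add: q.lin_def mu0_def)
      fix v assume v: "v \<in> V_space Y"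
      have "mu0 v = int01 (rep v)" using mu0_emb[of "rep v"] V_space_rep(3)[OF v] by simp
      then show "cmod (mu0 v) \<le> 2 * q.nrm v"
        using cmod_int01_le[OF V_space_rep(2)[OF v]] nrm_rep[OF v] by simp
    qed simp
    have "Re (ip_Hm1 e e) = (nrm2 (P_fun (rep e)))\<^sup>2 + (cmod (mu0 e))\<^sup>2" if "e \<in> F" for e
      using nrm_Hm1_emb_sq[OF V_space_rep(2)[OF FV[OF that]]] mu0_emb[of "rep e"]
        Hm1.nrm_sq[OF emb_Hm1[OF V_space_rep(2)[OF FV[OF that]]]] V_space_rep(3)[OF FV[OF that]] by simp
    then have "(\<Sum>e\<in>F. Re (ip_Hm1 e e)) = (\<Sum>e\<in>F. (nrm2 (P_fun (rep e)))\<^sup>2) + (\<Sum>e\<in>F. (cmod (mu0 e))\<^sup>2)"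
      by (simp add: sum.distrib)
    then show ?thesis using P M by simp
  qed
  show ?thesis
    unfolding c1_def[symmetric]
    by (intro form_setting.intro form_setting_axioms.intro H.hilbert_axioms V.hilbert_axioms q.semi_ip_axioms
      V_space_subset_H_space equiv shift_nonneg trace H_space_total[OF Y])
qed

section \<open>The operator and its part in \<open>V_space Y\<close>\<close>

lemma A_op_eq:
  "A_op Y K = {(f, g). f \<in> V_space Y \<and> g \<in> H_space Y \<and>
    (\<forall>h\<in>V_space Y. q_form K f h - complex_of_real (shift K) * ip_Hm1 f h = ip_Hm1 g h)}"
proof -
  have *: "(\<forall>h\<in>V_fun Y. a_form K f h = ip_Hm1 g (emb h)) \<longleftrightarrow>
      (\<forall>h\<in>V_space Y. q_form K (emb f) h - complex_of_real (shift K) * ip_Hm1 (emb f) h = ip_Hm1 g h)"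
    if "f \<in> V_fun Y" for f g
    using that by (auto simp: V_space_def V_fun_def q_form_def a_form_rep)
  have "A_op Y K = {(emb f, g) | f g. f \<in> V_fun Y \<and> g \<in> H_space Y \<and>
      (\<forall>h\<in>V_space Y. q_form K (emb f) h - complex_of_real (shift K) * ip_Hm1 (emb f) h = ip_Hm1 g h)}"
    unfolding A_op_def using * by blast
  then show ?thesis by (auto simp only: V_space_def)
qed

lemma Gamma2_eq: "Gamma2 u = vector [- int01 (wderiv (wderiv u)) - u 1, u 1 - u 0]"
  by (simp add: Gamma2_def mu0_emb)

lemma emb_minus_cong:
  assumes "AE x in \<mu>01. w x = - g x" "w \<in> L2" "g \<in> L2" shows "emb (- w) = emb g"
proof -
  have "AE x in \<mu>01. (- w) x = g x" using assms(1) by eventually_elim simp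
  then show ?thesis using emb_eq_iff[OF L2.minus_mem[OF assms(2)] assms(3)] by blast
qed

text \<open>The operator sees \<open>f\<close> only up to null sets. By \<open>form_eq_iff\<close>
  it agrees almost everywhere with an affine function minus a twofold primitive, and this
  representative is the one whose boundary values enter \<open>Gamma2\<close>.\<close>

theorem part_op_eq:
  assumes Y: "vec.subspace Y"
  shows "part_op (A_op Y K) (V_space Y) = {(emb u, emb (- wderiv (wderiv u))) | u.
    u \<in> H2 \<and> emb u \<in> Domain (A_op Y K) \<and> K *v Gamma1 u - Gamma2 u \<in> orth_C2 Y \<and> Gamma1 (wderiv (wderiv u)) \<in> Y}"
    (is "_ = ?R")
proof (intro set_eqI iffI)
  fix z assume "z \<in> part_op (A_op Y K) (V_space Y)"
  then obtain f w where z: "z = (emb f, w)" and A: "(emb f, w) \<in> A_op Y K" and f: "f \<in> V_fun Y" and wV: "w \<in> V_space Y"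
    and form: "\<forall>h\<in>V_fun Y. a_form K f h = ip_Hm1 w (emb h)"
    by (auto simp: part_op_def A_op_def)
  obtain g where g: "g \<in> V_fun Y" "g \<in> L2" "w = emb g" using wV by (rule V_spaceE)
  have fL: "f \<in> L2" and gY: "Gamma1 g \<in> Y" using f g by (auto simp: V_fun_def)
  have P: "prim (P_op (emb g)) x = prim (P_fun g) x" for x
    by (rule prim_cong_AE[OF P_op_emb[OF g(2)] P_op(1)[OF emb_Hm1[OF g(2)]] P_fun_L2[OF g(2)]])
  have PL: "P_fun g \<in> L2" by (rule P_fun_L2[OF g(2)])
  have P1: "int01 (P_fun g) = 0"
    using P_op_mean[OF emb_Hm1[OF g(2)]] P[of 1] by simp
  obtain c where AE: "AE x in \<mu>01. f x + prim (P_fun g) x = - affine_fun c x"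
    and orth: "K *v Gamma1 f - vector [int01 g, 0] - c \<in> orth_C2 Y"
    using form unfolding g(3) form_eq_iff[OF Y fL emb_Hm1[OF g(2)]] P mu0_emb by blast
  define u where "u x = - affine_fun c x - prim (P_fun g) x" for x
  have ng: "(- 1) *\<^sub>c g \<in> L2" by (rule L2.scale_mem[OF g(2)])
  \<comment> \<open>\<open>P_fun g\<close> is the primitive of \<open>g\<close> minus the constant
    \<open>mu1 g\<close>; integrating once more exhibits \<open>u\<close> in the shape that
    \<open>H2I\<close> asks for, with second derivative \<open>- g\<close>.\<close>
  have u_eq: "u x = (- c $ 1 - c $ 2) + prim (\<lambda>y. (c $ 2 + mu1 g) + prim ((- 1) *\<^sub>c g) y) x"
    if x: "x \<in> {0..1}" for x
  proof -
    have "(\<lambda>y. (c $ 2 + mu1 g) + prim ((- 1) *\<^sub>c g) y) = (\<lambda>y. c $ 2) - P_fun g"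
      using prim_scale[OF g(2), of "- 1"] by (simp add: fun_eq_iff P_fun_def)
    then have "prim (\<lambda>y. (c $ 2 + mu1 g) + prim ((- 1) *\<^sub>c g) y) x = c $ 2 * complex_of_real x - prim (P_fun g) x"
      using prim_diff[OF L2_const[of "c $ 2"] PL, of x] prim_const[OF x, of "c $ 2"] by simp
    then show ?thesis by (simp add: u_def affine_fun_apply algebra_simps)
  qed
  have u2: "u \<in> H2" and AE2: "AE x in \<mu>01. wderiv (wderiv u) x = ((- 1) *\<^sub>c g) x"
    using H2I[OF ng u_eq] by blast+
  have uL: "u \<in> L2" using H1_L2 H2_wderiv(1)[OF u2] by blast
  have wL: "wderiv (wderiv u) \<in> L2" by (rule H2_wderiv(2)[OF u2])
  have "AE x in \<mu>01. u x = f x" using AE by eventually_elim (simp add: u_def algebra_simps)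
  then have eu: "emb u = emb f" and Gu: "Gamma1 u = Gamma1 f"
    using emb_eq_iff[OF uL fL] Gamma1_cong_AE[OF _ uL fL] by blast+
  have Gw: "Gamma1 (wderiv (wderiv u)) = (- 1) *s Gamma1 g"
    using Gamma1_cong_AE[OF AE2 wL ng] unfolding Gamma1_scale[OF g(2)] .
  have iw: "int01 (wderiv (wderiv u)) = - int01 g" using arg_cong[OF Gw, of "\<lambda>x. x $ 1"] by simp
  \<comment> \<open>The primitive of \<open>P_fun g\<close> vanishes at both ends since
    \<open>P_fun g\<close> has mean zero. So \<open>c\<close> has the components
    \<open>- u 1\<close> and \<open>u 1 - u 0\<close>, and \<open>c\<close> plus
    \<open>(int01 g, 0)\<close> is \<open>Gamma2 u\<close>.\<close>
  have uv: "u 0 = - c $ 1 - c $ 2" "u 1 = - c $ 1" using P1 by (simp_all add: u_def affine_fun_apply)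
  have "K *v Gamma1 u - Gamma2 u = K *v Gamma1 f - vector [int01 g, 0] - c"
    unfolding Gu Gamma2_eq iw uv by (rule vec2_eqI) simp_all
  then have "K *v Gamma1 u - Gamma2 u \<in> orth_C2 Y" using orth by simp
  moreover have "Gamma1 (wderiv (wderiv u)) \<in> Y" unfolding Gw by (rule vec.subspace_scale[OF Y gY])
  moreover have "emb u \<in> Domain (A_op Y K)" using A eu by auto
  moreover have "emb (- wderiv (wderiv u)) = w"
    unfolding g(3) by (rule emb_minus_cong[OF _ wL g(2)]) (use AE2 in simp)
  then have "z = (emb u, emb (- wderiv (wderiv u)))" using z eu by simp
  ultimately show "z \<in> ?R" using u2 by blast
next
  fix z assume "z \<in> ?R"
  then obtain u where z: "z = (emb u, emb (- wderiv (wderiv u)))" and u: "u \<in> H2" and dom: "emb u \<in> Domain (A_op Y K)"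
    and orth: "K *v Gamma1 u - Gamma2 u \<in> orth_C2 Y" and GY: "Gamma1 (wderiv (wderiv u)) \<in> Y" by auto
  define v where "v = wderiv (wderiv u)"
  have uL: "u \<in> L2" using H1_L2 H2_wderiv(1)[OF u] by blast
  have v: "v \<in> L2" unfolding v_def by (rule H2_wderiv(2)[OF u])
  obtain k where k: "AE x in \<mu>01. wderiv u x = k + prim v x" using H2_wderiv(3)[OF u]
    by (auto simp: v_def)
  \<comment> \<open>Membership in the domain concerns the class of \<open>u\<close> only;
    \<open>Gamma1_cong_AE\<close> carries the condition on \<open>Gamma1\<close> over to
    \<open>u\<close> itself.\<close>
  obtain f where f: "f \<in> V_fun Y" "emb u = emb f" using dom by (auto simp: A_op_def)
  have "Gamma1 u = Gamma1 f"
    using f emb_eq_iff[OF uL] Gamma1_cong_AE[OF _ uL] by (auto simp: V_fun_def)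
  then have uV: "u \<in> V_fun Y" using f(1) uL by (simp add: V_fun_def)
  define g where "g = (- 1) *\<^sub>c v"
  have gL: "g \<in> L2" unfolding g_def by (rule L2.scale_mem[OF v])
  have "Gamma1 g \<in> Y" unfolding g_def Gamma1_scale[OF v]
    by (rule vec.subspace_scale[OF Y]) (use GY in \<open>simp add: v_def\<close>)
  then have gV: "g \<in> V_fun Y" using gL by (simp add: V_fun_def)
  then have gS: "emb g \<in> V_space Y" by (auto simp: V_space_def)
  have PL: "P_fun g \<in> L2" by (rule P_fun_L2[OF gL])
  have P: "prim (P_op (emb g)) x = prim (P_fun g) x" for x
    by (rule prim_cong_AE[OF P_op_emb[OF gL] P_op(1)[OF emb_Hm1[OF gL]] PL])
  have P1: "int01 (P_fun g) = 0" using P_op_mean[OF emb_Hm1[OF gL]] P[of 1] by simp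
  have kL: "(\<lambda>x. k + prim v x) \<in> L2" by (intro L2_continuous continuous_intros prim_continuous v)
  \<comment> \<open>The second derivatives of \<open>u\<close> and of the primitive of
    \<open>P_fun g\<close> cancel, so the sum is affine; its slope is then read off at
    \<open>x = 1\<close>.\<close>
  have line: "u x + prim (P_fun g) x = u 0 + (k + mu1 v) * complex_of_real x" if x: "x \<in> {0..1}" for x
  proof -
    have "u x = u 0 + prim (wderiv u) x" by (rule H1_wderiv(2)[OF H2_wderiv(1)[OF u] x])
    also have "prim (wderiv u) x = prim (\<lambda>x. k + prim v x) x"
      by (rule prim_cong_AE[OF k H1_wderiv(1)[OF H2_wderiv(1)[OF u]] kL])
    finally have "u x + prim (P_fun g) x = u 0 + (prim (\<lambda>x. k + prim v x) x + prim (P_fun g) x)" by simp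
    also have "prim (\<lambda>x. k + prim v x) x + prim (P_fun g) x = prim ((\<lambda>x. k + prim v x) + P_fun g) x"
      by (rule prim_add[OF kL PL, symmetric])
    also have "(\<lambda>x. k + prim v x) + P_fun g = (\<lambda>x. k + mu1 v)"
    proof -
      have "mu1 g = - mu1 v" unfolding g_def mu1_ip using L2.scale_left[OF v ramp_L2, of "-1"] by simp
      then show ?thesis using prim_scale[OF v, of "- 1"] by (simp add: fun_eq_iff P_fun_def g_def)
    qed
    also have "prim (\<lambda>x. k + mu1 v) x = (k + mu1 v) * complex_of_real x" by (rule prim_const[OF x])
    finally show ?thesis .
  qed
  have slope: "k + mu1 v = u 1 - u 0" using line[of 1] P1 by simp
  define c :: "complex^2" where "c = vector [- u 1, u 1 - u 0]"
  have AE: "AE x in \<mu>01. u x + prim (P_op (emb g)) x = - affine_fun c x"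
    using AE_unit_interval
  proof eventually_elim
    case (elim x)
    then have "u x + prim (P_fun g) x = u 0 + (u 1 - u 0) * complex_of_real x"
      using line[of x] slope by simp
    then show ?case by (simp add: P c_def affine_fun_apply algebra_simps)
  qed
  have mg: "mu0 (emb g) = - int01 v" by (simp add: mu0_emb g_def)
  have "K *v Gamma1 u - vector [mu0 (emb g), 0] - c = K *v Gamma1 u - Gamma2 u"
    unfolding mg c_def Gamma2_eq v_def by (rule vec2_eqI) simp_all
  then have "K *v Gamma1 u - vector [mu0 (emb g), 0] - c \<in> orth_C2 Y" using orth by (simp only:)
  with AE have form: "\<forall>h\<in>V_fun Y. a_form K u h = ip_Hm1 (emb g) (emb h)"
    unfolding form_eq_iff[OF Y uL emb_Hm1[OF gL]] by blast
  have "emb g \<in> H_space Y" using gS V_space_subset_H_space by blast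
  then have "(emb u, emb g) \<in> A_op Y K" unfolding A_op_def using uV form by blast
  moreover have "emb u \<in> V_space Y" using uV by (auto simp: V_space_def)
  moreover have "emb (- v) = emb g"
    by (rule emb_minus_cong[OF _ v gL]) (simp add: g_def)
  ultimately show "z \<in> part_op (A_op Y K) (V_space Y)"
    using z gS by (simp add: part_op_def v_def)
qed

theorem theorem3p6:
  fixes K :: "complex^2^2" and Y :: "(complex^2) set"
  assumes "hermitian K" and "vec.subspace Y"
  shows "(\<exists>T. C0_semigroup (H_space Y) ip_Hm1 T \<and> generator (H_space Y) ip_Hm1 T = neg_op (A_op Y K)) \<and>
    (\<forall>T. C0_semigroup (H_space Y) ip_Hm1 T \<and> generator (H_space Y) ip_Hm1 T = neg_op (A_op Y K) \<longrightarrow>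
      (\<forall>t\<ge>0. \<forall>u\<in>V_space Y. T t u \<in> V_space Y) \<and>
      analytic_semigroup (V_space Y) ip_emb_L2 (pi / 2) T \<and>
      (\<forall>t>0. trace_class (V_space Y) ip_emb_L2 (T t)) \<and>
      generator (V_space Y) ip_emb_L2 T = neg_op (part_op (A_op Y K) (V_space Y))) \<and>
    part_op (A_op Y K) (V_space Y) =
      {(emb u, emb (- wderiv (wderiv u))) | u.
        u \<in> H2 \<and> emb u \<in> Domain (A_op Y K) \<and>
        K *v Gamma1 u - Gamma2 u \<in> orth_C2 Y \<and>
        Gamma1 (wderiv (wderiv u)) \<in> Y}"
proof -
  interpret F: form_setting "H_space Y" "V_space Y" ip_Hm1 ip_emb_L2 "q_form K" "shift K"
    "1 + 2 * mat_bound K + 5 * shift K" 2 20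
    by (rule form_setting_concrete[OF assms(2,1)])
  have A: "A_op Y K = F.A" unfolding A_op_eq F.A_def ..
  show ?thesis
    unfolding part_op_eq[OF assms(2), symmetric] unfolding A using F.main by blast
qed

end
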